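(* Let $q\in[0,1)$, and let $u\in(0,1)$, $\eta>0$ be such that $u+\eta\in(0,1)$. Assume that $\sigma(0)\in\Omega^{\mathrm{quad}}$. Then there exists a continuous time (time-inhomogeneous) Markov chain $\sigma(\tau)$, $\tau\in\mathbb{R}_{\ge0}$, on configurations of up-right paths in the quadrant $\mathbb{Z}_{\ge0}\times\mathbb{Z}_{\ge1}$ started from $\sigma(0)$, whose generator at time $\tau$ acts on cylindric functions by $$(G^{\mathrm{quad}}_{u,\eta,\tau}f)(\sigma)=\eta e^{-\tau}\sum_{(v_1,v_2)\text{ is a seed pair of }\sigma} y(v_1)\,\mathfrak{R}_{v_1,v_2}\bigl(u+(1-e^{-\tau})\eta\bigr)\bigl(f(\sigma_{(v_1,v_2)})-f(\sigma)\bigr),$$ where $y(v_1)$ is the vertical coordinate of $v_1$. Moreover, the transition operator $\mathcal{Q}(\tau)$ of this Markov chain (from time $0$ to time $\tau$) acts on the homogeneous stochastic six vertex model, with step-$\lambda$ or empty-$\lambda$ boundary conditions for arbitrary fixed $\lambda\subset\mathbb{Z}_{\ge0}$, as $$\mathbb{P}_u^{\mathrm{s6v,\,hom}}\,\mathcal{Q}(\tau)=\mathbb{P}_{u+(1-e^{-\tau})\eta}^{\mathrm{s6v,\,hom}}$$ (both sides having the same boundary conditions).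
   Context: **Path configurations.** A configuration $\sigma$ of up-right paths in the quadrant $\mathbb{Z}_{\ge0}\times\mathbb{Z}_{\ge1}$ assigns states occupied ($1$) or empty ($0$) to all edges adjacent to vertices of the quadrant, including the incoming boundary edges $(-1,l)-(0,l)$, $l\ge1$, and $(i,0)-(i,1)$, $i\ge0$, so that at every vertex $i_1+j_1=i_2+j_2$, where $i_1,j_1,i_2,j_2\in\{0,1\}$ are the states of the bottom, left, top and right adjacent edges. The vertex type is $(i_1,j_1;i_2,j_2)$. A cylindric function depends only on finitely many edges. **Stochastic six vertex model.** For $u\in(0,1)$ let $w_u(0,0;0,0)=w_u(1,1;1,1)=1$, $w_u(1,0;1,0)=\frac{q(1-u)}{1-qu}$, $w_u(1,0;0,1)=\frac{1-q}{1-qu}$, $w_u(0,1;0,1)=\frac{1-u}{1-qu}$, $w_u(0,1;1,0)=\frac{u(1-q)}{1-qu}$. The measure $\mathbb{P}_u^{\mathrm{s6v,\,hom}}$ is the law of the random configuration in the quadrant sampled sequentially from fixed boundary conditions: each vertex chooses its outgoing edges $(i_2,j_2)$ given the incoming ones $(i_1,j_1)$ with probability $w_u(i_1,j_1;i_2,j_2)$. Step-$\lambda$ boundary conditions: all left boundary edges $(-1,l)-(0,l)$ are occupied, and the bottom edge $(i,0)-(i,1)$ is occupied iff $i\in\lambda$. Empty-$\lambda$: the left boundary edges are all empty, and the bottom edges are occupied according to $\lambda$. **Regular configurations.** $\Omega^{\mathrm{quad}}$ is the set of configurations such that for each $R'>0$ there is $R=R(R')$ for which either all vertices in $[0,R']\times[R,\infty)$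 have type $(0,0;0,0)$, or all of them have type $(1,1;1,1)$. It has probability $1$ under $\mathbb{P}_u^{\mathrm{s6v,\,hom}}$ with step-$\lambda$ or empty-$\lambda$ boundary conditions. **Rates.** $\mathfrak{a}(u)=\frac{(1-u)q}{(1-q)(1-qu)u}$, $\mathfrak{b}(u)=\frac{1-qu}{(1-u)(1-q)u}$, $\mathfrak{c}(u)=\frac{1-q}{(1-u)(1-qu)}$. **Seed pairs.** A pair $v_1=(x,y)$, $v_2=(x,y+1)$ of vertices of the quadrant is a seed pair if the types (type of $v_1$ / type of $v_2$) are one of the following; $\mathfrak{R}_{v_1,v_2}(u)$ is indicated. Up jump: $(0,1;0,1)/(0,0;0,0)$: $\mathfrak{c}(u)$; $(1,0;0,1)/(0,0;0,0)$: $\mathfrak{a}(u)$; $(0,1;0,1)/(0,1;1,0)$: $\mathfrak{b}(u)$. Down jump: $(1,0;1,0)/(1,1;1,1)$: $\mathfrak{c}(u)$; $(0,1;1,0)/(1,1;1,1)$: $\mathfrak{a}(u)$; $(1,0;1,0)/(1,0;0,1)$: $\mathfrak{b}(u)$. **Jumps.** For fixed $y$, let $L_i,U_i$ be the horizontal edges $(i,y)-(i+1,y)$ and $(i,y+1)-(i+1,y+1)$, and $V_i$ the vertical edge $(i,y)-(i,y+1)$. If the seed pair is for an up jump, let $c\ge0$ be the largest integer such that $L_{x+j}$ is occupied and $U_{x+j}$ is empty for all $j=0,\ldots,c$ (possibly $c=\infty$). Then $\sigma_{(v_1,v_2)}$ is obtained from $\sigma$ by making $V_x$ occupied, swapping the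 states of $L_{x+j},U_{x+j}$ for $0\le j\le c$, and (if $c<\infty$) changing $V_{x+c+1}$ from occupied to empty. For a down jump the same holds with occupied and empty interchanged. **Time-dependent rates.** Having the generator $G^{\mathrm{quad}}_{u,\eta,\tau}$ at time $\tau$ means that each seed pair $(v_1,v_2)$ carries an independent inhomogeneous Poisson clock with rate function $\tau\mapsto y(v_1)\,\eta e^{-\tau}\,\mathfrak{R}_{v_1,v_2}(u+(1-e^{-\tau})\eta)$, and at a ring $\sigma$ is replaced by $\sigma_{(v_1,v_2)}$. *)

theory Defs
  imports "HOL-Probability.Probability"
begin

section \<open>Path configurations in the quadrant\<close>

text \<open>
  \<open>Hor i l\<close> is the horizontal edge from \<open>(i - 1, l)\<close> to \<open>(i, l)\<close>, and \<open>Ver i l\<close> is the vertical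
  edge from \<open>(i, l)\<close> to \<open>(i, l + 1)\<close>. The quadrant has the vertices \<open>(x, y)\<close> with \<open>y \<ge> 1\<close>, so
  \<open>Hor i 0\<close> is not one of its edges. \<open>Hor 0 l\<close> and \<open>Ver i 0\<close> are the boundary edges.
\<close>

datatype edge = Hor nat nat | Ver nat nat

type_synonym config = "edge \<Rightarrow> bool"
type_synonym vertex = "nat \<times> nat"

definition quad_edges :: "edge set" where
  "quad_edges = {Hor i l | i l. 1 \<le> l} \<union> range (\<lambda>(i, l). Ver i l)"

text \<open>The tuple \<open>(i1, j1, i2, j2)\<close> lists the states of the bottom, left, top and right edges.\<close>

type_synonym vtype = "nat \<times> nat \<times> nat \<times> nat"

fun vertex_type :: "config \<Rightarrow> vertex \<Rightarrow> vtype" where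
  "vertex_type \<sigma> (x, y) =
     (of_bool (\<sigma> (Ver x (y - 1))), of_bool (\<sigma> (Hor x y)),
      of_bool (\<sigma> (Ver x y)), of_bool (\<sigma> (Hor (x + 1) y)))"

definition configurations :: "config set" where
  "configurations = {\<sigma> \<in> extensional quad_edges. \<forall>x. \<forall>y\<ge>1.
     case vertex_type \<sigma> (x, y) of (i1, j1, i2, j2) \<Rightarrow> i1 + j1 = i2 + j2}"

text \<open>
  Path conservation is not built into the measurable space of edge states below. It is a property of
  the elements of \<open>configurations\<close>, which carry all the measures of interest.
\<close>

definition config_space :: "config measure" where
  "config_space = (\<Pi>\<^sub>M e\<in>quad_edges. count_space UNIV)"

definition regular_configurations :: "config set" where
  "regular_configurations = {\<sigma> \<in> configurations. \<forall>R'>0. \<exists>R\<ge>1.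
     (\<forall>x\<le>R'. \<forall>y\<ge>R. vertex_type \<sigma> (x, y) = (0, 0, 0, 0)) \<or>
     (\<forall>x\<le>R'. \<forall>y\<ge>R. vertex_type \<sigma> (x, y) = (1, 1, 1, 1))}"

definition cylindric :: "(config \<Rightarrow> real) \<Rightarrow> bool" where
  "cylindric f \<longleftrightarrow> (\<exists>E. finite E \<and> E \<subseteq> quad_edges \<and>
     (\<forall>\<sigma> \<sigma>'. (\<forall>e\<in>E. \<sigma> e = \<sigma>' e) \<longrightarrow> f \<sigma> = f \<sigma>'))"


section \<open>The homogeneous stochastic six vertex model\<close>

definition s6v_weight :: "real \<Rightarrow> real \<Rightarrow> vtype \<Rightarrow> real" where
  "s6v_weight q u t =
    (if t = (0, 0, 0, 0) \<or> t = (1, 1, 1, 1) then 1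
     else if t = (1, 0, 1, 0) then q * (1 - u) / (1 - q * u)
     else if t = (1, 0, 0, 1) then (1 - q) / (1 - q * u)
     else if t = (0, 1, 0, 1) then (1 - u) / (1 - q * u)
     else if t = (0, 1, 1, 0) then u * (1 - q) / (1 - q * u)
     else 0)"

definition s6v_vertex_pmf :: "real \<Rightarrow> real \<Rightarrow> bool \<times> bool \<Rightarrow> (bool \<times> bool) pmf" where
  "s6v_vertex_pmf q u = (\<lambda>(i1, j1). embed_pmf (\<lambda>(i2, j2).
     s6v_weight q u (of_bool i1, of_bool j1, of_bool i2, of_bool j2)))"

lemma pmf_s6v_vertex_pmf:
  assumes "0 \<le> q" "q < 1" "0 < u" "u < 1"
  shows "pmf (s6v_vertex_pmf q u (i1, j1)) (i2, j2) =
           s6v_weight q u (of_bool i1, of_bool j1, of_bool i2, of_bool j2)"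
proof -
  have qu: "q * u < 1"
    using assms by (smt (verit) mult_left_le_one_le)
  let ?g = "\<lambda>(i2, j2). s6v_weight q u (of_bool i1, of_bool j1, of_bool i2, of_bool j2)"
  have nn: "0 \<le> ?g p" for p
    using assms qu by (auto simp: s6v_weight_def split: prod.splits)
  have U: "(UNIV :: (bool \<times> bool) set) = {(True, True), (True, False), (False, True), (False, False)}"
    by auto
  have "(\<Sum>p\<in>UNIV. ?g p) = 1"
    unfolding U using qu by (cases i1; cases j1) (auto simp: s6v_weight_def field_simps)
  then have "(\<integral>\<^sup>+ p. ennreal (?g p) \<partial>count_space UNIV) = 1"
    using nn by (simp add: nn_integral_count_space_finite sum_ennreal)
  then show ?thesis
    unfolding s6v_vertex_pmf_def using nn by (subst prod.case, subst pmf_embed_pmf) auto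
qed

text \<open>
  Sequential sampling is driven by a table \<open>\<omega>\<close> with independent entries: \<open>\<omega> (v, i, j)\<close> is the pair
  of outgoing (top, right) states which the vertex \<open>v\<close> chooses if its incoming (bottom, left)
  states are \<open>(i, j)\<close>. Only the entry selected by the incoming states which actually occur at \<open>v\<close>
  is used.
\<close>

type_synonym choices = "vertex \<times> bool \<times> bool \<Rightarrow> bool \<times> bool"

definition s6v_choices :: "real \<Rightarrow> real \<Rightarrow> choices measure" where
  "s6v_choices q u = (\<Pi>\<^sub>M k\<in>UNIV. measure_pmf (s6v_vertex_pmf q u (snd k)))"

function s6v_sample :: "(nat \<Rightarrow> bool) \<Rightarrow> (nat \<Rightarrow> bool) \<Rightarrow> choices \<Rightarrow> config" where
  "s6v_sample left bottom \<omega> (Ver x 0) = bottom x"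
| "s6v_sample left bottom \<omega> (Ver x (Suc y)) =
     fst (\<omega> ((x, Suc y), s6v_sample left bottom \<omega> (Ver x y), s6v_sample left bottom \<omega> (Hor x (Suc y))))"
| "s6v_sample left bottom \<omega> (Hor 0 y) = left y"
| "s6v_sample left bottom \<omega> (Hor (Suc x) y) =
     snd (\<omega> ((x, y), s6v_sample left bottom \<omega> (Ver x (y - 1)), s6v_sample left bottom \<omega> (Hor x y)))"
  by pat_completeness auto
termination
  by (relation "Wellfounded.measure (\<lambda>(left, bottom, \<omega>, e).
        case e of Ver x y \<Rightarrow> 2 * (x + y) + 1 | Hor x y \<Rightarrow> 2 * (x + y))") auto

definition s6v_law :: "real \<Rightarrow> real \<Rightarrow> (nat \<Rightarrow> bool) \<Rightarrow> (nat \<Rightarrow> bool) \<Rightarrow> config measure" where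
  "s6v_law q u left bottom = distr (s6v_choices q u) config_space
     (\<lambda>\<omega>. restrict (s6v_sample left bottom \<omega>) quad_edges)"

definition s6v_step :: "real \<Rightarrow> real \<Rightarrow> nat set \<Rightarrow> config measure" where
  "s6v_step q u \<Lambda> = s6v_law q u (\<lambda>_. True) (\<lambda>i. i \<in> \<Lambda>)"

definition s6v_empty :: "real \<Rightarrow> real \<Rightarrow> nat set \<Rightarrow> config measure" where
  "s6v_empty q u \<Lambda> = s6v_law q u (\<lambda>_. False) (\<lambda>i. i \<in> \<Lambda>)"


section \<open>Seed pairs, jumps and the generator\<close>

definition rate_a :: "real \<Rightarrow> real \<Rightarrow> real" where
  "rate_a q u = (1 - u) * q / ((1 - q) * (1 - q * u) * u)"

definition rate_b :: "real \<Rightarrow> real \<Rightarrow> real" where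
  "rate_b q u = (1 - q * u) / ((1 - u) * (1 - q) * u)"

definition rate_c :: "real \<Rightarrow> real \<Rightarrow> real" where
  "rate_c q u = (1 - q) / ((1 - u) * (1 - q * u))"

text \<open>
  A seed pair \<open>v1 = (x, y)\<close>, \<open>v2 = (x, y + 1)\<close> is represented by \<open>v1\<close>. Pairs of vertex types are
  listed as (type of \<open>v1\<close>, type of \<open>v2\<close>).
\<close>

definition up_types :: "(vtype \<times> vtype) set" where
  "up_types = {((0, 1, 0, 1), (0, 0, 0, 0)), ((1, 0, 0, 1), (0, 0, 0, 0)), ((0, 1, 0, 1), (0, 1, 1, 0))}"

definition down_types :: "(vtype \<times> vtype) set" where
  "down_types = {((1, 0, 1, 0), (1, 1, 1, 1)), ((0, 1, 1, 0), (1, 1, 1, 1)), ((1, 0, 1, 0), (1, 0, 0, 1))}"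

definition seed_rate :: "real \<Rightarrow> vtype \<times> vtype \<Rightarrow> real \<Rightarrow> real" where
  "seed_rate q p u =
    (if p \<in> {((0, 1, 0, 1), (0, 0, 0, 0)), ((1, 0, 1, 0), (1, 1, 1, 1))} then rate_c q u
     else if p \<in> {((1, 0, 0, 1), (0, 0, 0, 0)), ((0, 1, 1, 0), (1, 1, 1, 1))} then rate_a q u
     else if p \<in> {((0, 1, 0, 1), (0, 1, 1, 0)), ((1, 0, 1, 0), (1, 0, 0, 1))} then rate_b q u
     else 0)"

fun pair_type :: "config \<Rightarrow> vertex \<Rightarrow> vtype \<times> vtype" where
  "pair_type \<sigma> (x, y) = (vertex_type \<sigma> (x, y), vertex_type \<sigma> (x, y + 1))"

definition seed_pairs :: "config \<Rightarrow> vertex set" where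
  "seed_pairs \<sigma> = {v. 1 \<le> snd v \<and> pair_type \<sigma> v \<in> up_types \<union> down_types}"

text \<open>
  The flag \<open>b\<close> is \<open>True\<close> for up jumps; for down jumps, the roles of occupied and empty
  are interchanged. The edges \<open>L_i\<close>, \<open>U_i\<close>, \<open>V_i\<close> at height \<open>y\<close> are \<open>Hor (i + 1) y\<close>,
  \<open>Hor (i + 1) (y + 1)\<close>, \<open>Ver i y\<close>. The set \<open>jump_range\<close> is \<open>{0..c}\<close>, or \<open>UNIV\<close> if \<open>c = \<infinity>\<close>; it
  contains \<open>0\<close> for every seed pair.
\<close>

fun jump_range :: "bool \<Rightarrow> config \<Rightarrow> vertex \<Rightarrow> nat set" where
  "jump_range b \<sigma> (x, y) =
     {j. \<forall>i\<le>j. \<sigma> (Hor (x + i + 1) y) = b \<and> \<sigma> (Hor (x + i + 1) (y + 1)) = (\<not> b)}"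

fun jump :: "config \<Rightarrow> vertex \<Rightarrow> config" where
  "jump \<sigma> (x, y) =
    (let b = (pair_type \<sigma> (x, y) \<in> up_types); J = jump_range b \<sigma> (x, y) in
     (\<lambda>e. case e of
        Hor i l \<Rightarrow>
          (if l = y \<and> (\<exists>j\<in>J. i = x + j + 1) then \<sigma> (Hor i (y + 1))
           else if l = y + 1 \<and> (\<exists>j\<in>J. i = x + j + 1) then \<sigma> (Hor i y)
           else \<sigma> e)
      | Ver i l \<Rightarrow>
          (if l = y \<and> i = x then b
           else if l = y \<and> finite J \<and> i = x + Max J + 1 then \<not> b
           else \<sigma> e)))"

definition u_at :: "real \<Rightarrow> real \<Rightarrow> real \<Rightarrow> real" where
  "u_at u \<eta> \<tau> = u + (1 - exp (- \<tau>)) * \<eta>"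

text \<open>For a cylindric \<open>f\<close> only finitely many terms of the sum are nonzero.\<close>

definition generator_quad ::
    "real \<Rightarrow> real \<Rightarrow> real \<Rightarrow> real \<Rightarrow> (config \<Rightarrow> real) \<Rightarrow> config \<Rightarrow> real" where
  "generator_quad q u \<eta> \<tau> f \<sigma> = \<eta> * exp (- \<tau>) *
     (\<Sum>\<^sub>\<infinity>v\<in>seed_pairs \<sigma>. real (snd v) * seed_rate q (pair_type \<sigma> v) (u_at u \<eta> \<tau>) * (f (jump \<sigma> v) - f \<sigma>))"


section \<open>Time-inhomogeneous Markov chains on regular configurations\<close>

text \<open>
  \<open>Q s t \<sigma>\<close> is the law at time \<open>t\<close> of the chain which is in the state \<open>\<sigma>\<close> at time \<open>s\<close>. The state
  space is \<open>regular_configurations\<close>. The values of \<open>Q s t\<close> outside of it are irrelevant apart from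
  measurability.
\<close>

definition transition_functions :: "(real \<Rightarrow> real \<Rightarrow> config \<Rightarrow> config measure) \<Rightarrow> bool" where
  "transition_functions Q \<longleftrightarrow>
     (\<forall>s t. 0 \<le> s \<and> s \<le> t \<longrightarrow> Q s t \<in> config_space \<rightarrow>\<^sub>M prob_algebra config_space) \<and>
     (\<forall>s t. \<forall>\<sigma>\<in>regular_configurations. 0 \<le> s \<and> s \<le> t \<longrightarrow>
        (AE \<sigma>' in Q s t \<sigma>. \<sigma>' \<in> regular_configurations)) \<and>
     (\<forall>s. \<forall>\<sigma>\<in>regular_configurations. 0 \<le> s \<longrightarrow> Q s s \<sigma> = return config_space \<sigma>) \<and>
     (\<forall>r s t. \<forall>\<sigma>\<in>regular_configurations. 0 \<le> r \<and> r \<le> s \<and> s \<le> t \<longrightarrow>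
        Q r s \<sigma> \<bind> Q s t = Q r t \<sigma>)"

definition has_generator ::
    "(real \<Rightarrow> real \<Rightarrow> config \<Rightarrow> config measure) \<Rightarrow>
     (real \<Rightarrow> (config \<Rightarrow> real) \<Rightarrow> config \<Rightarrow> real) \<Rightarrow> bool" where
  "has_generator Q G \<longleftrightarrow>
     (\<forall>\<tau>\<ge>0. \<forall>f. cylindric f \<longrightarrow>
        uniform_limit regular_configurations
          (\<lambda>h \<sigma>. ((\<integral>\<sigma>'. f \<sigma>' \<partial>Q \<tau> (\<tau> + h) \<sigma>) - f \<sigma>) / h) (G \<tau> f) (at_right 0))"

text \<open>The Markov property is with respect to the natural filtration of \<open>X\<close>.\<close>

definition markov_chain_from ::
    "'w measure \<Rightarrow> (real \<Rightarrow> 'w \<Rightarrow> config) \<Rightarrow> (real \<Rightarrow> real \<Rightarrow> config \<Rightarrow> config measure) \<Rightarrow> config \<Rightarrow> bool" where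
  "markov_chain_from M X Q \<sigma>0 \<longleftrightarrow>
     prob_space M \<and>
     (\<forall>t\<ge>0. X t \<in> M \<rightarrow>\<^sub>M config_space) \<and>
     (AE \<omega> in M. X 0 \<omega> = \<sigma>0) \<and>
     (AE \<omega> in M. \<forall>t\<ge>0. X t \<omega> \<in> regular_configurations) \<and>
     (\<forall>s t. \<forall>H \<in> sets (\<Pi>\<^sub>M r\<in>{0..s}. config_space). \<forall>A \<in> sets config_space. 0 \<le> s \<and> s \<le> t \<longrightarrow>
        emeasure M {\<omega> \<in> space M. (\<lambda>r\<in>{0..s}. X r \<omega>) \<in> H \<and> X t \<omega> \<in> A} =
        (\<integral>\<^sup>+\<omega>. indicator H (\<lambda>r\<in>{0..s}. X r \<omega>) * emeasure (Q s t (X s \<omega>)) A \<partial>M))"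


section \<open>Poisson clocks\<close>

text \<open>
  \<open>T k \<omega>\<close> is the set of ringing times of the clock \<open>k\<close>. The clocks are independent inhomogeneous
  Poisson processes with intensities \<open>\<rho> k\<close>.
\<close>

definition poisson_clocks ::
    "'w measure \<Rightarrow> 'k set \<Rightarrow> ('k \<Rightarrow> 'w \<Rightarrow> real set) \<Rightarrow> ('k \<Rightarrow> real \<Rightarrow> real) \<Rightarrow> bool" where
  "poisson_clocks M K T \<rho> \<longleftrightarrow>
     (\<forall>k\<in>K. \<forall>\<omega>\<in>space M. T k \<omega> \<subseteq> {0<..} \<and> (\<forall>t. finite (T k \<omega> \<inter> {0..t}))) \<and>
     (\<forall>k\<in>K. \<forall>s t n. 0 \<le> s \<and> s \<le> t \<longrightarrow>
        measure M {\<omega> \<in> space M. card (T k \<omega> \<inter> {s<..t}) = n} =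
          (integral {s..t} (\<rho> k)) ^ n / fact n * exp (- integral {s..t} (\<rho> k))) \<and>
     (\<forall>t::nat \<Rightarrow> real. t 0 = 0 \<and> mono t \<longrightarrow>
        prob_space.indep_vars M (\<lambda>_. count_space UNIV)
          (\<lambda>(k, i) \<omega>. card (T k \<omega> \<inter> {t i<..t (Suc i)})) (K \<times> UNIV))"

text \<open>
  Since the rate of a seed pair depends on its types, every position \<open>v1\<close> has one clock for each of
  the six admissible pairs of types. At any time a seed pair listens to the clock of its current
  types only. By independence of the increments of a Poisson process, this is the same as letting
  each seed pair carry its own clock while it exists.
\<close>

type_synonym clock = "vertex \<times> (vtype \<times> vtype)"

definition seed_clocks :: "clock set" where
  "seed_clocks = {v. 1 \<le> snd v} \<times> (up_types \<union> down_types)"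

fun clock_rate :: "real \<Rightarrow> real \<Rightarrow> real \<Rightarrow> clock \<Rightarrow> real \<Rightarrow> real" where
  "clock_rate q u \<eta> (v, p) \<tau> = real (snd v) * (\<eta> * exp (- \<tau>)) * seed_rate q p (u_at u \<eta> \<tau>)"

text \<open>
  A trajectory is right-continuous with left limits in the product topology, that is, edge by edge.
  In any finite time interval the whole configuration may change infinitely often; \<open>\<xi>\<close> is the state
  just before time \<open>t\<close>. Almost surely, no two clocks ring simultaneously.
\<close>

definition driven_by_clocks :: "(real \<Rightarrow> config) \<Rightarrow> (clock \<Rightarrow> real set) \<Rightarrow> bool" where
  "driven_by_clocks X T \<longleftrightarrow>
     (\<forall>t\<ge>0. \<forall>e\<in>quad_edges. \<forall>\<^sub>F s in at_right t. X s e = X t e) \<and>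
     (\<forall>t>0. \<exists>\<xi>\<in>regular_configurations.
        (\<forall>e\<in>quad_edges. \<forall>\<^sub>F s in at_left t. X s e = \<xi> e) \<and>
        (\<forall>v\<in>seed_pairs \<xi>. t \<in> T (v, pair_type \<xi> v) \<longrightarrow> X t = jump \<xi> v) \<and>
        ((\<forall>v\<in>seed_pairs \<xi>. t \<notin> T (v, pair_type \<xi> v)) \<longrightarrow> X t = \<xi>))"

end

(*
  In the columns 0, ..., N the dynamics is autonomous, and almost surely these columns are frozen
  above some height. A jump at height y is triggered only by rings at the heights y - 1, y, y + 1, so an
  influence from far above needs a long chain of rings at consecutive heights. Since the rates grow only
  linearly with the height, such chains do not occur in short time intervals, and the flow of the
  Poisson clocks is well defined on regular configurations.

  For the six vertex measures, let every row have its own parameter, and let D_y be the derivative in the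
  parameter of the row y. A computation in a single column, propagated along two neighbouring rows,
  shows that D_y - D_(y+1) is the expectation of the generator restricted to the jumps at height y.
  Summation by parts turns the weights y into the total derivative; the boundary term (H + 1) D_(H+1)
  is bounded by the probability that the row H + 1 is not frozen yet, which is exponentially small.
*)
theory Submission
  imports Defs
begin

section \<open>Jumps and columns\<close>

text \<open>All kernels live on one probability space, and the noise enters only through the numbers
  of rings in intervals, the sole quantities that \<open>poisson_clocks\<close> makes measurable;
  the flow is therefore rewritten as a function of countably many such counts. The effect on the six
  vertex measures cannot be read off the generator directly: the rates are unbounded, and the
  backward evolution of a cylindric function under all clocks need not be cylindric. Keeping only
  the clocks in the columns up to \<open>N\<close> and the heights up to \<open>H\<close> cures
  both: the evolution then preserves functions of finitely many edges, and their expectations are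
  finite sums \<open>Ex\<close>; \<open>H\<close> tends to infinity only after the integration over
  time. In the single column computation, jumps that started further left must be accounted for
  without knowing where they started. This works because, given the two edges entering a column,
  their intensity \<open>kap\<close> has the same form in every column; it vanishes on the left
  boundary, where neighbouring rows have equal states.\<close>

definition run :: "bool \<Rightarrow> config \<Rightarrow> nat \<Rightarrow> nat \<Rightarrow> nat \<Rightarrow> bool" where
  "run b \<sigma> y x i \<longleftrightarrow> x \<le> i \<and> (\<forall>i'\<in>{x..i}. \<sigma> (Hor i' y) = b \<and> \<sigma> (Hor i' (Suc y)) = (\<not> b))"

text \<open>The part of a jump to the right of its seed, with \<open>x\<close> the first horizontal
  edge swapped. Leaving out the vertical edge of the seed lets a flight start at any column, as the
  induction over columns requires.\<close>

definition flight :: "bool \<Rightarrow> nat \<Rightarrow> nat \<Rightarrow> config \<Rightarrow> config" where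
  "flight b y x \<sigma> = (\<lambda>e. case e of
      Hor i l \<Rightarrow> if (l = y \<or> l = Suc y) \<and> run b \<sigma> y x i then \<not> \<sigma> e else \<sigma> e
    | Ver i l \<Rightarrow> if l = y \<and> run b \<sigma> y x i \<and> \<not> run b \<sigma> y x (Suc i) then \<not> b else \<sigma> e)"

lemma of_bool_eq_Suc_0[simp]: "of_bool P = Suc 0 \<longleftrightarrow> P"
  by (cases P) auto

text \<open>Turns the end of a jump, given by a maximum, into a condition on two neighbouring edges.
  For an infinite \<open>J\<close> both sides fail, as it should be for
  \<open>c = \<infinity>\<close>.\<close>

lemma finite_Max_iff_downward_closed:
  fixes J :: "nat set"
  assumes "\<And>i j. j \<in> J \<Longrightarrow> i \<le> j \<Longrightarrow> i \<in> J" "0 \<in> J"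
  shows "finite J \<and> m = Max J \<longleftrightarrow> m \<in> J \<and> Suc m \<notin> J"
proof
  assume "finite J \<and> m = Max J"
  then show "m \<in> J \<and> Suc m \<notin> J"
    using assms(2) Max_in[of J] Max_ge[of J "Suc m"] by (metis empty_iff not_less_eq_eq order_refl)
next
  assume m: "m \<in> J \<and> Suc m \<notin> J"
  then have "J = {..m}"
    using assms(1) by (metis atMost_iff not_less_eq_eq subsetI subset_antisym)
  then show "finite J \<and> m = Max J"
    by (metis Max_eqI atMost_iff finite_atMost order_refl)
qed

lemma up_or_down:
  assumes "pair_type \<sigma> (x, y) \<in> up_types \<union> down_types" "b = (pair_type \<sigma> (x, y) \<in> up_types)"
  shows "\<sigma> (Hor (Suc x) y) = b" "\<sigma> (Hor (Suc x) (Suc y)) = (\<not> b)" "\<sigma> (Ver x y) = (\<not> b)"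
proof -
  have "if b then \<sigma> (Hor (Suc x) y) \<and> \<not> \<sigma> (Hor (Suc x) (Suc y)) \<and> \<not> \<sigma> (Ver x y)
    else \<not> \<sigma> (Hor (Suc x) y) \<and> \<sigma> (Hor (Suc x) (Suc y)) \<and> \<sigma> (Ver x y)"
  proof (cases b)
    case True
    then have "pair_type \<sigma> (x, y) \<in> up_types" using assms(2) by blast
    then show ?thesis using True by (simp add: up_types_def pair_type.simps) blast
  next
    case False
    then have "pair_type \<sigma> (x, y) \<in> down_types" using assms by blast
    then show ?thesis using False by (simp add: down_types_def pair_type.simps) blast
  qed
  then show "\<sigma> (Hor (Suc x) y) = b" "\<sigma> (Hor (Suc x) (Suc y)) = (\<not> b)" "\<sigma> (Ver x y) = (\<not> b)"
    by presburger+
qed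

declare jump.simps [simp del] pair_type.simps [simp del]

lemma jump_flight:
  assumes "pair_type \<sigma> (x, y) \<in> up_types \<union> down_types" "b = (pair_type \<sigma> (x, y) \<in> up_types)"
  shows "jump \<sigma> (x, y) = (flight b y (Suc x) \<sigma>)(Ver x y := b)"
proof -
  note ud = up_or_down[OF assms]
  define J where "J = jump_range b \<sigma> (x, y)"
  have J: "j \<in> J \<longleftrightarrow> run b \<sigma> y (Suc x) (x + j + 1)" for j
  proof
    assume j: "j \<in> J"
    show "run b \<sigma> y (Suc x) (x + j + 1)"
      unfolding run_def
    proof (intro conjI ballI)
      fix i' assume "i' \<in> {Suc x..x + j + 1}"
      then have "i' - Suc x \<le> j" "x + (i' - Suc x) + 1 = i'" by auto
      then show "\<sigma> (Hor i' y) = b" "\<sigma> (Hor i' (Suc y)) = (\<not> b)"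
        using j unfolding J_def by (auto dest!: spec[of _ "i' - Suc x"])
    qed auto
  next
    assume "run b \<sigma> y (Suc x) (x + j + 1)"
    then show "j \<in> J" unfolding J_def run_def by auto
  qed
  have ex: "(\<exists>j\<in>J. i = x + j + 1) \<longleftrightarrow> run b \<sigma> y (Suc x) i" for i
  proof -
    have "run b \<sigma> y (Suc x) i \<Longrightarrow> i = x + (i - Suc x) + 1"
      by (auto simp: run_def)
    then show ?thesis using J by metis
  qed
  have dc: "\<And>i j. j \<in> J \<Longrightarrow> i \<le> j \<Longrightarrow> i \<in> J" "0 \<in> J"
    using ud by (auto simp: J_def)
  have mx: "(finite J \<and> i = x + Max J + 1) \<longleftrightarrow> run b \<sigma> y (Suc x) i \<and> \<not> run b \<sigma> y (Suc x) (Suc i)" for i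
  proof (cases "x < i")
    case True
    then obtain m where m: "i = x + m + 1" by (metis add.commute add_Suc_right less_iff_Suc_add plus_1_eq_Suc)
    have "(finite J \<and> i = x + Max J + 1) \<longleftrightarrow> finite J \<and> m = Max J" using m by auto
    also have "\<dots> \<longleftrightarrow> m \<in> J \<and> Suc m \<notin> J" by (rule finite_Max_iff_downward_closed) (use dc in blast)+
    finally show ?thesis using J m by auto
  qed (auto simp: run_def)
  have sw: "run b \<sigma> y (Suc x) i \<Longrightarrow> \<sigma> (Hor i y) = b \<and> \<sigma> (Hor i (Suc y)) = (\<not> b)" for i
    by (auto simp: run_def)
  show ?thesis
    unfolding jump.simps Let_def assms(2)[symmetric] J_def[symmetric] ex mx flight_def
    using sw by (intro ext) (auto split: edge.splits simp: run_def)
qed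

section \<open>Configurations seen through finitely many columns\<close>

fun incol :: "nat \<Rightarrow> edge \<Rightarrow> bool" where
  "incol N (Hor i l) \<longleftrightarrow> i \<le> Suc N"
| "incol N (Ver i l) \<longleftrightarrow> i \<le> N"

fun row :: "edge \<Rightarrow> nat" where
  "row (Hor i l) = l"
| "row (Ver i l) = l"

text \<open>\<open>incol N\<close> includes the edges that leave column \<open>N\<close> to the
  right, so all four edges at each vertex of the columns up to \<open>N\<close> are
  compared.\<close>

definition agree :: "nat \<Rightarrow> nat set \<Rightarrow> config \<Rightarrow> config \<Rightarrow> bool" where
  "agree N R \<sigma> \<sigma>' \<longleftrightarrow> (\<forall>e\<in>quad_edges. incol N e \<and> row e \<in> R \<longrightarrow> \<sigma> e = \<sigma>' e)"

lemma quad_edges_simps[simp]: "Hor i l \<in> quad_edges \<longleftrightarrow> 1 \<le> l" "Ver i l \<in> quad_edges"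
  by (auto simp: quad_edges_def)

lemma agreeD: "agree N R \<sigma> \<sigma>' \<Longrightarrow> e \<in> quad_edges \<Longrightarrow> incol N e \<Longrightarrow> row e \<in> R \<Longrightarrow> \<sigma> e = \<sigma>' e"
  by (auto simp: agree_def)

lemma agree_refl[simp]: "agree N R \<sigma> \<sigma>" by (simp add: agree_def)
lemma agree_sym: "agree N R \<sigma> \<sigma>' \<Longrightarrow> agree N R \<sigma>' \<sigma>" by (simp add: agree_def)
lemma agree_trans: "agree N R \<sigma> \<sigma>' \<Longrightarrow> agree N R \<sigma>' \<sigma>'' \<Longrightarrow> agree N R \<sigma> \<sigma>''" by (simp add: agree_def)
lemma agree_mono: "agree N R \<sigma> \<sigma>' \<Longrightarrow> N' \<le> N \<Longrightarrow> R' \<subseteq> R \<Longrightarrow> agree N' R' \<sigma> \<sigma>'"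
proof -
  assume a: "agree N R \<sigma> \<sigma>'" "N' \<le> N" "R' \<subseteq> R"
  have "incol N' e \<Longrightarrow> incol N e" for e using a(2) by (cases e) auto
  then show ?thesis using a unfolding agree_def by blast
qed

lemma finite_incol_rows: "finite {e. incol N e \<and> row e \<le> H}"
proof -
  have "{e. incol N e \<and> row e \<le> H} \<subseteq> (\<lambda>(i, l). Hor i l) ` ({..Suc N} \<times> {..H}) \<union> (\<lambda>(i, l). Ver i l) ` ({..N} \<times> {..H})"
  proof
    fix e assume "e \<in> {e. incol N e \<and> row e \<le> H}"
    then show "e \<in> (\<lambda>(i, l). Hor i l) ` ({..Suc N} \<times> {..H}) \<union> (\<lambda>(i, l). Ver i l) ` ({..N} \<times> {..H})"
      by (cases e) auto
  qed
  then show ?thesis by (rule finite_subset) auto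
qed

text \<open>A ring of a clock whose types are not the current ones has no effect. Thus the clocks
  ring independently of the configuration, and the dependence of the rates on the types sits in this
  test.\<close>

fun act :: "clock \<Rightarrow> config \<Rightarrow> config" where
  "act (v, p) \<sigma> = (if pair_type \<sigma> v = p then jump \<sigma> v else \<sigma>)"

lemma pair_type_agree:
  assumes "agree N R \<sigma> \<sigma>'" "x \<le> N" "1 \<le> y" "{y - 1, y, Suc y} \<subseteq> R"
  shows "pair_type \<sigma> (x, y) = pair_type \<sigma>' (x, y)"
  using assms by (auto simp: agreeD[OF assms(1)] pair_type.simps)

lemma run_agree:
  assumes "agree N R \<sigma> \<sigma>'" "i \<le> Suc N" "1 \<le> y" "{y, Suc y} \<subseteq> R"
  shows "run b \<sigma> y x i = run b \<sigma>' y x i"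
  using assms by (auto simp: run_def agreeD[OF assms(1)])

lemma flight_agree:
  assumes "agree N R \<sigma> \<sigma>'" "1 \<le> y" "{y, Suc y} \<subseteq> R"
  shows "agree N R (flight b y x \<sigma>) (flight b y x \<sigma>')"
  unfolding agree_def
proof (intro ballI impI)
  fix e assume e: "e \<in> quad_edges" "incol N e \<and> row e \<in> R"
  then have "\<sigma> e = \<sigma>' e" using assms(1) by (auto simp: agree_def)
  then show "flight b y x \<sigma> e = flight b y x \<sigma>' e"
    using e assms run_agree[OF assms(1) _ assms(2,3)] by (cases e) (auto simp: flight_def)
qed

lemma jump_agree:
  assumes "agree N R \<sigma> \<sigma>'" "x \<le> N" "1 \<le> y" "{y - 1, y, Suc y} \<subseteq> R"
    "pair_type \<sigma> (x, y) \<in> up_types \<union> down_types"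
  shows "agree N R (jump \<sigma> (x, y)) (jump \<sigma>' (x, y))"
proof -
  define b where "b = (pair_type \<sigma> (x, y) \<in> up_types)"
  have pt: "pair_type \<sigma> (x, y) = pair_type \<sigma>' (x, y)" by (rule pair_type_agree[OF assms(1-4)])
  have "agree N R (flight b y (Suc x) \<sigma>) (flight b y (Suc x) \<sigma>')"
    using assms by (intro flight_agree) auto
  then show ?thesis
    unfolding jump_flight[OF assms(5) b_def] jump_flight[OF assms(5)[unfolded pt] b_def[unfolded pt]]
    by (auto simp: agree_def)
qed

text \<open>Jumps run only to the right and decide edge by edge whether to go on, so nothing beyond
  column \<open>N\<close> is consulted. The row \<open>y - 1\<close> enters through the type of the
  lower vertex.\<close>

lemma act_agree:
  assumes "agree N R \<sigma> \<sigma>'" "((x, y), p) \<in> seed_clocks" "x \<le> N" "{y - 1, y, Suc y} \<subseteq> R"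
  shows "agree N R (act ((x, y), p) \<sigma>) (act ((x, y), p) \<sigma>')"
proof -
  have y: "1 \<le> y" and p: "p \<in> up_types \<union> down_types" using assms(2) by (auto simp: seed_clocks_def)
  show ?thesis
    using assms(1) jump_agree[OF assms(1,3) y assms(4)] pair_type_agree[OF assms(1,3) y assms(4)] p
    by simp
qed

text \<open>An edge keeps its state if the seed lies in a column to its right, if its row is not
  touched, or if it is a vertical edge on top of the upper row: a jump only redistributes paths
  between two rows.\<close>

lemma act_unaffected:
  assumes "((x, y), p) \<in> seed_clocks"
    and "(incol N e \<and> N < x) \<or> row e \<noteq> y \<and> row e \<noteq> Suc y \<or> (\<exists>i. e = Ver i (Suc y))"
  shows "act ((x, y), p) \<sigma> e = \<sigma> e"
proof (cases "pair_type \<sigma> (x, y) = p")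
  case True
  then have "pair_type \<sigma> (x, y) \<in> up_types \<union> down_types" using assms by (auto simp: seed_clocks_def)
  from jump_flight[OF this refl] True show ?thesis
    using assms(2) by (cases e) (auto simp: flight_def run_def )
qed (auto)

lemma act_ext:
  assumes "k \<in> seed_clocks" "\<sigma> \<in> extensional quad_edges"
  shows "act k \<sigma> \<in> extensional quad_edges"
proof -
  obtain x y p where k: "k = ((x, y), p)" by (metis surj_pair)
  have "act k \<sigma> e = \<sigma> e" if "e \<notin> quad_edges" for e
    unfolding k by (rule act_unaffected[where N = 0]) (use that assms k in \<open>cases e; auto simp: seed_clocks_def\<close>)+
  then show ?thesis using assms by (auto simp: extensional_def)
qed

lemma vertex_type_conserve:
  "(case vertex_type \<sigma> (x, y) of (i1, j1, i2, j2) \<Rightarrow> i1 + j1 = i2 + j2) \<longleftrightarrow>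
    (\<sigma> (Ver x (y - 1)) \<and> \<sigma> (Hor x y) \<longleftrightarrow> \<sigma> (Ver x y) \<and> \<sigma> (Hor (Suc x) y)) \<and>
    (\<sigma> (Ver x (y - 1)) \<or> \<sigma> (Hor x y) \<longleftrightarrow> \<sigma> (Ver x y) \<or> \<sigma> (Hor (Suc x) y))"
  by (auto simp: of_bool_def)

text \<open>Conservation has to be rechecked in the rows \<open>y\<close> and \<open>y + 1\<close>
  only: at the seed column, inside the run, and at the column where the run ends.\<close>

lemma act_configurations:
  assumes k: "k \<in> seed_clocks" and \<sigma>: "\<sigma> \<in> configurations"
  shows "act k \<sigma> \<in> configurations"
proof -
  obtain x y p where k': "k = ((x, y), p)" by (metis surj_pair)
  show ?thesis
  proof (cases "pair_type \<sigma> (x, y) = p")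
    case True
    define \<sigma>' where "\<sigma>' = act k \<sigma>"
    define b where "b = (pair_type \<sigma> (x, y) \<in> up_types)"
    have pt: "pair_type \<sigma> (x, y) \<in> up_types \<union> down_types" and y: "1 \<le> y"
      using k True by (auto simp: seed_clocks_def k')
    have \<sigma>': "\<sigma>' = (flight b y (Suc x) \<sigma>)(Ver x y := b)"
      using True jump_flight[OF pt b_def] by (simp add: \<sigma>'_def k' )
    note ud = up_or_down[OF pt b_def]
    have C: "(\<sigma> (Ver x (y - 1)) \<and> \<sigma> (Hor x y) \<longleftrightarrow> \<sigma> (Ver x y) \<and> \<sigma> (Hor (Suc x) y)) \<and>
    (\<sigma> (Ver x (y - 1)) \<or> \<sigma> (Hor x y) \<longleftrightarrow> \<sigma> (Ver x y) \<or> \<sigma> (Hor (Suc x) y))" if "1 \<le> y" for x y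
      using \<sigma> that unfolding configurations_def vertex_type_conserve by auto
    have E: "\<sigma>' e = \<sigma> e" if "row e \<noteq> y \<and> row e \<noteq> Suc y \<or> (\<exists>i. e = Ver i (Suc y))" for e
      unfolding \<sigma>'_def k' using k[unfolded k'] that by (intro act_unaffected[where N = 0]) auto
    have rS: "run b \<sigma> y (Suc x) (Suc i) \<longleftrightarrow> run b \<sigma> y (Suc x) i \<and> \<sigma> (Hor (Suc i) y) = b \<and> \<sigma> (Hor (Suc i) (Suc y)) = (\<not> b)"
      if "x < i" for i
      using that unfolding run_def by (auto simp: le_Suc_eq)
    have rD: "run b \<sigma> y (Suc x) i \<Longrightarrow> \<sigma> (Hor i y) = b \<and> \<sigma> (Hor i (Suc y)) = (\<not> b)" for i
      by (auto simp: run_def)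
    have rx: "run b \<sigma> y (Suc x) (Suc x)" using ud by (auto simp: run_def)
    have rl: "\<not> run b \<sigma> y (Suc x) i" if "i \<le> x" for i using that by (auto simp: run_def)
    have H: "\<sigma>' (Hor i y) = (if run b \<sigma> y (Suc x) i then \<not> b else \<sigma> (Hor i y))"
      "\<sigma>' (Hor i (Suc y)) = (if run b \<sigma> y (Suc x) i then b else \<sigma> (Hor i (Suc y)))"
      "\<sigma>' (Ver i y) = (if i = x then b else if run b \<sigma> y (Suc x) i \<and> \<not> run b \<sigma> y (Suc x) (Suc i) then \<not> b else \<sigma> (Ver i y))" for i
      unfolding \<sigma>' flight_def using rD[of i] by auto
    have "(\<sigma>' (Ver i (l - 1)) \<and> \<sigma>' (Hor i l) \<longleftrightarrow> \<sigma>' (Ver i l) \<and> \<sigma>' (Hor (Suc i) l)) \<and>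
    (\<sigma>' (Ver i (l - 1)) \<or> \<sigma>' (Hor i l) \<longleftrightarrow> \<sigma>' (Ver i l) \<or> \<sigma>' (Hor (Suc i) l))" if l: "1 \<le> l" for i l
    proof -
      have VV: "\<sigma>' (Ver i (y - 1)) = \<sigma> (Ver i (y - 1))" "\<sigma>' (Ver i (Suc y)) = \<sigma> (Ver i (Suc y))"
        using y by (auto intro!: E)
      note C1 = C[OF y, of i] and C2 = C[of "Suc y" i, simplified]
      consider "l \<noteq> y" "l \<noteq> Suc y" | "l = y \<or> l = Suc y" by blast
      then show ?thesis
      proof cases
        case 1
        then have "\<sigma>' (Ver i (l - 1)) = \<sigma> (Ver i (l - 1))"
          using l by (intro E) (cases "l - 1 = Suc y"; auto)
        with 1 show ?thesis using C[OF l, of i] E[of "Hor i l"] E[of "Ver i l"] E[of "Hor (Suc i) l"] by simp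
      next
        case 2
        consider "i < x" | "i = x" | "x < i" by linarith
        then show ?thesis
        proof cases
          case 1
          then have "\<sigma>' (Hor i y) = \<sigma> (Hor i y)" "\<sigma>' (Hor i (Suc y)) = \<sigma> (Hor i (Suc y))" "\<sigma>' (Ver i y) = \<sigma> (Ver i y)"
            "\<sigma>' (Hor (Suc i) y) = \<sigma> (Hor (Suc i) y)" "\<sigma>' (Hor (Suc i) (Suc y)) = \<sigma> (Hor (Suc i) (Suc y))"
            using rl[of i] rl[of "Suc i"] by (simp_all add: H)
          then show ?thesis using 2 C1 C2 VV by (elim disjE) simp_all
        next
          case i: 2
          have "\<sigma>' (Hor i y) = \<sigma> (Hor i y)" "\<sigma>' (Hor i (Suc y)) = \<sigma> (Hor i (Suc y))" "\<sigma>' (Ver i y) = b"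
            "\<sigma>' (Hor (Suc i) y) = (\<not> b)" "\<sigma>' (Hor (Suc i) (Suc y)) = b"
            using rl[of i] rx i by (simp_all add: H)
          then show ?thesis using 2 C1 C2 VV ud i by (elim disjE; cases b) simp_all
        next
          case 3
          \<comment> \<open>Where the run ends, one of the two outgoing edges differs from the
            pattern of the run, and conservation at its vertex forces the vertical edge between the
            rows into the state \<open>b\<close>. This is why the jump may flip it to
            \<open>\<not> b\<close>.\<close>
          have r: "\<sigma> (Ver i y) = b" if "run b \<sigma> y (Suc x) i" "\<not> run b \<sigma> y (Suc x) (Suc i)"
            using that rS[OF 3] rD[of i] C1 C2 by auto
          show ?thesis
          proof (cases "run b \<sigma> y (Suc x) i")
            case True
            note d = rD[OF this] and r = r[OF this]
            have h: "\<sigma>' (Hor i y) = (\<not> b)" "\<sigma>' (Hor i (Suc y)) = b" using True by (simp_all add: H)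
            show ?thesis
            proof (cases "run b \<sigma> y (Suc x) (Suc i)")
              case R: True
              have "\<sigma>' (Ver i y) = \<sigma> (Ver i y)" "\<sigma>' (Hor (Suc i) y) = (\<not> b)" "\<sigma>' (Hor (Suc i) (Suc y)) = b"
                using R 3 by (simp_all add: H)
              then show ?thesis using 2 C1 C2 VV h d rD[OF R] by (elim disjE; cases b) simp_all
            next
              case R: False
              have "\<sigma>' (Ver i y) = (\<not> b)" "\<sigma>' (Hor (Suc i) y) = \<sigma> (Hor (Suc i) y)" "\<sigma>' (Hor (Suc i) (Suc y)) = \<sigma> (Hor (Suc i) (Suc y))"
                using R 3 True by (simp_all add: H)
              then show ?thesis using 2 C1 C2 VV h d r[OF R] by (elim disjE; cases b) simp_all
            qed
          next
            case False
            then have "\<sigma>' (Hor i y) = \<sigma> (Hor i y)" "\<sigma>' (Hor i (Suc y)) = \<sigma> (Hor i (Suc y))" "\<sigma>' (Ver i y) = \<sigma> (Ver i y)"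
              "\<sigma>' (Hor (Suc i) y) = \<sigma> (Hor (Suc i) y)" "\<sigma>' (Hor (Suc i) (Suc y)) = \<sigma> (Hor (Suc i) (Suc y))"
              using 3 rS[OF 3] by (simp_all add: H)
            then show ?thesis using 2 C1 C2 VV by (elim disjE) simp_all
          qed
        qed
      qed
    qed
    then show ?thesis
      using act_ext[OF k] \<sigma> unfolding configurations_def vertex_type_conserve \<sigma>'_def by auto
  qed (use \<sigma> k' in \<open>auto\<close>)
qed

section \<open>Heights above which the first columns are trivial\<close>

definition triv :: "nat \<Rightarrow> nat \<Rightarrow> config \<Rightarrow> bool" where
  "triv N L \<sigma> \<longleftrightarrow> (\<forall>x\<le>N. \<forall>y\<ge>L. vertex_type \<sigma> (x, y) = (0, 0, 0, 0)) \<or>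
     (\<forall>x\<le>N. \<forall>y\<ge>L. vertex_type \<sigma> (x, y) = (1, 1, 1, 1))"

lemma triv_mono: "triv N L \<sigma> \<Longrightarrow> N' \<le> N \<Longrightarrow> L \<le> L' \<Longrightarrow> triv N' L' \<sigma>"
  unfolding triv_def by (meson order_trans)

lemma regular_iff: "\<sigma> \<in> regular_configurations \<longleftrightarrow> \<sigma> \<in> configurations \<and> (\<forall>N. \<exists>L. triv N L \<sigma>)"
proof -
  have *: "(\<exists>L. triv N L \<sigma>) \<longleftrightarrow> (\<exists>L\<ge>1. triv N L \<sigma>)" for N
    using triv_mono[of N _ \<sigma> N] by (meson max.cobounded1 max.cobounded2 order_refl)
  have "(\<forall>N. \<exists>L. triv N L \<sigma>) \<longleftrightarrow> (\<forall>N>0. \<exists>L. triv N L \<sigma>)"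
    using triv_mono by (metis le_add2 zero_less_one le_add1 plus_1_eq_Suc zero_less_Suc order_refl)
  then show ?thesis
    unfolding regular_configurations_def triv_def[symmetric] using * by auto
qed

lemma triv_agree: "agree N UNIV \<sigma> \<sigma>' \<Longrightarrow> 1 \<le> L \<Longrightarrow> triv N L \<sigma> \<Longrightarrow> triv N L \<sigma>'"
proof -
  assume a: "agree N UNIV \<sigma> \<sigma>'" "1 \<le> L" and t: "triv N L \<sigma>"
  have "vertex_type \<sigma> (x, y) = vertex_type \<sigma>' (x, y)" if "x \<le> N" "L \<le> y" for x y
    using that a by (auto simp: agreeD[OF a(1)])
  then show ?thesis using t unfolding triv_def by simp
qed

lemma triv_act_id:
  assumes "triv N L \<sigma>" "((x, y), p) \<in> seed_clocks" "x \<le> N" "L \<le> y"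
  shows "act ((x, y), p) \<sigma> = \<sigma>"
proof -
  have "pair_type \<sigma> (x, y) = ((0,0,0,0),(0,0,0,0)) \<or> pair_type \<sigma> (x, y) = ((1,1,1,1),(1,1,1,1))"
    using assms unfolding triv_def by (auto simp: pair_type.simps simp del: vertex_type.simps)
  then have "pair_type \<sigma> (x, y) \<noteq> p"
    using assms(2) unfolding seed_clocks_def up_types_def down_types_def by auto
  then show ?thesis by simp
qed

text \<open>A jump at a height below \<open>L - 1\<close> does not reach the trivial rows, and a
  jump at height \<open>L\<close> or more in these columns does not exist, as trivial types form no
  seed pair. So the trivial region can shrink only through a ring at height
  \<open>L - 1\<close>.\<close>

lemma triv_act:
  assumes "triv N L \<sigma>" "((x, y), p) \<in> seed_clocks" "x \<le> N \<longrightarrow> Suc y \<noteq> L"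
  shows "triv N L (act ((x, y), p) \<sigma>)"
proof (cases "x \<le> N \<and> L \<le> y")
  case True
  then show ?thesis using triv_act_id assms by simp
next
  case False
  have "vertex_type (act ((x, y), p) \<sigma>) (x', y') = vertex_type \<sigma> (x', y')" if "x' \<le> N" "L \<le> y'" for x' y'
  proof -
    have "act ((x, y), p) \<sigma> e = \<sigma> e"
      if "e \<in> {Ver x' (y' - 1), Hor x' y', Ver x' y', Hor (x' + 1) y'}" for e
      using that False assms(3) \<open>x' \<le> N\<close> \<open>L \<le> y'\<close>
      by (intro act_unaffected[OF assms(2), where N = N]) auto
    then show ?thesis by (simp del: act.simps)
  qed
  then show ?thesis using assms(1) unfolding triv_def by (simp del: vertex_type.simps act.simps)
qed

lemma act_regular:
  assumes "k \<in> seed_clocks" "\<sigma> \<in> regular_configurations"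
  shows "act k \<sigma> \<in> regular_configurations"
proof -
  obtain x y p where k: "k = ((x, y), p)" by (metis surj_pair)
  have "\<exists>L. triv N L (act k \<sigma>)" for N
  proof -
    obtain L where "triv N L \<sigma>" using assms(2) by (auto simp: regular_iff)
    then have "triv N (max L (y + 2)) \<sigma>" by (rule triv_mono) auto
    then have "triv N (max L (y + 2)) (act k \<sigma>)" unfolding k by (rule triv_act) (use assms k in auto)
    then show ?thesis by blast
  qed
  then show ?thesis using assms act_configurations by (auto simp: regular_iff)
qed

declare split_paired_All [simp del] split_paired_Ex [simp del] act.simps [simp del]

section \<open>The flow of the clocks\<close>

text \<open>The choice by \<open>SOME\<close> is unambiguous once no two clocks ring at the same
  time.\<close>

definition act_at :: "(clock \<Rightarrow> real set) \<Rightarrow> clock set \<Rightarrow> real \<Rightarrow> config \<Rightarrow> config" where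
  "act_at T K r = (if \<exists>k\<in>K. r \<in> T k then act (SOME k. k \<in> K \<and> r \<in> T k) else id)"

text \<open>The set \<open>A\<close> may contain times at which no clock of \<open>K\<close> rings.
  This allows two clock sets to be compared along the same list of times.\<close>

definition evo :: "(clock \<Rightarrow> real set) \<Rightarrow> clock set \<Rightarrow> real set \<Rightarrow> config \<Rightarrow> config" where
  "evo T K A = fold (act_at T K) (sorted_list_of_set A)"

definition rings :: "(clock \<Rightarrow> real set) \<Rightarrow> clock set \<Rightarrow> real set \<Rightarrow> real set" where
  "rings T K I = (\<Union>k\<in>K. T k) \<inter> I"

abbreviation evoI :: "(clock \<Rightarrow> real set) \<Rightarrow> clock set \<Rightarrow> real set \<Rightarrow> config \<Rightarrow> config" where
  "evoI T K I \<equiv> evo T K (rings T K I)"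

lemma ex_forall_ge_const:
  assumes "\<And>n. n \<ge> m0 \<Longrightarrow> f n = c"
  shows "(\<exists>m::nat. \<forall>n\<ge>m. f n) = c"
  using assms by (cases c) (blast, metis max.cobounded1 max.cobounded2)

lemma evo_empty[simp]: "evo T K {} \<sigma> = \<sigma>"
  by (simp add: evo_def)

lemma sorted_list_of_set_Un_less:
  fixes A B :: "'a::linorder set"
  assumes "finite A" "finite B" "\<forall>a\<in>A. \<forall>b\<in>B. a < b"
  shows "sorted_list_of_set (A \<union> B) = sorted_list_of_set A @ sorted_list_of_set B"
  by (rule sorted_distinct_set_unique) (use assms in \<open>fastforce simp: sorted_append\<close>)+

lemma evo_Un:
  assumes "finite A" "finite B" "\<forall>a\<in>A. \<forall>b\<in>B. a < b"
  shows "evo T K (A \<union> B) \<sigma> = evo T K B (evo T K A \<sigma>)"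
  unfolding evo_def sorted_list_of_set_Un_less[OF assms] by simp

lemma evo_single: "evo T K {r} \<sigma> = act_at T K r \<sigma>"
  by (simp add: evo_def)

lemma evo_insert:
  assumes "finite A" "\<forall>a\<in>A. a < b"
  shows "evo T K (insert b A) \<sigma> = act_at T K b (evo T K A \<sigma>)"
  using evo_Un[of A "{b}"] assms by (simp add: evo_single)

lemma evo_rings: "finite A \<Longrightarrow> evo T K (A \<inter> rings T K UNIV) \<sigma> = evo T K A \<sigma>"
proof (induction A rule: finite_linorder_max_induct)
  case (insert b A)
  show ?case
  proof (cases "b \<in> rings T K UNIV")
    case True
    then have "insert b A \<inter> rings T K UNIV = insert b (A \<inter> rings T K UNIV)" by auto
    then show ?thesis using insert by (simp add: evo_insert)
  next
    case False
    then have "act_at T K b = id" by (auto simp: act_at_def rings_def)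
    then show ?thesis using False insert by (simp add: evo_insert)
  qed
qed auto

lemma evoI_eq:
  assumes "finite A" "rings T K I \<subseteq> A" "A \<subseteq> I"
  shows "evoI T K I \<sigma> = evo T K A \<sigma>"
proof -
  have "A \<inter> rings T K UNIV = rings T K I" using assms by (auto simp: rings_def)
  then show ?thesis using evo_rings[OF assms(1), of T K \<sigma>] by simp
qed

lemma evo_induct[consumes 1]:
  assumes "finite A" "P \<sigma>" "\<And>k \<sigma>. k \<in> K \<Longrightarrow> P \<sigma> \<Longrightarrow> P (act k \<sigma>)"
  shows "P (evo T K A \<sigma>)"
  using assms(1)
proof (induction A rule: finite_linorder_max_induct)
  case (insert b A)
  show ?case
  proof (cases "\<exists>k\<in>K. b \<in> T k")
    case True
    then have "(SOME k. k \<in> K \<and> b \<in> T k) \<in> K"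
      using someI_ex[of "\<lambda>k. k \<in> K \<and> b \<in> T k"] by blast
    then show ?thesis using insert assms(3) True by (simp only: evo_insert act_at_def if_True)
  next
    case False
    then show ?thesis using insert by (simp only: evo_insert act_at_def if_False id_apply)
  qed
qed (use assms in auto)

definition chain :: "(clock \<Rightarrow> real set) \<Rightarrow> nat \<Rightarrow> nat \<Rightarrow> nat \<Rightarrow> real set \<Rightarrow> bool" where
  "chain T N y n I \<longleftrightarrow> (\<exists>f::nat \<Rightarrow> real.
     (\<forall>i<n. f i \<in> I \<and> (\<exists>x\<le>N. \<exists>p. ((x, y + i), p) \<in> seed_clocks \<and> f i \<in> T ((x, y + i), p))) \<and>
     (\<forall>i. Suc i < n \<longrightarrow> f i < f (Suc i)))"

lemma chain_mono: "chain T N y n I \<Longrightarrow> I \<subseteq> I' \<Longrightarrow> chain T N y n I'"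
  unfolding chain_def by blast

lemma chain_shorter: "chain T N y n I \<Longrightarrow> m \<le> n \<Longrightarrow> chain T N y m I"
  unfolding chain_def by (metis (no_types, lifting) order_less_le_trans)

text \<open>The height is strictly below \<open>H\<close>, so the box with the heights
  \<open>1\<close> to \<open>H\<close> is \<open>kbox N (Suc H)\<close>.\<close>

definition kbox :: "nat \<Rightarrow> nat \<Rightarrow> clock set" where
  "kbox N H = {k \<in> seed_clocks. fst (fst k) \<le> N \<and> snd (fst k) < H}"

lemma kbox_seed: "kbox N H \<subseteq> seed_clocks" by (auto simp: kbox_def)

lemma kbox_mono: "N \<le> N' \<Longrightarrow> H \<le> H' \<Longrightarrow> kbox N H \<subseteq> kbox N' H'" by (auto simp: kbox_def)

lemma finite_types: "finite (up_types \<union> down_types)"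
  by (simp add: up_types_def down_types_def)

lemma finite_kbox: "finite (kbox N H)"
proof (rule finite_subset)
  show "kbox N H \<subseteq> ({..N} \<times> {..<H}) \<times> (up_types \<union> down_types)"
    by (auto simp: kbox_def seed_clocks_def)
  show "finite (({..N} \<times> {..<H}) \<times> (up_types \<union> down_types))"
    using finite_types by blast
qed

lemma finite_sub_kbox:
  assumes "finite K" "K \<subseteq> seed_clocks"
  shows "\<exists>n0. \<forall>n\<ge>n0. K \<subseteq> kbox n n"
proof -
  define n0 where "n0 = Suc (Max (insert 0 ((\<lambda>k. max (fst (fst k)) (snd (fst k))) ` K)))"
  have "max (fst (fst k)) (snd (fst k)) < n0" if "k \<in> K" for k
    using assms(1) that unfolding n0_def by (intro le_imp_less_Suc Max_ge) auto
  then have "K \<subseteq> kbox n n" if "n0 \<le> n" for n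
    using that assms(2) unfolding kbox_def by fastforce
  then show ?thesis by blast
qed

text \<open>
  \<open>no_chain\<close> excludes explosions: the height above which the first columns are trivial grows by
  rings at successive levels only.
\<close>

locale good_rings =
  fixes T :: "clock \<Rightarrow> real set"
  assumes fin: "k \<in> seed_clocks \<Longrightarrow> finite (T k \<inter> {0..t})"
    and pos: "k \<in> seed_clocks \<Longrightarrow> T k \<subseteq> {0<..}"
    and no_ties: "k \<in> seed_clocks \<Longrightarrow> k' \<in> seed_clocks \<Longrightarrow> r \<in> T k \<Longrightarrow> r \<in> T k' \<Longrightarrow> k = k'"
    and no_chain: "\<exists>\<delta>>0. \<forall>(j::nat) y. \<exists>n. \<not> chain T N y n {real j * \<delta><..real (Suc j) * \<delta>}"
begin

lemma act_at_ring:
  assumes "K \<subseteq> seed_clocks" "k \<in> K" "r \<in> T k"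
  shows "act_at T K r = act k"
proof -
  have "(SOME k. k \<in> K \<and> r \<in> T k) = k"
    using assms no_ties by (intro some_equality) blast+
  then show ?thesis using assms unfolding act_at_def by (metis (full_types))
qed

lemma act_at_no_ring:
  assumes "\<And>k. k \<in> K \<Longrightarrow> r \<notin> T k"
  shows "act_at T K r = id"
  using assms by (auto simp: act_at_def)

lemma finite_rings:
  assumes "finite K" "K \<subseteq> seed_clocks" "I \<subseteq> {..t}"
  shows "finite (rings T K I)"
proof (rule finite_subset)
  show "rings T K I \<subseteq> (\<Union>k\<in>K. T k \<inter> {0..t})"
  proof
    fix r assume "r \<in> rings T K I"
    then obtain k where "k \<in> K" "r \<in> T k" "r \<in> I" by (auto simp: rings_def)
    then show "r \<in> (\<Union>k\<in>K. T k \<inter> {0..t})" using assms pos[of k] by force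
  qed
  show "finite (\<Union>k\<in>K. T k \<inter> {0..t})"
    using assms fin by blast
qed

text \<open>Induction on the last time. If the level \<open>Suc y + m\<close> is lost at that time,
  the ring is at height \<open>y + m\<close>, and the level below must have been lost before; the
  earlier times then carry a chain that this ring prolongs by one.\<close>

lemma chain_of_not_triv:
  assumes "finite A" "K \<subseteq> seed_clocks" "triv N (Suc y) \<sigma>"
    and "\<not> triv N (Suc y + m) (evo T K A \<sigma>)"
  shows "chain T N y (Suc m) A"
  using assms(1,4)
proof (induction A arbitrary: m rule: finite_linorder_max_induct)
  case empty
  then show ?case using triv_mono[OF assms(3), of N "Suc y + m"] by auto
next
  case (insert b A)
  define \<sigma>' where "\<sigma>' = evo T K A \<sigma>"
  have nt: "\<not> triv N (Suc y + m) (act_at T K b \<sigma>')"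
    using insert by (simp add: evo_insert \<sigma>'_def)
  show ?case
  proof (cases "triv N (Suc y + m) \<sigma>'")
    case False
    then have "chain T N y (Suc m) A" using insert.IH \<sigma>'_def by simp
    then show ?thesis by (rule chain_mono) auto
  next
    case True
    have "\<exists>k\<in>K. b \<in> T k" using nt True act_at_no_ring by fastforce
    then obtain x' y' p where k: "((x', y'), p) \<in> K" "b \<in> T ((x', y'), p)" by (metis surj_pair)
    then have seed: "((x', y'), p) \<in> seed_clocks" using assms by auto
    have nt': "\<not> triv N (Suc y + m) (act ((x', y'), p) \<sigma>')"
      using nt act_at_ring[OF assms(2) k] by simp
    then have x': "x' \<le> N" and y': "y' = y + m"
      using triv_act[OF True seed] by auto
    show ?thesis
    proof (cases m)
      case 0
      then show ?thesis
        unfolding chain_def using k seed x' y' by (intro exI[of _ "\<lambda>_. b"]) (simp, blast)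
    next
      case (Suc m')
      \<comment> \<open>Otherwise the ring at height \<open>y + m = Suc y + m'\<close> would fall
        into the trivial region and do nothing.\<close>
      have "\<not> triv N (Suc y + m') \<sigma>'"
        using nt' triv_act_id[of N "Suc y + m'" \<sigma>' x' y' p] seed x' y' Suc True by auto
      then have "chain T N y (Suc m') A" using insert.IH \<sigma>'_def by simp
      then obtain f where f: "\<And>i. i < Suc m' \<Longrightarrow> f i \<in> A \<and> (\<exists>x\<le>N. \<exists>p. ((x, y + i), p) \<in> seed_clocks \<and> f i \<in> T ((x, y + i), p))"
        "\<And>i. Suc i < Suc m' \<Longrightarrow> f i < f (Suc i)"
        unfolding chain_def by blast
      show ?thesis
        unfolding chain_def
      proof (rule exI[of _ "f(Suc m' := b)"], intro conjI allI impI)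
        fix i assume "i < Suc m"
        then consider "i < Suc m'" | "i = Suc m'" using Suc by linarith
        then show "(f(Suc m' := b)) i \<in> insert b A"
          "\<exists>x\<le>N. \<exists>p. ((x, y + i), p) \<in> seed_clocks \<and> (f(Suc m' := b)) i \<in> T ((x, y + i), p)"
          by (cases; use f(1)[of i] k seed x' y' Suc in auto)+
      next
        fix i assume "Suc i < Suc m"
        then consider "Suc i < Suc m'" | "i = m'" using Suc by linarith
        then show "(f(Suc m' := b)) i < (f(Suc m' := b)) (Suc i)"
          by cases (use f(1)[of i] f(2)[of i] insert.hyps Suc in auto)
      qed
    qed
  qed
qed

text \<open>The time interval is crossed in steps of length \<delta>; if no chain of length
  \<open>n\<close> starts at the present level within a step, the level rises by at most
  \<open>n\<close>. The resulting \<open>H\<close> is uniform in the configuration, the clock set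
  and the times, so it controls all finite approximations at once.\<close>

lemma triv_bound:
  "\<exists>H\<ge>1. \<forall>\<sigma> K A. triv N L \<sigma> \<longrightarrow> K \<subseteq> seed_clocks \<longrightarrow> finite A \<longrightarrow> A \<subseteq> {0<..t} \<longrightarrow> triv N H (evo T K A \<sigma>)"
proof -
  obtain \<delta> where \<delta>: "\<delta> > 0" "\<And>(j::nat) y. \<exists>n. \<not> chain T N y n {real j * \<delta><..real (Suc j) * \<delta>}"
    using no_chain by blast
  have "\<exists>y. \<forall>\<sigma> K A. triv N L \<sigma> \<longrightarrow> K \<subseteq> seed_clocks \<longrightarrow> finite A \<longrightarrow> A \<subseteq> {0<..real j * \<delta>} \<longrightarrow> triv N (Suc y) (evo T K A \<sigma>)" for j
  proof (induction j)
    case 0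
    have "triv N L \<sigma> \<longrightarrow> triv N (Suc L) \<sigma>" for \<sigma> using triv_mono by auto
    then show ?case by (intro exI[of _ L]) auto
  next
    case (Suc j)
    then obtain y where y: "\<And>\<sigma> K A. triv N L \<sigma> \<Longrightarrow> K \<subseteq> seed_clocks \<Longrightarrow> finite A \<Longrightarrow> A \<subseteq> {0<..real j * \<delta>} \<Longrightarrow> triv N (Suc y) (evo T K A \<sigma>)"
      by blast
    obtain n where n: "\<not> chain T N y n {real j * \<delta><..real (Suc j) * \<delta>}" using \<delta> by blast
    show ?case
    proof (intro exI[of _ "y + n"] allI impI)
      fix \<sigma> K A assume a: "triv N L \<sigma>" "K \<subseteq> seed_clocks" "finite A" "A \<subseteq> {0<..real (Suc j) * \<delta>}"
      define A1 A2 where "A1 = A \<inter> {..real j * \<delta>}" and "A2 = A \<inter> {real j * \<delta><..}"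
      have A: "A = A1 \<union> A2" "finite A1" "finite A2" "A1 \<subseteq> {0<..real j * \<delta>}" "A2 \<subseteq> {real j * \<delta><..real (Suc j) * \<delta>}"
        using a by (auto simp: A1_def A2_def)
      have "evo T K A \<sigma> = evo T K A2 (evo T K A1 \<sigma>)"
        unfolding A(1) by (rule evo_Un) (auto simp: A1_def A2_def a)
      moreover have "triv N (Suc y + n) (evo T K A2 (evo T K A1 \<sigma>))"
      proof (rule ccontr)
        assume "\<not> ?thesis"
        then have "chain T N y (Suc n) A2"
          by (rule chain_of_not_triv[OF A(3) a(2) y[OF a(1,2) A(2,4)]])
        then show False using n chain_mono[OF _ A(5)] chain_shorter by (metis Suc_n_not_le_n linear)
      qed
      ultimately show "triv N (Suc (y + n)) (evo T K A \<sigma>)" by simp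
    qed
  qed
  moreover obtain j :: nat where "t \<le> real j * \<delta>"
    using real_arch_simple[of "t / \<delta>"] \<delta>(1) by (auto simp: pos_divide_le_eq)
  ultimately obtain y where y: "\<forall>\<sigma> K A. triv N L \<sigma> \<longrightarrow> K \<subseteq> seed_clocks \<longrightarrow> finite A \<longrightarrow> A \<subseteq> {0<..real j * \<delta>} \<longrightarrow> triv N (Suc y) (evo T K A \<sigma>)"
    by blast
  have "{0<..t} \<subseteq> {0<..real j * \<delta>}" using \<open>t \<le> real j * \<delta>\<close> by auto
  then show ?thesis using y by (intro exI[of _ "Suc y"]) (auto dest: subset_trans)
qed

text \<open>Since both evolutions stay trivial above a common \<open>H\<close>, clocks outside
  \<open>kbox N H\<close> are invisible in the columns up to \<open>N\<close>. Hence enlarging the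
  box beyond \<open>H\<close> changes nothing there.\<close>

lemma evo_agree:
  "\<exists>H\<ge>1. \<forall>\<sigma> \<sigma>' K K' A. triv N L \<sigma> \<longrightarrow> agree N UNIV \<sigma> \<sigma>' \<longrightarrow> K \<subseteq> seed_clocks \<longrightarrow> K' \<subseteq> seed_clocks \<longrightarrow>
     K \<inter> kbox N H = K' \<inter> kbox N H \<longrightarrow> finite A \<longrightarrow> A \<subseteq> {0<..t} \<longrightarrow>
     agree N UNIV (evo T K A \<sigma>) (evo T K' A \<sigma>')"
proof -
  obtain H where H: "H \<ge> 1" "\<And>\<sigma> K A. triv N L \<sigma> \<Longrightarrow> K \<subseteq> seed_clocks \<Longrightarrow> finite A \<Longrightarrow> A \<subseteq> {0<..t} \<Longrightarrow> triv N H (evo T K A \<sigma>)"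
    using triv_bound[of N L t] by blast
  have key: "agree N UNIV (act_at T K b \<sigma>) (act_at T K' b \<sigma>')"
    if KK: "K \<subseteq> seed_clocks" "K' \<subseteq> seed_clocks" "K \<inter> kbox N H = K' \<inter> kbox N H"
      and tr: "triv N H \<sigma>" "triv N H \<sigma>'" and ag: "agree N UNIV \<sigma> \<sigma>'" for \<sigma> \<sigma>' K K' b
  proof -
    \<comment> \<open>A ring outside the box either starts to the right of column \<open>N\<close>
      or falls into the trivial region.\<close>
    have out: "agree N UNIV (act_at T K b \<sigma>) \<sigma>"
      if "K \<subseteq> seed_clocks" "triv N H \<sigma>" "\<And>k. k \<in> K \<inter> kbox N H \<Longrightarrow> b \<notin> T k" for \<sigma> K
    proof (cases "\<exists>k\<in>K. b \<in> T k")
      case True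
      then obtain x y p where k: "((x, y), p) \<in> K" "b \<in> T ((x, y), p)" by (metis surj_pair)
      then have s: "((x, y), p) \<in> seed_clocks" and "((x, y), p) \<notin> kbox N H" using that by blast+
      then have xy: "N < x \<or> x \<le> N \<and> H \<le> y" by (auto simp: kbox_def)
      have "act ((x, y), p) \<sigma> e = \<sigma> e" if "incol N e" for e
        using xy triv_act_id[OF \<open>triv N H \<sigma>\<close> s] act_unaffected[OF s, of N e] that by auto
      then show ?thesis using act_at_ring[OF that(1) k] by (auto simp: agree_def)
    qed (use act_at_no_ring in force)
    show ?thesis
    proof (cases "\<exists>k\<in>K \<inter> kbox N H. b \<in> T k")
      case True
      then obtain x y p where k: "((x, y), p) \<in> K \<inter> kbox N H" "b \<in> T ((x, y), p)" by (metis surj_pair)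
      then have k': "((x, y), p) \<in> K'" using that(3) by auto
      have "agree N UNIV (act ((x, y), p) \<sigma>) (act ((x, y), p) \<sigma>')"
        by (rule act_agree[OF ag]) (use k in \<open>auto simp: kbox_def\<close>)
      then show ?thesis using act_at_ring[OF KK(1) _ k(2)] act_at_ring[OF KK(2) k' k(2)] k(1) by simp
    next
      case False
      then have "agree N UNIV (act_at T K b \<sigma>) \<sigma>" "agree N UNIV (act_at T K' b \<sigma>') \<sigma>'"
        using out[of K \<sigma>] out[of K' \<sigma>'] KK tr by auto
      then show ?thesis using ag agree_trans agree_sym by metis
    qed
  qed
  show ?thesis
  proof (intro exI[of _ "max H (max 1 L)"] conjI allI impI)
    fix \<sigma> \<sigma>' K K' A
    assume a: "triv N L \<sigma>" "agree N UNIV \<sigma> \<sigma>'" "K \<subseteq> seed_clocks" "K' \<subseteq> seed_clocks"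
      "K \<inter> kbox N (max H (max 1 L)) = K' \<inter> kbox N (max H (max 1 L))" "finite A" "A \<subseteq> {0<..t}"
    have KK: "K \<inter> kbox N H = K' \<inter> kbox N H" using a(5) kbox_mono[of N N H "max H (max 1 L)"] by auto
    have tb: "triv N H (evo T K A \<sigma>)" if "finite A" "A \<subseteq> {0<..t}" for A
      using H(2) a that by auto
    show "agree N UNIV (evo T K A \<sigma>) (evo T K' A \<sigma>')"
      using a(6,7)
    proof (induction A rule: finite_linorder_max_induct)
      case (insert b A)
      have ag: "agree N UNIV (evo T K A \<sigma>) (evo T K' A \<sigma>')" using insert by auto
      have t1: "triv N H (evo T K A \<sigma>)" using tb insert by auto
      have t2: "triv N H (evo T K' A \<sigma>')" using triv_agree[OF ag H(1) t1] .
      show ?case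
        using key[OF a(3,4) KK t1 t2 ag, of b] insert by (simp add: evo_insert)
    qed (use a in auto)
  qed (use H in auto)
qed

end

text \<open>The eventual value of each edge along growing boxes, written as a formula that makes
  sense without convergence (it is then \<open>False\<close>). The parameter \<open>C\<close> allows
  finite clock sets and the set of all clocks to be treated together.\<close>

definition flow :: "(clock \<Rightarrow> real set) \<Rightarrow> clock set \<Rightarrow> real set \<Rightarrow> config \<Rightarrow> config" where
  "flow T C I \<sigma> = (\<lambda>e\<in>quad_edges. \<exists>m. \<forall>n\<ge>m. evoI T (kbox n n \<inter> C) I \<sigma> e)"

lemma flow_ext: "flow T C I \<sigma> \<in> extensional quad_edges"
  by (simp add: flow_def)

lemma evo_ext:
  assumes "finite A" "K \<subseteq> seed_clocks" "\<sigma> \<in> extensional quad_edges"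
  shows "evo T K A \<sigma> \<in> extensional quad_edges"
  by (rule evo_induct[OF assms(1)]) (use assms act_ext in auto)

lemma incol_bound: "\<exists>N. incol N e"
  by (cases e) (auto intro: le_SucI)

lemma ext_agree_eq:
  assumes "\<sigma> \<in> extensional quad_edges" "\<sigma>' \<in> extensional quad_edges" "\<And>N. agree N UNIV \<sigma> \<sigma>'"
  shows "\<sigma> = \<sigma>'"
proof
  fix e
  show "\<sigma> e = \<sigma>' e"
    using assms incol_bound[of e] by (cases "e \<in> quad_edges") (auto simp: agree_def extensional_def)
qed

lemma configurations_agree:
  assumes "\<sigma> \<in> extensional quad_edges" "\<And>N. \<exists>\<sigma>'\<in>configurations. agree N UNIV \<sigma> \<sigma>'"
  shows "\<sigma> \<in> configurations"
  unfolding configurations_def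
proof (intro CollectI conjI allI impI)
  fix x y :: nat assume y: "1 \<le> y"
  obtain \<sigma>' where s: "\<sigma>' \<in> configurations" and a: "agree x UNIV \<sigma> \<sigma>'" using assms by blast
  have "vertex_type \<sigma> (x, y) = vertex_type \<sigma>' (x, y)" using y by (auto simp: agreeD[OF a])
  then show "case vertex_type \<sigma> (x, y) of (i1, j1, i2, j2) \<Rightarrow> i1 + j1 = i2 + j2"
    using s y unfolding configurations_def by (auto simp del: vertex_type.simps)
qed fact

lemma regular_agree:
  assumes "\<sigma> \<in> extensional quad_edges" "\<And>N. \<exists>\<sigma>'\<in>regular_configurations. agree N UNIV \<sigma> \<sigma>'"
  shows "\<sigma> \<in> regular_configurations"
  unfolding regular_iff
proof (intro conjI allI)
  show "\<sigma> \<in> configurations" using assms by (intro configurations_agree) (metis regular_iff)+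
  fix N
  obtain \<sigma>' where s: "\<sigma>' \<in> regular_configurations" and a: "agree N UNIV \<sigma> \<sigma>'" using assms by blast
  then obtain L where "triv N L \<sigma>'" by (auto simp: regular_iff)
  then have "triv N (Suc L) \<sigma>'" using triv_mono by auto
  then have "triv N (Suc L) \<sigma>" using triv_agree[OF agree_sym[OF a]] by auto
  then show "\<exists>L. triv N L \<sigma>" by blast
qed

context good_rings
begin

text \<open>The height \<open>H\<close> serves every finite \<open>K\<close> that contains the box
  and every \<open>I\<close> up to time \<open>t\<close>; this reduces statements about the flow to
  finite evolutions.\<close>

lemma flow_agree:
  assumes \<sigma>: "\<sigma> \<in> regular_configurations" and C: "C \<subseteq> seed_clocks"
  shows "\<exists>H. \<forall>K I. finite K \<longrightarrow> kbox N H \<inter> C \<subseteq> K \<longrightarrow> K \<subseteq> C \<longrightarrow> I \<subseteq> {0<..t} \<longrightarrow>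
     agree N UNIV (flow T C I \<sigma>) (evoI T K I \<sigma>)"
proof -
  obtain L where "triv N L \<sigma>" using \<sigma> by (auto simp: regular_iff)
  with evo_agree[of N L t] obtain H where H: "\<And>K K' A. K \<subseteq> seed_clocks \<Longrightarrow> K' \<subseteq> seed_clocks \<Longrightarrow>
     K \<inter> kbox N H = K' \<inter> kbox N H \<Longrightarrow> finite A \<Longrightarrow> A \<subseteq> {0<..t} \<Longrightarrow>
     agree N UNIV (evo T K A \<sigma>) (evo T K' A \<sigma>)" by (metis agree_refl)
  show ?thesis
  proof (intro exI[of _ H] allI impI)
    fix K I assume a: "finite K" "kbox N H \<inter> C \<subseteq> K" "K \<subseteq> C" "I \<subseteq> {0<..t}"
    have *: "agree N UNIV (evoI T (kbox n n \<inter> C) I \<sigma>) (evoI T K I \<sigma>)" if n: "n \<ge> max N H" for n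
    proof -
      define A where "A = rings T (kbox n n \<inter> C) I \<union> rings T K I"
      have fA: "finite A"
        unfolding A_def using finite_kbox a C by (auto intro!: finite_rings[where t = t])
      have It: "A \<subseteq> I" by (auto simp: A_def rings_def)
      have "kbox N H \<subseteq> kbox n n" using n by (intro kbox_mono) auto
      then have "agree N UNIV (evo T (kbox n n \<inter> C) A \<sigma>) (evo T K A \<sigma>)"
        using a C It by (intro H fA) (auto simp: kbox_def)
      moreover have "evoI T (kbox n n \<inter> C) I \<sigma> = evo T (kbox n n \<inter> C) A \<sigma>" "evoI T K I \<sigma> = evo T K A \<sigma>"
        by (rule evoI_eq[OF fA _ It]; auto simp: A_def)+
      ultimately show ?thesis by simp
    qed
    show "agree N UNIV (flow T C I \<sigma>) (evoI T K I \<sigma>)"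
      unfolding agree_def
    proof (intro ballI impI)
      fix e assume e: "e \<in> quad_edges" "incol N e \<and> row e \<in> UNIV"
      have "evoI T (kbox n n \<inter> C) I \<sigma> e = evoI T K I \<sigma> e" if "n \<ge> max N H" for n
        using *[OF that] e by (auto simp: agree_def)
      then show "flow T C I \<sigma> e = evoI T K I \<sigma> e"
        unfolding flow_def using e(1) ex_forall_ge_const[of "max N H" "\<lambda>n. evoI T (kbox n n \<inter> C) I \<sigma> e"] by simp
    qed
  qed
qed

lemma flow_finite:
  assumes "finite C" "C \<subseteq> seed_clocks"
  shows "flow T C I \<sigma> = restrict (evoI T C I \<sigma>) quad_edges"
proof -
  obtain n0 where n0: "\<And>n. n \<ge> n0 \<Longrightarrow> C \<subseteq> kbox n n" using finite_sub_kbox[OF assms] by blast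
  have "kbox n n \<inter> C = C" if "n \<ge> n0" for n using n0[OF that] by auto
  then have "(\<exists>m. \<forall>n\<ge>m. evoI T (kbox n n \<inter> C) I \<sigma> e) = evoI T C I \<sigma> e" for e
    by (intro ex_forall_ge_const[of n0]) simp
  then show ?thesis unfolding flow_def by auto
qed

lemma flow_regular:
  assumes \<sigma>: "\<sigma> \<in> regular_configurations" and C: "C \<subseteq> seed_clocks" and I: "I \<subseteq> {0<..t}"
  shows "flow T C I \<sigma> \<in> regular_configurations"
proof (rule regular_agree[OF flow_ext])
  fix N
  obtain H where H: "agree N UNIV (flow T C I \<sigma>) (evoI T (kbox N H \<inter> C) I \<sigma>)"
    using flow_agree[OF \<sigma> C, of N t] I finite_kbox by (meson Int_lower2 finite_Int order_refl)
  have "evoI T (kbox N H \<inter> C) I \<sigma> \<in> regular_configurations"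
  proof (rule evo_induct)
    show "finite (rings T (kbox N H \<inter> C) I)"
      using finite_kbox C I by (intro finite_rings[where t = t]) auto
  qed (use \<sigma> C act_regular in auto)
  then show "\<exists>\<sigma>'\<in>regular_configurations. agree N UNIV (flow T C I \<sigma>) \<sigma>'" using H by blast
qed

lemma evoI_Un:
  assumes "finite K" "K \<subseteq> seed_clocks" "I \<subseteq> {0<..t}" "J \<subseteq> {0<..t}" "\<forall>a\<in>I. \<forall>b\<in>J. a < b"
  shows "evoI T K (I \<union> J) \<sigma> = evoI T K J (evoI T K I \<sigma>)"
proof -
  have "rings T K (I \<union> J) = rings T K I \<union> rings T K J" by (auto simp: rings_def)
  moreover have "finite (rings T K I)" "finite (rings T K J)"
    using assms by (auto intro!: finite_rings[where t = t])
  ultimately show ?thesis using assms(5) by (auto intro!: evo_Un simp: rings_def)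
qed

lemma evo_agree_finite:
  assumes "finite A" "K \<subseteq> seed_clocks" "agree N UNIV \<sigma> \<sigma>'"
  shows "agree N UNIV (evo T K A \<sigma>) (evo T K A \<sigma>')"
  using assms(1)
proof (induction A rule: finite_linorder_max_induct)
  case (insert b A)
  show ?case
  proof (cases "\<exists>k\<in>K. b \<in> T k")
    case True
    then obtain x y p where k: "((x, y), p) \<in> K" "b \<in> T ((x, y), p)" by (metis surj_pair)
    then have s: "((x, y), p) \<in> seed_clocks" using assms by auto
    have "agree N UNIV (act ((x, y), p) \<sigma>) (act ((x, y), p) \<sigma>')"
      if "agree N UNIV \<sigma> \<sigma>'" for \<sigma> \<sigma>'
    proof (cases "x \<le> N")
      case False
      then have "act ((x, y), p) \<sigma> e = \<sigma> e" if "incol N e" for e \<sigma>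
        using that by (intro act_unaffected[OF s, of N]) auto
      then show ?thesis using that by (simp add: agree_def)
    qed (use act_agree[OF that s] in auto)
    then show ?thesis using insert act_at_ring[OF assms(2) k] by (simp add: evo_insert)
  qed (use insert act_at_no_ring[of K b] in \<open>auto simp: evo_insert\<close>)
qed (use assms in auto)

text \<open>In given columns, the flows from \<sigma> and from the intermediate configuration are
  both computed by the larger of two boxes, and finite evolutions compose.
  \<open>evo_agree_finite\<close> then replaces the intermediate configuration by its finite
  approximation.\<close>

lemma flow_Un:
  assumes \<sigma>: "\<sigma> \<in> regular_configurations" and C: "C \<subseteq> seed_clocks"
    and IJ: "I \<subseteq> {0<..t}" "J \<subseteq> {0<..t}" "\<forall>a\<in>I. \<forall>b\<in>J. a < b"
  shows "flow T C (I \<union> J) \<sigma> = flow T C J (flow T C I \<sigma>)"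
proof (rule ext_agree_eq[OF flow_ext flow_ext])
  fix N
  note reg = flow_regular[OF \<sigma> C IJ(1)]
  obtain H1 where H1: "\<And>K I. finite K \<Longrightarrow> kbox N H1 \<inter> C \<subseteq> K \<Longrightarrow> K \<subseteq> C \<Longrightarrow> I \<subseteq> {0<..t} \<Longrightarrow>
     agree N UNIV (flow T C I \<sigma>) (evoI T K I \<sigma>)" using flow_agree[OF \<sigma> C, of N t] by blast
  obtain H2 where H2: "\<And>K I'. finite K \<Longrightarrow> kbox N H2 \<inter> C \<subseteq> K \<Longrightarrow> K \<subseteq> C \<Longrightarrow> I' \<subseteq> {0<..t} \<Longrightarrow>
     agree N UNIV (flow T C I' (flow T C I \<sigma>)) (evoI T K I' (flow T C I \<sigma>))" using flow_agree[OF reg C, of N t] by blast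
  define K where "K = kbox N (max H1 H2) \<inter> C"
  have K: "finite K" "kbox N H1 \<inter> C \<subseteq> K" "kbox N H2 \<inter> C \<subseteq> K" "K \<subseteq> C" "K \<subseteq> seed_clocks"
    using finite_kbox kbox_mono[of N N H1 "max H1 H2"] kbox_mono[of N N H2 "max H1 H2"] C by (auto simp: K_def)
  have "agree N UNIV (flow T C (I \<union> J) \<sigma>) (evoI T K J (evoI T K I \<sigma>))"
    using H1[OF K(1,2,4), of "I \<union> J"] IJ evoI_Un[OF K(1,5) IJ] by auto
  moreover have "agree N UNIV (evoI T K J (evoI T K I \<sigma>)) (evoI T K J (flow T C I \<sigma>))"
    by (rule evo_agree_finite[OF finite_rings[OF K(1,5), where t = t] K(5) agree_sym[OF H1[OF K(1,2,4)]]])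
      (use IJ in auto)
  moreover have "agree N UNIV (evoI T K J (flow T C I \<sigma>)) (flow T C J (flow T C I \<sigma>))"
    by (rule agree_sym[OF H2[OF K(1,3,4) IJ(2)]])
  ultimately show "agree N UNIV (flow T C (I \<union> J) \<sigma>) (flow T C J (flow T C I \<sigma>))"
    using agree_trans by blast
qed

lemma flow_Un_finite:
  assumes "finite C" "C \<subseteq> seed_clocks" "\<sigma> \<in> extensional quad_edges"
    and IJ: "I \<subseteq> {0<..t}" "J \<subseteq> {0<..t}" "\<forall>a\<in>I. \<forall>b\<in>J. a < b"
  shows "flow T C (I \<union> J) \<sigma> = flow T C J (flow T C I \<sigma>)"
proof -
  have "evoI T C I \<sigma> \<in> extensional quad_edges"
    using assms by (intro evo_ext finite_rings[where t = t]) auto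
  then show ?thesis
    unfolding flow_finite[OF assms(1,2)] using evoI_Un[OF assms(1,2) IJ, of \<sigma>]
    by (simp add: extensional_restrict)
qed

lemma flow_no_rings:
  assumes "\<And>k. k \<in> C \<Longrightarrow> T k \<inter> I = {}" "\<sigma> \<in> extensional quad_edges"
  shows "flow T C I \<sigma> = \<sigma>"
proof -
  have "rings T (kbox n n \<inter> C) I = {}" for n using assms(1) unfolding rings_def by blast
  moreover have "(\<exists>m::nat. \<forall>n\<ge>m. \<sigma> e) = \<sigma> e" for e by (rule ex_forall_ge_const) simp
  ultimately have "flow T C I \<sigma> = restrict \<sigma> quad_edges" by (simp add: flow_def)
  then show ?thesis using assms(2) by (simp add: extensional_restrict)
qed

lemma flow_single:
  assumes "k \<in> C" "C \<subseteq> seed_clocks" "r \<in> T k" "\<sigma> \<in> extensional quad_edges"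
  shows "flow T C {r} \<sigma> = act k \<sigma>"
proof -
  obtain n0 where n0: "\<And>n. n \<ge> n0 \<Longrightarrow> {k} \<subseteq> kbox n n" using finite_sub_kbox[of "{k}"] assms by auto
  have "evoI T (kbox n n \<inter> C) {r} \<sigma> = act k \<sigma>" if "n \<ge> n0" for n
  proof -
    have "rings T (kbox n n \<inter> C) {r} = {r}" using n0[OF that] assms by (auto simp: rings_def)
    moreover have "act_at T (kbox n n \<inter> C) r = act k"
      using n0[OF that] assms by (intro act_at_ring) auto
    ultimately show ?thesis by (simp add: evo_single)
  qed
  then have "(\<exists>m. \<forall>n\<ge>m. evoI T (kbox n n \<inter> C) {r} \<sigma> e) = act k \<sigma> e" for e
    by (intro ex_forall_ge_const[of n0]) simp
  then have "flow T C {r} \<sigma> = restrict (act k \<sigma>) quad_edges" by (auto simp: flow_def)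
  moreover have "act k \<sigma> \<in> extensional quad_edges" using assms act_ext by blast
  ultimately show ?thesis by (simp add: extensional_restrict)
qed

text \<open>Up to time \<open>t\<close>, a single edge depends on finitely many ring times only.
  Right-continuity and left limits edge by edge follow, although the whole configuration may change
  infinitely often.\<close>

lemma flow_eq_nearby:
  assumes \<sigma>: "\<sigma> \<in> regular_configurations" and e: "e \<in> quad_edges"
  shows "\<exists>R. finite R \<and> (\<forall>I J. I \<subseteq> {0<..t} \<longrightarrow> J \<subseteq> {0<..t} \<longrightarrow> R \<inter> I = R \<inter> J \<longrightarrow>
    flow T seed_clocks I \<sigma> e = flow T seed_clocks J \<sigma> e)"
proof -
  obtain N where N: "incol N e" using incol_bound by blast
  obtain H where H: "\<And>K I. finite K \<Longrightarrow> kbox N H \<inter> seed_clocks \<subseteq> K \<Longrightarrow> K \<subseteq> seed_clocks \<Longrightarrow> I \<subseteq> {0<..t} \<Longrightarrow>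
     agree N UNIV (flow T seed_clocks I \<sigma>) (evoI T K I \<sigma>)" using flow_agree[OF \<sigma> order_refl, of N t] by blast
  define R where "R = rings T (kbox N H) {0<..t}"
  have "flow T seed_clocks I \<sigma> e = evo T (kbox N H) (R \<inter> I) \<sigma> e" if "I \<subseteq> {0<..t}" for I
  proof -
    have "rings T (kbox N H) I = R \<inter> I" using that by (auto simp: R_def rings_def)
    then show ?thesis using H[of "kbox N H" I] finite_kbox kbox_seed that N e by (auto simp: agree_def)
  qed
  moreover have "finite R" unfolding R_def by (rule finite_rings[where t = t]) (use finite_kbox kbox_seed in auto)
  ultimately show ?thesis by (intro exI[of _ R]) auto
qed

lemma eventually_no_points:
  fixes t :: real
  assumes "finite R"
  shows "\<forall>\<^sub>F s in at_right t. R \<inter> {t<..s} = {}" "\<forall>\<^sub>F s in at_left t. R \<inter> {s<..<t} = {}"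
proof -
  have "\<forall>\<^sub>F s in at_right t. \<forall>r\<in>R. r \<notin> {t<..s}"
  proof (rule eventually_ball_finite[OF assms], rule ballI)
    fix r
    show "\<forall>\<^sub>F s in at_right t. r \<notin> {t<..s}"
      using eventually_at_right[of t "t + 1"] by (cases "r > t") (auto intro!: exI[of _ r] simp: eventually_at_right[of t r])
  qed
  then show "\<forall>\<^sub>F s in at_right t. R \<inter> {t<..s} = {}" by (rule eventually_mono) auto
  have "\<forall>\<^sub>F s in at_left t. \<forall>r\<in>R. r \<notin> {s<..<t}"
  proof (rule eventually_ball_finite[OF assms], rule ballI)
    fix r
    show "\<forall>\<^sub>F s in at_left t. r \<notin> {s<..<t}"
      using eventually_at_left[of "t - 1" t] by (cases "r < t") (auto intro!: exI[of _ r] simp: eventually_at_left[of r t])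
  qed
  then show "\<forall>\<^sub>F s in at_left t. R \<inter> {s<..<t} = {}" by (rule eventually_mono) auto
qed

lemma driven_by_clocks_flow:
  assumes \<sigma>: "\<sigma> \<in> regular_configurations"
  shows "driven_by_clocks (\<lambda>t. flow T seed_clocks {0<..t} \<sigma>) T"
  unfolding driven_by_clocks_def
proof (intro conjI allI impI ballI)
  fix t :: real and e assume t: "0 \<le> t" and e: "e \<in> quad_edges"
  obtain R where R: "finite R" "\<And>I J. I \<subseteq> {0<..t + 1} \<Longrightarrow> J \<subseteq> {0<..t + 1} \<Longrightarrow> R \<inter> I = R \<inter> J \<Longrightarrow>
    flow T seed_clocks I \<sigma> e = flow T seed_clocks J \<sigma> e" using flow_eq_nearby[OF \<sigma> e, of "t + 1"] by blast
  have "\<forall>\<^sub>F s in at_right t. s \<in> {t<..<t + 1}" by (rule eventually_at_right_real) simp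
  with eventually_no_points(1)[OF R(1)]
  show "\<forall>\<^sub>F s in at_right t. flow T seed_clocks {0<..s} \<sigma> e = flow T seed_clocks {0<..t} \<sigma> e"
  proof eventually_elim
    case (elim s)
    then have "R \<inter> {0<..s} = R \<inter> {0<..t}" by auto
    then show ?case using elim by (intro R) auto
  qed
next
  fix t :: real assume t: "0 < t"
  \<comment> \<open>The open interval leaves out a ring at \<open>t\<close> itself, which is then
    applied separately; by \<open>no_ties\<close> at most one clock rings then.\<close>
  define \<xi> where "\<xi> = flow T seed_clocks {0<..<t} \<sigma>"
  have reg: "\<xi> \<in> regular_configurations"
    unfolding \<xi>_def by (rule flow_regular[OF \<sigma> order_refl, of _ t]) auto
  have ext: "\<xi> \<in> extensional quad_edges" unfolding \<xi>_def by (rule flow_ext)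
  have "{0<..t} = {0<..<t} \<union> {t}" using t by auto
  then have Xt: "flow T seed_clocks {0<..t} \<sigma> = flow T seed_clocks {t} \<xi>"
    using flow_Un[OF \<sigma> order_refl, of "{0<..<t}" t "{t}"] t by (auto simp: \<xi>_def)
  show "\<exists>\<xi>\<in>regular_configurations.
        (\<forall>e\<in>quad_edges. \<forall>\<^sub>F s in at_left t. flow T seed_clocks {0<..s} \<sigma> e = \<xi> e) \<and>
        (\<forall>v\<in>seed_pairs \<xi>. t \<in> T (v, pair_type \<xi> v) \<longrightarrow> flow T seed_clocks {0<..t} \<sigma> = jump \<xi> v) \<and>
        ((\<forall>v\<in>seed_pairs \<xi>. t \<notin> T (v, pair_type \<xi> v)) \<longrightarrow> flow T seed_clocks {0<..t} \<sigma> = \<xi>)"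
  proof (intro bexI[OF _ reg] conjI ballI impI)
    fix e assume e: "e \<in> quad_edges"
    obtain R where R: "finite R" "\<And>I J. I \<subseteq> {0<..t} \<Longrightarrow> J \<subseteq> {0<..t} \<Longrightarrow> R \<inter> I = R \<inter> J \<Longrightarrow>
      flow T seed_clocks I \<sigma> e = flow T seed_clocks J \<sigma> e" using flow_eq_nearby[OF \<sigma> e, of t] by blast
    have "\<forall>\<^sub>F s in at_left t. s \<in> {0<..<t}" by (rule eventually_at_left_real) (use t in simp)
    with eventually_no_points(2)[OF R(1)]
    show "\<forall>\<^sub>F s in at_left t. flow T seed_clocks {0<..s} \<sigma> e = \<xi> e"
    proof eventually_elim
      case (elim s)
      then have "R \<inter> {0<..s} = R \<inter> {0<..<t}" by fastforce
      then show ?case unfolding \<xi>_def using elim by (intro R) auto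
    qed
  next
    fix v assume v: "v \<in> seed_pairs \<xi>" "t \<in> T (v, pair_type \<xi> v)"
    then have k: "(v, pair_type \<xi> v) \<in> seed_clocks" by (auto simp: seed_pairs_def seed_clocks_def)
    show "flow T seed_clocks {0<..t} \<sigma> = jump \<xi> v"
      unfolding Xt flow_single[OF k order_refl v(2) ext] by (simp add: act.simps)
  next
    assume none: "\<forall>v\<in>seed_pairs \<xi>. t \<notin> T (v, pair_type \<xi> v)"
    show "flow T seed_clocks {0<..t} \<sigma> = \<xi>"
    proof (cases "\<exists>k\<in>seed_clocks. t \<in> T k")
      case True
      then obtain v p where k: "(v, p) \<in> seed_clocks" "t \<in> T (v, p)" by (metis surj_pair)
      have "pair_type \<xi> v \<noteq> p" using none k by (auto simp: seed_pairs_def seed_clocks_def)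
      then show ?thesis unfolding Xt flow_single[OF k(1) order_refl k(2) ext] by (simp add: act.simps)
    next
      case False
      then show ?thesis unfolding Xt by (intro flow_no_rings ext) auto
    qed
  qed
qed

end

section \<open>Counts of Poisson clocks\<close>

text \<open>Finitely many coordinates with countable range have countably many joint values, so
  \<open>S\<close> is a countable union of cylinders. No topology or structure of \<open>S\<close>
  enters.\<close>

lemma sets_PiM_finite_dep:
  fixes I :: "'i set" and S :: "('i \<Rightarrow> 'a::countable) set"
  assumes J: "finite J" "J \<subseteq> I"
    and S: "S \<subseteq> space (\<Pi>\<^sub>M i\<in>I. count_space UNIV)"
    and dep: "\<And>z z'. z \<in> S \<Longrightarrow> z' \<in> space (\<Pi>\<^sub>M i\<in>I. count_space UNIV) \<Longrightarrow> (\<And>j. j \<in> J \<Longrightarrow> z j = z' j) \<Longrightarrow> z' \<in> S"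
  shows "S \<in> sets (\<Pi>\<^sub>M i\<in>I. count_space UNIV)"
proof -
  let ?M = "\<Pi>\<^sub>M i\<in>I. count_space (UNIV :: 'a set)"
  define P where "P = (\<lambda>z. restrict z J) ` S"
  have "P \<subseteq> (\<Pi>\<^sub>E j\<in>J. UNIV)" by (auto simp: P_def)
  moreover have "countable (\<Pi>\<^sub>E j\<in>J. (UNIV :: 'a set))" by (rule countable_PiE) (use J in auto)
  ultimately have P: "countable P" by (rule countable_subset)
  have "S = (\<Union>p\<in>P. {z \<in> space ?M. \<forall>j\<in>J. z j = p j})"
  proof (intro equalityI subsetI)
    fix z assume "z \<in> S"
    then show "z \<in> (\<Union>p\<in>P. {z \<in> space ?M. \<forall>j\<in>J. z j = p j})" using S unfolding P_def by fastforce
  next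
    fix z assume "z \<in> (\<Union>p\<in>P. {z \<in> space ?M. \<forall>j\<in>J. z j = p j})"
    then obtain z0 where "z0 \<in> S" "z \<in> space ?M" "\<And>j. j \<in> J \<Longrightarrow> z j = z0 j" unfolding P_def by auto
    then show "z \<in> S" using dep[of z0 z] by simp
  qed
  also have "\<dots> \<in> sets ?M"
  proof (rule sets.countable_UN''[OF P])
    fix p assume "p \<in> P"
    have "{z \<in> space ?M. z j = p j} \<in> sets ?M" if "j \<in> J" for j
    proof -
      have "(\<lambda>z. z j) \<in> measurable ?M (count_space UNIV)"
        using J that by (intro measurable_component_singleton) auto
      from measurable_sets[OF this, of "{p j}"] show ?thesis by (simp add: vimage_def Int_def conj_commute)
    qed
    then show "{z \<in> space ?M. \<forall>j\<in>J. z j = p j} \<in> sets ?M"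
      using J(1) by (intro sets.sets_Collect_finite_All) auto
  qed
  finally show ?thesis .
qed

lemma measurable_PiM_finite_dep:
  fixes I :: "'i set" and f :: "('i \<Rightarrow> 'a::countable) \<Rightarrow> 'b"
  assumes J: "finite J" "J \<subseteq> I"
    and dep: "\<And>z z'. z \<in> space (\<Pi>\<^sub>M i\<in>I. count_space UNIV) \<Longrightarrow> z' \<in> space (\<Pi>\<^sub>M i\<in>I. count_space UNIV) \<Longrightarrow> (\<And>j. j \<in> J \<Longrightarrow> z j = z' j) \<Longrightarrow> f z = f z'"
    and sp: "\<And>z. z \<in> space (\<Pi>\<^sub>M i\<in>I. count_space UNIV) \<Longrightarrow> f z \<in> space N"
  shows "f \<in> measurable (\<Pi>\<^sub>M i\<in>I. count_space UNIV) N"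
proof (rule measurableI[OF sp])
  fix A assume "A \<in> sets N"
  show "f -` A \<inter> space (\<Pi>\<^sub>M i\<in>I. count_space UNIV) \<in> sets (\<Pi>\<^sub>M i\<in>I. count_space UNIV)"
  proof (rule sets_PiM_finite_dep[OF J])
    fix z z' assume z: "z \<in> f -` A \<inter> space (\<Pi>\<^sub>M i\<in>I. count_space UNIV)" "z' \<in> space (\<Pi>\<^sub>M i\<in>I. count_space UNIV)"
      and "\<And>j. j \<in> J \<Longrightarrow> z j = z' j"
    then have "f z = f z'" by (intro dep) simp_all
    then show "z' \<in> f -` A \<inter> space (\<Pi>\<^sub>M i\<in>I. count_space UNIV)" using z by simp
  qed blast
qed

lemma Int_stable_vimage:
  assumes "Int_stable G"
  shows "Int_stable {f -` X \<inter> S |X. X \<in> G}"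
proof (rule Int_stableI)
  fix A B assume "A \<in> {f -` X \<inter> S |X. X \<in> G}" "B \<in> {f -` X \<inter> S |X. X \<in> G}"
  then obtain X Y where "X \<in> G" "Y \<in> G" "A = f -` X \<inter> S" "B = f -` Y \<inter> S" by blast
  then have "X \<inter> Y \<in> G" "A \<inter> B = f -` (X \<inter> Y) \<inter> S" using Int_stableD[OF assms] by auto
  then show "A \<inter> B \<in> {f -` X \<inter> S |X. X \<in> G}" by blast
qed

definition cnt :: "(clock \<Rightarrow> 'w \<Rightarrow> real set) \<Rightarrow> clock \<Rightarrow> real \<Rightarrow> real \<Rightarrow> 'w \<Rightarrow> nat" where
  "cnt T k s t \<omega> = card (T k \<omega> \<inter> {s<..t})"

text \<open>The rates are left abstract; a bound linear in the height is what makes long chains of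
  rings improbable.\<close>

locale clock_process = prob_space M
  for M :: "'w measure" and T :: "clock \<Rightarrow> 'w \<Rightarrow> real set" and \<rho> :: "clock \<Rightarrow> real \<Rightarrow> real" and C :: real +
  assumes pc: "poisson_clocks M seed_clocks T \<rho>"
    and rate: "k \<in> seed_clocks \<Longrightarrow> 0 \<le> t \<Longrightarrow> 0 \<le> \<rho> k t \<and> \<rho> k t \<le> C * real (snd (fst k))"
    and cont: "k \<in> seed_clocks \<Longrightarrow> continuous_on {0..} (\<rho> k)"
    and C_pos: "0 < C"
begin

definition lam :: "clock \<Rightarrow> real \<Rightarrow> real \<Rightarrow> real" where
  "lam k s t = integral {s..t} (\<rho> k)"

lemma rings_pos: "k \<in> seed_clocks \<Longrightarrow> \<omega> \<in> space M \<Longrightarrow> T k \<omega> \<subseteq> {0<..}"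
  and rings_finite: "k \<in> seed_clocks \<Longrightarrow> \<omega> \<in> space M \<Longrightarrow> finite (T k \<omega> \<inter> {0..t})"
  using pc unfolding poisson_clocks_def by blast+

lemma indep_counts:
  "t 0 = 0 \<Longrightarrow> mono t \<Longrightarrow> indep_vars (\<lambda>_. count_space UNIV)
     (\<lambda>(k, i) \<omega>. cnt T k (t i) (t (Suc i)) \<omega>) (seed_clocks \<times> UNIV)"
  using pc unfolding poisson_clocks_def cnt_def by blast

lemma prob_cnt:
  "k \<in> seed_clocks \<Longrightarrow> 0 \<le> s \<Longrightarrow> s \<le> t \<Longrightarrow>
    prob {\<omega> \<in> space M. cnt T k s t \<omega> = n} = lam k s t ^ n / fact n * exp (- lam k s t)"
  using pc unfolding poisson_clocks_def cnt_def lam_def by blast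

text \<open>The independence in \<open>poisson_clocks\<close> refers to partitions starting at
  \<open>0\<close>. Here the interval from \<open>s\<close> to \<open>t\<close> becomes the cell
  with index \<open>1\<close> of such a partition.\<close>

definition two_step :: "real \<Rightarrow> real \<Rightarrow> nat \<Rightarrow> real" where
  "two_step s t i = (if i = 0 then 0 else if i = 1 then s else t)"

lemma two_step: "0 \<le> s \<Longrightarrow> s \<le> t \<Longrightarrow> two_step s t 0 = 0 \<and> mono (two_step s t)"
  unfolding two_step_def by (auto intro!: monoI)

lemma measurable_cnt[measurable]:
  assumes "k \<in> seed_clocks" "0 \<le> s" "s \<le> t"
  shows "cnt T k s t \<in> measurable M (count_space UNIV)"
proof -
  have "indep_vars (\<lambda>_. count_space UNIV)
     (\<lambda>(k, i) \<omega>. cnt T k (two_step s t i) (two_step s t (Suc i)) \<omega>) (seed_clocks \<times> UNIV)"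
    using two_step assms by (intro indep_counts) auto
  then have "(\<lambda>(k, i) \<omega>. cnt T k (two_step s t i) (two_step s t (Suc i)) \<omega>) (k, 1) \<in> measurable M (count_space UNIV)"
    using assms unfolding indep_vars_def by blast
  moreover have "(\<lambda>(k, i) \<omega>. cnt T k (two_step s t i) (two_step s t (Suc i)) \<omega>) (k, 1) = cnt T k s t"
    by (auto simp: two_step_def fun_eq_iff)
  ultimately show ?thesis by simp
qed

lemma events_cnt:
  assumes "k \<in> seed_clocks" "0 \<le> s" "s \<le> t"
  shows "{\<omega> \<in> space M. P (cnt T k s t \<omega>)} \<in> events"
  using measurable_sets[OF measurable_cnt[OF assms], of "Collect P"] by (simp add: vimage_def Int_def conj_commute)

lemma rate_integrable: "k \<in> seed_clocks \<Longrightarrow> 0 \<le> s \<Longrightarrow> \<rho> k integrable_on {s..t}"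
  by (intro integrable_continuous_interval continuous_on_subset[OF cont]) auto

lemma lam_nonneg: "k \<in> seed_clocks \<Longrightarrow> 0 \<le> s \<Longrightarrow> 0 \<le> lam k s t"
  unfolding lam_def using rate by (intro integral_nonneg rate_integrable) auto

lemma lam_le:
  assumes "k \<in> seed_clocks" "0 \<le> s" "s \<le> t"
  shows "lam k s t \<le> C * real (snd (fst k)) * (t - s)"
proof -
  have "lam k s t \<le> integral {s..t} (\<lambda>_. C * real (snd (fst k)))"
    unfolding lam_def using rate assms by (intro integral_le rate_integrable) auto
  then show ?thesis using assms(3) by (simp add: mult_ac)
qed

lemma prob_counts:
  assumes K: "finite K" "K \<subseteq> seed_clocks" and st: "0 \<le> s" "s \<le> t"
  shows "prob {\<omega> \<in> space M. \<forall>k\<in>K. cnt T k s t \<omega> = n k} =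
    (\<Prod>k\<in>K. lam k s t ^ n k / fact (n k) * exp (- lam k s t))"
proof (cases "K = {}")
  case True
  then show ?thesis by (simp add: prob_space)
next
  case False
  let ?X = "\<lambda>(k, i) \<omega>. cnt T k (two_step s t i) (two_step s t (Suc i)) \<omega>"
  have ind: "indep_vars (\<lambda>_. count_space UNIV) ?X (seed_clocks \<times> UNIV)"
    using two_step st by (intro indep_counts) auto
  have "prob (\<Inter>j\<in>K \<times> {1}. ?X j -` {n (fst j)} \<inter> space M) = (\<Prod>j\<in>K \<times> {1}. prob (?X j -` {n (fst j)} \<inter> space M))"
    by (rule indep_varsD[OF ind]) (use K False in auto)
  moreover have "(\<Inter>j\<in>K \<times> {1}. ?X j -` {n (fst j)} \<inter> space M) = {\<omega> \<in> space M. \<forall>k\<in>K. cnt T k s t \<omega> = n k}"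
    using False by (auto simp: two_step_def)
  moreover have "(\<Prod>j\<in>K \<times> {1}. prob (?X j -` {n (fst j)} \<inter> space M)) = (\<Prod>k\<in>K. prob {\<omega> \<in> space M. cnt T k s t \<omega> = n k})"
  proof -
    have "K \<times> {1::nat} = (\<lambda>k. (k, 1)) ` K" by auto
    moreover have "inj_on (\<lambda>k. (k, 1::nat)) K" by (auto intro: inj_onI)
    ultimately show ?thesis
      by (simp add: prod.reindex two_step_def vimage_def Int_def conj_commute)
  qed
  moreover have "(\<Prod>k\<in>K. prob {\<omega> \<in> space M. cnt T k s t \<omega> = n k}) = (\<Prod>k\<in>K. lam k s t ^ n k / fact (n k) * exp (- lam k s t))"
    using K(2) st by (intro prod.cong refl prob_cnt) auto
  ultimately show ?thesis by simp
qed

lemma prob_ring_le: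
  assumes "k \<in> seed_clocks" "0 \<le> s" "s \<le> t"
  shows "prob {\<omega> \<in> space M. cnt T k s t \<omega> \<noteq> 0} \<le> lam k s t"
proof -
  have "prob {\<omega> \<in> space M. cnt T k s t \<omega> \<noteq> 0} = 1 - prob {\<omega> \<in> space M. cnt T k s t \<omega> = 0}"
    using assms by (intro prob_neg events_cnt)
  also have "\<dots> = 1 - exp (- lam k s t)" using assms by (simp add: prob_cnt)
  also have "\<dots> \<le> lam k s t" using exp_ge_add_one_self[of "- lam k s t"] by simp
  finally show ?thesis .
qed

text \<open>First order expansion in a short interval: with total intensity \<open>L\<close>, no
  ring has probability \<open>exp (- L)\<close>, a single ring of \<open>k\<close> has probability
  \<open>lam k s t * exp (- L)\<close>, and all other outcomes together have probability at most the
  square of \<open>L\<close>.\<close>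

lemma short_time:
  assumes K: "finite K" "K \<subseteq> seed_clocks" and st: "0 \<le> s" "s \<le> t"
    and h: "h \<in> borel_measurable M" "\<And>\<omega>. \<omega> \<in> space M \<Longrightarrow> \<bar>h \<omega>\<bar> \<le> B" and c: "\<bar>c0\<bar> \<le> B" "\<And>k. k \<in> K \<Longrightarrow> \<bar>c k\<bar> \<le> B"
    and none: "AE \<omega> in M. (\<forall>k\<in>K. cnt T k s t \<omega> = 0) \<longrightarrow> h \<omega> = c0"
    and one: "AE \<omega> in M. \<forall>k\<in>K. (\<forall>k'\<in>K. cnt T k' s t \<omega> = of_bool (k' = k)) \<longrightarrow> h \<omega> = c k"
  shows "\<bar>expectation h - c0 - (\<Sum>k\<in>K. lam k s t * (c k - c0))\<bar> \<le> 3 * B * (\<Sum>k\<in>K. lam k s t)\<^sup>2"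
proof -
  define L where "L = (\<Sum>k\<in>K. lam k s t)"
  define A0 where "A0 = {\<omega> \<in> space M. \<forall>k\<in>K. cnt T k s t \<omega> = 0}"
  define A where "A k = {\<omega> \<in> space M. \<forall>k'\<in>K. cnt T k' s t \<omega> = of_bool (k' = k)}" for k
  have lam0: "0 \<le> lam k s t" if "k \<in> K" for k using lam_nonneg[of k s t] that K st by blast
  have L0: "0 \<le> L" unfolding L_def using lam0 by (rule sum_nonneg)
  have B0: "0 \<le> B" using c(1) by linarith
  have m: "{\<omega> \<in> space M. \<forall>k\<in>K. cnt T k s t \<omega> = n k} \<in> events" for n
    by (rule sets.sets_Collect_finite_All[OF events_cnt K(1)]) (use K st in blast)+
  have mA: "A0 \<in> events" "A k \<in> events" for k
    unfolding A0_def A_def by (rule m)+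
  have ee: "(\<Prod>k\<in>K. exp (- lam k s t)) = exp (- L)"
    unfolding L_def using K(1) by (simp add: exp_sum[symmetric] sum_negf)
  have p0: "prob A0 = exp (- L)"
    unfolding A0_def using prob_counts[OF K st, of "\<lambda>_. 0"] ee by simp
  have pk: "prob (A k) = lam k s t * exp (- L)" if "k \<in> K" for k
  proof -
    have "prob (A k) = (\<Prod>k'\<in>K. lam k' s t ^ of_bool (k' = k) / fact (of_bool (k' = k)) * exp (- lam k' s t))"
      unfolding A_def by (rule prob_counts[OF K st])
    also have "\<dots> = (\<Prod>k'\<in>K. (if k' = k then lam k s t else 1) * exp (- lam k' s t))"
      by (intro prod.cong refl) auto
    also have "\<dots> = lam k s t * exp (- L)"
      using that K(1) by (simp add: prod.distrib ee)
    finally show ?thesis .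
  qed
  \<comment> \<open>The prediction for \<open>h\<close> when at most one clock of \<open>K\<close>
    rings; \<open>w\<close> is the indicator of the remaining event, on which \<open>h\<close> is
    only known to be bounded.\<close>
  define g where "g \<omega> = indicator A0 \<omega> * c0 + (\<Sum>k\<in>K. indicator (A k) \<omega> * c k)" for \<omega>
  define w where "w \<omega> = 1 - indicator A0 \<omega> - (\<Sum>k\<in>K. indicator (A k) \<omega> :: real)" for \<omega>
  have ih: "integrable M h"
    by (rule integrable_const_bound[of _ B]) (use h in auto)
  have ii: "integrable M (\<lambda>\<omega>. indicator (A k) \<omega> * c)" "integrable M (\<lambda>\<omega>. indicator A0 \<omega> * c)" for k and c :: real
    using mA by (auto simp: emeasure_eq_measure)
  have ig: "integrable M g" unfolding g_def using ii by auto
  have iw: "integrable M w" unfolding w_def using ii(1)[of _ 1] ii(2)[of 1] by (auto simp: emeasure_eq_measure)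
  have Eg: "expectation g = exp (- L) * c0 + (\<Sum>k\<in>K. lam k s t * exp (- L) * c k)"
    unfolding g_def using ii mA by (simp add: p0 pk)
  have Ew: "expectation w = 1 - exp (- L) - L * exp (- L)"
    unfolding w_def L_def[symmetric] using ii(1)[of _ 1] ii(2)[of 1] mA by (simp add: p0 pk prob_space sum_distrib_right[symmetric] L_def[symmetric])
  have "AE \<omega> in M. \<bar>h \<omega> - g \<omega>\<bar> \<le> B * w \<omega>"
    using none one AE_space
  proof eventually_elim
    fix \<omega> assume \<omega>: "(\<forall>k\<in>K. cnt T k s t \<omega> = 0) \<longrightarrow> h \<omega> = c0"
      "\<forall>k\<in>K. (\<forall>k'\<in>K. cnt T k' s t \<omega> = of_bool (k' = k)) \<longrightarrow> h \<omega> = c k" "\<omega> \<in> space M"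
    consider "\<omega> \<in> A0" | k where "k \<in> K" "\<omega> \<in> A k" | "\<omega> \<notin> A0" "\<And>k. k \<in> K \<Longrightarrow> \<omega> \<notin> A k" by blast
    then show "\<bar>h \<omega> - g \<omega>\<bar> \<le> B * w \<omega>"
    proof cases
      case 1
      then have "\<omega> \<notin> A k" if "k \<in> K" for k using that by (fastforce simp: A0_def A_def)
      then show ?thesis using 1 \<omega>(1) by (simp add: g_def w_def A0_def)
    next
      case (2 k)
      then have "\<omega> \<notin> A0" by (fastforce simp: A0_def A_def)
      moreover have "\<omega> \<notin> A k'" if "k' \<in> K" "k' \<noteq> k" for k' using that 2 by (fastforce simp: A_def)
      then have "indicator (A k') \<omega> = (of_bool (k' = k) :: real)" if "k' \<in> K" for k'
        using that 2 by (cases "k' = k") auto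
      moreover have "h \<omega> = c k" using \<omega>(2) 2 by (simp add: A_def)
      ultimately show ?thesis using 2 K(1) by (simp add: g_def w_def of_bool_def if_distrib[of "\<lambda>x. x * _"] cong: if_cong)
    next
      case 3
      then show ?thesis using h(2)[OF \<omega>(3)] by (simp add: g_def w_def)
    qed
  qed
  then have "\<bar>expectation (\<lambda>\<omega>. h \<omega> - g \<omega>)\<bar> \<le> expectation (\<lambda>\<omega>. B * w \<omega>)"
    using ih ig iw by (intro order_trans[OF integral_abs_bound] integral_mono_AE) auto
  then have r: "\<bar>expectation h - expectation g\<bar> \<le> B * (1 - exp (- L) - L * exp (- L))"
    using ih ig iw by (simp add: Ew)
  have eL: "1 - L \<le> exp (- L)" using exp_ge_add_one_self[of "- L"] by simp
  have eL1: "exp (- L) \<le> 1" using L0 by simp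
  have eL2: "exp (- L) - 1 + L \<le> L\<^sup>2"
  proof -
    have "exp (- L) * (1 + L) \<le> 1"
      using exp_ge_add_one_self[of L] mult_left_mono[of "1 + L" "exp L" "exp (- L)"] by (simp add: exp_minus_inverse mult.commute flip: exp_add)
    then have "exp (- L) - 1 + L \<le> L - L * exp (- L)" by (simp add: algebra_simps)
    also have "\<dots> = L * (1 - exp (- L))" by (simp add: algebra_simps)
    also have "\<dots> \<le> L * L" using eL L0 by (intro mult_left_mono) auto
    finally show ?thesis by (simp add: power2_eq_square)
  qed
  have w2: "1 - exp (- L) - L * exp (- L) \<le> L\<^sup>2"
  proof -
    have "(1 - L) * (1 + L) \<le> exp (- L) * (1 + L)" using eL L0 by (intro mult_right_mono) auto
    then show ?thesis by (simp add: algebra_simps power2_eq_square)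
  qed
  have "expectation h - c0 - (\<Sum>k\<in>K. lam k s t * (c k - c0)) =
     (expectation h - expectation g) + (exp (- L) - 1 + L) * c0 - (\<Sum>k\<in>K. lam k s t * ((1 - exp (- L)) * c k))"
    unfolding Eg L_def by (simp add: algebra_simps sum_subtractf sum_distrib_left sum_distrib_right)
  \<comment> \<open>Three errors of size \<open>B * L * L\<close>: the remaining event, the
    expansion of \<open>exp (- L)\<close> in front of \<open>c0\<close>, and its replacement by
    \<open>1\<close> in the first order terms. This explains the factor \<open>3\<close>.\<close>
  also have "\<bar>\<dots>\<bar> \<le> B * L\<^sup>2 + L\<^sup>2 * B + L * (L * B)"
  proof -
    have "\<bar>(exp (- L) - 1 + L) * c0\<bar> \<le> L\<^sup>2 * B"
      unfolding abs_mult using eL eL2 c(1) by (intro mult_mono) auto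
    moreover have "\<bar>\<Sum>k\<in>K. lam k s t * ((1 - exp (- L)) * c k)\<bar> \<le> L * (L * B)"
    proof -
      have "\<bar>\<Sum>k\<in>K. lam k s t * ((1 - exp (- L)) * c k)\<bar> \<le> (\<Sum>k\<in>K. lam k s t * (L * B))"
      proof (rule order_trans[OF sum_abs], rule sum_mono)
        fix k assume k: "k \<in> K"
        have "\<bar>(1 - exp (- L)) * c k\<bar> \<le> L * B"
          unfolding abs_mult using eL eL1 c(2)[OF k] L0 by (intro mult_mono) auto
        then show "\<bar>lam k s t * ((1 - exp (- L)) * c k)\<bar> \<le> lam k s t * (L * B)"
          unfolding abs_mult[of "lam k s t"] using lam0[OF k] by (intro mult_mono) auto
      qed
      then show ?thesis by (simp add: L_def sum_distrib_right)
    qed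
    moreover have "B * (1 - exp (- L) - L * exp (- L)) \<le> B * L\<^sup>2" using w2 B0 by (rule mult_left_mono)
    ultimately show ?thesis using r by linarith
  qed
  finally show ?thesis unfolding L_def[symmetric] by (simp add: power2_eq_square mult_ac)
qed

section \<open>Exclusion of long chains and of simultaneous rings\<close>

definition level :: "nat \<Rightarrow> nat \<Rightarrow> clock set" where
  "level N l = {k \<in> seed_clocks. fst (fst k) \<le> N \<and> snd (fst k) = l}"

lemma finite_level: "finite (level N l)" and card_level: "card (level N l) \<le> 6 * (N + 1)"
proof -
  have sub: "level N l \<subseteq> ({..N} \<times> {l}) \<times> (up_types \<union> down_types)"
    by (auto simp: level_def seed_clocks_def)
  have fin: "finite (({..N} \<times> {l}) \<times> (up_types \<union> down_types))" using finite_types by blast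
  show "finite (level N l)" by (rule finite_subset[OF sub fin])
  have "card (up_types \<union> down_types) \<le> 6" by (simp add: up_types_def down_types_def)
  then have "card (({..N} \<times> {l}) \<times> (up_types \<union> down_types)) \<le> 6 * (N + 1)"
    using mult_le_mono2[of "card (up_types \<union> down_types)" 6 "N + 1"] by (simp add: card_cartesian_product mult.commute)
  then show "card (level N l) \<le> 6 * (N + 1)" using card_mono[OF fin sub] by linarith
qed

text \<open>
  The interval is cut into \<open>n\<close> cells. A chain of \<open>n\<close> rings visits the cells in a nondecreasing order
  \<open>c 0 \<le> c 1 \<le> \<dots>\<close>, which is encoded by the subset \<open>{c i + i | i < n}\<close> of \<open>{..<2 * n}\<close>; hence there are
  at most \<open>4 ^ n\<close> such orders.
\<close>

lemma AE_no_chain: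
  assumes a: "0 \<le> a" and \<delta>: "\<delta> = 1 / (96 * real (N + 1) * C)"
  shows "AE \<omega> in M. \<exists>n. \<not> chain (\<lambda>k. T k \<omega>) N y n {a<..a + \<delta>}"
proof -
  have \<delta>0: "0 < \<delta>" using \<delta> C_pos by simp
  \<comment> \<open>The index \<open>0\<close> is spent on the time before \<open>a\<close>, because
    partitions must start at \<open>0\<close>. The cell \<open>c\<close> lies between the indices
    \<open>Suc c\<close> and \<open>Suc (Suc c)\<close>, and \<open>min\<close> stops the sequence
    at the right end of the interval.\<close>
  define t where "t n i = (if i = 0 then 0 else a + \<delta> * real (min (i - 1) n) / real n)" for n i :: nat
  have t0: "t n 0 = 0" for n by (simp add: t_def)
  have tm: "mono (t n)" for n
  proof (rule monoI)
    fix i j :: nat assume "i \<le> j"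
    then have "real (min (i - 1) n) \<le> real (min (j - 1) n)" by auto
    then have "\<delta> * real (min (i - 1) n) / real n \<le> \<delta> * real (min (j - 1) n) / real n"
      using \<delta>0 by (intro divide_right_mono mult_left_mono) auto
    then show "t n i \<le> t n j" using \<open>i \<le> j\<close> a \<delta>0 by (auto simp: t_def)
  qed
  have tpos: "0 \<le> t n i" for n i using monoD[OF tm, of 0 i n] t0 by simp
  have tlen: "t n (Suc (Suc i)) - t n (Suc i) \<le> \<delta> / real n" for n i
  proof -
    have "real (min (Suc i) n) \<le> real (min i n) + 1" by auto
    then have "\<delta> * real (min (Suc i) n) \<le> \<delta> * (real (min i n) + 1)" using \<delta>0 by (intro mult_left_mono) auto
    then have "\<delta> * real (min (Suc i) n) / real n \<le> \<delta> * (real (min i n) + 1) / real n" by (rule divide_right_mono) simp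
    then show ?thesis by (simp add: t_def add_divide_distrib algebra_simps)
  qed
  \<comment> \<open>The entry \<open>i\<close> of the enumerated set is \<open>c i + i\<close>, so
    subtracting \<open>i\<close> recovers the cell; \<open>Suc\<close> skips the piece before
    \<open>a\<close>.\<close>
  define ce where "ce n S i = Suc (sorted_list_of_set S ! i - i)" for n i :: nat and S :: "nat set"
  define E where "E n S \<kappa> = {\<omega> \<in> space M. \<forall>i<n. cnt T (\<kappa> i) (t n (ce n S i)) (t n (Suc (ce n S i))) \<omega> \<noteq> 0}"
    for n S and \<kappa> :: "nat \<Rightarrow> clock"
  define K where "K n = (\<Pi>\<^sub>E i\<in>{..<n}. level N (y + i))" for n :: nat
  define U where "U n = (\<Union>S\<in>Pow {..<2 * n}. \<Union>\<kappa>\<in>K n. E n S \<kappa>)" for n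
  have finK: "finite (K n)" for n unfolding K_def using finite_level by (intro finite_PiE) auto
  have KD: "\<kappa> i \<in> seed_clocks" "snd (fst (\<kappa> i)) = y + i" if "\<kappa> \<in> K n" "i < n" for \<kappa> i n
    using that unfolding K_def level_def by (auto dest!: PiE_mem[where x = i])
  have mE: "E n S \<kappa> \<in> events" if "\<kappa> \<in> K n" for n S \<kappa>
  proof -
    have "E n S \<kappa> = {\<omega> \<in> space M. \<forall>i\<in>{..<n}. cnt T (\<kappa> i) (t n (ce n S i)) (t n (Suc (ce n S i))) \<omega> \<noteq> 0}"
      by (auto simp: E_def)
    also have "\<dots> \<in> events"
      by (rule sets.sets_Collect_finite_All[OF events_cnt]) (use KD[OF that] tpos monoD[OF tm] in auto)
    finally show ?thesis .
  qed
  have pE: "prob (E n S \<kappa>) \<le> (\<Prod>i<n. C * real (y + i) * (\<delta> / real n))" if \<kappa>: "\<kappa> \<in> K n" and n: "0 < n" for n S \<kappa>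
  proof -
    let ?X = "\<lambda>(k, i) \<omega>. cnt T k (t n i) (t n (Suc i)) \<omega>"
    let ?j = "\<lambda>i. (\<kappa> i, ce n S i)"
    \<comment> \<open>The rings of a chain have different heights and so belong to different clocks;
      they are independent even within one cell.\<close>
    have inj: "inj_on ?j {..<n}"
      by (rule inj_onI) (use KD[OF \<kappa>] in \<open>metis add_left_cancel lessThan_iff prod.inject\<close>)
    have "prob (\<Inter>j\<in>?j ` {..<n}. ?X j -` (- {0}) \<inter> space M) = (\<Prod>j\<in>?j ` {..<n}. prob (?X j -` (- {0}) \<inter> space M))"
      by (rule indep_varsD[OF indep_counts[OF t0 tm]]) (use KD[OF \<kappa>] n in auto)
    moreover have "(\<Inter>j\<in>?j ` {..<n}. ?X j -` (- {0}) \<inter> space M) = E n S \<kappa>"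
      using n by (auto simp: E_def)
    ultimately have "prob (E n S \<kappa>) = (\<Prod>i<n. prob {\<omega> \<in> space M. cnt T (\<kappa> i) (t n (ce n S i)) (t n (Suc (ce n S i))) \<omega> \<noteq> 0})"
      using inj by (simp add: prod.reindex vimage_def Int_def conj_commute)
    also have "\<dots> \<le> (\<Prod>i<n. C * real (y + i) * (\<delta> / real n))"
    proof (rule prod_mono, intro conjI)
      fix i assume i: "i \<in> {..<n}"
      then have s: "\<kappa> i \<in> seed_clocks" "snd (fst (\<kappa> i)) = y + i" using KD[OF \<kappa>] by auto
      have le: "t n (ce n S i) \<le> t n (Suc (ce n S i))" using monoD[OF tm] by simp
      have "prob {\<omega> \<in> space M. cnt T (\<kappa> i) (t n (ce n S i)) (t n (Suc (ce n S i))) \<omega> \<noteq> 0} \<le> lam (\<kappa> i) (t n (ce n S i)) (t n (Suc (ce n S i)))"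
        by (rule prob_ring_le[OF s(1) tpos le])
      also have "\<dots> \<le> C * real (y + i) * (t n (Suc (ce n S i)) - t n (ce n S i))"
        using lam_le[OF s(1) tpos le] s(2) by simp
      also have "\<dots> \<le> C * real (y + i) * (\<delta> / real n)"
        using tlen C_pos unfolding ce_def by (intro mult_left_mono) auto
      finally show "prob {\<omega> \<in> space M. cnt T (\<kappa> i) (t n (ce n S i)) (t n (Suc (ce n S i))) \<omega> \<noteq> 0} \<le> C * real (y + i) * (\<delta> / real n)" .
    qed simp
    finally show ?thesis .
  qed
  have cK: "card (K n) \<le> (6 * (N + 1)) ^ n" for n
  proof -
    have "card (K n) = (\<Prod>i<n. card (level N (y + i)))" unfolding K_def by (simp add: card_PiE)
    also have "\<dots> \<le> (\<Prod>i<n. 6 * (N + 1))" using card_level by (intro prod_mono) auto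
    finally show ?thesis by simp
  qed
  have mU: "U n \<in> events" for n
    unfolding U_def by (intro sets.finite_UN finK mE) auto
  \<comment> \<open>For \<open>n \<ge> y\<close> all heights of the chain are below
    \<open>2 * n\<close>, so a ring in a prescribed cell costs at most
    \<open>2 * C * \<delta>\<close>. Together with the factor \<open>4\<close> for the orders and
    \<open>6 * (N + 1)\<close> for the clocks of a level this gives \<open>1 / 2\<close> per ring,
    which is the origin of the \<open>96\<close> in \<delta>.\<close>
  have pU: "prob (U n) \<le> (1 / 2) ^ n" if n: "y \<le> n" "0 < n" for n
  proof -
    define w where "w = (\<Prod>i<n. C * real (y + i) * (\<delta> / real n))"
    have w0: "0 \<le> w" unfolding w_def using C_pos \<delta>0 by (intro prod_nonneg) auto
    have "prob (U n) \<le> (\<Sum>S\<in>Pow {..<2 * n}. prob (\<Union>\<kappa>\<in>K n. E n S \<kappa>))"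
      unfolding U_def by (intro finite_measure_subadditive_finite) (auto intro!: sets.finite_UN finK mE)
    also have "\<dots> \<le> (\<Sum>S\<in>Pow {..<2 * n}. \<Sum>\<kappa>\<in>K n. prob (E n S \<kappa>))"
      by (intro sum_mono finite_measure_subadditive_finite finK) (auto intro!: mE)
    also have "\<dots> \<le> (\<Sum>S\<in>Pow {..<2 * n}. \<Sum>\<kappa>\<in>K n. w)"
      unfolding w_def by (intro sum_mono pE n) auto
    also have "\<dots> = 4 ^ n * (real (card (K n)) * w)"
      by (simp add: card_Pow power_mult)
    also have "\<dots> \<le> 4 ^ n * ((6 * (real N + 1)) ^ n * w)"
    proof -
      have "real (card (K n)) \<le> real ((6 * (N + 1)) ^ n)" using cK of_nat_mono by blast
      then show ?thesis using w0 by (intro mult_left_mono mult_right_mono) (auto simp: algebra_simps)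
    qed
    also have "w \<le> (\<Prod>i<n. C * (2 * \<delta>))"
      unfolding w_def
    proof (rule prod_mono, intro conjI)
      fix i assume "i \<in> {..<n}"
      then have "real (y + i) * (\<delta> / real n) \<le> (2 * real n) * (\<delta> / real n)"
        using n \<delta>0 by (intro mult_right_mono) auto
      also have "\<dots> = 2 * \<delta>" using n by simp
      finally have "C * (real (y + i) * (\<delta> / real n)) \<le> C * (2 * \<delta>)"
        using C_pos by (intro mult_left_mono) auto
      then show "C * real (y + i) * (\<delta> / real n) \<le> C * (2 * \<delta>)" by (simp only: mult.assoc)
    qed (use C_pos \<delta>0 in auto)
    also have "4 ^ n * ((6 * (real N + 1)) ^ n * (\<Prod>i<n. C * (2 * \<delta>))) = (4 * (6 * (real N + 1)) * (C * (2 * \<delta>))) ^ n"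
      by (simp only: prod_constant card_lessThan power_mult_distrib mult_ac)
    also have "4 * (6 * (real N + 1)) * (C * (2 * \<delta>)) = 1 / 2"
    proof -
      have "\<delta> * (96 * real (N + 1) * C) = 1" unfolding \<delta> using C_pos by simp
      then show ?thesis by (simp add: algebra_simps)
    qed
    finally show ?thesis by simp
  qed
  have chU: "\<omega> \<in> U n" if \<omega>: "\<omega> \<in> space M" and n: "0 < n" and ch: "chain (\<lambda>k. T k \<omega>) N y n {a<..a + \<delta>}" for \<omega> n
  proof -
    obtain f where f: "\<And>i. i < n \<Longrightarrow> f i \<in> {a<..a + \<delta>} \<and> (\<exists>x\<le>N. \<exists>p. ((x, y + i), p) \<in> seed_clocks \<and> f i \<in> T ((x, y + i), p) \<omega>)"
      and fS: "\<And>i. Suc i < n \<Longrightarrow> f i < f (Suc i)"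
      using ch unfolding chain_def by blast
    have "\<exists>k. k \<in> level N (y + i) \<and> f i \<in> T k \<omega>" if "i < n" for i
    proof -
      obtain x p where "x \<le> N" "((x, y + i), p) \<in> seed_clocks" "f i \<in> T ((x, y + i), p) \<omega>" using f[OF \<open>i < n\<close>] by blast
      then show ?thesis by (intro exI[of _ "((x, y + i), p)"]) (simp add: level_def)
    qed
    then obtain \<kappa>0 where \<kappa>0: "\<And>i. i < n \<Longrightarrow> \<kappa>0 i \<in> level N (y + i) \<and> f i \<in> T (\<kappa>0 i) \<omega>" by metis
    define \<kappa> where "\<kappa> = restrict \<kappa>0 {..<n}"
    have \<kappa>: "\<kappa> \<in> K n" unfolding K_def \<kappa>_def using \<kappa>0 by (intro restrict_PiE_iff[THEN iffD2]) auto
    define z where "z i = (f i - a) * real n / \<delta>" for i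
    \<comment> \<open>The cells are open on the left and closed on the right, hence the ceiling
      minus one.\<close>
    define c where "c i = nat \<lceil>z i\<rceil> - 1" for i
    have z: "0 < z i" "z i \<le> real n" if "i < n" for i
      using f[OF that] \<delta>0 n by (auto simp: z_def pos_divide_le_eq mult.commute)
    have c: "c i < n" "real (c i) < z i" "z i \<le> real (c i) + 1" if "i < n" for i
    proof -
      have "1 \<le> \<lceil>z i\<rceil>" "\<lceil>z i\<rceil> \<le> int n" using z[OF that] by (auto simp: ceiling_le_iff)
      then have "int (c i) = \<lceil>z i\<rceil> - 1" unfolding c_def by linarith
      then show "c i < n" "real (c i) < z i" "z i \<le> real (c i) + 1"
        using \<open>\<lceil>z i\<rceil> \<le> int n\<close> n by linarith+
    qed
    have zm: "z i < z (Suc i)" if "Suc i < n" for i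
      using fS[OF that] \<delta>0 n by (auto simp: z_def intro!: divide_strict_right_mono mult_strict_right_mono)
    have cS: "c i \<le> c (Suc i)" if "Suc i < n" for i
      using zm[OF that] unfolding c_def by (intro diff_le_mono nat_mono ceiling_mono) auto
    have sm: "c i + i < c j + j" if "i < j" "j < n" for i j
      using that
    proof (induction j)
      case (Suc j)
      then show ?case using cS[of j] by (cases "i = j") auto
    qed simp
    define S where "S = (\<lambda>i. c i + i) ` {..<n}"
    have S: "S \<in> Pow {..<2 * n}" using c(1) by (auto simp: S_def intro: add_less_le_mono[of _ n _ n, simplified] simp: mult_2)
    have sl: "sorted_list_of_set S = map (\<lambda>i. c i + i) [0..<n]"
    proof (rule sorted_distinct_set_unique)
      show "sorted (map (\<lambda>i. c i + i) [0..<n])"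
        using sm by (auto simp: sorted_iff_nth_mono_less less_imp_le)
      show "distinct (map (\<lambda>i. c i + i) [0..<n])"
        unfolding distinct_map by (auto intro!: inj_onI) (metis linorder_neqE_nat nat_neq_iff sm)
    qed (auto simp: S_def)
    have "cnt T (\<kappa> i) (t n (ce n S i)) (t n (Suc (ce n S i))) \<omega> \<noteq> 0" if i: "i < n" for i
    proof -
      have ce: "ce n S i = Suc (c i)" unfolding ce_def sl using i by simp
      have "t n (Suc (c i)) < f i" "f i \<le> t n (Suc (Suc (c i)))"
        using c[OF i] n \<delta>0 by (auto simp: t_def z_def field_simps)
      then have "f i \<in> T (\<kappa> i) \<omega> \<inter> {t n (ce n S i)<..t n (Suc (ce n S i))}"
        using \<kappa>0[OF i] i by (simp add: \<kappa>_def ce)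
      moreover have "finite (T (\<kappa> i) \<omega> \<inter> {t n (ce n S i)<..t n (Suc (ce n S i))})"
        by (rule finite_subset[OF _ rings_finite[OF KD(1)[OF \<kappa> i] \<omega>, of "t n (Suc (ce n S i))"]]) (use tpos[of n "ce n S i"] in auto)
      ultimately show ?thesis by (auto simp: cnt_def)
    qed
    then show "\<omega> \<in> U n" unfolding U_def E_def using \<omega> S \<kappa> by blast
  qed
  define V where "V = (\<Inter>n. U (Suc (y + n)))"
  have mV: "V \<in> events" unfolding V_def using mU by (intro sets.countable_INT) auto
  have "prob V \<le> (1 / 2) ^ n" for n
  proof -
    have "prob V \<le> prob (U (Suc (y + n)))" unfolding V_def by (intro finite_measure_mono mU) auto
    also have "\<dots> \<le> (1 / 2) ^ Suc (y + n)" by (rule pU) auto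
    also have "\<dots> \<le> (1 / 2) ^ n" by (rule power_decreasing) auto
    finally show ?thesis .
  qed
  moreover have "(\<lambda>n. (1 / 2 :: real) ^ n) \<longlonglongrightarrow> 0" by (rule LIMSEQ_realpow_zero) auto
  ultimately have "prob V \<le> 0" by (intro LIMSEQ_le_const) auto
  then have "V \<in> null_sets M" using mV by (auto simp: null_sets_def emeasure_eq_measure measure_le_0_iff)
  then have "AE \<omega> in M. \<omega> \<notin> V" by (rule AE_not_in)
  then show ?thesis
    using AE_space
  proof eventually_elim
    case (elim \<omega>)
    then show ?case using chU[OF elim(2)] unfolding V_def by blast
  qed
qed

text \<open>Cut the time up to \<open>m\<close> into \<open>n + 1\<close> equal cells. Two given
  clocks both ring in a given cell with probability of the order of the squared cell length, so they
  share some cell with probability of order \<open>1 / n\<close>.\<close>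

lemma AE_no_ties: "AE \<omega> in M. \<forall>k\<in>seed_clocks. \<forall>k'\<in>seed_clocks. k \<noteq> k' \<longrightarrow> T k \<omega> \<inter> T k' \<omega> = {}"
proof -
  have pair: "AE \<omega> in M. T k \<omega> \<inter> T k' \<omega> \<inter> {..real m} = {}"
    if k: "k \<in> seed_clocks" "k' \<in> seed_clocks" "k \<noteq> k'" for k k' and m :: nat
  proof -
    define t where "t n i = real m * real i / real (Suc n)" for n i
    have t0: "t n 0 = 0" and tn: "t n (Suc n) = real m" for n by (simp_all add: t_def del: of_nat_Suc)
    have tm: "mono (t n)" for n
      by (rule monoI) (auto simp: t_def simp del: of_nat_Suc intro!: divide_right_mono mult_left_mono)
    have tlen: "t n (Suc i) - t n i = real m / real (Suc n)" for n i
    proof -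
      have "t n (Suc i) = t n i + real m / real (Suc n)"
        by (simp add: t_def distrib_left add_divide_distrib)
      then show ?thesis by simp
    qed
    have tpos: "0 \<le> t n i" for n i using monoD[OF tm, of 0 i n] t0 by simp
    define E where "E n i = {\<omega> \<in> space M. \<forall>\<kappa>\<in>{k, k'}. cnt T \<kappa> (t n i) (t n (Suc i)) \<omega> \<noteq> 0}" for n i
    define U where "U n = (\<Union>i\<in>{..n}. E n i)" for n
    define D where "D = (C * real (snd (fst k)) * real m) * (C * real (snd (fst k')) * real m)"
    have mE: "E n i \<in> events" for n i
      unfolding E_def by (rule sets.sets_Collect_finite_All[OF events_cnt]) (use k tpos monoD[OF tm, of i "Suc i"] in auto)
    have mU: "U n \<in> events" for n unfolding U_def using mE by blast
    have pE: "prob (E n i) \<le> D / (real (Suc n))\<^sup>2" for n i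
    proof -
      let ?X = "\<lambda>(\<kappa>, i) \<omega>. cnt T \<kappa> (t n i) (t n (Suc i)) \<omega>"
      have "prob (\<Inter>j\<in>{k, k'} \<times> {i}. ?X j -` (- {0}) \<inter> space M) = (\<Prod>j\<in>{k, k'} \<times> {i}. prob (?X j -` (- {0}) \<inter> space M))"
        by (rule indep_varsD[OF indep_counts[of "t n", OF t0 tm]]) (use k in auto)
      moreover have "(\<Inter>j\<in>{k, k'} \<times> {i}. ?X j -` (- {0}) \<inter> space M) = E n i" by (auto simp: E_def)
      moreover have "(\<Prod>j\<in>{k, k'} \<times> {i}. prob (?X j -` (- {0}) \<inter> space M)) = prob (?X (k, i) -` (- {0}) \<inter> space M) * prob (?X (k', i) -` (- {0}) \<inter> space M)"
        using k(3) by (simp add: Sigma_def)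
      ultimately have eq: "prob (E n i) = prob (?X (k, i) -` (- {0}) \<inter> space M) * prob (?X (k', i) -` (- {0}) \<inter> space M)" by simp
      have le: "prob (?X (\<kappa>, i) -` (- {0}) \<inter> space M) \<le> C * real (snd (fst \<kappa>)) * real m / real (Suc n)" if "\<kappa> \<in> seed_clocks" for \<kappa>
      proof -
        have "?X (\<kappa>, i) -` (- {0}) \<inter> space M = {\<omega> \<in> space M. cnt T \<kappa> (t n i) (t n (Suc i)) \<omega> \<noteq> 0}" by auto
        then have "prob (?X (\<kappa>, i) -` (- {0}) \<inter> space M) \<le> lam \<kappa> (t n i) (t n (Suc i))"
          using prob_ring_le[OF that tpos monoD[OF tm, of i "Suc i"]] by simp
        also have "\<dots> \<le> C * real (snd (fst \<kappa>)) * (real m / real (Suc n))"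
          using lam_le[OF that tpos monoD[OF tm, of i "Suc i"]] unfolding tlen by simp
        finally show ?thesis by simp
      qed
      have "prob (E n i) \<le> (C * real (snd (fst k)) * real m / real (Suc n)) * (C * real (snd (fst k')) * real m / real (Suc n))"
        unfolding eq using C_pos by (intro mult_mono le k measure_nonneg divide_nonneg_nonneg mult_nonneg_nonneg) auto
      then show ?thesis by (simp add: D_def power2_eq_square del: of_nat_Suc)
    qed
    have pU: "prob (U n) \<le> D / real (Suc n)" for n
    proof -
      have "prob (U n) \<le> (\<Sum>i\<in>{..n}. prob (E n i))" unfolding U_def by (rule finite_measure_subadditive_finite) (use mE in auto)
      also have "\<dots> \<le> (\<Sum>i\<in>{..n}. D / (real (Suc n))\<^sup>2)" by (rule sum_mono[OF pE])
      also have "\<dots> = D / real (Suc n)" by (simp add: power2_eq_square del: of_nat_Suc)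
      finally show ?thesis .
    qed
    define V where "V = (\<Inter>n. U n)"
    have mV: "V \<in> events" unfolding V_def using mU by (intro sets.countable_INT) auto
    have "prob V \<le> D / real (Suc n)" for n
    proof -
      have "prob V \<le> prob (U n)" unfolding V_def by (intro finite_measure_mono mU) auto
      then show ?thesis using pU[of n] by linarith
    qed
    then have "prob V \<le> 0" by (intro LIMSEQ_le_const[OF LIMSEQ_Suc[OF lim_const_over_n[of D]]]) auto
    then have "V \<in> null_sets M" using mV by (auto simp: null_sets_def emeasure_eq_measure measure_le_0_iff)
    then have "AE \<omega> in M. \<omega> \<notin> V" by (rule AE_not_in)
    then show ?thesis
      using AE_space
    proof eventually_elim
      case (elim \<omega>)
      show ?case
      proof (rule ccontr)
        assume "T k \<omega> \<inter> T k' \<omega> \<inter> {..real m} \<noteq> {}"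
        then obtain r where r: "r \<in> T k \<omega>" "r \<in> T k' \<omega>" "r \<le> real m" by blast
        then have r0: "0 < r" using rings_pos[OF k(1) elim(2)] by auto
        have "\<omega> \<in> U n" for n
        proof -
          define i where "i = (LEAST i. r \<le> t n (Suc i))"
          have ex: "r \<le> t n (Suc n)" using r(3) tn by simp
          have i: "r \<le> t n (Suc i)" "i \<le> n" unfolding i_def using LeastI[of "\<lambda>i. r \<le> t n (Suc i)", OF ex] Least_le[of "\<lambda>i. r \<le> t n (Suc i)", OF ex] by auto
          have "t n i < r"
          proof (cases i)
            case (Suc l)
            then show ?thesis using not_less_Least[of l "\<lambda>i. r \<le> t n (Suc i)"] by (simp add: i_def)
          qed (use t0 r0 in simp)
          then have "r \<in> T \<kappa> \<omega> \<inter> {t n i<..t n (Suc i)}" if "\<kappa> \<in> {k, k'}" for \<kappa> using r i that by auto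
          moreover have "finite (T \<kappa> \<omega> \<inter> {t n i<..t n (Suc i)})" if "\<kappa> \<in> {k, k'}" for \<kappa>
            by (rule finite_subset[OF _ rings_finite[of \<kappa> \<omega> "t n (Suc i)"]]) (use k elim that tpos[of n i] in auto)
          ultimately have "cnt T \<kappa> (t n i) (t n (Suc i)) \<omega> \<noteq> 0" if "\<kappa> \<in> {k, k'}" for \<kappa>
            using that unfolding cnt_def by (metis card_0_eq empty_iff)
          then show ?thesis unfolding U_def E_def using i(2) elim(2) by blast
        qed
        then show False using elim(1) by (simp add: V_def)
      qed
    qed
  qed
  have "countable seed_clocks" by simp
  then have "AE \<omega> in M. \<forall>k\<in>seed_clocks. \<forall>k'\<in>seed_clocks. \<forall>m. k \<noteq> k' \<longrightarrow> T k \<omega> \<inter> T k' \<omega> \<inter> {..real m} = {}"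
    using pair by (simp only: AE_ball_countable AE_all_countable) (auto intro!: AE_impI)
  then show ?thesis
  proof eventually_elim
    case (elim \<omega>)
    show ?case
    proof (intro ballI impI equals0I)
      fix k k' r assume k: "k \<in> seed_clocks" "k' \<in> seed_clocks" "k \<noteq> k'" and r: "r \<in> T k \<omega> \<inter> T k' \<omega>"
      obtain m :: nat where "r \<le> real m" using real_arch_simple by blast
      then show False using bspec[OF bspec[OF elim k(1)] k(2)] k(3) r by blast
    qed
  qed
qed

text \<open>The step \<delta> depends on \<open>N\<close> alone, so for each \<open>N\<close> only
  countably many pairs of a starting time and a height have to be considered.\<close>

lemma AE_good_rings: "AE \<omega> in M. good_rings (\<lambda>k. T k \<omega>)"
proof -
  define \<delta> where "\<delta> N = 1 / (96 * real (N + 1) * C)" for N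
  have \<delta>0: "0 < \<delta> N" for N using C_pos by (simp add: \<delta>_def)
  have "AE \<omega> in M. \<forall>N (j::nat) y. \<exists>n. \<not> chain (\<lambda>k. T k \<omega>) N y n {real j * \<delta> N<..real j * \<delta> N + \<delta> N}"
    unfolding AE_all_countable using \<delta>0 by (intro allI AE_no_chain) (auto simp: \<delta>_def less_imp_le)
  then show ?thesis
    using AE_no_ties AE_space
  proof eventually_elim
    case (elim \<omega>)
    show ?case
    proof
      fix N
      have "real (Suc j) * \<delta> N = real j * \<delta> N + \<delta> N" for j by (simp add: algebra_simps)
      then show "\<exists>\<delta>>0. \<forall>(j::nat) y. \<exists>n. \<not> chain (\<lambda>k. T k \<omega>) N y n {real j * \<delta><..real (Suc j) * \<delta>}"
        using elim(1) \<delta>0 by (intro exI[of _ "\<delta> N"]) auto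
    qed (use elim rings_pos rings_finite in blast)+
  qed
qed

lemma finite_ring_interval:
  assumes "k \<in> seed_clocks" "\<omega> \<in> space M" "0 \<le> a"
  shows "finite (T k \<omega> \<inter> {a<..b})"
  by (rule finite_subset[OF _ rings_finite[OF assms(1,2), of b]]) (use assms(3) in auto)

section \<open>Independence of the past and the future of the clocks\<close>

lemma cnt_additive:
  assumes "k \<in> seed_clocks" "\<omega> \<in> space M" "0 \<le> a" "a \<le> b" "b \<le> c"
  shows "cnt T k a c \<omega> = cnt T k a b \<omega> + cnt T k b c \<omega>"
proof -
  have "T k \<omega> \<inter> {a<..c} = (T k \<omega> \<inter> {a<..b}) \<union> (T k \<omega> \<inter> {b<..c})" using assms by auto
  then show ?thesis unfolding cnt_def
    using assms by (simp, intro card_Un_disjoint finite_ring_interval) auto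
qed

lemma cnt_empty[simp]: "cnt T k a a \<omega> = 0" by (simp add: cnt_def)

lemma cnt_partition:
  assumes "k \<in> seed_clocks" "\<omega> \<in> space M" "t 0 = 0" "mono t" "m \<le> n"
  shows "cnt T k (t m) (t n) \<omega> = (\<Sum>i=m..<n. cnt T k (t i) (t (Suc i)) \<omega>)"
  using assms(5)
proof (induction n rule: dec_induct)
  case (step n)
  have "cnt T k (t m) (t (Suc n)) \<omega> = cnt T k (t m) (t n) \<omega> + cnt T k (t n) (t (Suc n)) \<omega>"
    using assms(3) monoD[OF assms(4), of 0 m] step by (intro cnt_additive assms(1,2) monoD[OF assms(4)]) auto
  then show ?case using step by simp
qed simp

lemma ex_partition:
  assumes "finite P" "P \<subseteq> {0::real..}"
  shows "\<exists>t::nat \<Rightarrow> real. t 0 = 0 \<and> mono t \<and> P \<subseteq> range t"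
proof -
  define l where "l = sorted_list_of_set (insert 0 P)"
  have l: "sorted l" "set l = insert 0 P" "l \<noteq> []" using assms(1) by (simp_all add: l_def del: sorted_list_of_set_insert_remove)
  define t where "t i = l ! min i (length l - 1)" for i
  have "mono t" unfolding t_def using l by (auto intro!: monoI sorted_nth_mono simp: min_less_iff_disj)
  moreover have "t 0 = 0"
  proof -
    obtain i where "i < length l" "l ! i = 0" using l by (metis in_set_conv_nth insertI1)
    then have "t 0 \<le> 0" using sorted_nth_mono[OF l(1), of 0 i] by (simp add: t_def)
    moreover have "t 0 \<in> insert 0 P" unfolding t_def l(2)[symmetric] using l by (intro nth_mem) auto
    ultimately show ?thesis using assms(2) by force
  qed
  moreover have "P \<subseteq> range t"
  proof
    fix p assume "p \<in> P"
    then obtain i where "i < length l" "l ! i = p" using l by (metis in_set_conv_nth insertI2)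
    then show "p \<in> range t" by (intro image_eqI[of _ _ i]) (auto simp: t_def min_def)
  qed
  ultimately show ?thesis by blast
qed

text \<open>Counts from time \<open>0\<close> at all real times up to \<open>s\<close>, so that
  every state of the chain up to \<open>s\<close> is a function of \<open>past s\<close>.\<close>

definition past :: "real \<Rightarrow> 'w \<Rightarrow> clock \<times> real \<Rightarrow> nat" where
  "past s \<omega> = (\<lambda>j\<in>seed_clocks \<times> {0..s}. cnt T (fst j) 0 (snd j) \<omega>)"

definition future :: "real \<Rightarrow> 'w \<Rightarrow> clock \<times> real \<Rightarrow> nat" where
  "future s \<omega> = (\<lambda>j\<in>seed_clocks \<times> {s..}. cnt T (fst j) s (snd j) \<omega>)"

abbreviation "past_space s \<equiv> \<Pi>\<^sub>M j\<in>seed_clocks \<times> {0..s}. count_space (UNIV :: nat set)"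
abbreviation "future_space s \<equiv> \<Pi>\<^sub>M j\<in>seed_clocks \<times> {s..}. count_space (UNIV :: nat set)"

lemma measurable_past: "past s \<in> measurable M (past_space s)"
  unfolding past_def by (intro measurable_restrict measurable_cnt) auto

lemma measurable_future: "0 \<le> s \<Longrightarrow> future s \<in> measurable M (future_space s)"
  unfolding future_def by (intro measurable_restrict measurable_cnt) auto

text \<open>A common partition through \<open>s\<close> writes the counts before \<open>s\<close>
  and after \<open>s\<close> as sums of increments over disjoint blocks of cells, and blocks of
  independent increments are independent.\<close>

lemma prob_past_future_finite:
  assumes s: "0 \<le> s" and J1: "finite J1" "J1 \<subseteq> seed_clocks \<times> {0..s}" and J2: "finite J2" "J2 \<subseteq> seed_clocks \<times> {s..}"
  shows "prob ({\<omega> \<in> space M. \<forall>j\<in>J1. cnt T (fst j) 0 (snd j) \<omega> \<in> E1 j} \<inter> {\<omega> \<in> space M. \<forall>j\<in>J2. cnt T (fst j) s (snd j) \<omega> \<in> E2 j}) =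
    prob {\<omega> \<in> space M. \<forall>j\<in>J1. cnt T (fst j) 0 (snd j) \<omega> \<in> E1 j} * prob {\<omega> \<in> space M. \<forall>j\<in>J2. cnt T (fst j) s (snd j) \<omega> \<in> E2 j}"
proof -
  define P where "P = insert s (snd ` J1 \<union> snd ` J2)"
  have "finite P" "P \<subseteq> {0..}" using assms by (auto simp: P_def)
  from ex_partition[OF this] obtain t :: "nat \<Rightarrow> real" where t: "t 0 = 0" "mono t" "P \<subseteq> range t" by blast
  define ix where "ix a = (LEAST i. t i = a)" for a
  have ix: "t (ix a) = a" if "a \<in> P" for a
    using t(3) that unfolding ix_def by (metis (mono_tags, lifting) LeastI imageE subsetD)
  have ixm: "ix a \<le> ix b" if "a \<in> P" "b \<in> P" "a \<le> b" for a b
    using ix[OF that(1)] ix[OF that(2)] that(3) monoD[OF t(2)] by (metis dual_order.antisym nle_le)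
  let ?X = "\<lambda>(k, i) \<omega>. cnt T k (t i) (t (Suc i)) \<omega>"
  define A1 A2 where "A1 = seed_clocks \<times> {..<ix s}" and "A2 = seed_clocks \<times> {ix s..}"
  let ?R = "\<lambda>A. \<lambda>\<omega>. \<lambda>j\<in>A. ?X j \<omega>" and ?S = "\<lambda>A. \<Pi>\<^sub>M j\<in>A. count_space (UNIV :: nat set)"
  have ind: "indep_var (?S A1) (?R A1) (?S A2) (?R A2)"
    by (rule indep_var_restrict[OF indep_counts[OF t(1,2)]]) (auto simp: A1_def A2_def)
  define S1 where "S1 = {z \<in> space (?S A1). \<forall>j\<in>J1. (\<Sum>i=0..<ix (snd j). z (fst j, i)) \<in> E1 j}"
  define S2 where "S2 = {z \<in> space (?S A2). \<forall>j\<in>J2. (\<Sum>i=ix s..<ix (snd j). z (fst j, i)) \<in> E2 j}"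
  have iJ1: "ix (snd j) \<le> ix s" "fst j \<in> seed_clocks" "snd j \<in> P" if "j \<in> J1" for j
    using J1(2) that by (auto intro!: ixm simp: P_def)
  have iJ2: "ix s \<le> ix (snd j)" "fst j \<in> seed_clocks" "snd j \<in> P" if "j \<in> J2" for j
    using J2(2) that by (auto intro!: ixm simp: P_def)
  have mS1: "S1 \<in> sets (?S A1)"
  proof (rule sets_PiM_finite_dep)
    show "finite (\<Union>j\<in>J1. {fst j} \<times> {0..<ix (snd j)})" using J1 by auto
    show "(\<Union>j\<in>J1. {fst j} \<times> {0..<ix (snd j)}) \<subseteq> A1" using iJ1 by (fastforce simp: A1_def)
    fix z z' assume z: "z \<in> S1" "z' \<in> space (?S A1)" and eq: "\<And>j. j \<in> (\<Union>j\<in>J1. {fst j} \<times> {0..<ix (snd j)}) \<Longrightarrow> z j = z' j"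
    have "(\<Sum>i=0..<ix (snd j). z (fst j, i)) = (\<Sum>i=0..<ix (snd j). z' (fst j, i))" if "j \<in> J1" for j
      by (rule sum.cong[OF refl], rule eq) (use that in auto)
    then show "z' \<in> S1" using z by (auto simp: S1_def)
  qed (auto simp: S1_def)
  have mS2: "S2 \<in> sets (?S A2)"
  proof (rule sets_PiM_finite_dep)
    show "finite (\<Union>j\<in>J2. {fst j} \<times> {ix s..<ix (snd j)})" using J2 by auto
    show "(\<Union>j\<in>J2. {fst j} \<times> {ix s..<ix (snd j)}) \<subseteq> A2" using iJ2 by (fastforce simp: A2_def)
    fix z z' assume z: "z \<in> S2" "z' \<in> space (?S A2)" and eq: "\<And>j. j \<in> (\<Union>j\<in>J2. {fst j} \<times> {ix s..<ix (snd j)}) \<Longrightarrow> z j = z' j"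
    have "(\<Sum>i=ix s..<ix (snd j). z (fst j, i)) = (\<Sum>i=ix s..<ix (snd j). z' (fst j, i))" if "j \<in> J2" for j
      by (rule sum.cong[OF refl], rule eq) (use that in auto)
    then show "z' \<in> S2" using z by (auto simp: S2_def)
  qed (auto simp: S2_def)
  have R: "?R A \<omega> \<in> space (?S A)" for A \<omega> by (simp add: space_PiM)
  have e1: "?R A1 -` S1 \<inter> space M = {\<omega> \<in> space M. \<forall>j\<in>J1. cnt T (fst j) 0 (snd j) \<omega> \<in> E1 j}"
  proof -
    have "(\<Sum>i=0..<ix (snd j). ?R A1 \<omega> (fst j, i)) = cnt T (fst j) 0 (snd j) \<omega>" if "j \<in> J1" "\<omega> \<in> space M" for j \<omega>
    proof -
      have "(\<Sum>i=0..<ix (snd j). ?R A1 \<omega> (fst j, i)) = (\<Sum>i=0..<ix (snd j). cnt T (fst j) (t i) (t (Suc i)) \<omega>)"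
        using iJ1[OF that(1)] by (intro sum.cong refl) (auto simp: A1_def)
      also have "\<dots> = cnt T (fst j) (t 0) (t (ix (snd j))) \<omega>"
        using iJ1[OF that(1)] that(2) t by (intro cnt_partition[symmetric]) auto
      finally show ?thesis using ix[OF iJ1(3)[OF that(1)]] t(1) by simp
    qed
    then show ?thesis using R by (auto simp: S1_def)
  qed
  have e2: "?R A2 -` S2 \<inter> space M = {\<omega> \<in> space M. \<forall>j\<in>J2. cnt T (fst j) s (snd j) \<omega> \<in> E2 j}"
  proof -
    have "(\<Sum>i=ix s..<ix (snd j). ?R A2 \<omega> (fst j, i)) = cnt T (fst j) s (snd j) \<omega>" if "j \<in> J2" "\<omega> \<in> space M" for j \<omega>
    proof -
      have "(\<Sum>i=ix s..<ix (snd j). ?R A2 \<omega> (fst j, i)) = (\<Sum>i=ix s..<ix (snd j). cnt T (fst j) (t i) (t (Suc i)) \<omega>)"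
        using iJ2[OF that(1)] by (intro sum.cong refl) (auto simp: A2_def)
      also have "\<dots> = cnt T (fst j) (t (ix s)) (t (ix (snd j))) \<omega>"
        using iJ2[OF that(1)] that(2) t by (intro cnt_partition[symmetric]) auto
      finally show ?thesis using ix[OF iJ2(3)[OF that(1)]] ix[of s] by (simp add: P_def)
    qed
    then show ?thesis using R by (auto simp: S2_def)
  qed
  have "(\<lambda>\<omega>. (?R A1 \<omega>, ?R A2 \<omega>)) -` (S1 \<times> S2) \<inter> space M = (?R A1 -` S1 \<inter> space M) \<inter> (?R A2 -` S2 \<inter> space M)"
    by auto
  with indep_varD[OF ind mS1 mS2] show ?thesis unfolding e1 e2 by simp
qed

text \<open>The events of finitely many counts are stable under intersection and generate the two
  sigma-algebras, so the product formula extends from them.\<close>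

lemma indep_past_future:
  assumes s: "0 \<le> s"
  shows "indep_var (past_space s) (past s) (future_space s) (future s)"
proof -
  let ?I1 = "seed_clocks \<times> {0..s}" and ?I2 = "seed_clocks \<times> {s..}" and ?N = "\<lambda>_. count_space (UNIV :: nat set)"
  define G1 where "G1 = {past s -` X \<inter> space M |X. X \<in> prod_algebra ?I1 ?N}"
  define G2 where "G2 = {future s -` X \<inter> space M |X. X \<in> prod_algebra ?I2 ?N}"
  have form1: "\<exists>J E. finite J \<and> J \<subseteq> ?I1 \<and> A = {\<omega> \<in> space M. \<forall>j\<in>J. cnt T (fst j) 0 (snd j) \<omega> \<in> E j}" if "A \<in> G1" for A
  proof -
    obtain X where X: "X \<in> prod_algebra ?I1 ?N" "A = past s -` X \<inter> space M" using \<open>A \<in> G1\<close> unfolding G1_def by blast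
    obtain J E where J: "X = prod_emb ?I1 ?N J (\<Pi>\<^sub>E j\<in>J. E j)" "finite J" "J \<subseteq> ?I1" using X(1) by (rule prod_algebraE) blast
    have "\<And>\<omega>. past s \<omega> \<in> X \<longleftrightarrow> (\<forall>j\<in>J. cnt T (fst j) 0 (snd j) \<omega> \<in> E j)"
    proof -
      fix \<omega>
      have "past s \<omega> j = cnt T (fst j) 0 (snd j) \<omega>" if "j \<in> J" for j
        unfolding past_def using subsetD[OF J(3) that] by (rule restrict_apply')
      moreover have "past s \<omega> \<in> extensional ?I1" by (simp add: past_def)
      ultimately show "past s \<omega> \<in> X \<longleftrightarrow> (\<forall>j\<in>J. cnt T (fst j) 0 (snd j) \<omega> \<in> E j)"
        unfolding J(1) prod_emb_iff restrict_PiE_iff by simp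
    qed
    then show ?thesis using X(2) J by (intro exI[of _ J] exI[of _ E]) auto
  qed
  have form2: "\<exists>J E. finite J \<and> J \<subseteq> ?I2 \<and> A = {\<omega> \<in> space M. \<forall>j\<in>J. cnt T (fst j) s (snd j) \<omega> \<in> E j}" if "A \<in> G2" for A
  proof -
    obtain X where X: "X \<in> prod_algebra ?I2 ?N" "A = future s -` X \<inter> space M" using \<open>A \<in> G2\<close> unfolding G2_def by blast
    obtain J E where J: "X = prod_emb ?I2 ?N J (\<Pi>\<^sub>E j\<in>J. E j)" "finite J" "J \<subseteq> ?I2" using X(1) by (rule prod_algebraE) blast
    have "\<And>\<omega>. future s \<omega> \<in> X \<longleftrightarrow> (\<forall>j\<in>J. cnt T (fst j) s (snd j) \<omega> \<in> E j)"
    proof -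
      fix \<omega>
      have "future s \<omega> j = cnt T (fst j) s (snd j) \<omega>" if "j \<in> J" for j
        unfolding future_def using subsetD[OF J(3) that] by (rule restrict_apply')
      moreover have "future s \<omega> \<in> extensional ?I2" by (simp add: future_def)
      ultimately show "future s \<omega> \<in> X \<longleftrightarrow> (\<forall>j\<in>J. cnt T (fst j) s (snd j) \<omega> \<in> E j)"
        unfolding J(1) prod_emb_iff restrict_PiE_iff by simp
    qed
    then show ?thesis using X(2) J by (intro exI[of _ J] exI[of _ E]) auto
  qed
  have sub: "prod_algebra I ?N \<subseteq> sets (Pi\<^sub>M I ?N)" for I :: "(clock \<times> real) set"
    unfolding sets_PiM by auto
  have ev: "G1 \<subseteq> events" "G2 \<subseteq> events"
    unfolding G1_def G2_def using measurable_sets[OF measurable_past] measurable_sets[OF measurable_future[OF s]] sub by blast+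
  have "indep_set G1 G2"
    unfolding indep_sets2_eq
  proof (intro conjI ev ballI)
    fix A B assume "A \<in> G1" "B \<in> G2"
    obtain J1 E1 where 1: "finite J1" "J1 \<subseteq> ?I1" "A = {\<omega> \<in> space M. \<forall>j\<in>J1. cnt T (fst j) 0 (snd j) \<omega> \<in> E1 j}"
      using form1[OF \<open>A \<in> G1\<close>] by blast
    obtain J2 E2 where 2: "finite J2" "J2 \<subseteq> ?I2" "B = {\<omega> \<in> space M. \<forall>j\<in>J2. cnt T (fst j) s (snd j) \<omega> \<in> E2 j}"
      using form2[OF \<open>B \<in> G2\<close>] by blast
    show "prob (A \<inter> B) = prob A * prob B"
      unfolding 1(3) 2(3) by (rule prob_past_future_finite[OF s 1(1,2) 2(1,2)])
  qed
  moreover have "Int_stable G1" "Int_stable G2"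
    unfolding G1_def G2_def by (intro Int_stable_vimage Int_stable_prod_algebra)+
  ultimately have "indep_set (sigma_sets (space M) G1) (sigma_sets (space M) G2)" by (rule indep_set_sigma_sets)
  moreover have "{past s -` A \<inter> space M |A. A \<in> sets (past_space s)} = sigma_sets (space M) G1"
    unfolding G1_def sets_PiM
    by (rule sigma_sets_vimage_commute) (use measurable_space[OF measurable_past] in \<open>auto simp: space_PiM\<close>)
  moreover have "{future s -` A \<inter> space M |A. A \<in> sets (future_space s)} = sigma_sets (space M) G2"
    unfolding G2_def sets_PiM
    by (rule sigma_sets_vimage_commute) (use measurable_space[OF measurable_future[OF s]] in \<open>auto simp: space_PiM\<close>)
  ultimately show ?thesis
    unfolding indep_var_eq using measurable_past measurable_future[OF s]
    by (simp add: sigma_sets_sigma_sets_eq[of _ "space M"] ev order_trans[OF ev(1) sets.space_closed] order_trans[OF ev(2) sets.space_closed] sigma_sets_into_sp)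
qed

end

section \<open>Transition operators\<close>

definition cut :: "real \<Rightarrow> real \<Rightarrow> nat \<Rightarrow> nat \<Rightarrow> real" where
  "cut s t m j = s + (t - s) * real j / real (Suc m)"

text \<open>
  The flow over \<open>{s<..t}\<close> as a limit of functions of finitely many counts: in the stage \<open>m\<close>,
  the interval is cut into \<open>m + 1\<close> cells, and each cell contributes at most one ring.
\<close>

definition ring_seq :: "clock set \<Rightarrow> (clock \<times> nat \<times> nat \<Rightarrow> nat) \<Rightarrow> nat \<Rightarrow> clock option list" where
  "ring_seq K c m = map (\<lambda>j. if \<exists>k\<in>K. c (k, m, j) \<noteq> 0 then Some (SOME k. k \<in> K \<and> c (k, m, j) \<noteq> 0) else None) [0..<Suc m]"

text \<open>The test \<open>k \<in> seed_clocks\<close> makes every list measurable as a map, also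
  one with entries that are no clocks of the quadrant.\<close>

definition run_seq :: "clock option list \<Rightarrow> config \<Rightarrow> config" where
  "run_seq = fold (\<lambda>oc \<sigma>. case oc of None \<Rightarrow> \<sigma> | Some k \<Rightarrow> if k \<in> seed_clocks then act k \<sigma> else \<sigma>)"

text \<open>The order of the limits matters: for a fixed finite box the cells become fine enough to
  separate all its rings, and only then does the box grow. No single \<open>m\<close> would do for
  all boxes.\<close>

definition Psi :: "clock set \<Rightarrow> (clock \<times> nat \<times> nat \<Rightarrow> nat) \<Rightarrow> config \<Rightarrow> config" where
  "Psi A c \<sigma> = (\<lambda>e\<in>quad_edges. \<exists>m0. \<forall>n\<ge>m0. \<exists>m1. \<forall>m\<ge>m1. run_seq (ring_seq (kbox n n \<inter> A) c m) \<sigma> e)"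

definition cells :: "(clock \<times> nat \<times> nat) set" where
  "cells = {(k, m, j). k \<in> seed_clocks \<and> j \<le> m}"

lemma cut_mono: "s \<le> t \<Longrightarrow> i \<le> j \<Longrightarrow> cut s t m i \<le> cut s t m j"
  unfolding cut_def by (intro add_left_mono divide_right_mono mult_left_mono) auto

lemma cut_0[simp]: "cut s t m 0 = s" and cut_last[simp]: "cut s t m (Suc m) = t"
  by (simp_all add: cut_def del: of_nat_Suc)

lemma finite_gap:
  fixes R :: "real set"
  assumes "finite R"
  shows "\<exists>d>0. \<forall>r\<in>R. \<forall>r'\<in>R. r \<noteq> r' \<longrightarrow> d \<le> \<bar>r - r'\<bar>"
proof -
  define D where "D = (\<lambda>(r, r'). \<bar>r - r'\<bar>) ` {(r, r') \<in> R \<times> R. r \<noteq> r'}"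
  have fin: "finite D" unfolding D_def
    by (intro finite_imageI finite_subset[OF _ finite_cartesian_product[OF assms assms]]) auto
  show ?thesis
  proof (intro exI[of _ "Min (insert 1 D)"] conjI ballI impI)
    show "0 < Min (insert 1 D)" using fin by (auto simp: D_def)
    fix r r' assume "r \<in> R" "r' \<in> R" "r \<noteq> r'"
    then have "\<bar>r - r'\<bar> \<in> D" by (auto simp: D_def)
    then show "Min (insert 1 D) \<le> \<bar>r - r'\<bar>" using fin by (intro Min_le) auto
  qed
qed

lemma ring_seq_cong:
  assumes "\<And>k j. k \<in> K \<Longrightarrow> j \<le> m \<Longrightarrow> c (k, m, j) = c' (k, m, j)"
  shows "ring_seq K c m = ring_seq K c' m"
  unfolding ring_seq_def
proof (rule map_cong[OF refl])
  fix j assume "j \<in> set [0..<Suc m]"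
  then have "j \<le> m" by auto
  then have "k \<in> K \<and> c (k, m, j) \<noteq> 0 \<longleftrightarrow> k \<in> K \<and> c' (k, m, j) \<noteq> 0" for k using assms[of k j] by metis
  then show "(if \<exists>k\<in>K. c (k, m, j) \<noteq> 0 then Some (SOME k. k \<in> K \<and> c (k, m, j) \<noteq> 0) else None) =
    (if \<exists>k\<in>K. c' (k, m, j) \<noteq> 0 then Some (SOME k. k \<in> K \<and> c' (k, m, j) \<noteq> 0) else None)"
    unfolding Bex_def by presburger
qed

lemma Psi_cong:
  assumes "A \<subseteq> seed_clocks" "\<And>x. x \<in> cells \<Longrightarrow> c x = c' x"
  shows "Psi A c \<sigma> = Psi A c' \<sigma>"
proof -
  have "ring_seq (kbox n n \<inter> A) c m = ring_seq (kbox n n \<inter> A) c' m" for n m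
  proof (rule ring_seq_cong)
    fix k j assume "k \<in> kbox n n \<inter> A" "j \<le> m"
    then show "c (k, m, j) = c' (k, m, j)" using assms(1) assms(2)[of "(k, m, j)"] by (simp add: cells_def subset_iff)
  qed
  then show ?thesis by (simp add: Psi_def)
qed

context good_rings
begin

text \<open>Finitely many rings have a smallest gap \<open>d\<close>. Once the cells are shorter
  than \<open>d\<close>, each holds at most one ring, and the counts determine the order of the
  rings, which is all that the evolution uses.\<close>

lemma run_seq_evo:
  assumes K: "finite K" "K \<subseteq> seed_clocks" and st: "0 \<le> s" "s \<le> t"
    and c: "\<And>k m j. k \<in> seed_clocks \<Longrightarrow> c (k, m, j) = card (T k \<inter> {cut s t m j<..cut s t m (Suc j)})"
  shows "\<exists>m1. \<forall>m\<ge>m1. run_seq (ring_seq K c m) \<sigma> = evoI T K {s<..t} \<sigma>"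
proof -
  define R where "R = rings T K {s<..t}"
  have "finite R" unfolding R_def by (rule finite_rings[OF K, of _ t]) auto
  from finite_gap[OF this] obtain d where d: "d > 0" "\<And>r r'. r \<in> R \<Longrightarrow> r' \<in> R \<Longrightarrow> r \<noteq> r' \<Longrightarrow> d \<le> \<bar>r - r'\<bar>" by blast
  obtain m1 :: nat where m1: "(t - s) / d < real m1" using reals_Archimedean2 by blast
  show ?thesis
  proof (intro exI[of _ m1] allI impI)
    fix m assume m: "m1 \<le> m"
    let ?f = "\<lambda>j. if \<exists>k\<in>K. c (k, m, j) \<noteq> 0 then Some (SOME k. k \<in> K \<and> c (k, m, j) \<noteq> 0) else None"
    have len: "cut s t m (Suc j) - cut s t m j < d" for j
    proof -
      have "cut s t m (Suc j) - cut s t m j = (t - s) / real (Suc m)"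
      proof -
        have "(t - s) * real (Suc j) = (t - s) * real j + (t - s)" by (simp add: algebra_simps)
        then show ?thesis by (simp only: cut_def add_divide_distrib)
      qed
      moreover have "(t - s) / d < real (Suc m)" using m1 m by simp
      then have "(t - s) < real (Suc m) * d" using d(1) by (simp add: pos_divide_less_eq)
      ultimately show ?thesis by (simp add: pos_divide_less_eq mult.commute)
    qed
    have "run_seq (map ?f [0..<j]) \<sigma> = evoI T K {s<..cut s t m j} \<sigma>" if "j \<le> Suc m" for j
      using that
    proof (induction j)
      case 0
      then show ?case by (simp add: run_seq_def rings_def)
    next
      case (Suc j)
      define ce where "ce = {cut s t m j<..cut s t m (Suc j)}"
      have le: "s \<le> cut s t m j" "cut s t m j \<le> cut s t m (Suc j)" "cut s t m (Suc j) \<le> t"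
        using cut_mono[OF st(2), of 0 j m] cut_mono[OF st(2), of j "Suc j" m] cut_mono[OF st(2), of "Suc j" "Suc m" m] Suc.prems by auto
      have ceR: "rings T K ce \<subseteq> R" using le by (auto simp: rings_def R_def ce_def)
      have U: "{s<..cut s t m (Suc j)} = {s<..cut s t m j} \<union> ce" using le by (auto simp: ce_def)
      have "evoI T K {s<..cut s t m (Suc j)} \<sigma> = evoI T K ce (evoI T K {s<..cut s t m j} \<sigma>)"
        unfolding U by (rule evoI_Un[OF K, of _ t]) (use st le in \<open>auto simp: ce_def\<close>)
      moreover have "(case ?f j of None \<Rightarrow> \<sigma>' | Some k \<Rightarrow> if k \<in> seed_clocks then act k \<sigma>' else \<sigma>') = evoI T K ce \<sigma>'" for \<sigma>'
      proof (cases "\<exists>k\<in>K. c (k, m, j) \<noteq> 0")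
        case True
        define k where "k = (SOME k. k \<in> K \<and> c (k, m, j) \<noteq> 0)"
        have k: "k \<in> K" "c (k, m, j) \<noteq> 0" using True someI_ex[of "\<lambda>k. k \<in> K \<and> c (k, m, j) \<noteq> 0"] unfolding k_def by blast+
        then have ks: "k \<in> seed_clocks" using K by blast
        then obtain r where r: "r \<in> T k" "r \<in> ce" using k c[OF ks] unfolding ce_def by (metis card.empty disjoint_iff)
        have "rings T K ce = {r}"
        proof (intro equalityI subsetI)
          fix r' assume r': "r' \<in> rings T K ce"
          have "r \<in> rings T K ce" using r k by (auto simp: rings_def)
          moreover have "\<bar>r - r'\<bar> < d" using len[of j] r r' by (auto simp: ce_def rings_def)
          ultimately show "r' \<in> {r}" using d(2)[of r r'] ceR r' by force
        qed (use r k in \<open>auto simp: rings_def\<close>)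
        moreover have "?f j = Some k" using True by (simp only: k_def if_True)
        ultimately show ?thesis using ks act_at_ring[OF K(2) k(1) r(1)] by (simp only: evo_single option.case if_True)
      next
        case False
        have "T k \<inter> ce = {}" if "k \<in> K" for k
        proof -
          have "finite (T k \<inter> ce)"
            by (rule finite_subset[OF _ fin[of k t]]) (use that K st le in \<open>auto simp: ce_def\<close>)
          moreover have "card (T k \<inter> ce) = 0" using False that c[of k m j] K unfolding ce_def by force
          ultimately show ?thesis by simp
        qed
        then have "rings T K ce = {}" unfolding rings_def by blast
        then show ?thesis using False by simp
      qed
      ultimately show ?case using Suc by (simp add: run_seq_def)
    qed
    from this[of "Suc m"] show "run_seq (ring_seq K c m) \<sigma> = evoI T K {s<..t} \<sigma>"
      unfolding ring_seq_def by simp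
  qed
qed

lemma Psi_flow:
  assumes A: "A \<subseteq> seed_clocks" and st: "0 \<le> s" "s \<le> t"
    and c: "\<And>k m j. k \<in> seed_clocks \<Longrightarrow> j \<le> m \<Longrightarrow> c (k, m, j) = card (T k \<inter> {cut s t m j<..cut s t m (Suc j)})"
  shows "Psi A c \<sigma> = flow T A {s<..t} \<sigma>"
proof -
  define c' where "c' = (\<lambda>(k, m, j). card (T k \<inter> {cut s t m j<..cut s t m (Suc j)}))"
  have "Psi A c \<sigma> = Psi A c' \<sigma>" by (rule Psi_cong[OF A]) (use c in \<open>auto simp: cells_def c'_def\<close>)
  moreover have "(\<exists>m1. \<forall>m\<ge>m1. run_seq (ring_seq (kbox n n \<inter> A) c' m) \<sigma> e) = evoI T (kbox n n \<inter> A) {s<..t} \<sigma> e" for n e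
  proof -
    have "finite (kbox n n \<inter> A)" "kbox n n \<inter> A \<subseteq> seed_clocks" using finite_kbox A by auto
    from run_seq_evo[OF this st, of c' \<sigma>]
    obtain m1 where "\<And>m. m \<ge> m1 \<Longrightarrow> run_seq (ring_seq (kbox n n \<inter> A) c' m) \<sigma> = evoI T (kbox n n \<inter> A) {s<..t} \<sigma>"
      by (auto simp: c'_def)
    then show ?thesis by (intro ex_forall_ge_const[of m1]) simp
  qed
  ultimately show ?thesis by (simp add: Psi_def flow_def)
qed

end

section \<open>Measurability of the flow in the counts and the configuration\<close>

lemma space_config: "space config_space = extensional quad_edges"
  by (auto simp: config_space_def space_PiM PiE_def)

lemma measurable_config_component[measurable]: "e \<in> quad_edges \<Longrightarrow> (\<lambda>\<sigma>. \<sigma> e) \<in> measurable config_space (count_space UNIV)"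
  unfolding config_space_def by (rule measurable_component_singleton)

lemma measurable_into_config:
  assumes "\<And>e. e \<in> quad_edges \<Longrightarrow> (\<lambda>x. f x e) \<in> measurable N (count_space UNIV)" "\<And>x. x \<in> space N \<Longrightarrow> f x \<in> extensional quad_edges"
  shows "f \<in> measurable N config_space"
  unfolding config_space_def
  by (rule measurable_PiM_single'[of quad_edges "\<lambda>e x. f x e" N "\<lambda>_. count_space UNIV"])
    (use assms in \<open>auto simp: PiE_def\<close>)

lemma measurable_config_finite_dep:
  assumes "finite J" "\<And>\<sigma> \<sigma>'. (\<And>e. e \<in> J \<Longrightarrow> e \<in> quad_edges \<Longrightarrow> \<sigma> e = \<sigma>' e) \<Longrightarrow>
      \<sigma> \<in> extensional quad_edges \<Longrightarrow> \<sigma>' \<in> extensional quad_edges \<Longrightarrow> f \<sigma> = f \<sigma>'"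
    "\<And>\<sigma>. \<sigma> \<in> extensional quad_edges \<Longrightarrow> f \<sigma> \<in> space N"
  shows "f \<in> measurable config_space N"
proof -
  have sp: "space (\<Pi>\<^sub>M e\<in>quad_edges. count_space (UNIV :: bool set)) = extensional quad_edges"
    using space_config by (simp only: config_space_def)
  show ?thesis
    unfolding config_space_def
  proof (rule measurable_PiM_finite_dep[of "J \<inter> quad_edges"])
    fix z z' assume a: "z \<in> space (\<Pi>\<^sub>M e\<in>quad_edges. count_space (UNIV :: bool set))" "z' \<in> space (\<Pi>\<^sub>M e\<in>quad_edges. count_space (UNIV :: bool set))"
      "\<And>j. j \<in> J \<inter> quad_edges \<Longrightarrow> z j = z' j"
    show "f z = f z'"
      by (rule assms(2)) (use a in \<open>simp_all only: sp Int_iff\<close>)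
  next
    fix z assume "z \<in> space (\<Pi>\<^sub>M e\<in>quad_edges. count_space (UNIV :: bool set))"
    then show "f z \<in> space N" by (intro assms(3)) (simp only: sp)
  qed (use assms(1) in simp_all)
qed

lemma measurable_act:
  assumes k: "k \<in> seed_clocks"
  shows "act k \<in> measurable config_space config_space"
proof (rule measurable_into_config)
  fix e assume e: "e \<in> quad_edges"
  obtain x y p where k': "k = ((x, y), p)" by (metis surj_pair)
  obtain N0 where N0: "incol N0 e" using incol_bound by blast
  define N where "N = max N0 x"
  have N: "incol N e" using N0 by (cases e) (auto simp: N_def)
  define H where "H = max (row e) (Suc y)"
  show "(\<lambda>\<sigma>. act k \<sigma> e) \<in> measurable config_space (count_space UNIV)"
  proof (rule measurable_config_finite_dep[OF finite_incol_rows[of N H]])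
    fix \<sigma> \<sigma>' :: config assume "\<And>e. e \<in> {e. incol N e \<and> row e \<le> H} \<Longrightarrow> e \<in> quad_edges \<Longrightarrow> \<sigma> e = \<sigma>' e"
    then have "agree N {..H} \<sigma> \<sigma>'" by (auto simp: agree_def)
    moreover have "{y - 1, y, Suc y} \<subseteq> {..H}" "x \<le> N" by (auto simp: N_def H_def)
    ultimately have "agree N {..H} (act k \<sigma>) (act k \<sigma>')"
      unfolding k' using act_agree k[unfolded k'] by blast
    then show "act k \<sigma> e = act k \<sigma>' e" using e N by (auto simp: agree_def H_def)
  qed auto
qed (use act_ext[OF k] in \<open>auto simp: space_config\<close>)

lemma measurable_run_seq: "run_seq l \<in> measurable config_space config_space"
proof (induction l rule: rev_induct)
  case (snoc oc l)
  have "(\<lambda>\<sigma>. case oc of None \<Rightarrow> \<sigma> | Some k \<Rightarrow> if k \<in> seed_clocks then act k \<sigma> else \<sigma>) \<in> measurable config_space config_space"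
  proof (cases oc)
    case (Some k)
    then show ?thesis using measurable_act[of k] by (cases "k \<in> seed_clocks") simp_all
  qed simp
  note step = this
  have eq: "run_seq (l @ [oc]) = (\<lambda>\<sigma>. (\<lambda>\<sigma>. case oc of None \<Rightarrow> \<sigma> | Some k \<Rightarrow> if k \<in> seed_clocks then act k \<sigma> else \<sigma>) (run_seq l \<sigma>))"
    unfolding run_seq_def by (simp add: fun_eq_iff)
  show ?case unfolding eq by (rule measurable_compose[OF snoc step])
qed (simp add: run_seq_def)

abbreviation "cell_space \<equiv> \<Pi>\<^sub>M j\<in>cells. count_space (UNIV :: nat set)"

lemma measurable_ring_seq:
  assumes "finite K" "K \<subseteq> seed_clocks"
  shows "(\<lambda>c. ring_seq K c m) \<in> measurable cell_space (count_space UNIV)"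
proof (rule measurable_PiM_finite_dep[of "K \<times> {m} \<times> {..m}"])
  show "K \<times> {m} \<times> {..m} \<subseteq> cells" using assms by (auto simp: cells_def)
  fix c c' :: "clock \<times> nat \<times> nat \<Rightarrow> nat" assume "\<And>j. j \<in> K \<times> {m} \<times> {..m} \<Longrightarrow> c j = c' j"
  then show "ring_seq K c m = ring_seq K c' m" by (intro ring_seq_cong) simp
qed (use assms in auto)

text \<open>The list of rings has countably many possible values, so it may be fixed; for a fixed
  list the map is a composition of measurable jumps, and eventual values are countable
  operations.\<close>

lemma measurable_Psi:
  assumes A: "A \<subseteq> seed_clocks"
  shows "(\<lambda>x. Psi A (fst x) (snd x)) \<in> measurable (cell_space \<Otimes>\<^sub>M config_space) config_space"
proof (rule measurable_into_config)
  fix e assume e: "e \<in> quad_edges"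
  have [measurable]: "Measurable.pred (cell_space \<Otimes>\<^sub>M config_space) (\<lambda>x. run_seq (ring_seq (kbox n n \<inter> A) (fst x) m) (snd x) e)" for n m
  proof (rule measurable_compose_countable[of "\<lambda>l x. run_seq l (snd x) e"])
    show "(\<lambda>x. run_seq l (snd x) e) \<in> measurable (cell_space \<Otimes>\<^sub>M config_space) (count_space UNIV)" for l
      using measurable_compose[OF measurable_compose[OF measurable_snd measurable_run_seq] measurable_config_component[OF e]] .
    show "(\<lambda>x. ring_seq (kbox n n \<inter> A) (fst x) m) \<in> measurable (cell_space \<Otimes>\<^sub>M config_space) (count_space UNIV)"
      by (rule measurable_compose[OF measurable_fst measurable_ring_seq]) (use finite_kbox A in auto)
  qed
  have "Measurable.pred (cell_space \<Otimes>\<^sub>M config_space) (\<lambda>x. \<exists>m0. \<forall>n\<ge>m0. \<exists>m1. \<forall>m\<ge>m1. run_seq (ring_seq (kbox n n \<inter> A) (fst x) m) (snd x) e)"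
    by measurable
  then show "(\<lambda>x. Psi A (fst x) (snd x) e) \<in> measurable (cell_space \<Otimes>\<^sub>M config_space) (count_space UNIV)"
    using e by (simp add: Psi_def)
qed (auto simp: Psi_def)

lemma regular_sets: "regular_configurations \<in> sets config_space"
proof -
  have vt: "Measurable.pred config_space (\<lambda>\<sigma>. P (vertex_type \<sigma> (x, y)))" for x y P
  proof (rule measurable_config_finite_dep[of "{Ver x (y - 1), Hor x y, Ver x y, Hor (x + 1) y}"])
    fix \<sigma> \<sigma>' :: config
    assume eq: "\<And>e. e \<in> {Ver x (y - 1), Hor x y, Ver x y, Hor (x + 1) y} \<Longrightarrow> e \<in> quad_edges \<Longrightarrow> \<sigma> e = \<sigma>' e"
      and ext: "\<sigma> \<in> extensional quad_edges" "\<sigma>' \<in> extensional quad_edges"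
    have "\<sigma> e = \<sigma>' e" if "e \<in> {Ver x (y - 1), Hor x y, Ver x y, Hor (x + 1) y}" for e
      using eq[OF that] ext by (cases "e \<in> quad_edges") (auto simp: extensional_def)
    then show "P (vertex_type \<sigma> (x, y)) = P (vertex_type \<sigma>' (x, y))" by simp
  qed simp_all
  have eq0: "{\<sigma> \<in> space config_space. vertex_type \<sigma> (x, y) = (0, 0, 0, 0)} \<in> sets config_space"
    and eq1: "{\<sigma> \<in> space config_space. vertex_type \<sigma> (x, y) = (1, 1, 1, 1)} \<in> sets config_space"
    and cons: "{\<sigma> \<in> space config_space. case vertex_type \<sigma> (x, y) of (i1, j1, i2, j2) \<Rightarrow> i1 + j1 = i2 + j2} \<in> sets config_space" for x y
    by (rule predE[OF vt])+
  have "regular_configurations = {\<sigma> \<in> space config_space. (\<forall>x. \<forall>y\<ge>1. case vertex_type \<sigma> (x, y) of (i1, j1, i2, j2) \<Rightarrow> i1 + j1 = i2 + j2) \<and>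
     (\<forall>N. \<exists>L. (\<forall>x\<le>N. \<forall>y\<ge>L. vertex_type \<sigma> (x, y) = (0, 0, 0, 0)) \<or> (\<forall>x\<le>N. \<forall>y\<ge>L. vertex_type \<sigma> (x, y) = (1, 1, 1, 1)))}"
    unfolding set_eq_iff regular_iff configurations_def triv_def space_config mem_Collect_eq
    by (intro allI) (rule iffI; elim conjE; intro conjI; assumption)
  also have "\<dots> \<in> sets config_space"
    by (intro sets.sets_Collect_conj sets.sets_Collect_countable_All sets.sets_Collect_countable_Ex sets.sets_Collect_disj
        sets.sets_Collect_imp sets.sets_Collect_const eq0 eq1 cons)
  finally show ?thesis .
qed

lemma regular_space: "\<sigma> \<in> regular_configurations \<Longrightarrow> \<sigma> \<in> space config_space"
  by (auto simp: regular_iff configurations_def space_config)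

section \<open>The random flow, its kernels and their composition\<close>

context clock_process
begin

definition counts :: "real \<Rightarrow> real \<Rightarrow> 'w \<Rightarrow> clock \<times> nat \<times> nat \<Rightarrow> nat" where
  "counts s t \<omega> = (\<lambda>(k, m, j)\<in>cells. cnt T k (cut s t m j) (cut s t m (Suc j)) \<omega>)"

text \<open>Defined through the counts for every outcome, so measurability is unconditional; it
  coincides with the flow on the almost sure event of good rings.\<close>

definition Phi :: "clock set \<Rightarrow> real \<Rightarrow> real \<Rightarrow> 'w \<Rightarrow> config \<Rightarrow> config" where
  "Phi A s t \<omega> \<sigma> = Psi A (counts s t \<omega>) \<sigma>"

lemma Phi_flow:
  assumes "good_rings (\<lambda>k. T k \<omega>)" "A \<subseteq> seed_clocks" "0 \<le> s" "s \<le> t"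
  shows "Phi A s t \<omega> \<sigma> = flow (\<lambda>k. T k \<omega>) A {s<..t} \<sigma>"
  unfolding Phi_def by (rule good_rings.Psi_flow[OF assms]) (auto simp: counts_def cells_def cnt_def)

lemma cut_ge: "0 \<le> s \<Longrightarrow> s \<le> t \<Longrightarrow> 0 \<le> cut s t m j" and cut_ge': "s \<le> t \<Longrightarrow> s \<le> cut s t m j"
  using cut_mono[of s t 0 j m] by auto

lemma cut_le: "s \<le> t \<Longrightarrow> j \<le> Suc m \<Longrightarrow> cut s t m j \<le> t"
  using cut_mono[of s t j "Suc m" m] by auto

lemma measurable_counts:
  assumes "0 \<le> s" "s \<le> t"
  shows "counts s t \<in> measurable M cell_space"
proof -
  have "counts s t = (\<lambda>\<omega>. \<lambda>x\<in>cells. cnt T (fst x) (cut s t (fst (snd x)) (snd (snd x))) (cut s t (fst (snd x)) (Suc (snd (snd x)))) \<omega>)"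
    by (auto simp: counts_def fun_eq_iff)
  also have "\<dots> \<in> measurable M cell_space"
    by (intro measurable_restrict measurable_cnt) (use assms cut_ge cut_mono in \<open>auto simp: cells_def\<close>)
  finally show ?thesis .
qed

lemma measurable_Phi_pair:
  assumes "A \<subseteq> seed_clocks" "0 \<le> s" "s \<le> t"
  shows "(\<lambda>x. Phi A s t (snd x) (fst x)) \<in> measurable (config_space \<Otimes>\<^sub>M M) config_space"
proof -
  have "(\<lambda>x. (counts s t (snd x), fst x)) \<in> measurable (config_space \<Otimes>\<^sub>M M) (cell_space \<Otimes>\<^sub>M config_space)"
    using measurable_counts[OF assms(2,3)] by measurable
  from measurable_compose[OF this measurable_Psi[OF assms(1)]] show ?thesis by (simp add: Phi_def)
qed

lemma measurable_Phi:
  assumes "A \<subseteq> seed_clocks" "0 \<le> s" "s \<le> t" "\<sigma> \<in> space config_space"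
  shows "(\<lambda>\<omega>. Phi A s t \<omega> \<sigma>) \<in> measurable M config_space"
  using measurable_compose[OF measurable_Pair1'[OF assms(4), of M] measurable_Phi_pair[OF assms(1-3)]] by simp

definition Q :: "clock set \<Rightarrow> real \<Rightarrow> real \<Rightarrow> config \<Rightarrow> config measure" where
  "Q A s t \<sigma> = distr M config_space (\<lambda>\<omega>. Phi A s t \<omega> \<sigma>)"

lemma measurable_Q:
  assumes "A \<subseteq> seed_clocks" "0 \<le> s" "s \<le> t"
  shows "Q A s t \<in> measurable config_space (prob_algebra config_space)"
  unfolding Q_def
proof (rule measurable_distr_prob_space2)
  show "(\<lambda>x. M) \<in> measurable config_space (prob_algebra M)"
    by (rule measurable_const) (simp add: space_prob_algebra prob_space_axioms)
  show "(\<lambda>(x, y). Phi A s t y x) \<in> measurable (config_space \<Otimes>\<^sub>M M) config_space"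
    using measurable_Phi_pair[OF assms] by (simp add: case_prod_beta)
qed

text \<open>Recovers the counts in cells from cumulative counts, whose starting time cancels; hence
  \<open>z\<close> may be \<open>past s\<close> as well as \<open>future s\<close>. The truncated
  subtraction is harmless as cumulative counts increase.\<close>

definition diff_counts :: "real \<Rightarrow> real \<Rightarrow> (clock \<times> real \<Rightarrow> nat) \<Rightarrow> clock \<times> nat \<times> nat \<Rightarrow> nat" where
  "diff_counts s t z = (\<lambda>x\<in>cells. z (fst x, cut s t (fst (snd x)) (Suc (snd (snd x)))) - z (fst x, cut s t (fst (snd x)) (snd (snd x))))"

lemma measurable_diff_counts:
  assumes "\<And>k m j. (k, m, j) \<in> cells \<Longrightarrow> (k, cut s t m j) \<in> I \<and> (k, cut s t m (Suc j)) \<in> I"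
  shows "diff_counts s t \<in> measurable (\<Pi>\<^sub>M j\<in>I. count_space UNIV) cell_space"
  unfolding diff_counts_def
proof (rule measurable_restrict)
  fix x assume x: "x \<in> cells"
  let ?a = "(fst x, cut s t (fst (snd x)) (Suc (snd (snd x))))" and ?b = "(fst x, cut s t (fst (snd x)) (snd (snd x)))"
  show "(\<lambda>z :: clock \<times> real \<Rightarrow> nat. z ?a - z ?b) \<in> measurable (\<Pi>\<^sub>M j\<in>I. count_space UNIV) (count_space UNIV)"
  proof (rule measurable_PiM_finite_dep[of "{?a, ?b}" I])
    show "finite {?a, ?b}" "{?a, ?b} \<subseteq> I" using x assms[of "fst x" "fst (snd x)" "snd (snd x)"] by auto
    fix z z' :: "clock \<times> real \<Rightarrow> nat" assume "\<And>j. j \<in> {?a, ?b} \<Longrightarrow> z j = z' j"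
    then show "z ?a - z ?b = z' ?a - z' ?b" by (metis insertCI)
  qed auto
qed

lemma counts_past:
  assumes "0 \<le> a" "a \<le> r" "r \<le> s" "\<omega> \<in> space M"
  shows "counts a r \<omega> = diff_counts a r (past s \<omega>)"
proof
  fix x :: "clock \<times> nat \<times> nat"
  obtain k m j where x: "x = (k, m, j)" by (metis surj_pair)
  show "counts a r \<omega> x = diff_counts a r (past s \<omega>) x"
  proof (cases "x \<in> cells")
    case True
    then have k: "k \<in> seed_clocks" "j \<le> m" by (auto simp: x cells_def)
    have c: "0 \<le> cut a r m j" "cut a r m j \<le> cut a r m (Suc j)" "cut a r m (Suc j) \<le> s"
      using cut_ge[of a r m j] cut_mono[of a r j "Suc j" m] cut_le[of a r "Suc j" m] k assms by auto
    have "cnt T k 0 (cut a r m (Suc j)) \<omega> = cnt T k 0 (cut a r m j) \<omega> + cnt T k (cut a r m j) (cut a r m (Suc j)) \<omega>"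
      by (rule cnt_additive[OF k(1) assms(4)]) (use c in auto)
    then show ?thesis using True k c by (simp add: x counts_def diff_counts_def past_def)
  qed (simp add: counts_def diff_counts_def)
qed

lemma counts_future:
  assumes "0 \<le> s" "s \<le> t" "\<omega> \<in> space M"
  shows "counts s t \<omega> = diff_counts s t (future s \<omega>)"
proof
  fix x :: "clock \<times> nat \<times> nat"
  obtain k m j where x: "x = (k, m, j)" by (metis surj_pair)
  show "counts s t \<omega> x = diff_counts s t (future s \<omega>) x"
  proof (cases "x \<in> cells")
    case True
    then have k: "k \<in> seed_clocks" "j \<le> m" by (auto simp: x cells_def)
    have c: "s \<le> cut s t m j" "cut s t m j \<le> cut s t m (Suc j)"
      using cut_ge'[of s t m j] cut_mono[of s t j "Suc j" m] assms by auto
    have "cnt T k s (cut s t m (Suc j)) \<omega> = cnt T k s (cut s t m j) \<omega> + cnt T k (cut s t m j) (cut s t m (Suc j)) \<omega>"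
      by (rule cnt_additive[OF k(1) assms(3)]) (use c assms in auto)
    then show ?thesis using True k c by (simp add: x counts_def diff_counts_def future_def)
  qed (simp add: counts_def diff_counts_def)
qed

lemma measurable_diff_past:
  assumes "0 \<le> a" "a \<le> r" "r \<le> s"
  shows "diff_counts a r \<in> measurable (past_space s) cell_space"
proof (rule measurable_diff_counts)
  fix k m j assume "(k, m, j) \<in> cells"
  then have k: "k \<in> seed_clocks" "j \<le> m" by (auto simp: cells_def)
  show "(k, cut a r m j) \<in> seed_clocks \<times> {0..s} \<and> (k, cut a r m (Suc j)) \<in> seed_clocks \<times> {0..s}"
    using cut_ge[of a r m j] cut_ge[of a r m "Suc j"] cut_le[of a r j m] cut_le[of a r "Suc j" m] k assms by auto
qed

lemma measurable_diff_future:
  assumes "s \<le> t"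
  shows "diff_counts s t \<in> measurable (future_space s) cell_space"
  by (rule measurable_diff_counts) (use cut_ge'[OF assms] in \<open>auto simp: cells_def\<close>)

lemma measurable_Phi_past:
  assumes "A \<subseteq> seed_clocks" "0 \<le> a" "a \<le> r" "r \<le> s" "\<sigma> \<in> space config_space"
  shows "(\<lambda>z. Psi A (diff_counts a r z) \<sigma>) \<in> measurable (past_space s) config_space"
proof -
  have "(\<lambda>z. (diff_counts a r z, \<sigma>)) \<in> measurable (past_space s) (cell_space \<Otimes>\<^sub>M config_space)"
    by (intro measurable_Pair measurable_diff_past measurable_const) (use assms in auto)
  from measurable_compose[OF this measurable_Psi[OF assms(1)]] show ?thesis by simp
qed

text \<open>The joint law of past and future is a product, so the future can be integrated out while
  the past, and with it the state \<open>g (past s \<omega>)\<close>, is held fixed. Both the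
  composition of the kernels and the Markov property are instances.\<close>

lemma markov_core:
  assumes A: "A \<subseteq> seed_clocks" and st: "0 \<le> s" "s \<le> t"
    and g[measurable]: "g \<in> measurable (past_space s) config_space" and H[measurable]: "H \<in> sets (past_space s)" and B[measurable]: "B \<in> sets config_space"
  shows "emeasure M {\<omega> \<in> space M. past s \<omega> \<in> H \<and> Phi A s t \<omega> (g (past s \<omega>)) \<in> B} =
    (\<integral>\<^sup>+\<omega>. indicator H (past s \<omega>) * emeasure (Q A s t (g (past s \<omega>))) B \<partial>M)"
proof -
  note [measurable] = measurable_past[of s] measurable_future[OF st(1)] measurable_diff_future[OF st(2)] measurable_Psi[OF A]
  let ?P = "past_space s" and ?F = "future_space s"
  define D1 where "D1 = distr M ?P (past s)"
  define D2 where "D2 = distr M ?F (future s)"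
  interpret D2: prob_space D2 unfolding D2_def by (rule prob_space_distr) measurable
  have sD[measurable_cong]: "sets D1 = sets ?P" "sets D2 = sets ?F" by (simp_all add: D1_def D2_def)
  have Psi2[measurable]: "(\<lambda>x. Psi A (diff_counts s t (snd x)) (g (fst x))) \<in> measurable (?P \<Otimes>\<^sub>M ?F) config_space"
  proof -
    have "(\<lambda>x. (diff_counts s t (snd x), g (fst x))) \<in> measurable (?P \<Otimes>\<^sub>M ?F) (cell_space \<Otimes>\<^sub>M config_space)" by measurable
    from measurable_compose[OF this measurable_Psi[OF A]] show ?thesis by simp
  qed
  define W where "W = {x \<in> space (?P \<Otimes>\<^sub>M ?F). fst x \<in> H \<and> Psi A (diff_counts s t (snd x)) (g (fst x)) \<in> B}"
  have W[measurable]: "W \<in> sets (?P \<Otimes>\<^sub>M ?F)" unfolding W_def by measurable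
  have pr: "D1 \<Otimes>\<^sub>M D2 = distr M (?P \<Otimes>\<^sub>M ?F) (\<lambda>\<omega>. (past s \<omega>, future s \<omega>))"
    using indep_past_future[OF st(1)] unfolding indep_var_distribution_eq D1_def D2_def by blast
  have ps: "past s \<omega> \<in> space ?P" "future s \<omega> \<in> space ?F" if "\<omega> \<in> space M" for \<omega>
    using that measurable_space[OF measurable_past] measurable_space[OF measurable_future[OF st(1)]] by auto
  have "{\<omega> \<in> space M. past s \<omega> \<in> H \<and> Phi A s t \<omega> (g (past s \<omega>)) \<in> B} = (\<lambda>\<omega>. (past s \<omega>, future s \<omega>)) -` W \<inter> space M"
    using ps by (auto simp: W_def Phi_def counts_future[OF st] space_pair_measure)
  also have "emeasure M \<dots> = emeasure (D1 \<Otimes>\<^sub>M D2) W"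
    unfolding pr by (rule emeasure_distr[symmetric]) measurable
  also have "\<dots> = (\<integral>\<^sup>+p. emeasure D2 (Pair p -` W) \<partial>D1)"
    by (rule D2.emeasure_pair_measure_alt) (simp add: sets_pair_measure_cong[OF sD])
  also have "\<dots> = (\<integral>\<^sup>+\<omega>. emeasure D2 (Pair (past s \<omega>) -` W) \<partial>M)"
    unfolding D1_def
  proof (rule nn_integral_distr[OF measurable_past])
    have "W \<in> sets (?P \<Otimes>\<^sub>M D2)" by (simp add: sets_pair_measure_cong[OF refl sD(2)])
    then have "(\<lambda>p. emeasure D2 (Pair p -` W)) \<in> borel_measurable ?P" by (rule D2.measurable_emeasure_Pair)
    then show "(\<lambda>p. emeasure D2 (Pair p -` W)) \<in> borel_measurable (distr M ?P (past s))" by simp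
  qed
  also have "\<dots> = (\<integral>\<^sup>+\<omega>. indicator H (past s \<omega>) * emeasure (Q A s t (g (past s \<omega>))) B \<partial>M)"
  proof (rule nn_integral_cong)
    fix \<omega> assume \<omega>: "\<omega> \<in> space M"
    have gs: "g (past s \<omega>) \<in> space config_space" using measurable_space[OF g ps(1)[OF \<omega>]] .
    have "emeasure D2 (Pair (past s \<omega>) -` W) = emeasure M (future s -` (Pair (past s \<omega>) -` W) \<inter> space M)"
      unfolding D2_def by (rule emeasure_distr) (use sets_Pair1[OF W] in measurable)
    also have "future s -` (Pair (past s \<omega>) -` W) \<inter> space M = (if past s \<omega> \<in> H then {\<omega>' \<in> space M. Phi A s t \<omega>' (g (past s \<omega>)) \<in> B} else {})"
      using ps \<omega> by (auto simp: W_def Phi_def counts_future[OF st] space_pair_measure)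
    also have "emeasure M \<dots> = indicator H (past s \<omega>) * emeasure (Q A s t (g (past s \<omega>))) B"
      unfolding Q_def using measurable_Phi[OF A st gs] by (auto simp: emeasure_distr vimage_def Int_def conj_commute)
    finally show "emeasure D2 (Pair (past s \<omega>) -` W) = indicator H (past s \<omega>) * emeasure (Q A s t (g (past s \<omega>))) B" .
  qed
  finally show ?thesis .
qed

text \<open>\<open>markov_core\<close> with \<open>g\<close> the state at time \<open>s\<close> and
  the trivial event of the past. The flow property is an assumption because it comes from different
  sources: regular configurations for all clocks, arbitrary ones for finite
  \<open>A\<close>.\<close>

lemma chapman_kolmogorov:
  assumes A: "A \<subseteq> seed_clocks" and rst: "0 \<le> r" "r \<le> s" "s \<le> t" and \<sigma>: "\<sigma> \<in> space config_space"
    and fl: "AE \<omega> in M. Phi A s t \<omega> (Phi A r s \<omega> \<sigma>) = Phi A r t \<omega> \<sigma>"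
  shows "Q A r s \<sigma> \<bind> Q A s t = Q A r t \<sigma>"
proof -
  have s0: "0 \<le> s" and rt: "r \<le> t" using rst by auto
  note mQ = measurable_Q[OF A s0 rst(3)]
  have Qr: "Q A r s \<sigma> \<in> space (prob_algebra config_space)"
    using measurable_space[OF measurable_Q[OF A rst(1,2)] \<sigma>] .
  show ?thesis
  proof (rule measure_eqI)
    have ne: "space (Q A r s \<sigma>) \<noteq> {}" using \<sigma> by (auto simp: Q_def)
    have sc: "sets (Q A r s \<sigma>) = sets config_space" by (simp add: Q_def)
    have m': "Q A s t \<in> measurable (Q A r s \<sigma>) (subprob_algebra config_space)"
      using measurable_prob_algebraD[OF mQ] measurable_cong_sets[OF sc refl] by blast
    show ss: "sets (Q A r s \<sigma> \<bind> Q A s t) = sets (Q A r t \<sigma>)"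
      using sets_bind_measurable[OF m' ne] by (simp add: Q_def)
    fix B assume "B \<in> sets (Q A r s \<sigma> \<bind> Q A s t)"
    then have B[measurable]: "B \<in> sets config_space" unfolding ss by (simp add: Q_def)
    let ?g = "\<lambda>z. Psi A (diff_counts r s z) \<sigma>"
    have g: "?g \<in> measurable (past_space s) config_space"
      by (rule measurable_Phi_past) (use A rst \<sigma> in auto)
    have gP: "?g (past s \<omega>) = Phi A r s \<omega> \<sigma>" if "\<omega> \<in> space M" for \<omega>
      using counts_past[OF rst(1,2) order_refl that] by (simp add: Phi_def)
    have "emeasure (Q A r s \<sigma> \<bind> Q A s t) B = (\<integral>\<^sup>+\<sigma>'. emeasure (Q A s t \<sigma>') B \<partial>Q A r s \<sigma>)"
      by (rule emeasure_bind_prob_algebra[OF Qr mQ B])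
    also have "\<dots> = (\<integral>\<^sup>+\<omega>. emeasure (Q A s t (Phi A r s \<omega> \<sigma>)) B \<partial>M)"
      unfolding Q_def[of A r s]
      by (rule nn_integral_distr[OF measurable_Phi[OF A rst(1,2) \<sigma>]])
        (simp add: measurable_emeasure_kernel[OF measurable_prob_algebraD[OF mQ] B])
    also have "\<dots> = (\<integral>\<^sup>+\<omega>. indicator (space (past_space s)) (past s \<omega>) * emeasure (Q A s t (?g (past s \<omega>))) B \<partial>M)"
      using measurable_space[OF measurable_past] by (intro nn_integral_cong) (simp add: gP)
    also have "\<dots> = emeasure M {\<omega> \<in> space M. past s \<omega> \<in> space (past_space s) \<and> Phi A s t \<omega> (?g (past s \<omega>)) \<in> B}"
      by (rule markov_core[symmetric, OF A s0 rst(3) g _ B]) auto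
    also have "\<dots> = emeasure M ((\<lambda>\<omega>. Phi A s t \<omega> (Phi A r s \<omega> \<sigma>)) -` B \<inter> space M)"
      using measurable_space[OF measurable_past] by (intro arg_cong[where f = "emeasure M"]) (auto simp: gP)
    also have "\<dots> = emeasure M ((\<lambda>\<omega>. Phi A r t \<omega> \<sigma>) -` B \<inter> space M)"
    proof (rule emeasure_eq_AE)
      show "AE \<omega> in M. (\<omega> \<in> (\<lambda>\<omega>. Phi A s t \<omega> (Phi A r s \<omega> \<sigma>)) -` B \<inter> space M) = (\<omega> \<in> (\<lambda>\<omega>. Phi A r t \<omega> \<sigma>) -` B \<inter> space M)"
        using fl by eventually_elim auto
      have "(\<lambda>\<omega>. (Phi A r s \<omega> \<sigma>, \<omega>)) \<in> measurable M (config_space \<Otimes>\<^sub>M M)"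
        using measurable_Phi[OF A rst(1,2) \<sigma>] by measurable
      from measurable_sets[OF measurable_compose[OF this measurable_Phi_pair[OF A s0 rst(3)]] B]
      show "(\<lambda>\<omega>. Phi A s t \<omega> (Phi A r s \<omega> \<sigma>)) -` B \<inter> space M \<in> events" by simp
      show "(\<lambda>\<omega>. Phi A r t \<omega> \<sigma>) -` B \<inter> space M \<in> events"
        by (rule measurable_sets[OF measurable_Phi[OF A rst(1) rt \<sigma>] B])
    qed
    also have "\<dots> = emeasure (Q A r t \<sigma>) B"
      unfolding Q_def by (rule emeasure_distr[symmetric, OF measurable_Phi[OF A rst(1) rt \<sigma>] B])
    finally show "emeasure (Q A r s \<sigma> \<bind> Q A s t) B = emeasure (Q A r t \<sigma>) B" .
  qed
qed

lemma AE_flow_Phi: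
  assumes "\<sigma> \<in> regular_configurations" "0 \<le> r" "r \<le> s" "s \<le> t"
  shows "AE \<omega> in M. Phi seed_clocks s t \<omega> (Phi seed_clocks r s \<omega> \<sigma>) = Phi seed_clocks r t \<omega> \<sigma>"
  using AE_good_rings
proof eventually_elim
  case (elim \<omega>)
  have U: "{r<..t} = {r<..s} \<union> {s<..t}" "{r<..s} \<subseteq> {0<..t}" "{s<..t} \<subseteq> {0<..t}" using assms by auto
  then show ?case
    using good_rings.flow_Un[OF elim assms(1) order_refl, of "{r<..s}" t "{s<..t}"] assms
    by (simp add: Phi_flow[OF elim order_refl])
qed

lemma AE_flow_Phi_finite:
  assumes "finite A" "A \<subseteq> seed_clocks" "\<sigma> \<in> space config_space" "0 \<le> r" "r \<le> s" "s \<le> t"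
  shows "AE \<omega> in M. Phi A s t \<omega> (Phi A r s \<omega> \<sigma>) = Phi A r t \<omega> \<sigma>"
  using AE_good_rings
proof eventually_elim
  case (elim \<omega>)
  have U: "{r<..t} = {r<..s} \<union> {s<..t}" "{r<..s} \<subseteq> {0<..t}" "{s<..t} \<subseteq> {0<..t}" using assms by auto
  then show ?case
    using good_rings.flow_Un_finite[OF elim assms(1,2), of \<sigma> "{r<..s}" t "{s<..t}"] assms
    by (simp add: Phi_flow[OF elim assms(2)] space_config)
qed

lemma transition_functions_Q: "transition_functions (Q seed_clocks)"
  unfolding transition_functions_def
proof (intro conjI allI impI ballI)
  fix s t :: real assume "0 \<le> s \<and> s \<le> t"
  then show "Q seed_clocks s t \<in> measurable config_space (prob_algebra config_space)"
    by (intro measurable_Q) auto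
next
  fix s t :: real and \<sigma> assume \<sigma>: "\<sigma> \<in> regular_configurations" and st: "0 \<le> s \<and> s \<le> t"
  have "AE \<omega> in M. Phi seed_clocks s t \<omega> \<sigma> \<in> regular_configurations"
    using AE_good_rings
  proof eventually_elim
    case (elim \<omega>)
    show ?case using st by (subst Phi_flow[OF elim]) (auto intro!: good_rings.flow_regular[OF elim \<sigma>, of _ _ t])
  qed
  moreover have "{\<sigma> \<in> space config_space. \<sigma> \<in> regular_configurations} \<in> sets config_space"
    using regular_sets regular_space by (metis (no_types, lifting) Collect_cong Collect_mem_eq)
  ultimately show "AE \<sigma>' in Q seed_clocks s t \<sigma>. \<sigma>' \<in> regular_configurations"
    unfolding Q_def using measurable_Phi[of seed_clocks s t \<sigma>] st regular_space[OF \<sigma>] by (subst AE_distr_iff) auto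
next
  fix s :: real and \<sigma> assume \<sigma>: "\<sigma> \<in> regular_configurations" and s: "0 \<le> s"
  have "AE \<omega> in M. Phi seed_clocks s s \<omega> \<sigma> = \<sigma>"
    using AE_good_rings
  proof eventually_elim
    case (elim \<omega>)
    show ?case using regular_space[OF \<sigma>] s
      by (subst Phi_flow[OF elim]) (auto intro!: good_rings.flow_no_rings[OF elim] simp: space_config)
  qed
  then have "Q seed_clocks s s \<sigma> = distr M config_space (\<lambda>_. \<sigma>)"
    unfolding Q_def using measurable_Phi[of seed_clocks s s \<sigma>] s regular_space[OF \<sigma>] by (intro distr_cong_AE) auto
  then show "Q seed_clocks s s \<sigma> = return config_space \<sigma>"
    using distr_const[OF regular_space[OF \<sigma>]] by simp
next
  fix r s t :: real and \<sigma> assume \<sigma>: "\<sigma> \<in> regular_configurations" and rst: "0 \<le> r \<and> r \<le> s \<and> s \<le> t"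
  show "Q seed_clocks r s \<sigma> \<bind> Q seed_clocks s t = Q seed_clocks r t \<sigma>"
    by (rule chapman_kolmogorov) (use rst \<sigma> AE_flow_Phi regular_space in auto)
qed

end

section \<open>The generator and the Markov property\<close>

text \<open>Dependence on a full rectangle of edges rather than on a finite set: the jumps respect
  rectangles, since they read and change edges of adjacent rows and never look to the right of the
  columns considered.\<close>

definition box_fun :: "nat \<Rightarrow> nat \<Rightarrow> (config \<Rightarrow> 'b) \<Rightarrow> bool" where
  "box_fun N H f \<longleftrightarrow> (\<forall>\<sigma> \<sigma>'. agree N {..H} \<sigma> \<sigma>' \<longrightarrow> f \<sigma> = f \<sigma>')"

lemma box_funD: "box_fun N H f \<Longrightarrow> agree N {..H} \<sigma> \<sigma>' \<Longrightarrow> f \<sigma> = f \<sigma>'"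
  by (simp add: box_fun_def)

lemma box_fun_mono: "box_fun N H f \<Longrightarrow> N \<le> N' \<Longrightarrow> H \<le> H' \<Longrightarrow> box_fun N' H' f"
  unfolding box_fun_def using agree_mono[of N' "{..H'}" _ _ N "{..H}"] by auto

lemma box_fun_finite_range:
  assumes "box_fun N H f"
  shows "finite (range f)"
proof -
  let ?E = "{e. incol N e \<and> row e \<le> H}"
  have "f \<sigma> \<in> (\<lambda>p. f (\<lambda>e. e \<in> ?E \<and> p e)) ` (\<Pi>\<^sub>E e\<in>?E. UNIV)" for \<sigma>
  proof (rule image_eqI[of _ _ "restrict \<sigma> ?E"])
    show "f \<sigma> = f (\<lambda>e. e \<in> ?E \<and> restrict \<sigma> ?E e)"
      by (rule box_funD[OF assms]) (auto simp: agree_def)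
  qed auto
  then have "range f \<subseteq> (\<lambda>p. f (\<lambda>e. e \<in> ?E \<and> p e)) ` (\<Pi>\<^sub>E e\<in>?E. UNIV)" by auto
  then show ?thesis by (rule finite_subset) (intro finite_imageI finite_PiE finite_incol_rows, simp)
qed

lemma box_fun_bounded:
  fixes f :: "config \<Rightarrow> real"
  assumes "box_fun N H f"
  shows "\<exists>B\<ge>0. \<forall>\<sigma>. \<bar>f \<sigma>\<bar> \<le> B"
proof -
  have "finite (abs ` range f)" using box_fun_finite_range[OF assms] by simp
  then have "\<bar>f \<sigma>\<bar> \<le> Max (abs ` range f)" for \<sigma> by (rule Max_ge) auto
  then show ?thesis by (meson abs_ge_zero order_trans)
qed

lemma box_fun_measurable:
  assumes "box_fun N H f" "range f \<subseteq> space X"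
  shows "f \<in> measurable config_space X"
proof (rule measurable_config_finite_dep[OF finite_incol_rows[of N H]])
  fix \<sigma> \<sigma>' :: config assume "\<And>e. e \<in> {e. incol N e \<and> row e \<le> H} \<Longrightarrow> e \<in> quad_edges \<Longrightarrow> \<sigma> e = \<sigma>' e"
  then show "f \<sigma> = f \<sigma>'" by (intro box_funD[OF assms(1)]) (auto simp: agree_def)
qed (use assms in auto)

lemma cylindric_box:
  assumes "cylindric f"
  shows "\<exists>N H. box_fun N H f"
proof -
  obtain E where E: "finite E" "E \<subseteq> quad_edges" "\<And>\<sigma> \<sigma>'. (\<forall>e\<in>E. \<sigma> e = \<sigma>' e) \<Longrightarrow> f \<sigma> = f \<sigma>'"
    using assms unfolding cylindric_def by blast
  obtain n where n: "\<And>e. incol (n e) e" using incol_bound by metis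
  define N where "N = Max (insert 0 (n ` E))"
  define H where "H = Max (insert 0 (row ` E))"
  have "incol N e" if "e \<in> E" for e
  proof -
    have "n e \<le> N" unfolding N_def using E(1) that by (intro Max_ge) auto
    then show ?thesis using n[of e] by (cases e) auto
  qed
  moreover have "row e \<le> H" if "e \<in> E" for e
    unfolding H_def using E(1) that by (intro Max_ge) auto
  ultimately have *: "incol N e \<and> row e \<le> H" if "e \<in> E" for e using that by blast
  have "box_fun N H f"
    unfolding box_fun_def
  proof (intro allI impI E(3) ballI)
    fix \<sigma> \<sigma>' e assume "agree N {..H} \<sigma> \<sigma>'" "e \<in> E"
    then show "\<sigma> e = \<sigma>' e" using * E(2) by (intro agreeD) auto
  qed
  then show ?thesis by blast
qed

lemma act_outside_box:
  assumes "k \<in> seed_clocks" "k \<notin> kbox N (Suc H)"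
  shows "agree N {..H} (act k \<sigma>) \<sigma>"
proof -
  obtain x y p where k: "k = ((x, y), p)" by (metis surj_pair)
  have xy: "N < x \<or> H < y" using assms by (auto simp: k kbox_def)
  have "act k \<sigma> e = \<sigma> e" if "incol N e" "row e \<le> H" for e
    unfolding k by (rule act_unaffected[of _ _ _ N]) (use assms k xy that in auto)
  then show ?thesis by (auto simp: agree_def)
qed

text \<open>A jump at height \<open>H\<close> also reads and changes the row \<open>Suc H\<close>,
  so the agreement must extend one row above the clocks of the box.\<close>

lemma act_agree_box:
  assumes "k \<in> kbox N (Suc H)" "agree N {..Suc H} \<sigma> \<sigma>'"
  shows "agree N {..Suc H} (act k \<sigma>) (act k \<sigma>')"
proof -
  obtain x y p where k: "k = ((x, y), p)" by (metis surj_pair)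
  show ?thesis
    unfolding k by (rule act_agree[OF assms(2)]) (use assms(1) k in \<open>auto simp: kbox_def\<close>)
qed

context good_rings
begin

lemma evo_outside_box:
  assumes "finite A" "K \<subseteq> seed_clocks" "\<And>k. k \<in> K \<inter> kbox N (Suc H) \<Longrightarrow> T k \<inter> A = {}"
  shows "agree N {..H} (evo T K A \<sigma>) \<sigma>"
  using assms(1,3)
proof (induction A rule: finite_linorder_max_induct)
  case (insert b A)
  have ag: "agree N {..H} (evo T K A \<sigma>) \<sigma>" using insert by blast
  show ?case
  proof (cases "\<exists>k\<in>K. b \<in> T k")
    case True
    then obtain k where k: "k \<in> K" "b \<in> T k" by blast
    then have "k \<notin> kbox N (Suc H)" using insert.prems by blast
    then have "agree N {..H} (act k (evo T K A \<sigma>)) (evo T K A \<sigma>)"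
      using k assms(2) by (intro act_outside_box) auto
    then show ?thesis using insert agree_trans[OF _ ag] by (simp add: evo_insert act_at_ring[OF assms(2) k])
  next
    case False
    then show ?thesis using insert ag act_at_no_ring[of K b] by (simp add: evo_insert)
  qed
qed simp

lemma flow_no_box_rings:
  assumes \<sigma>: "\<sigma> \<in> regular_configurations" and I: "I \<subseteq> {0<..t}"
    and none: "\<And>k. k \<in> kbox N (Suc H) \<Longrightarrow> T k \<inter> I = {}"
  shows "agree N {..H} (flow T seed_clocks I \<sigma>) \<sigma>"
proof -
  obtain H' where H': "agree N UNIV (flow T seed_clocks I \<sigma>) (evoI T (kbox N H') I \<sigma>)"
    using flow_agree[OF \<sigma> order_refl, of N t] I finite_kbox kbox_seed by (meson Int_lower1)
  have "I \<subseteq> {..t}" using I by auto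
  then have fin: "finite (rings T (kbox N H') I)" by (rule finite_rings[OF finite_kbox kbox_seed])
  have "agree N {..H} (evoI T (kbox N H') I \<sigma>) \<sigma>"
  proof (rule evo_outside_box[OF fin kbox_seed])
    fix k assume "k \<in> kbox N H' \<inter> kbox N (Suc H)"
    then have "T k \<inter> I = {}" by (intro none) simp
    then show "T k \<inter> rings T (kbox N H') I = {}" unfolding rings_def by blast
  qed
  then show ?thesis using agree_trans agree_mono[OF H', of N "{..H}"] by blast
qed

text \<open>The box is one row higher than the clocks that can change rows up to \<open>H\<close>:
  the single ring may read the row \<open>Suc H\<close>, which must still be as in \<sigma> when it
  happens.\<close>

lemma flow_one_box_ring:
  assumes \<sigma>: "\<sigma> \<in> regular_configurations" and I: "I \<subseteq> {0<..t}"
    and k: "k \<in> kbox N (Suc (Suc H))" "T k \<inter> I = {r}"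
    and none: "\<And>k'. k' \<in> kbox N (Suc (Suc H)) \<Longrightarrow> k' \<noteq> k \<Longrightarrow> T k' \<inter> I = {}"
  shows "agree N {..H} (flow T seed_clocks I \<sigma>) (act k \<sigma>)"
proof -
  define I1 I2 where "I1 = I \<inter> {..<r}" and "I2 = I \<inter> {r<..}"
  have r: "r \<in> I" "r \<in> T k" using k by auto
  have U: "I = (I1 \<union> {r}) \<union> I2" using r by (auto simp: I1_def I2_def)
  have sub: "I1 \<subseteq> {0<..t}" "{r} \<subseteq> {0<..t}" "I1 \<union> {r} \<subseteq> {0<..t}" "I2 \<subseteq> {0<..t}" using I r by (auto simp: I1_def I2_def)
  have empty: "T k' \<inter> I1 = {}" "T k' \<inter> I2 = {}" if "k' \<in> kbox N (Suc (Suc H))" for k'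
  proof -
    have "T k' \<inter> I \<subseteq> {r}" using none[OF that] k(2) by (cases "k' = k") simp_all
    then show "T k' \<inter> I1 = {}" "T k' \<inter> I2 = {}" by (auto simp: I1_def I2_def)
  qed
  have ks: "k \<in> seed_clocks" using k kbox_seed by blast
  define \<sigma>1 where "\<sigma>1 = flow T seed_clocks I1 \<sigma>"
  have r1: "\<sigma>1 \<in> regular_configurations" unfolding \<sigma>1_def by (rule flow_regular[OF \<sigma> order_refl sub(1)])
  have "flow T seed_clocks (I1 \<union> {r}) \<sigma> = flow T seed_clocks {r} \<sigma>1"
    unfolding \<sigma>1_def by (rule flow_Un[OF \<sigma> order_refl sub(1,2)]) (auto simp: I1_def)
  also have "\<dots> = act k \<sigma>1"
    by (rule flow_single[OF ks order_refl r(2)]) (use regular_space[OF r1] space_config in auto)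
  finally have 2: "flow T seed_clocks (I1 \<union> {r}) \<sigma> = act k \<sigma>1" .
  have "flow T seed_clocks I \<sigma> = flow T seed_clocks I2 (act k \<sigma>1)"
  proof -
    have "flow T seed_clocks ((I1 \<union> {r}) \<union> I2) \<sigma> = flow T seed_clocks I2 (flow T seed_clocks (I1 \<union> {r}) \<sigma>)"
      by (rule flow_Un[OF \<sigma> order_refl sub(3,4)]) (auto simp: I1_def I2_def)
    then show ?thesis unfolding 2 using U by simp
  qed
  moreover have "agree N {..Suc H} (flow T seed_clocks I2 (act k \<sigma>1)) (act k \<sigma>1)"
    by (rule flow_no_box_rings[OF act_regular[OF ks r1] sub(4) empty(2)])
  ultimately have a: "agree N {..H} (flow T seed_clocks I \<sigma>) (act k \<sigma>1)"
    using agree_mono[of N "{..Suc H}" _ _ N "{..H}"] by auto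
  have b: "agree N {..Suc H} \<sigma>1 \<sigma>"
    unfolding \<sigma>1_def by (rule flow_no_box_rings[OF \<sigma> sub(1) empty(1)])
  have "agree N {..H} (act k \<sigma>1) (act k \<sigma>)"
  proof (cases "k \<in> kbox N (Suc H)")
    case True
    then show ?thesis using act_agree_box[OF True b] agree_mono[of N "{..Suc H}" _ _ N "{..H}"] by auto
  next
    case False
    have "agree N {..H} \<sigma>1 \<sigma>" using b agree_mono[of N "{..Suc H}" _ _ N "{..H}"] by auto
    then show ?thesis using act_outside_box[OF ks False] agree_trans agree_sym by metis
  qed
  then show ?thesis using a agree_trans by blast
qed

lemma flow_finite_one_ring:
  assumes "finite C" "C \<subseteq> seed_clocks" "k \<in> C" "T k \<inter> I = {r}" "\<sigma> \<in> extensional quad_edges"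
    and none: "\<And>k'. k' \<in> C \<Longrightarrow> k' \<noteq> k \<Longrightarrow> T k' \<inter> I = {}"
  shows "flow T C I \<sigma> = act k \<sigma>"
proof -
  have "rings T C I = {r}" unfolding rings_def using assms(3,4) none by blast
  moreover have "act_at T C r = act k" using assms by (intro act_at_ring) auto
  moreover have "act k \<sigma> \<in> extensional quad_edges" using assms act_ext by blast
  ultimately show ?thesis unfolding flow_finite[OF assms(1,2)] by (simp add: evo_single extensional_restrict)
qed

end

context clock_process
begin

lemma cnt_0_iff:
  assumes "k \<in> seed_clocks" "\<omega> \<in> space M" "0 \<le> s"
  shows "cnt T k s t \<omega> = 0 \<longleftrightarrow> T k \<omega> \<inter> {s<..t} = {}"
  unfolding cnt_def using finite_ring_interval[OF assms] by simp

lemma expectation_box_fun: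
  fixes f :: "config \<Rightarrow> real"
  assumes "box_fun N H f" "A \<subseteq> seed_clocks" "0 \<le> s" "s \<le> t" "\<sigma> \<in> space config_space"
  shows "(\<integral>\<sigma>'. f \<sigma>' \<partial>Q A s t \<sigma>) = expectation (\<lambda>\<omega>. f (Phi A s t \<omega> \<sigma>))"
    "(\<lambda>\<omega>. f (Phi A s t \<omega> \<sigma>)) \<in> borel_measurable M"
proof -
  have f: "f \<in> borel_measurable config_space" by (rule box_fun_measurable[OF assms(1)]) simp
  show "(\<integral>\<sigma>'. f \<sigma>' \<partial>Q A s t \<sigma>) = expectation (\<lambda>\<omega>. f (Phi A s t \<omega> \<sigma>))"
    unfolding Q_def by (rule integral_distr[OF measurable_Phi[OF assms(2-5)] f])
  show "(\<lambda>\<omega>. f (Phi A s t \<omega> \<sigma>)) \<in> borel_measurable M"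
    by (rule measurable_compose[OF measurable_Phi[OF assms(2-5)] f])
qed

text \<open>Infinitely many clocks ring in any interval, but as long as at most one clock of the box
  rings, the value of \<open>f\<close> is determined by it. The error bound is the same for all
  configurations.\<close>

lemma Q_short_time:
  fixes f :: "config \<Rightarrow> real"
  assumes f: "box_fun N H f" and B: "\<And>\<sigma>. \<bar>f \<sigma>\<bar> \<le> B" and \<sigma>: "\<sigma> \<in> regular_configurations" and st: "0 \<le> s" "s \<le> t"
  shows "\<bar>(\<integral>\<sigma>'. f \<sigma>' \<partial>Q seed_clocks s t \<sigma>) - f \<sigma> - (\<Sum>k\<in>kbox N (Suc (Suc H)). lam k s t * (f (act k \<sigma>) - f \<sigma>))\<bar>
    \<le> 3 * B * (\<Sum>k\<in>kbox N (Suc (Suc H)). lam k s t)\<^sup>2"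
  unfolding expectation_box_fun(1)[OF f order_refl st regular_space[OF \<sigma>]]
proof (rule short_time[OF finite_kbox kbox_seed st expectation_box_fun(2)[OF f order_refl st regular_space[OF \<sigma>]] B B B])
  have I: "{s<..t} \<subseteq> {0<..t}" using st by auto
  show "AE \<omega> in M. (\<forall>k\<in>kbox N (Suc (Suc H)). cnt T k s t \<omega> = 0) \<longrightarrow> f (Phi seed_clocks s t \<omega> \<sigma>) = f \<sigma>"
    using AE_good_rings AE_space
  proof eventually_elim
    case (elim \<omega>)
    show ?case
    proof
      assume c: "\<forall>k\<in>kbox N (Suc (Suc H)). cnt T k s t \<omega> = 0"
      have "T k \<omega> \<inter> {s<..t} = {}" if "k \<in> kbox N (Suc (Suc H))" for k
        using bspec[OF c that] cnt_0_iff[OF subsetD[OF kbox_seed that] elim(2) st(1), of t] by simp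
      then have "agree N {..Suc H} (flow (\<lambda>k. T k \<omega>) seed_clocks {s<..t} \<sigma>) \<sigma>"
        by (rule good_rings.flow_no_box_rings[OF elim(1) \<sigma> I])
      then show "f (Phi seed_clocks s t \<omega> \<sigma>) = f \<sigma>"
        unfolding Phi_flow[OF elim(1) order_refl st] using agree_mono[of N "{..Suc H}" _ _ N "{..H}"] by (intro box_funD[OF f]) auto
    qed
  qed
  show "AE \<omega> in M. \<forall>k\<in>kbox N (Suc (Suc H)). (\<forall>k'\<in>kbox N (Suc (Suc H)). cnt T k' s t \<omega> = of_bool (k' = k)) \<longrightarrow>
    f (Phi seed_clocks s t \<omega> \<sigma>) = f (act k \<sigma>)"
    using AE_good_rings AE_space
  proof eventually_elim
    case (elim \<omega>)
    show ?case
    proof (intro ballI impI)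
      fix k assume k: "k \<in> kbox N (Suc (Suc H))" and c: "\<forall>k'\<in>kbox N (Suc (Suc H)). cnt T k' s t \<omega> = of_bool (k' = k)"
      have "card (T k \<omega> \<inter> {s<..t}) = 1" using c k by (simp add: cnt_def)
      then obtain r where r: "T k \<omega> \<inter> {s<..t} = {r}" by (rule card_1_singletonE)
      have "k' \<in> kbox N (Suc (Suc H)) \<Longrightarrow> k' \<noteq> k \<Longrightarrow> T k' \<omega> \<inter> {s<..t} = {}" for k'
        using c cnt_0_iff[OF _ elim(2) st(1), of k' t] kbox_seed by fastforce
      then have "agree N {..H} (flow (\<lambda>k. T k \<omega>) seed_clocks {s<..t} \<sigma>) (act k \<sigma>)"
        by (rule good_rings.flow_one_box_ring[OF elim(1) \<sigma> I k r])
      then show "f (Phi seed_clocks s t \<omega> \<sigma>) = f (act k \<sigma>)"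
        unfolding Phi_flow[OF elim(1) order_refl st] by (rule box_funD[OF f])
    qed
  qed
qed

lemma Q_short_time_finite:
  fixes f :: "config \<Rightarrow> real"
  assumes f: "box_fun N H f" and B: "\<And>\<sigma>. \<bar>f \<sigma>\<bar> \<le> B" and \<sigma>: "\<sigma> \<in> space config_space" and st: "0 \<le> s" "s \<le> t"
    and A: "finite A" "A \<subseteq> seed_clocks"
  shows "\<bar>(\<integral>\<sigma>'. f \<sigma>' \<partial>Q A s t \<sigma>) - f \<sigma> - (\<Sum>k\<in>A. lam k s t * (f (act k \<sigma>) - f \<sigma>))\<bar> \<le> 3 * B * (\<Sum>k\<in>A. lam k s t)\<^sup>2"
  unfolding expectation_box_fun(1)[OF f A(2) st \<sigma>]
proof (rule short_time[OF A st expectation_box_fun(2)[OF f A(2) st \<sigma>] B B B])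
  have ext: "\<sigma> \<in> extensional quad_edges" using \<sigma> by (simp add: space_config)
  show "AE \<omega> in M. (\<forall>k\<in>A. cnt T k s t \<omega> = 0) \<longrightarrow> f (Phi A s t \<omega> \<sigma>) = f \<sigma>"
    using AE_good_rings AE_space
  proof eventually_elim
    case (elim \<omega>)
    show ?case
    proof
      assume c: "\<forall>k\<in>A. cnt T k s t \<omega> = 0"
      have "T k \<omega> \<inter> {s<..t} = {}" if "k \<in> A" for k
        using bspec[OF c that] cnt_0_iff[OF subsetD[OF A(2) that] elim(2) st(1), of t] by simp
      then show "f (Phi A s t \<omega> \<sigma>) = f \<sigma>"
        unfolding Phi_flow[OF elim(1) A(2) st] by (subst good_rings.flow_no_rings[OF elim(1) _ ext]) auto
    qed
  qed
  show "AE \<omega> in M. \<forall>k\<in>A. (\<forall>k'\<in>A. cnt T k' s t \<omega> = of_bool (k' = k)) \<longrightarrow> f (Phi A s t \<omega> \<sigma>) = f (act k \<sigma>)"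
    using AE_good_rings AE_space
  proof eventually_elim
    case (elim \<omega>)
    show ?case
    proof (intro ballI impI)
      fix k assume k: "k \<in> A" and c: "\<forall>k'\<in>A. cnt T k' s t \<omega> = of_bool (k' = k)"
      have "card (T k \<omega> \<inter> {s<..t}) = 1" using c k by (simp add: cnt_def)
      then obtain r where r: "T k \<omega> \<inter> {s<..t} = {r}" by (rule card_1_singletonE)
      have "k' \<in> A \<Longrightarrow> k' \<noteq> k \<Longrightarrow> T k' \<omega> \<inter> {s<..t} = {}" for k'
        using c cnt_0_iff[OF _ elim(2) st(1), of k' t] A(2) by fastforce
      then have "flow (\<lambda>k. T k \<omega>) A {s<..t} \<sigma> = act k \<sigma>"
        by (rule good_rings.flow_finite_one_ring[OF elim(1) A k r ext])
      then show "f (Phi A s t \<omega> \<sigma>) = f (act k \<sigma>)"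
        unfolding Phi_flow[OF elim(1) A(2) st] by simp
    qed
  qed
qed

lemma lam_deriv_right:
  assumes k: "k \<in> seed_clocks" and \<tau>: "0 \<le> \<tau>"
  shows "((\<lambda>h. lam k \<tau> (\<tau> + h) / h) \<longlongrightarrow> \<rho> k \<tau>) (at_right 0)"
proof -
  have "((\<lambda>x. integral {\<tau>..x} (\<rho> k)) has_real_derivative \<rho> k \<tau>) (at \<tau> within {\<tau>..\<tau> + 1})"
    by (rule integral_has_real_derivative) (use \<tau> in \<open>auto intro!: continuous_on_subset[OF cont[OF k]]\<close>)
  then have "((\<lambda>x. lam k \<tau> x / (x - \<tau>)) \<longlongrightarrow> \<rho> k \<tau>) (at_right \<tau>)"
    unfolding has_field_derivative_iff lam_def by (simp add: at_within_Icc_at_right)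
  then show ?thesis
    unfolding filterlim_at_right_to_0[of _ _ \<tau>] by (simp add: add.commute)
qed

lemma generator_limit:
  fixes f :: "config \<Rightarrow> real"
  assumes f: "box_fun N H f" and \<tau>: "0 \<le> \<tau>"
  shows "uniform_limit regular_configurations
          (\<lambda>h \<sigma>. ((\<integral>\<sigma>'. f \<sigma>' \<partial>Q seed_clocks \<tau> (\<tau> + h) \<sigma>) - f \<sigma>) / h)
          (\<lambda>\<sigma>. \<Sum>k\<in>kbox N (Suc (Suc H)). \<rho> k \<tau> * (f (act k \<sigma>) - f \<sigma>)) (at_right 0)"
proof -
  obtain B where B: "B \<ge> 0" "\<And>\<sigma>. \<bar>f \<sigma>\<bar> \<le> B" using box_fun_bounded[OF f] by blast
  let ?K = "kbox N (Suc (Suc H))"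
  define L where "L h = (\<Sum>k\<in>?K. lam k \<tau> (\<tau> + h))" for h
  \<comment> \<open>A bound for the error of the difference quotient that does not mention the
    configuration, which yields the uniform limit.\<close>
  define b where "b h = 3 * B * (L h / h)\<^sup>2 * h + (\<Sum>k\<in>?K. \<bar>lam k \<tau> (\<tau> + h) / h - \<rho> k \<tau>\<bar> * (2 * B))" for h
  have l: "((\<lambda>h. lam k \<tau> (\<tau> + h) / h) \<longlongrightarrow> \<rho> k \<tau>) (at_right 0)" if "k \<in> ?K" for k
    using that kbox_seed \<tau> by (intro lam_deriv_right) auto
  have "((\<lambda>h. L h / h) \<longlongrightarrow> (\<Sum>k\<in>?K. \<rho> k \<tau>)) (at_right 0)"
    unfolding L_def sum_divide_distrib by (intro tendsto_sum l)
  then have "(b \<longlongrightarrow> 3 * B * (\<Sum>k\<in>?K. \<rho> k \<tau>)\<^sup>2 * 0 + (\<Sum>k\<in>?K. \<bar>\<rho> k \<tau> - \<rho> k \<tau>\<bar> * (2 * B))) (at_right 0)"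
    unfolding b_def using l by (intro tendsto_intros) auto
  then have b0: "(b \<longlongrightarrow> 0) (at_right 0)" by simp
  show ?thesis
  proof (rule uniform_limitI)
    fix \<epsilon> :: real assume "0 < \<epsilon>"
    then have "\<forall>\<^sub>F h in at_right 0. b h < \<epsilon>" using order_tendstoD(2)[OF b0] by simp
    moreover have "\<forall>\<^sub>F h :: real in at_right 0. 0 < h" by (rule eventually_at_right_less)
    ultimately show "\<forall>\<^sub>F h in at_right 0. \<forall>\<sigma>\<in>regular_configurations.
       dist (((\<integral>\<sigma>'. f \<sigma>' \<partial>Q seed_clocks \<tau> (\<tau> + h) \<sigma>) - f \<sigma>) / h) (\<Sum>k\<in>?K. \<rho> k \<tau> * (f (act k \<sigma>) - f \<sigma>)) < \<epsilon>"
    proof eventually_elim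
      case (elim h)
      show ?case
      proof
        fix \<sigma> assume \<sigma>: "\<sigma> \<in> regular_configurations"
        define D where "D = (\<integral>\<sigma>'. f \<sigma>' \<partial>Q seed_clocks \<tau> (\<tau> + h) \<sigma>) - f \<sigma>"
        define S where "S = (\<Sum>k\<in>?K. lam k \<tau> (\<tau> + h) * (f (act k \<sigma>) - f \<sigma>))"
        define G where "G = (\<Sum>k\<in>?K. \<rho> k \<tau> * (f (act k \<sigma>) - f \<sigma>))"
        have "\<bar>D - S\<bar> \<le> 3 * B * (L h)\<^sup>2"
          unfolding D_def S_def L_def using elim \<tau> by (intro Q_short_time[OF f B(2) \<sigma>]) auto
        then have "\<bar>D / h - S / h\<bar> \<le> 3 * B * (L h)\<^sup>2 / h"
          using elim by (simp add: diff_divide_distrib[symmetric] divide_right_mono)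
        also have "\<dots> = 3 * B * (L h / h)\<^sup>2 * h" using elim by (simp add: power2_eq_square)
        finally have 1: "\<bar>D / h - S / h\<bar> \<le> 3 * B * (L h / h)\<^sup>2 * h" .
        have eq: "S / h - G = (\<Sum>k\<in>?K. (lam k \<tau> (\<tau> + h) / h - \<rho> k \<tau>) * (f (act k \<sigma>) - f \<sigma>))"
          unfolding S_def G_def by (simp add: sum_divide_distrib sum_subtractf[symmetric] algebra_simps)
        have "\<bar>S / h - G\<bar> \<le> (\<Sum>k\<in>?K. \<bar>lam k \<tau> (\<tau> + h) / h - \<rho> k \<tau>\<bar> * (2 * B))"
          unfolding eq
        proof (rule order_trans[OF sum_abs], rule sum_mono)
          fix k
          have "\<bar>f (act k \<sigma>) - f \<sigma>\<bar> \<le> 2 * B" using B(2)[of \<sigma>] B(2)[of "act k \<sigma>"] by linarith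
          then show "\<bar>(lam k \<tau> (\<tau> + h) / h - \<rho> k \<tau>) * (f (act k \<sigma>) - f \<sigma>)\<bar> \<le> \<bar>lam k \<tau> (\<tau> + h) / h - \<rho> k \<tau>\<bar> * (2 * B)"
            unfolding abs_mult by (rule mult_left_mono) simp
        qed
        then have "\<bar>D / h - G\<bar> \<le> b h" using 1 unfolding b_def by linarith
        then show "dist (((\<integral>\<sigma>'. f \<sigma>' \<partial>Q seed_clocks \<tau> (\<tau> + h) \<sigma>) - f \<sigma>) / h) (\<Sum>k\<in>?K. \<rho> k \<tau> * (f (act k \<sigma>) - f \<sigma>)) < \<epsilon>"
          using elim unfolding dist_real_def D_def[symmetric] G_def[symmetric] by linarith
      qed
    qed
  qed
qed

text \<open>The truncation at \<open>0\<close> gives a measurable value at every real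
  \<open>t\<close>.\<close>

definition chain_from :: "config \<Rightarrow> real \<Rightarrow> 'w \<Rightarrow> config" where
  "chain_from \<sigma>0 t \<omega> = Phi seed_clocks 0 (max 0 t) \<omega> \<sigma>0"

lemma chain_from_flow:
  assumes "good_rings (\<lambda>k. T k \<omega>)"
  shows "chain_from \<sigma>0 t \<omega> = flow (\<lambda>k. T k \<omega>) seed_clocks {0<..t} \<sigma>0"
proof -
  have "{0<..max 0 t} = {0<..t}" by auto
  then show ?thesis by (simp add: chain_from_def Phi_flow[OF assms])
qed

lemma chain_from_driven:
  assumes "\<sigma>0 \<in> regular_configurations"
  shows "AE \<omega> in M. driven_by_clocks (\<lambda>t. chain_from \<sigma>0 t \<omega>) (\<lambda>k. T k \<omega>)"
  using AE_good_rings
  by eventually_elim (simp add: chain_from_flow good_rings.driven_by_clocks_flow[OF _ assms])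

lemma measurable_chain_from:
  "\<sigma>0 \<in> space config_space \<Longrightarrow> chain_from \<sigma>0 t \<in> measurable M config_space"
  unfolding chain_from_def by (intro measurable_Phi) auto

lemma chain_from_markov:
  assumes \<sigma>0: "\<sigma>0 \<in> regular_configurations"
  shows "markov_chain_from M (chain_from \<sigma>0) (Q seed_clocks) \<sigma>0"
  unfolding markov_chain_from_def
proof (intro conjI allI impI ballI)
  note sp = regular_space[OF \<sigma>0]
  show "prob_space M" by (rule prob_space_axioms)
  show "chain_from \<sigma>0 t \<in> measurable M config_space" for t by (rule measurable_chain_from[OF sp])
  show "AE \<omega> in M. chain_from \<sigma>0 0 \<omega> = \<sigma>0"
    using AE_good_rings
  proof eventually_elim
    case (elim \<omega>)
    show ?case unfolding chain_from_flow[OF elim]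
      by (rule good_rings.flow_no_rings[OF elim]) (use sp in \<open>auto simp: space_config\<close>)
  qed
  show "AE \<omega> in M. \<forall>t\<ge>0. chain_from \<sigma>0 t \<omega> \<in> regular_configurations"
    using AE_good_rings
  proof eventually_elim
    case (elim \<omega>)
    show ?case unfolding chain_from_flow[OF elim]
      using good_rings.flow_regular[OF elim \<sigma>0 order_refl] by blast
  qed
  fix s t :: real and H A
  assume H: "H \<in> sets (\<Pi>\<^sub>M r\<in>{0..s}. config_space)" and A: "A \<in> sets config_space" and st: "0 \<le> s \<and> s \<le> t"
  let ?g = "\<lambda>r z. Psi seed_clocks (diff_counts 0 r z) \<sigma>0"
  have g: "?g r \<in> measurable (past_space s) config_space" if "r \<in> {0..s}" for r
    by (rule measurable_Phi_past) (use that sp in auto)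
  have gX: "?g r (past s \<omega>) = chain_from \<sigma>0 r \<omega>" if "r \<in> {0..s}" "\<omega> \<in> space M" for r \<omega>
    using counts_past[of 0 r s \<omega>] that by (simp add: chain_from_def Phi_def max_def)
  \<comment> \<open>The trajectory up to \<open>s\<close> as a measurable function of the past
    counts; it pulls the event \<open>H\<close> back to an event of the past.\<close>
  define P where "P z = (\<lambda>r\<in>{0..s}. ?g r z)" for z
  have P: "P \<in> measurable (past_space s) (\<Pi>\<^sub>M r\<in>{0..s}. config_space)"
    unfolding P_def by (intro measurable_restrict g)
  define H' where "H' = P -` H \<inter> space (past_space s)"
  have H': "H' \<in> sets (past_space s)" unfolding H'_def by (rule measurable_sets[OF P H])
  have HH: "past s \<omega> \<in> H' \<longleftrightarrow> (\<lambda>r\<in>{0..s}. chain_from \<sigma>0 r \<omega>) \<in> H" if "\<omega> \<in> space M" for \<omega>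
  proof -
    have "P (past s \<omega>) = (\<lambda>r\<in>{0..s}. chain_from \<sigma>0 r \<omega>)"
      unfolding P_def using gX that by (intro restrict_ext) auto
    then show ?thesis using measurable_space[OF measurable_past that] by (simp add: H'_def)
  qed
  have ss: "s \<in> {0..s}" using st by auto
  have fl: "AE \<omega> in M. Phi seed_clocks s t \<omega> (Phi seed_clocks 0 s \<omega> \<sigma>0) = Phi seed_clocks 0 t \<omega> \<sigma>0"
    by (rule AE_flow_Phi[OF \<sigma>0]) (use st in auto)
  have "emeasure M {\<omega> \<in> space M. (\<lambda>r\<in>{0..s}. chain_from \<sigma>0 r \<omega>) \<in> H \<and> chain_from \<sigma>0 t \<omega> \<in> A} =
     emeasure M {\<omega> \<in> space M. past s \<omega> \<in> H' \<and> Phi seed_clocks s t \<omega> (?g s (past s \<omega>)) \<in> A}"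
  proof (rule emeasure_eq_AE)
    show "AE \<omega> in M. (\<omega> \<in> {\<omega> \<in> space M. (\<lambda>r\<in>{0..s}. chain_from \<sigma>0 r \<omega>) \<in> H \<and> chain_from \<sigma>0 t \<omega> \<in> A}) =
      (\<omega> \<in> {\<omega> \<in> space M. past s \<omega> \<in> H' \<and> Phi seed_clocks s t \<omega> (?g s (past s \<omega>)) \<in> A})"
      using fl AE_space
    proof eventually_elim
      case (elim \<omega>)
      then have "Phi seed_clocks s t \<omega> (?g s (past s \<omega>)) = chain_from \<sigma>0 t \<omega>"
        using st gX[OF ss elim(2)] by (simp add: chain_from_def max_def)
      then show ?case using elim(2) HH by simp
    qed
    have "{\<omega> \<in> space M. (\<lambda>r\<in>{0..s}. chain_from \<sigma>0 r \<omega>) \<in> H \<and> chain_from \<sigma>0 t \<omega> \<in> A} =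
      (past s -` H' \<inter> space M) \<inter> (chain_from \<sigma>0 t -` A \<inter> space M)" using HH by auto
    also have "\<dots> \<in> events"
      using measurable_sets[OF measurable_past H'] measurable_sets[OF measurable_chain_from[OF sp] A] by blast
    finally show "{\<omega> \<in> space M. (\<lambda>r\<in>{0..s}. chain_from \<sigma>0 r \<omega>) \<in> H \<and> chain_from \<sigma>0 t \<omega> \<in> A} \<in> events" .
    have m: "(\<lambda>\<omega>. (?g s (past s \<omega>), \<omega>)) \<in> measurable M (config_space \<Otimes>\<^sub>M M)"
      using measurable_compose[OF measurable_past g[OF ss]] by measurable
    have "(\<lambda>\<omega>. Phi seed_clocks s t \<omega> (?g s (past s \<omega>))) \<in> measurable M config_space"
      using measurable_compose[OF m measurable_Phi_pair[of seed_clocks s t]] st by simp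
    moreover have "{\<omega> \<in> space M. past s \<omega> \<in> H' \<and> Phi seed_clocks s t \<omega> (?g s (past s \<omega>)) \<in> A} =
      (past s -` H' \<inter> space M) \<inter> ((\<lambda>\<omega>. Phi seed_clocks s t \<omega> (?g s (past s \<omega>))) -` A \<inter> space M)" by auto
    ultimately show "{\<omega> \<in> space M. past s \<omega> \<in> H' \<and> Phi seed_clocks s t \<omega> (?g s (past s \<omega>)) \<in> A} \<in> events"
      using measurable_sets[OF measurable_past H'] A by auto
  qed
  also have "\<dots> = (\<integral>\<^sup>+\<omega>. indicator H' (past s \<omega>) * emeasure (Q seed_clocks s t (?g s (past s \<omega>))) A \<partial>M)"
    by (rule markov_core[OF order_refl _ _ g[OF ss] H' A]) (use st in auto)
  also have "\<dots> = (\<integral>\<^sup>+\<omega>. indicator H (\<lambda>r\<in>{0..s}. chain_from \<sigma>0 r \<omega>) * emeasure (Q seed_clocks s t (chain_from \<sigma>0 s \<omega>)) A \<partial>M)"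
    by (rule nn_integral_cong) (simp add: HH gX[OF ss] indicator_def)
  finally show "emeasure M {\<omega> \<in> space M. (\<lambda>r\<in>{0..s}. chain_from \<sigma>0 r \<omega>) \<in> H \<and> chain_from \<sigma>0 t \<omega> \<in> A} =
        (\<integral>\<^sup>+\<omega>. indicator H (\<lambda>r\<in>{0..s}. chain_from \<sigma>0 r \<omega>) * emeasure (Q seed_clocks s t (chain_from \<sigma>0 s \<omega>)) A \<partial>M)" .
qed

end

section \<open>Derivatives in the row parameters\<close>

definition W :: "real \<Rightarrow> real \<Rightarrow> bool \<Rightarrow> bool \<Rightarrow> bool \<Rightarrow> bool \<Rightarrow> real" where
  "W q u i j a b = s6v_weight q u (of_bool i, of_bool j, of_bool a, of_bool b)"

text \<open>The derivative of \<open>W\<close> in \<open>u\<close>, see \<open>W_deriv\<close>. It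
  vanishes for equal incoming edges, as the outcome is then forced.\<close>

definition dW :: "real \<Rightarrow> real \<Rightarrow> bool \<Rightarrow> bool \<Rightarrow> bool \<Rightarrow> bool \<Rightarrow> real" where
  "dW q u i j a b =
    (if (i, j, a, b) = (True, False, True, False) then - q * (1 - q) / (1 - q * u)\<^sup>2
     else if (i, j, a, b) = (True, False, False, True) then q * (1 - q) / (1 - q * u)\<^sup>2
     else if (i, j, a, b) = (False, True, False, True) then - (1 - q) / (1 - q * u)\<^sup>2
     else if (i, j, a, b) = (False, True, True, False) then (1 - q) / (1 - q * u)\<^sup>2
     else 0)"

lemma W_simps:
  "W q u True True True True = 1" "W q u False False False False = 1"
  "W q u True False True False = q * (1 - u) / (1 - q * u)"
  "W q u True False False True = (1 - q) / (1 - q * u)"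
  "W q u False True False True = (1 - u) / (1 - q * u)"
  "W q u False True True False = u * (1 - q) / (1 - q * u)"
  "W q u True True a False = 0" "W q u True True False b = 0"
  "W q u False False a True = 0" "W q u False False True b = 0"
  "W q u True False True True = 0" "W q u True False False False = 0"
  "W q u False True True True = 0" "W q u False True False False = 0"
  by (simp_all add: W_def s6v_weight_def)

lemma dW_simps:
  "dW q u True True a b = 0" "dW q u False False a b = 0"
  "dW q u True False True False = - q * (1 - q) / (1 - q * u)\<^sup>2"
  "dW q u True False False True = q * (1 - q) / (1 - q * u)\<^sup>2"
  "dW q u False True False True = - (1 - q) / (1 - q * u)\<^sup>2"
  "dW q u False True True False = (1 - q) / (1 - q * u)\<^sup>2"
  "dW q u True False True True = 0" "dW q u True False False False = 0"
  "dW q u False True True True = 0" "dW q u False True False False = 0"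
  by (simp_all add: dW_def)

text \<open>Intensity of jumps that arrive from the left and turn the entering pair (lower, upper)
  from \<open>(r, l)\<close> into \<open>(l, r)\<close>: up jumps if \<open>r\<close> is occupied,
  down jumps otherwise. The values are such that \<open>column_identity\<close> holds with the same
  function for the right edges and for the left edges, so the claim passes from column to
  column.\<close>

definition kap :: "real \<Rightarrow> real \<Rightarrow> bool \<Rightarrow> bool \<Rightarrow> real" where
  "kap q u l r = (if l = r then 0 else if r then 1 / ((1 - q) * u) else q / ((1 - q) * u))"

definition rate_at :: "real \<Rightarrow> real \<Rightarrow> bool \<Rightarrow> bool \<Rightarrow> bool \<Rightarrow> bool \<Rightarrow> bool \<Rightarrow> bool \<Rightarrow> bool \<Rightarrow> real" where
  "rate_at q u i l V L r T U = seed_rate q ((of_bool i, of_bool l, of_bool V, of_bool L), (of_bool V, of_bool r, of_bool T, of_bool U)) u"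

lemma rate_at_eq: "rate_at q u i l V L r T U =
   (if (i, l, V, L, r, T, U) = (False, True, False, True, False, False, False) then rate_c q u
    else if (i, l, V, L, r, T, U) = (True, False, True, False, True, True, True) then rate_c q u
    else if (i, l, V, L, r, T, U) = (True, False, False, True, False, False, False) then rate_a q u
    else if (i, l, V, L, r, T, U) = (False, True, True, False, True, True, True) then rate_a q u
    else if (i, l, V, L, r, T, U) = (False, True, False, True, True, True, False) then rate_b q u
    else if (i, l, V, L, r, T, U) = (True, False, True, False, False, False, True) then rate_b q u
    else 0)"
  by (cases i; cases l; cases V; cases L; cases r; cases T; cases U) (simp_all add: rate_at_def seed_rate_def)

lemma sum_bool: "(\<Sum>b\<in>(UNIV::bool set). f b) = f True + (f False :: real)"
  by (simp add: UNIV_bool add.commute)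

text \<open>
  The key computation. The lower vertex has the type \<open>(i, l; V, L)\<close> and the upper one \<open>(V, r; T, U)\<close>; the
  values \<open>A\<close> and \<open>B\<close> are those without and with a jump passing through the two right edges.
\<close>

lemma column_identity:
  fixes q u :: real and A B :: "bool \<Rightarrow> bool \<Rightarrow> bool \<Rightarrow> bool \<Rightarrow> real"
  assumes q: "0 \<le> q" "q < 1" and u: "0 < u" "u < 1"
  shows "(\<Sum>V\<in>UNIV. \<Sum>L\<in>UNIV. \<Sum>T\<in>UNIV. \<Sum>U\<in>UNIV.
       (dW q u i l V L * W q u V r T U - W q u i l V L * dW q u V r T U) * A V L T U +
       W q u i l V L * W q u V r T U * (kap q u L U * (B V L T U - A V L T U)))
    = (\<Sum>V\<in>UNIV. \<Sum>L\<in>UNIV. \<Sum>T\<in>UNIV. \<Sum>U\<in>UNIV.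
       W q u i l V L * W q u V r T U * (rate_at q u i l V L r T U * (B L (\<not> L) T L - A V L T U)) +
       kap q u l r * (W q u i r V L * W q u V l T U * (if L = r \<and> U = l then B V l T r else A l L T U) -
         W q u i l V L * W q u V r T U * A V L T U))"
proof -
  have "q * u < 1" using assms by (smt (verit) mult_left_le_one_le)
  then have nz: "q * u \<noteq> 1" "u \<noteq> 1" "q \<noteq> 1" "u \<noteq> 0" using assms by auto
  show ?thesis
    unfolding sum_bool rate_at_eq kap_def
    \<comment> \<open>For each triple of incoming edges most weights vanish by conservation; the
      coefficients of the remaining values of \<open>A\<close> and \<open>B\<close> are compared as
      rational functions of \<open>q\<close> and \<open>u\<close>.\<close>
    apply (cases i; cases l; cases r)
    apply (simp_all add: W_simps dW_simps rate_a_def rate_b_def rate_c_def)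
    apply (simp_all add: divide_simps nz power2_eq_square)
    apply (simp_all add: algebra_simps)?
    done
qed

section \<open>Expectations under sequential sampling and their derivatives\<close>

fun put :: "config \<Rightarrow> vertex \<Rightarrow> bool \<times> bool \<Rightarrow> config" where
  "put \<sigma> (x, y) (a, b) = \<sigma>(Ver x y := a, Hor (Suc x) y := b)"

fun vwt :: "(bool \<Rightarrow> bool \<Rightarrow> bool \<Rightarrow> bool \<Rightarrow> real) \<Rightarrow> config \<Rightarrow> vertex \<Rightarrow> bool \<times> bool \<Rightarrow> real" where
  "vwt w \<sigma> (x, y) (a, b) = w (\<sigma> (Ver x (y - 1))) (\<sigma> (Hor x y)) a b"

text \<open>
  Expectation of \<open>g\<close> when the vertices of the list are sampled one after the other, starting from \<open>\<sigma>\<close>;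
  \<open>dEx y\<close> is its partial derivative in the spectral parameter of the row \<open>y\<close>.
\<close>

fun Ex :: "real \<Rightarrow> real \<Rightarrow> vertex list \<Rightarrow> config \<Rightarrow> (config \<Rightarrow> real) \<Rightarrow> real" where
  "Ex q u [] \<sigma> g = g \<sigma>"
| "Ex q u (v # vs) \<sigma> g = (\<Sum>o'\<in>UNIV. vwt (W q u) \<sigma> v o' * Ex q u vs (put \<sigma> v o') g)"

fun dEx :: "real \<Rightarrow> real \<Rightarrow> nat \<Rightarrow> vertex list \<Rightarrow> config \<Rightarrow> (config \<Rightarrow> real) \<Rightarrow> real" where
  "dEx q u y [] \<sigma> g = 0"
| "dEx q u y (v # vs) \<sigma> g = (\<Sum>o'\<in>UNIV. (if snd v = y then vwt (dW q u) \<sigma> v o' * Ex q u vs (put \<sigma> v o') g else 0) +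
     vwt (W q u) \<sigma> v o' * dEx q u y vs (put \<sigma> v o') g)"

fun vreads :: "vertex \<Rightarrow> edge set" where
  "vreads (x, y) = {Ver x (y - 1), Hor x y}"

fun vwrites :: "vertex \<Rightarrow> edge set" where
  "vwrites (x, y) = {Ver x y, Hor (Suc x) y}"

lemma sum_bool2: "(\<Sum>p\<in>(UNIV :: (bool \<times> bool) set). f p) = (\<Sum>a\<in>UNIV. \<Sum>b\<in>UNIV. f (a, b) :: real)"
  by (simp add: sum.cartesian_product)

lemma put_other: "e \<notin> vwrites v \<Longrightarrow> put \<sigma> v p e = \<sigma> e"
  by (cases v; cases p) auto

lemma put_upd: "e \<notin> vwrites v \<Longrightarrow> put (\<sigma>(e := b)) v p = (put \<sigma> v p)(e := b)"
  by (cases v; cases p) (auto simp: fun_upd_twist)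

lemma vwt_upd: "e \<notin> vreads v \<Longrightarrow> vwt w (\<sigma>(e := b)) v p = vwt w \<sigma> v p"
  by (cases v; cases p) auto

text \<open>Allows the vertical edge changed by a seed to be pulled through the sampling of the
  vertices that come later.\<close>

lemma Ex_upd:
  assumes "\<And>v. v \<in> set vs \<Longrightarrow> e \<notin> vreads v \<union> vwrites v"
  shows "Ex q u vs (\<sigma>(e := b)) g = Ex q u vs \<sigma> (\<lambda>\<sigma>. g (\<sigma>(e := b)))"
  using assms
proof (induction vs arbitrary: \<sigma>)
  case (Cons v vs)
  have e: "e \<notin> vreads v" "e \<notin> vwrites v" using Cons.prems[of v] by auto
  have IH: "Ex q u vs (\<sigma>(e := b)) g = Ex q u vs \<sigma> (\<lambda>\<sigma>. g (\<sigma>(e := b)))" for \<sigma>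
    by (rule Cons.IH) (use Cons.prems in simp)
  show ?case by (simp only: Ex.simps put_upd[OF e(2)] vwt_upd[OF e(1)] IH)
qed simp

text \<open>Sampling alters only edges written by the listed vertices, so the integrands need to
  coincide only on configurations that equal \<sigma> elsewhere.\<close>

lemma Ex_cong:
  assumes "\<And>\<sigma>'. (\<And>e. (\<And>v. v \<in> set vs \<Longrightarrow> e \<notin> vwrites v) \<Longrightarrow> \<sigma>' e = \<sigma> e) \<Longrightarrow> g \<sigma>' = h \<sigma>'"
  shows "Ex q u vs \<sigma> g = Ex q u vs \<sigma> h"
  using assms
proof (induction vs arbitrary: \<sigma>)
  case (Cons v vs)
  have "Ex q u vs (put \<sigma> v p) g = Ex q u vs (put \<sigma> v p) h" for p
  proof (rule Cons.IH)
    fix \<sigma>' assume *: "\<And>e. (\<And>v. v \<in> set vs \<Longrightarrow> e \<notin> vwrites v) \<Longrightarrow> \<sigma>' e = put \<sigma> v p e"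
    show "g \<sigma>' = h \<sigma>'"
    proof (rule Cons.prems)
      fix e assume "\<And>v'. v' \<in> set (v # vs) \<Longrightarrow> e \<notin> vwrites v'"
      then show "\<sigma>' e = \<sigma> e" using *[of e] put_other[of e v \<sigma> p] by simp
    qed
  qed
  then show ?case by simp
qed simp

lemma Ex_add: "Ex q u vs \<sigma> (\<lambda>\<sigma>. g \<sigma> + h \<sigma>) = Ex q u vs \<sigma> g + Ex q u vs \<sigma> h"
  by (induction vs arbitrary: \<sigma>) (simp_all add: sum.distrib distrib_left)

lemma Ex_scale: "Ex q u vs \<sigma> (\<lambda>\<sigma>. c * g \<sigma>) = c * Ex q u vs \<sigma> g"
  by (induction vs arbitrary: \<sigma>) (simp_all add: sum_distrib_left mult_ac)

lemma Ex_diff: "Ex q u vs \<sigma> (\<lambda>\<sigma>. g \<sigma> - h \<sigma>) = Ex q u vs \<sigma> g - Ex q u vs \<sigma> h"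
  by (induction vs arbitrary: \<sigma>) (simp_all add: sum_subtractf right_diff_distrib)

lemma Ex_sum: "Ex q u vs \<sigma> (\<lambda>\<sigma>. \<Sum>i\<in>I. g i \<sigma>) = (\<Sum>i\<in>I. Ex q u vs \<sigma> (g i))"
proof (induction vs arbitrary: \<sigma>)
  case (Cons v vs)
  then show ?case by (simp only: Ex.simps sum_distrib_left) (rule sum.swap)
qed simp

lemma W_nonneg: "0 \<le> q \<Longrightarrow> q < 1 \<Longrightarrow> 0 < u \<Longrightarrow> u < 1 \<Longrightarrow> 0 \<le> W q u i j a b"
  and W_sum: "0 \<le> q \<Longrightarrow> q < 1 \<Longrightarrow> 0 < u \<Longrightarrow> u < 1 \<Longrightarrow> W q u i j True True + W q u i j True False + (W q u i j False True + W q u i j False False) = 1"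
proof -
  assume a: "0 \<le> q" "q < 1" "0 < u" "u < 1"
  then have "q * u < 1" by (smt (verit) mult_left_le_one_le)
  then show "0 \<le> W q u i j a b" "W q u i j True True + W q u i j True False + (W q u i j False True + W q u i j False False) = 1"
    using a by (cases i; cases j; cases a; cases b; simp add: W_simps divide_simps; simp add: algebra_simps)+
qed

lemma vwt_nonneg: "0 \<le> q \<Longrightarrow> q < 1 \<Longrightarrow> 0 < u \<Longrightarrow> u < 1 \<Longrightarrow> 0 \<le> vwt (W q u) \<sigma> v p"
  by (cases v; cases p) (simp add: W_nonneg)

lemma vwt_sum: "0 \<le> q \<Longrightarrow> q < 1 \<Longrightarrow> 0 < u \<Longrightarrow> u < 1 \<Longrightarrow> (\<Sum>p\<in>UNIV. vwt (W q u) \<sigma> v p) = 1"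
  by (cases v) (simp add: sum_bool2 sum_bool W_sum)

lemma Ex_const: "0 \<le> q \<Longrightarrow> q < 1 \<Longrightarrow> 0 < u \<Longrightarrow> u < 1 \<Longrightarrow> Ex q u vs \<sigma> (\<lambda>_. c) = c"
  by (induction vs arbitrary: \<sigma>) (simp_all add: sum_distrib_right[symmetric] vwt_sum)

lemma Ex_mono: "0 \<le> q \<Longrightarrow> q < 1 \<Longrightarrow> 0 < u \<Longrightarrow> u < 1 \<Longrightarrow> (\<And>\<sigma>. g \<sigma> \<le> h \<sigma>) \<Longrightarrow> Ex q u vs \<sigma> g \<le> Ex q u vs \<sigma> h"
  by (induction vs arbitrary: \<sigma>) (auto intro!: sum_mono mult_left_mono vwt_nonneg)

lemma Ex_abs:
  assumes "0 \<le> q" "q < 1" "0 < u" "u < 1" "\<And>\<sigma>. \<bar>g \<sigma>\<bar> \<le> B"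
  shows "\<bar>Ex q u vs \<sigma> g\<bar> \<le> B"
proof -
  have b: "g \<sigma> \<le> B" "- B \<le> g \<sigma>" for \<sigma> using assms(5)[of \<sigma>] by linarith+
  have "Ex q u vs \<sigma> g \<le> Ex q u vs \<sigma> (\<lambda>_. B)" "Ex q u vs \<sigma> (\<lambda>_. - B) \<le> Ex q u vs \<sigma> g"
    by (rule Ex_mono[OF assms(1-4) b(1)], rule Ex_mono[OF assms(1-4) b(2)])
  then show ?thesis using Ex_const[OF assms(1-4)] by (simp add: abs_le_iff)
qed

text \<open>Every nonconstant weight is a linear fractional function of \<open>u\<close> with
  denominator \<open>1 - q * u\<close>, so a single quotient rule covers all of them.\<close>

lemma W_deriv:
  assumes "q * u \<noteq> 1"
  shows "((\<lambda>u. W q u i j a b) has_real_derivative dW q u i j a b) (at u)"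
proof -
  have lf: "((\<lambda>u. (a + b * u) / (1 - q * u)) has_real_derivative (b + a * q) / (1 - q * u)\<^sup>2) (at u)" for a b
  proof -
    have "((\<lambda>u. (a + b * u) / (1 - q * u)) has_real_derivative (b * (1 - q * u) - (a + b * u) * (- q)) / ((1 - q * u) * (1 - q * u))) (at u)"
      by (rule DERIV_divide) (use assms in \<open>auto intro!: derivative_eq_intros\<close>)
    moreover have "b * (1 - q * u) - (a + b * u) * (- q) = b + a * q" by (simp add: algebra_simps)
    ultimately show ?thesis by (simp add: power2_eq_square)
  qed
  have "((\<lambda>u. q * (1 - u) / (1 - q * u)) has_real_derivative - q * (1 - q) / (1 - q * u)\<^sup>2) (at u)"
    using lf[of q "- q"] by (simp add: algebra_simps)
  moreover have "((\<lambda>u. (1 - q) / (1 - q * u)) has_real_derivative q * (1 - q) / (1 - q * u)\<^sup>2) (at u)"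
    using lf[of "1 - q" 0] by (simp add: algebra_simps)
  moreover have "((\<lambda>u. (1 - u) / (1 - q * u)) has_real_derivative - (1 - q) / (1 - q * u)\<^sup>2) (at u)"
    using lf[of 1 "- 1"] by (simp add: algebra_simps)
  moreover have "((\<lambda>u. u * (1 - q) / (1 - q * u)) has_real_derivative (1 - q) / (1 - q * u)\<^sup>2) (at u)"
    using lf[of 0 "1 - q"] by (simp add: algebra_simps)
  ultimately show ?thesis
    by (cases i; cases j; cases a; cases b) (simp_all add: W_simps dW_simps)
qed

text \<open>Give each row its own parameter and set all of them equal to \<open>u\<close>: by the
  chain rule the total derivative is the sum of the row derivatives.\<close>

lemma Ex_deriv:
  assumes "q * u \<noteq> 1" "finite Y" "snd ` set vs \<subseteq> Y"
  shows "((\<lambda>u. Ex q u vs \<sigma> g) has_real_derivative (\<Sum>y\<in>Y. dEx q u y vs \<sigma> g)) (at u)"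
  using assms(3)
proof (induction vs arbitrary: \<sigma>)
  case (Cons v vs)
  have w: "((\<lambda>u. vwt (W q u) \<sigma> v p) has_real_derivative vwt (dW q u) \<sigma> v p) (at u)" for p
    using W_deriv[OF assms(1)] by (cases v; cases p) simp
  have "((\<lambda>u. Ex q u (v # vs) \<sigma> g) has_real_derivative
      (\<Sum>p\<in>UNIV. vwt (dW q u) \<sigma> v p * Ex q u vs (put \<sigma> v p) g + (\<Sum>y\<in>Y. dEx q u y vs (put \<sigma> v p) g) * vwt (W q u) \<sigma> v p)) (at u)"
    unfolding Ex.simps by (intro DERIV_sum DERIV_mult w Cons.IH) (use Cons.prems in auto)
  also have "(\<Sum>p\<in>UNIV. vwt (dW q u) \<sigma> v p * Ex q u vs (put \<sigma> v p) g + (\<Sum>y\<in>Y. dEx q u y vs (put \<sigma> v p) g) * vwt (W q u) \<sigma> v p) =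
     (\<Sum>y\<in>Y. dEx q u y (v # vs) \<sigma> g)"
  proof -
    have "(\<Sum>y\<in>Y. dEx q u y (v # vs) \<sigma> g) = (\<Sum>p\<in>UNIV. \<Sum>y\<in>Y. (if snd v = y then vwt (dW q u) \<sigma> v p * Ex q u vs (put \<sigma> v p) g else 0) +
     vwt (W q u) \<sigma> v p * dEx q u y vs (put \<sigma> v p) g)"
      unfolding dEx.simps by (rule sum.swap)
    also have "\<dots> = (\<Sum>p\<in>UNIV. vwt (dW q u) \<sigma> v p * Ex q u vs (put \<sigma> v p) g + (\<Sum>y\<in>Y. dEx q u y vs (put \<sigma> v p) g) * vwt (W q u) \<sigma> v p)"
      using assms(2) Cons.prems by (intro sum.cong refl) (simp add: sum.distrib sum.delta' sum_distrib_left sum_distrib_right mult.commute)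
    finally show ?thesis by simp
  qed
  finally show ?case .
qed simp

section \<open>Jumps crossing two neighbouring rows\<close>

definition swp :: "nat \<Rightarrow> nat \<Rightarrow> config \<Rightarrow> config" where
  "swp y x \<sigma> = \<sigma>(Hor x y := \<sigma> (Hor x (Suc y)), Hor x (Suc y) := \<sigma> (Hor x y))"

lemma swp_swp[simp]: "swp y x (swp y x \<sigma>) = \<sigma>"
  by (auto simp: swp_def fun_eq_iff)

lemma swp_apply:
  "swp y x \<sigma> (Hor i l) = (if i = x \<and> l = y then \<sigma> (Hor x (Suc y)) else if i = x \<and> l = Suc y then \<sigma> (Hor x y) else \<sigma> (Hor i l))"
  "swp y x \<sigma> (Ver i l) = \<sigma> (Ver i l)"
  by (auto simp: swp_def)

lemma put_swp:
  assumes "Hor x y \<notin> vwrites v" "Hor x (Suc y) \<notin> vwrites v"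
  shows "put (swp y x \<sigma>) v p = swp y x (put \<sigma> v p)"
  unfolding swp_def using assms by (simp add: put_upd put_other)

lemma Ex_swp:
  assumes "\<And>v. v \<in> set vs \<Longrightarrow> Hor x y \<notin> vreads v \<union> vwrites v \<and> Hor x (Suc y) \<notin> vreads v \<union> vwrites v"
  shows "Ex q u vs (swp y x \<sigma>) g = Ex q u vs \<sigma> (\<lambda>\<sigma>. g (swp y x \<sigma>))"
  using assms
proof (induction vs arbitrary: \<sigma>)
  case (Cons v vs)
  have v: "Hor x y \<notin> vreads v" "Hor x (Suc y) \<notin> vreads v" "Hor x y \<notin> vwrites v" "Hor x (Suc y) \<notin> vwrites v"
    using Cons.prems[of v] by auto
  have vw: "vwt w (swp y x \<sigma>) v p = vwt w \<sigma> v p" for w p \<sigma> using v by (simp add: swp_def vwt_upd)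
  have IH: "Ex q u vs (swp y x \<sigma>) g = Ex q u vs \<sigma> (\<lambda>\<sigma>. g (swp y x \<sigma>))" for \<sigma>
    by (rule Cons.IH) (use Cons.prems in simp)
  show ?case by (simp only: Ex.simps put_swp[OF v(3,4)] vw IH)
qed simp

text \<open>A flight advances by one column: swap the entering pair, then either go on or end by
  flipping the vertical edge. This matches the step of the induction over columns.\<close>

lemma flight_rec:
  assumes "\<sigma> (Hor x y) = b" "\<sigma> (Hor x (Suc y)) = (\<not> b)"
  shows "flight b y x \<sigma> = (if \<sigma> (Hor (Suc x) y) = b \<and> \<sigma> (Hor (Suc x) (Suc y)) = (\<not> b)
     then flight b y (Suc x) (swp y x \<sigma>) else (swp y x \<sigma>)(Ver x y := \<not> b))"
proof -
  define P where "P i \<longleftrightarrow> \<sigma> (Hor i y) = b \<and> \<sigma> (Hor i (Suc y)) = (\<not> b)" for i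
  have P: "run b \<sigma> y x' i \<longleftrightarrow> x' \<le> i \<and> (\<forall>j\<in>{x'..i}. P j)" for x' i
    unfolding run_def P_def by (rule refl)
  have Px: "P x" using assms by (simp add: P_def)
  have r': "run b \<sigma> y x i \<longleftrightarrow> i = x \<or> run b \<sigma> y (Suc x) i \<and> P (Suc x)" for i
  proof (cases "i \<le> x")
    case True
    then show ?thesis using Px unfolding P by (cases "i = x") simp_all
  next
    case False
    then have "{x..i} = insert x {Suc x..i}" "Suc x \<in> {Suc x..i}" by auto
    then show ?thesis using Px False unfolding P by simp (metis \<open>Suc x \<in> {Suc x..i}\<close>)
  qed
  note r = r'[unfolded P_def]
  have s: "run b (swp y x \<sigma>) y (Suc x) i = run b \<sigma> y (Suc x) i" for i
    by (auto simp: run_def swp_def)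
  have nr: "\<not> run b \<sigma> y (Suc x) i" if "i \<le> x" for i \<sigma> using that by (simp add: run_def)
  have r1: "run b \<sigma> y (Suc x) (Suc x) \<longleftrightarrow> \<sigma> (Hor (Suc x) y) = b \<and> \<sigma> (Hor (Suc x) (Suc y)) = (\<not> b)"
    by (simp add: run_def)
  have C: "\<sigma> (Hor (Suc x) y) = b \<and> \<sigma> (Hor (Suc x) (Suc y)) = (\<not> b) \<longleftrightarrow> P (Suc x)" by (simp add: P_def)
  have hor: "flight b y x \<sigma> (Hor i l) = (if P (Suc x) then flight b y (Suc x) (swp y x \<sigma>) else (swp y x \<sigma>)(Ver x y := \<not> b)) (Hor i l)" for i l
  proof (cases "i = x")
    case True
    have "\<sigma> (Hor x (Suc y)) = (\<not> \<sigma> (Hor x y))" using assms by simp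
    then show ?thesis using True r'[of x] by (simp add: flight_def nr swp_apply)
  next
    case False
    then show ?thesis using r'[of i] by (simp add: flight_def s swp_apply)
  qed
  have ver: "flight b y x \<sigma> (Ver i l) = (if P (Suc x) then flight b y (Suc x) (swp y x \<sigma>) else (swp y x \<sigma>)(Ver x y := \<not> b)) (Ver i l)" for i l
  proof (cases "i = x")
    case True
    then show ?thesis using nr[of x \<sigma>] r'[of x] r'[of "Suc x"] r1[unfolded C] by (simp add: flight_def s swp_apply)
  next
    case False
    show ?thesis
    proof (cases "Suc i = x")
      case True
      then show ?thesis using False r'[of i] r'[of x] nr[of i \<sigma>] nr[of x \<sigma>] by (simp add: flight_def s swp_apply)
    next
      case F2: False
      then show ?thesis using False r'[of i] r'[of "Suc i"] by (simp add: flight_def s swp_apply)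
    qed
  qed
  show ?thesis
    unfolding C
  proof
    fix e
    show "flight b y x \<sigma> e = (if P (Suc x) then flight b y (Suc x) (swp y x \<sigma>) else (swp y x \<sigma>)(Ver x y := \<not> b)) e"
      using hor ver by (cases e) simp_all
  qed
qed

lemma flight_upd:
  assumes "i < x"
  shows "flight b y x (\<sigma>(Ver i l := a)) = (flight b y x \<sigma>)(Ver i l := a)"
proof -
  have "run b (\<sigma>(Ver i l := a)) y x j = run b \<sigma> y x j" for j by (simp add: run_def)
  then show ?thesis using assms by (auto simp: flight_def fun_eq_iff run_def split: edge.splits)
qed


definition seed_diff :: "real \<Rightarrow> real \<Rightarrow> nat \<Rightarrow> (config \<Rightarrow> real) \<Rightarrow> nat \<Rightarrow> config \<Rightarrow> real" where
  "seed_diff q u y g x \<sigma> = seed_rate q (pair_type \<sigma> (x, y)) u * (g (jump \<sigma> (x, y)) - g \<sigma>)"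

text \<open>
  The last term accounts for the jumps which arrive from the left at the column \<open>x\<close>: conditionally on the
  edges entering that column, they arrive with the intensity \<open>kap\<close>.
\<close>

definition two_row_id :: "real \<Rightarrow> real \<Rightarrow> nat \<Rightarrow> nat \<Rightarrow> (config \<Rightarrow> real) \<Rightarrow> nat \<Rightarrow> vertex list \<Rightarrow> bool" where
  "two_row_id q u y N g x vs \<longleftrightarrow> (\<forall>\<sigma>. dEx q u y vs \<sigma> g - dEx q u (Suc y) vs \<sigma> g =
     Ex q u vs \<sigma> (\<lambda>\<sigma>'. \<Sum>x'=x..N. seed_diff q u y g x' \<sigma>') +
     kap q u (\<sigma> (Hor x y)) (\<sigma> (Hor x (Suc y))) *
       (Ex q u vs (swp y x \<sigma>) (\<lambda>\<sigma>'. g (flight (\<sigma> (Hor x (Suc y))) y x \<sigma>')) - Ex q u vs \<sigma> g))"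

text \<open>A vertex in another row carries neither of the two parameters and touches neither of the
  two entering edges, so the identity is simply averaged over its outcomes.\<close>

lemma two_row_id_other:
  assumes "two_row_id q u y N g x vs" "snd v \<noteq> y" "snd v \<noteq> Suc y"
  shows "two_row_id q u y N g x (v # vs)"
  unfolding two_row_id_def
proof
  fix \<sigma>
  obtain x0 l where v: "v = (x0, l)" by (cases v)
  have l: "l \<noteq> y" "l \<noteq> Suc y" using assms v by auto
  have w: "Hor x y \<notin> vwrites v" "Hor x (Suc y) \<notin> vwrites v" "Hor x y \<notin> vreads v" "Hor x (Suc y) \<notin> vreads v" using l by (auto simp: v)
  let ?S = "\<lambda>\<sigma>'. \<Sum>x'=x..N. seed_diff q u y g x' \<sigma>'"
  let ?F = "\<lambda>\<sigma>'. g (flight (\<sigma> (Hor x (Suc y))) y x \<sigma>')"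
  let ?k = "kap q u (\<sigma> (Hor x y)) (\<sigma> (Hor x (Suc y)))"
  have vw: "vwt (W q u) (swp y x \<sigma>) v p = vwt (W q u) \<sigma> v p" for p using w by (simp add: swp_def vwt_upd)
  have IH: "dEx q u y vs (put \<sigma> v p) g - dEx q u (Suc y) vs (put \<sigma> v p) g =
     Ex q u vs (put \<sigma> v p) ?S + ?k * (Ex q u vs (swp y x (put \<sigma> v p)) ?F - Ex q u vs (put \<sigma> v p) g)" for p
    using assms(1) unfolding two_row_id_def by (simp add: put_other[OF w(1)] put_other[OF w(2)])
  have "dEx q u y (v # vs) \<sigma> g - dEx q u (Suc y) (v # vs) \<sigma> g =
     (\<Sum>p\<in>UNIV. vwt (W q u) \<sigma> v p * (dEx q u y vs (put \<sigma> v p) g - dEx q u (Suc y) vs (put \<sigma> v p) g))"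
    using assms(2,3) by (simp add: sum_subtractf right_diff_distrib)
  also have "\<dots> = Ex q u (v # vs) \<sigma> ?S + ?k * (Ex q u (v # vs) (swp y x \<sigma>) ?F - Ex q u (v # vs) \<sigma> g)"
    unfolding IH Ex.simps put_swp[OF w(1,2)] vw
    by (simp add: distrib_left right_diff_distrib sum.distrib sum_subtractf sum_distrib_left mult.left_commute)
  finally show "dEx q u y (v # vs) \<sigma> g - dEx q u (Suc y) (v # vs) \<sigma> g =
     Ex q u (v # vs) \<sigma> ?S + ?k * (Ex q u (v # vs) (swp y x \<sigma>) ?F - Ex q u (v # vs) \<sigma> g)" .
qed

lemma two_row_id_others:
  assumes "two_row_id q u y N g x vs" "\<And>v. v \<in> set ws \<Longrightarrow> snd v \<noteq> y \<and> snd v \<noteq> Suc y"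
  shows "two_row_id q u y N g x (ws @ vs)"
  using assms(2) by (induction ws) (auto intro!: two_row_id_other assms(1))

lemma seed_rate_nonzero: "seed_rate q p u \<noteq> 0 \<Longrightarrow> p \<in> up_types \<union> down_types"
  unfolding seed_rate_def up_types_def down_types_def by (simp split: if_splits) blast+

text \<open>The induction step. \<open>vs\<close> holds the rest of column \<open>x\<close> above
  the pair and all later columns; the jumps leaving the pair to the right, described by
  \<open>kap\<close> at its right edges, are converted by \<open>column_identity\<close> into seeds
  at column \<open>x\<close> and jumps arriving from the left.\<close>

lemma two_row_id_pair:
  assumes q: "0 \<le> q" "q < 1" and u: "0 < u" "u < 1" and y: "1 \<le> y" and x: "x \<le> N"
    and vs: "two_row_id q u y N g (Suc x) vs" "\<And>x' l. (x', l) \<in> set vs \<Longrightarrow> x < x' \<or> x' = x \<and> Suc y < l"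
  shows "two_row_id q u y N g x ((x, y) # (x, Suc y) # vs)"
  unfolding two_row_id_def
proof
  fix \<sigma> :: config
  define i l r where "i = \<sigma> (Ver x (y - 1))" and "l = \<sigma> (Hor x y)" and "r = \<sigma> (Hor x (Suc y))"
  define S where "S V L T' U = put (put \<sigma> (x, y) (V, L)) (x, Suc y) (T', U)" for V L T' U
  have rw: "e \<notin> vreads v \<union> vwrites v" if "v \<in> set vs" "e \<in> {Hor x y, Hor x (Suc y), Ver x y}" for v e
    using vs(2)[of "fst v" "snd v"] that by (cases v) auto
  have wr: "e \<notin> vwrites v" if "v \<in> set vs" "e \<in> {Ver x (y - 1), Hor (Suc x) y, Hor (Suc x) (Suc y), Ver x (Suc y)}" for v e
    using vs(2)[of "fst v" "snd v"] that by (cases v) auto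
  \<comment> \<open>\<open>A\<close> is the expectation without a jump, \<open>B\<close> with a jump
    crossing the right edges of the pair (after which they are \<open>L\<close> and
    \<open>U\<close>), and \<open>G\<close> collects the seeds in later columns.\<close>
  define A where "A V L T' U = Ex q u vs (S V L T' U) g" for V L T' U
  define B where "B V L T' U = Ex q u vs (swp y (Suc x) (S V L T' U)) (\<lambda>\<sigma>'. g (flight U y (Suc x) \<sigma>'))" for V L T' U
  define G where "G V L T' U = Ex q u vs (S V L T' U) (\<lambda>\<sigma>'. \<Sum>x'=Suc x..N. seed_diff q u y g x' \<sigma>')" for V L T' U
  define S4 where "S4 f = (\<Sum>V\<in>UNIV. \<Sum>L\<in>UNIV. \<Sum>T'\<in>UNIV. \<Sum>U\<in>UNIV. f V L T' U :: real)" for f :: "bool \<Rightarrow> bool \<Rightarrow> bool \<Rightarrow> bool \<Rightarrow> real"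
  have S4: "S4 (\<lambda>V L T' U. f V L T' U + h V L T' U) = S4 f + S4 h" "S4 (\<lambda>V L T' U. f V L T' U - h V L T' U) = S4 f - S4 h"
    "S4 (\<lambda>V L T' U. c * f V L T' U) = c * S4 f" for f h c
    by (simp_all add: S4_def sum.distrib sum_subtractf sum_distrib_left)
  have Sval: "S V L T' U (Ver x (y - 1)) = i" "S V L T' U (Hor x y) = l" "S V L T' U (Hor x (Suc y)) = r"
    "S V L T' U (Ver x y) = V" "S V L T' U (Hor (Suc x) y) = L" "S V L T' U (Ver x (Suc y)) = T'" "S V L T' U (Hor (Suc x) (Suc y)) = U" for V L T' U
    using y by (auto simp: S_def i_def l_def r_def)
  have E1: "Ex q u ((x, y) # (x, Suc y) # vs) \<sigma> h = S4 (\<lambda>V L T' U. W q u i l V L * W q u V r T' U * Ex q u vs (S V L T' U) h)" for h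
    by (simp add: sum_bool2 S4_def S_def i_def l_def r_def sum_distrib_left mult.assoc)
  have E1s: "Ex q u ((x, y) # (x, Suc y) # vs) (swp y x \<sigma>) h = S4 (\<lambda>V L T' U. W q u i r V L * W q u V l T' U * Ex q u vs (swp y x (S V L T' U)) h)" for h
  proof -
    have "put (put (swp y x \<sigma>) (x, y) (V, L)) (x, Suc y) (T', U) = swp y x (S V L T' U)" for V L T' U
      unfolding S_def by (subst put_swp, simp, simp)+ simp
    then show ?thesis
      by (simp add: sum_bool2 S4_def i_def l_def r_def sum_distrib_left mult.assoc swp_apply del: put.simps) (simp add: swp_apply)
  qed
  have E2: "dEx q u y ((x, y) # (x, Suc y) # vs) \<sigma> g = S4 (\<lambda>V L T' U. dW q u i l V L * W q u V r T' U * A V L T' U + W q u i l V L * W q u V r T' U * dEx q u y vs (S V L T' U) g)"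
    by (simp add: sum_bool2 S4_def S_def A_def i_def l_def r_def sum_distrib_left mult.assoc sum.distrib distrib_left)
  have E3: "dEx q u (Suc y) ((x, y) # (x, Suc y) # vs) \<sigma> g = S4 (\<lambda>V L T' U. W q u i l V L * dW q u V r T' U * A V L T' U + W q u i l V L * W q u V r T' U * dEx q u (Suc y) vs (S V L T' U) g)"
    by (simp add: sum_bool2 S4_def S_def A_def i_def l_def r_def sum_distrib_left mult.assoc sum.distrib distrib_left)
  have IH: "dEx q u y vs (S V L T' U) g - dEx q u (Suc y) vs (S V L T' U) g = G V L T' U + kap q u L U * (B V L T' U - A V L T' U)" for V L T' U
    using vs(1) unfolding two_row_id_def G_def B_def A_def by (simp only: Sval)
  have stay: "\<sigma>' e = S V L T' U e" if "\<And>e. (\<And>v. v \<in> set vs \<Longrightarrow> e \<notin> vwrites v) \<Longrightarrow> \<sigma>' e = S V L T' U e"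
    "e \<in> {Hor x y, Hor x (Suc y), Ver x y, Ver x (y - 1), Hor (Suc x) y, Hor (Suc x) (Suc y), Ver x (Suc y)}" for \<sigma>' e V L T' U
    by (rule that(1)) (use rw wr that(2) in blast)
  \<comment> \<open>The later vertices do not rewrite the edges at the pair, so the types of the
    possible seed at column \<open>x\<close> are already fixed and its rate can be taken out of the
    expectation.\<close>
  have GEN: "Ex q u vs (S V L T' U) (\<lambda>\<sigma>'. \<Sum>x'=x..N. seed_diff q u y g x' \<sigma>') =
      rate_at q u i l V L r T' U * (B L (\<not> L) T' L - A V L T' U) + G V L T' U" for V L T' U
  proof -
    let ?c = "rate_at q u i l V L r T' U"
    have pt: "pair_type \<sigma>' (x, y) = ((of_bool i, of_bool l, of_bool V, of_bool L), (of_bool V, of_bool r, of_bool T', of_bool U))"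
      if "\<And>e. (\<And>v. v \<in> set vs \<Longrightarrow> e \<notin> vwrites v) \<Longrightarrow> \<sigma>' e = S V L T' U e" for \<sigma>'
      using stay[OF that] by (simp add: pair_type.simps Sval Sval[simplified])
    have "Ex q u vs (S V L T' U) (\<lambda>\<sigma>'. \<Sum>x'=x..N. seed_diff q u y g x' \<sigma>') =
      Ex q u vs (S V L T' U) (\<lambda>\<sigma>'. seed_diff q u y g x \<sigma>') + G V L T' U"
      unfolding G_def Ex_add[symmetric] using x by (simp add: sum.atLeast_Suc_atMost)
    also have "Ex q u vs (S V L T' U) (\<lambda>\<sigma>'. seed_diff q u y g x \<sigma>') =
       Ex q u vs (S V L T' U) (\<lambda>\<sigma>'. ?c * (g (flight L y (Suc x) (\<sigma>'(Ver x y := L))) - g \<sigma>'))"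
    proof (rule Ex_cong)
      fix \<sigma>' assume ag: "\<And>e. (\<And>v. v \<in> set vs \<Longrightarrow> e \<notin> vwrites v) \<Longrightarrow> \<sigma>' e = S V L T' U e"
      have c: "seed_rate q (pair_type \<sigma>' (x, y)) u = ?c"
        unfolding rate_at_def by (rule arg_cong[where f = "\<lambda>p. seed_rate q p u"], rule pt, rule ag, assumption)
      show "seed_diff q u y g x \<sigma>' = ?c * (g (flight L y (Suc x) (\<sigma>'(Ver x y := L))) - g \<sigma>')"
      proof (cases "?c = 0")
        case False
        then have ud: "pair_type \<sigma>' (x, y) \<in> up_types \<union> down_types" using seed_rate_nonzero c by metis
        have "\<sigma>' (Hor (Suc x) y) = L" using stay[OF ag, of "Hor (Suc x) y"] by (simp add: Sval)
        then have "L = (pair_type \<sigma>' (x, y) \<in> up_types)" using up_or_down(1)[OF ud refl] by simp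
        then have "jump \<sigma>' (x, y) = flight L y (Suc x) (\<sigma>'(Ver x y := L))"
          using jump_flight[OF ud] flight_upd[of x "Suc x"] by simp
        then show ?thesis unfolding seed_diff_def c by simp
      qed (simp add: seed_diff_def c)
    qed
    also have "\<dots> = ?c * (Ex q u vs (S V L T' U) (\<lambda>\<sigma>'. g (flight L y (Suc x) (\<sigma>'(Ver x y := L)))) - A V L T' U)"
      unfolding Ex_scale Ex_diff A_def by (rule refl)
    also have "Ex q u vs (S V L T' U) (\<lambda>\<sigma>'. g (flight L y (Suc x) (\<sigma>'(Ver x y := L)))) =
      Ex q u vs ((S V L T' U)(Ver x y := L)) (\<lambda>\<sigma>'. g (flight L y (Suc x) \<sigma>'))"
      by (rule Ex_upd[symmetric]) (use rw in blast)
    also have "?c * (\<dots> - A V L T' U) = ?c * (B L (\<not> L) T' L - A V L T' U)"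
    proof (cases "?c = 0")
      case False
      \<comment> \<open>A seed pair has opposite right edges. With the vertical edge set to
        \<open>L\<close>, the configuration before the flight is the swap of the one with right
        edges \<open>\<not> L\<close> and \<open>L\<close>, which is the argument of
        \<open>B\<close>.\<close>
      then have "U = (\<not> L)" unfolding rate_at_eq by (auto split: if_splits)
      then have "(S V L T' U)(Ver x y := L) = swp y (Suc x) (S L (\<not> L) T' L)"
        by (auto simp: S_def swp_def fun_eq_iff)
      then show ?thesis by (simp add: B_def)
    qed simp
    finally show ?thesis .
  qed
  \<comment> \<open>A jump arriving from the left passes through the column if the right edges
    continue its pattern; otherwise it ends there, and the vertical edge of the pair becomes
    \<open>l\<close>, the negation of \<open>r\<close>.\<close>
  have SWAP: "Ex q u vs (swp y x (S V L T' U)) (\<lambda>\<sigma>'. g (flight r y x \<sigma>')) = (if L = r \<and> U = l then B V l T' r else A l L T' U)"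
    if lr: "l \<noteq> r" for V L T' U
  proof -
    let ?c = "L = r \<and> U = l"
    let ?h = "\<lambda>\<sigma>'. g (if ?c then flight r y (Suc x) \<sigma>' else \<sigma>'(Ver x y := l))"
    have "Ex q u vs (swp y x (S V L T' U)) (\<lambda>\<sigma>'. g (flight r y x \<sigma>')) = Ex q u vs (swp y x (S V L T' U)) (\<lambda>\<sigma>'. ?h (swp y x \<sigma>'))"
    proof (rule Ex_cong)
      fix \<sigma>' assume ag: "\<And>e. (\<And>v. v \<in> set vs \<Longrightarrow> e \<notin> vwrites v) \<Longrightarrow> \<sigma>' e = swp y x (S V L T' U) e"
      have v: "\<sigma>' e = swp y x (S V L T' U) e" if "e \<in> {Hor x y, Hor x (Suc y), Hor (Suc x) y, Hor (Suc x) (Suc y)}" for e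
        by (rule ag) (use rw wr that in blast)
      have "\<sigma>' (Hor x y) = r" "\<sigma>' (Hor x (Suc y)) = (\<not> r)" "\<sigma>' (Hor (Suc x) y) = L" "\<sigma>' (Hor (Suc x) (Suc y)) = U"
        using v lr by (auto simp: swp_apply Sval)
      then show "g (flight r y x \<sigma>') = ?h (swp y x \<sigma>')"
        using flight_rec[of \<sigma>' x y r] lr by auto
    qed
    also have "\<dots> = Ex q u vs (swp y x (swp y x (S V L T' U))) ?h"
      by (rule Ex_swp[symmetric]) (use rw in blast)
    also have "\<dots> = (if ?c then B V l T' r else A l L T' U)"
    proof (cases ?c)
      case True
      have "S V L T' U = swp y (Suc x) (S V l T' r)" using True by (auto simp: S_def swp_def fun_eq_iff)
      then show ?thesis using True by (simp add: B_def)
    next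
      case False
      have "Ex q u vs (S V L T' U) (\<lambda>\<sigma>'. g (\<sigma>'(Ver x y := l))) = Ex q u vs ((S V L T' U)(Ver x y := l)) g"
        by (rule Ex_upd[symmetric]) (use rw in blast)
      also have "(S V L T' U)(Ver x y := l) = S l L T' U" by (auto simp: S_def fun_eq_iff)
      finally show ?thesis using False by (simp only: A_def swp_swp if_False)
    qed
    finally show ?thesis .
  qed
  let ?WW = "\<lambda>V L T' U. W q u i l V L * W q u V r T' U"
  have "dEx q u y ((x, y) # (x, Suc y) # vs) \<sigma> g - dEx q u (Suc y) ((x, y) # (x, Suc y) # vs) \<sigma> g =
    S4 (\<lambda>V L T' U. (dW q u i l V L * W q u V r T' U - W q u i l V L * dW q u V r T' U) * A V L T' U +
      ?WW V L T' U * (dEx q u y vs (S V L T' U) g - dEx q u (Suc y) vs (S V L T' U) g))"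
    unfolding E2 E3 S4(2)[symmetric] by (rule arg_cong[where f = S4]) (intro ext, simp add: algebra_simps)
  also have "\<dots> = S4 (\<lambda>V L T' U. (dW q u i l V L * W q u V r T' U - W q u i l V L * dW q u V r T' U) * A V L T' U +
      ?WW V L T' U * (kap q u L U * (B V L T' U - A V L T' U))) + S4 (\<lambda>V L T' U. ?WW V L T' U * G V L T' U)"
    unfolding IH S4(1)[symmetric] by (rule arg_cong[where f = S4]) (intro ext, simp add: algebra_simps)
  also have "S4 (\<lambda>V L T' U. (dW q u i l V L * W q u V r T' U - W q u i l V L * dW q u V r T' U) * A V L T' U +
      ?WW V L T' U * (kap q u L U * (B V L T' U - A V L T' U))) =
    S4 (\<lambda>V L T' U. ?WW V L T' U * (rate_at q u i l V L r T' U * (B L (\<not> L) T' L - A V L T' U)) +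
       kap q u l r * (W q u i r V L * W q u V l T' U * (if L = r \<and> U = l then B V l T' r else A l L T' U) -
         ?WW V L T' U * A V L T' U))"
    unfolding S4_def by (rule column_identity[OF q u])
  also have "\<dots> + S4 (\<lambda>V L T' U. ?WW V L T' U * G V L T' U) =
    S4 (\<lambda>V L T' U. ?WW V L T' U * (rate_at q u i l V L r T' U * (B L (\<not> L) T' L - A V L T' U) + G V L T' U)) +
    kap q u l r * (S4 (\<lambda>V L T' U. W q u i r V L * W q u V l T' U * (if L = r \<and> U = l then B V l T' r else A l L T' U)) - S4 (\<lambda>V L T' U. ?WW V L T' U * A V L T' U))"
    unfolding S4(1) S4(2)[symmetric] S4(3)[symmetric] distrib_left by simp
  also have "kap q u l r * (S4 (\<lambda>V L T' U. W q u i r V L * W q u V l T' U * (if L = r \<and> U = l then B V l T' r else A l L T' U)) - S4 (\<lambda>V L T' U. ?WW V L T' U * A V L T' U)) =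
    kap q u l r * (S4 (\<lambda>V L T' U. W q u i r V L * W q u V l T' U * Ex q u vs (swp y x (S V L T' U)) (\<lambda>\<sigma>'. g (flight r y x \<sigma>'))) - S4 (\<lambda>V L T' U. ?WW V L T' U * A V L T' U))"
  proof (cases "l = r")
    case False
    show ?thesis unfolding SWAP[OF False] by (rule refl)
  qed (simp add: kap_def)
  finally show "dEx q u y ((x, y) # (x, Suc y) # vs) \<sigma> g - dEx q u (Suc y) ((x, y) # (x, Suc y) # vs) \<sigma> g =
     Ex q u ((x, y) # (x, Suc y) # vs) \<sigma> (\<lambda>\<sigma>'. \<Sum>x'=x..N. seed_diff q u y g x' \<sigma>') +
     kap q u (\<sigma> (Hor x y)) (\<sigma> (Hor x (Suc y))) *
       (Ex q u ((x, y) # (x, Suc y) # vs) (swp y x \<sigma>) (\<lambda>\<sigma>'. g (flight (\<sigma> (Hor x (Suc y))) y x \<sigma>')) - Ex q u ((x, y) # (x, Suc y) # vs) \<sigma> g)"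
    unfolding E1 E1s GEN A_def[symmetric] l_def[symmetric] r_def[symmetric] .
qed

definition col :: "nat \<Rightarrow> nat \<Rightarrow> vertex list" where
  "col H x = map (Pair x) [1..<Suc H]"

text \<open>The order is column by column, each from bottom to top, so that removing the first
  column leaves a list of the same form.\<close>

definition boxl :: "nat \<Rightarrow> nat \<Rightarrow> nat \<Rightarrow> vertex list" where
  "boxl H x N = concat (map (col H) [x..<Suc N])"

lemma set_boxl: "set (boxl H x N) = {x..N} \<times> {1..H}"
  by (simp add: boxl_def col_def atLeastLessThanSuc_atLeastAtMost del: upt_Suc) blast

lemma boxl_Cons: "x \<le> N \<Longrightarrow> boxl H x N = col H x @ boxl H (Suc x) N"
  by (simp add: boxl_def upt_conv_Cons del: upt_Suc)

text \<open>Induction from the rightmost column to the left; in each column the vertices outside the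
  two rows are inserted around the pair by \<open>two_row_id_others\<close>.\<close>

lemma two_row_id_box:
  assumes q: "0 \<le> q" "q < 1" and u: "0 < u" "u < 1" and y: "1 \<le> y" "Suc y \<le> H" and g: "box_fun N H' g"
    and x: "x \<le> Suc N"
  shows "two_row_id q u y N g x (boxl H x N)"
  using x
proof (induction "Suc N - x" arbitrary: x)
  case 0
  then have x: "x = Suc N" by simp
  \<comment> \<open>To the right of the box no vertex is left. The flight undoes the swap of the
    entering pair, and everything else it changes lies outside the columns that \<open>g\<close>
    depends on.\<close>
  have "kap q u l r * (g (flight r y x (swp y x \<sigma>)) - g \<sigma>) = 0" if "l = \<sigma> (Hor x y)" "r = \<sigma> (Hor x (Suc y))" for \<sigma> l r
  proof (cases "l = r")
    case False
    have "agree N {..H'} (flight r y x (swp y x \<sigma>)) \<sigma>"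
      unfolding agree_def
    proof (intro ballI impI)
      fix e assume e: "e \<in> quad_edges" "incol N e \<and> row e \<in> {..H'}"
      show "flight r y x (swp y x \<sigma>) e = \<sigma> e"
      proof (cases e)
        case (Hor i j)
        then have "i \<le> Suc N" using e by simp
        moreover have "run r (swp y x \<sigma>) y x x" using False that by (auto simp: run_def swp_apply)
        ultimately show ?thesis using False that x
          by (cases "i = Suc N") (auto simp: Hor flight_def swp_apply run_def)
      next
        case (Ver i j)
        then have "i < x" using e x by simp
        then show ?thesis by (simp add: Ver flight_def swp_apply run_def)
      qed
    qed
    then show ?thesis using box_funD[OF g] by simp
  qed (simp add: kap_def)
  then show ?case unfolding two_row_id_def using x by (simp add: boxl_def)
next
  case (Suc n)
  then have x: "x \<le> N" by simp
  have "two_row_id q u y N g (Suc x) (boxl H (Suc x) N)" using Suc by simp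
  then have "two_row_id q u y N g (Suc x) (map (Pair x) [Suc (Suc y)..<Suc H] @ boxl H (Suc x) N)"
    by (rule two_row_id_others) auto
  then have "two_row_id q u y N g x ((x, y) # (x, Suc y) # map (Pair x) [Suc (Suc y)..<Suc H] @ boxl H (Suc x) N)"
    by (rule two_row_id_pair[OF q u y(1) x]) (auto simp: set_boxl)
  then have "two_row_id q u y N g x (map (Pair x) [1..<y] @ (x, y) # (x, Suc y) # map (Pair x) [Suc (Suc y)..<Suc H] @ boxl H (Suc x) N)"
    by (rule two_row_id_others) auto
  moreover have "[1..<Suc H] = [1..<y] @ y # Suc y # [Suc (Suc y)..<Suc H]"
  proof -
    have "[1..<Suc H] = [1..<y] @ [y..<Suc H]" using upt_add_eq_append[of 1 y "Suc H - y"] y by simp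
    then show ?thesis using y by (simp add: upt_conv_Cons del: upt_Suc)
  qed
  ultimately show ?case unfolding boxl_Cons[OF x] col_def by simp
qed

text \<open>Equal boundary states in the two rows make \<open>kap\<close> vanish: no jump enters the
  quadrant from the left.\<close>

lemma two_row_derivative:
  assumes q: "0 \<le> q" "q < 1" and u: "0 < u" "u < 1" and y: "1 \<le> y" "Suc y \<le> H" and g: "box_fun N H' g"
    and bd: "\<sigma> (Hor 0 y) = \<sigma> (Hor 0 (Suc y))"
  shows "dEx q u y (boxl H 0 N) \<sigma> g - dEx q u (Suc y) (boxl H 0 N) \<sigma> g = Ex q u (boxl H 0 N) \<sigma> (\<lambda>\<sigma>'. \<Sum>x=0..N. seed_diff q u y g x \<sigma>')"
  using two_row_id_box[OF q u y g, of 0] bd unfolding two_row_id_def by (simp add: kap_def)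

text \<open>Summation by parts over the rows turns the factor \<open>y\<close> of the rates into the total derivative.\<close>

lemma generator_derivative:
  assumes q: "0 \<le> q" "q < 1" and u: "0 < u" "u < 1" and g: "box_fun N H' g"
    and bd: "\<And>y. 1 \<le> y \<Longrightarrow> \<sigma> (Hor 0 y) = a"
  shows "Ex q u (boxl (Suc H) 0 N) \<sigma> (\<lambda>\<sigma>'. \<Sum>y=1..H. real y * (\<Sum>x=0..N. seed_diff q u y g x \<sigma>')) =
    (\<Sum>y=1..Suc H. dEx q u y (boxl (Suc H) 0 N) \<sigma> g) - real (Suc H) * dEx q u (Suc H) (boxl (Suc H) 0 N) \<sigma> g"
proof -
  define D where "D y = dEx q u y (boxl (Suc H) 0 N) \<sigma> g" for y
  have "Ex q u (boxl (Suc H) 0 N) \<sigma> (\<lambda>\<sigma>'. \<Sum>y=1..H. real y * (\<Sum>x=0..N. seed_diff q u y g x \<sigma>')) = (\<Sum>y=1..H. real y * (D y - D (Suc y)))"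
  proof (subst Ex_sum, rule sum.cong[OF refl])
    fix y assume "y \<in> {1..H}"
    then show "Ex q u (boxl (Suc H) 0 N) \<sigma> (\<lambda>\<sigma>'. real y * (\<Sum>x=0..N. seed_diff q u y g x \<sigma>')) = real y * (D y - D (Suc y))"
      unfolding Ex_scale D_def using two_row_derivative[OF q u _ _ g, where y = y and H = "Suc H" and \<sigma> = \<sigma>] bd[of y] bd[of "Suc y"] by simp
  qed
  also have "\<dots> = (\<Sum>y=1..Suc h. D y) - real (Suc h) * D (Suc h)" if "h = H" for h
    unfolding that[symmetric] by (induction h) (auto simp: algebra_simps)
  finally show ?thesis by (simp add: D_def)
qed

text \<open>The bound is relative to the weight itself, so a differentiated vertex can be
  reinterpreted as a sampled one, at the cost of a constant and the indicator of different incoming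
  edges.\<close>

lemma dW_le:
  assumes q: "0 \<le> q" "q < 1" and u: "0 < u" "u < 1"
  shows "\<bar>dW q u i j a b\<bar> \<le> 1 / (u * (1 - u) * (1 - q)) * (W q u i j a b * of_bool (i \<noteq> j))"
proof -
  define p where "p = 1 - q * u"
  have p: "1 - q \<le> p" "p \<le> 1" "0 < p" using q u
    by (auto simp: p_def mult_left_le intro: mult_nonneg_nonneg) (smt (verit) mult_left_le)
  define c where "c = 1 / (u * (1 - u) * (1 - q))"
  have pos: "0 < u * (1 - u) * (1 - q)" using q u by simp
  have c1: "(1 - q) / p\<^sup>2 \<le> c * ((1 - u) / p)"
  proof -
    have "(1 - q) / p\<^sup>2 \<le> 1 / p" using p q by (simp add: power2_eq_square divide_simps)
    also have "\<dots> \<le> 1 / (u * (1 - q)) * (1 / p)"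
    proof -
      have "u * (1 - q) \<le> 1" using q u by (simp add: mult_le_one)
      then have "1 \<le> 1 / (u * (1 - q))" using q u by (simp add: divide_simps)
      then show ?thesis using p mult_right_mono[of 1 "1 / (u * (1 - q))" "1 / p"] by simp
    qed
    also have "\<dots> = c * ((1 - u) / p)" using u q by (simp add: c_def divide_simps)
    finally show ?thesis .
  qed
  have c2: "(1 - q) / p\<^sup>2 \<le> c * (u * (1 - q) / p)"
  proof -
    have "(1 - q) / p\<^sup>2 \<le> 1 / p" using p q by (simp add: power2_eq_square divide_simps)
    also have "\<dots> \<le> 1 / (1 - u) * (1 / p)"
      using p u mult_right_mono[of 1 "1 / (1 - u)" "1 / p"] by (simp add: divide_simps)
    also have "\<dots> = c * (u * (1 - q) / p)" using u q by (simp add: c_def divide_simps)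
    finally show ?thesis .
  qed
  have c3: "q * (1 - q) / p\<^sup>2 \<le> c * ((1 - q) / p)"
  proof -
    have "q * (1 - q) / p\<^sup>2 \<le> 1 / p" 
    proof -
      have "q * (1 - q) \<le> p" using q p mult_left_le[of q "1 - q"] by (smt (verit) mult.commute mult_left_le)
      then show ?thesis using p by (simp add: power2_eq_square divide_simps)
    qed
    also have "\<dots> \<le> 1 / (u * (1 - u)) * (1 / p)"
    proof -
      have "u * (1 - u) \<le> 1" using u by (simp add: mult_le_one)
      then have "1 \<le> 1 / (u * (1 - u))" using u by (simp add: divide_simps)
      then show ?thesis using p mult_right_mono[of 1 "1 / (u * (1 - u))" "1 / p"] by simp
    qed
    also have "\<dots> = c * ((1 - q) / p)" using u q by (simp add: c_def divide_simps)
    finally show ?thesis .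
  qed
  have c4: "q * (1 - q) / p\<^sup>2 \<le> c * (q * (1 - u) / p)"
    using mult_left_mono[OF c1 q(1)] by (simp add: mult_ac)
  have "0 \<le> (1 - q) / p\<^sup>2" "0 \<le> q * (1 - q) / p\<^sup>2" "\<bar>q - 1\<bar> = 1 - q" using q p by auto
  then show ?thesis
    unfolding c_def[symmetric]
    by (cases i; cases j; cases a; cases b) (use c1 c2 c3 c4 in \<open>simp_all add: W_simps dW_simps p_def[symmetric]\<close>)
qed

text \<open>Only at such vertices does the weight depend on the spectral parameter.\<close>

definition nontriv :: "vertex \<Rightarrow> config \<Rightarrow> bool" where
  "nontriv v \<sigma> \<longleftrightarrow> \<sigma> (Ver (fst v) (snd v - 1)) \<noteq> \<sigma> (Hor (fst v) (snd v))"

text \<open>Ensures that the edges which a vertex reads already have their final values when it is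
  sampled, and that no vertex is sampled twice.\<close>

fun okl :: "vertex list \<Rightarrow> bool" where
  "okl [] = True"
| "okl (v # vs) = (okl vs \<and> v \<notin> set vs \<and> (\<forall>v'\<in>set (v # vs). vreads v \<inter> vwrites v' = {}))"

definition vless :: "vertex \<Rightarrow> vertex \<Rightarrow> bool" where
  "vless v w \<longleftrightarrow> fst v < fst w \<or> fst v = fst w \<and> snd v < snd w"

lemma sorted_boxl: "sorted_wrt vless (boxl H x N)"
proof (induction "Suc N - x" arbitrary: x)
  case 0
  then show ?case by (simp add: boxl_def)
next
  case (Suc n)
  have "sorted_wrt vless (col H x)" unfolding col_def sorted_wrt_map by (simp add: vless_def del: upt_Suc)
  moreover have "vless v w" if "v \<in> set (col H x)" "w \<in> set (boxl H (Suc x) N)" for v w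
    using that unfolding set_boxl by (auto simp: col_def vless_def simp del: upt_Suc)
  moreover have "sorted_wrt vless (boxl H (Suc x) N)" using Suc by simp
  ultimately show ?case using Suc(2) by (simp add: boxl_Cons sorted_wrt_append)
qed

lemma okl_boxl: "okl (boxl H x N)"
proof -
  have "sorted_wrt vless (boxl H x N)" by (rule sorted_boxl)
  moreover have "\<And>v. v \<in> set (boxl H x N) \<Longrightarrow> 1 \<le> snd v" by (auto simp: set_boxl)
  moreover have "okl vs" if "sorted_wrt vless vs" "\<And>v. v \<in> set vs \<Longrightarrow> 1 \<le> snd v" for vs
    using that
  proof (induction vs)
    case (Cons v vs)
    obtain a b where v: "v = (a, b)" by (cases v)
    have b: "1 \<le> b" using Cons.prems(2)[of v] v by simp
    have "vreads v \<inter> vwrites v' = {}" if "v' \<in> set (v # vs)" for v'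
    proof -
      obtain a' b' where v': "v' = (a', b')" by (cases v')
      have "vless v v' \<or> v' = v" using that Cons.prems(1) by auto
      then show ?thesis using b by (auto simp: v v' vless_def)
    qed
    moreover have "v \<notin> set vs" using Cons.prems(1) by (auto simp: vless_def)
    ultimately show ?case using Cons by auto
  qed simp
  ultimately show ?thesis by blast
qed

text \<open>By the product rule each vertex of the row \<open>y\<close> is differentiated once;
  \<open>dW_le\<close> turns this into the probability that its incoming edges differ, while the
  other factors are bounded by \<open>B\<close>.\<close>

lemma dEx_abs:
  assumes q: "0 \<le> q" "q < 1" and u: "0 < u" "u < 1" and g: "\<And>\<sigma>. \<bar>g \<sigma>\<bar> \<le> B" and ok: "okl vs"
  shows "\<bar>dEx q u y vs \<sigma> g\<bar> \<le> B / (u * (1 - u) * (1 - q)) * (\<Sum>v\<leftarrow>vs. of_bool (snd v = y) * Ex q u vs \<sigma> (\<lambda>\<sigma>'. of_bool (nontriv v \<sigma>')))"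
  using ok
proof (induction vs arbitrary: \<sigma>)
  case (Cons v vs)
  define c where "c = 1 / (u * (1 - u) * (1 - q))"
  have B0: "0 \<le> B" using g[of undefined] by linarith
  have c0: "0 \<le> c" unfolding c_def using q u by simp
  obtain x l where v: "v = (x, l)" by (cases v)
  have rd: "e \<notin> vwrites v'" if "e \<in> {Ver x (l - 1), Hor x l}" "v' \<in> set (v # vs)" for e v'
    using Cons.prems that v by fastforce
  \<comment> \<open>By \<open>okl\<close> the edges read by \<open>v\<close> are never rewritten, so
    the indicator in the final configuration equals the one before sampling.\<close>
  have nt: "Ex q u (v # vs) \<sigma> (\<lambda>\<sigma>'. of_bool (nontriv v \<sigma>')) = of_bool (nontriv v \<sigma>)"
  proof -
    have "Ex q u (v # vs) \<sigma> (\<lambda>\<sigma>'. of_bool (nontriv v \<sigma>')) = Ex q u (v # vs) \<sigma> (\<lambda>\<sigma>'. of_bool (nontriv v \<sigma>))"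
    proof (rule Ex_cong)
      fix \<sigma>' assume ag: "\<And>e. (\<And>v'. v' \<in> set (v # vs) \<Longrightarrow> e \<notin> vwrites v') \<Longrightarrow> \<sigma>' e = \<sigma> e"
      have "\<sigma>' (Ver x (l - 1)) = \<sigma> (Ver x (l - 1))" "\<sigma>' (Hor x l) = \<sigma> (Hor x l)" by (rule ag, rule rd, simp, assumption)+
      then show "of_bool (nontriv v \<sigma>') = (of_bool (nontriv v \<sigma>) :: real)" by (simp add: nontriv_def v)
    qed
    also have "\<dots> = of_bool (nontriv v \<sigma>)" by (rule Ex_const[OF q u])
    finally show ?thesis .
  qed
  have "\<bar>dEx q u y (v # vs) \<sigma> g\<bar> \<le> (\<Sum>p\<in>UNIV. of_bool (snd v = y) * (c * (vwt (W q u) \<sigma> v p * of_bool (nontriv v \<sigma>)) * B) +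
     vwt (W q u) \<sigma> v p * (B * c * (\<Sum>v'\<leftarrow>vs. of_bool (snd v' = y) * Ex q u vs (put \<sigma> v p) (\<lambda>\<sigma>'. of_bool (nontriv v' \<sigma>')))))"
    unfolding dEx.simps
  proof (rule order_trans[OF sum_abs], rule sum_mono)
    fix p :: "bool \<times> bool"
    have gen: "\<bar>P\<bar> \<le> PB \<Longrightarrow> \<bar>R\<bar> \<le> RB \<Longrightarrow> \<bar>(if b then P else 0) + R\<bar> \<le> of_bool b * PB + RB" for P PB R RB :: real and b
      by (cases b) auto
    have "\<bar>vwt (dW q u) \<sigma> v p\<bar> \<le> c * (vwt (W q u) \<sigma> v p * of_bool (nontriv v \<sigma>))"
      using dW_le[OF q u] unfolding c_def v by (cases p) (simp add: nontriv_def)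
    then have 1: "\<bar>vwt (dW q u) \<sigma> v p * Ex q u vs (put \<sigma> v p) g\<bar> \<le> c * (vwt (W q u) \<sigma> v p * of_bool (nontriv v \<sigma>)) * B"
      unfolding abs_mult using Ex_abs[OF q u g] c0 vwt_nonneg[OF q u] by (intro mult_mono) auto
    have "\<bar>dEx q u y vs (put \<sigma> v p) g\<bar> \<le> B * c * (\<Sum>v'\<leftarrow>vs. of_bool (snd v' = y) * Ex q u vs (put \<sigma> v p) (\<lambda>\<sigma>'. of_bool (nontriv v' \<sigma>')))"
      using Cons.IH[of "put \<sigma> v p"] Cons.prems by (simp add: c_def)
    then have 2: "\<bar>vwt (W q u) \<sigma> v p * dEx q u y vs (put \<sigma> v p) g\<bar> \<le> vwt (W q u) \<sigma> v p * (B * c * (\<Sum>v'\<leftarrow>vs. of_bool (snd v' = y) * Ex q u vs (put \<sigma> v p) (\<lambda>\<sigma>'. of_bool (nontriv v' \<sigma>'))))"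
      unfolding abs_mult abs_of_nonneg[OF vwt_nonneg[OF q u]] by (rule mult_left_mono[OF _ vwt_nonneg[OF q u]])
    show "\<bar>(if snd v = y then vwt (dW q u) \<sigma> v p * Ex q u vs (put \<sigma> v p) g else 0) + vwt (W q u) \<sigma> v p * dEx q u y vs (put \<sigma> v p) g\<bar> \<le>
      of_bool (snd v = y) * (c * (vwt (W q u) \<sigma> v p * of_bool (nontriv v \<sigma>)) * B) +
     vwt (W q u) \<sigma> v p * (B * c * (\<Sum>v'\<leftarrow>vs. of_bool (snd v' = y) * Ex q u vs (put \<sigma> v p) (\<lambda>\<sigma>'. of_bool (nontriv v' \<sigma>'))))"
      by (rule gen[OF 1 2])
  qed
  also have "\<dots> = of_bool (snd v = y) * (c * of_bool (nontriv v \<sigma>) * B) + B * c * (\<Sum>v'\<leftarrow>vs. of_bool (snd v' = y) * Ex q u (v # vs) \<sigma> (\<lambda>\<sigma>'. of_bool (nontriv v' \<sigma>')))"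
  proof -
    have s1: "(\<Sum>p\<in>UNIV. of_bool (snd v = y) * (c * (vwt (W q u) \<sigma> v p * of_bool (nontriv v \<sigma>)) * B)) = of_bool (snd v = y) * (c * of_bool (nontriv v \<sigma>) * B)"
    proof -
      have "(\<Sum>p\<in>UNIV. of_bool (snd v = y) * (c * (vwt (W q u) \<sigma> v p * of_bool (nontriv v \<sigma>)) * B)) =
        (\<Sum>p\<in>UNIV. vwt (W q u) \<sigma> v p) * (of_bool (snd v = y) * (c * of_bool (nontriv v \<sigma>) * B))"
        unfolding sum_distrib_right by (intro sum.cong refl) (simp only: mult_ac)
      then show ?thesis by (simp add: vwt_sum[OF q u])
    qed
    have s2: "(\<Sum>p\<in>UNIV. vwt (W q u) \<sigma> v p * (B * c * (\<Sum>v'\<leftarrow>ws. of_bool (snd v' = y) * Ex q u vs (put \<sigma> v p) (\<lambda>\<sigma>'. of_bool (nontriv v' \<sigma>'))))) =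
      B * c * (\<Sum>v'\<leftarrow>ws. of_bool (snd v' = y) * Ex q u (v # vs) \<sigma> (\<lambda>\<sigma>'. of_bool (nontriv v' \<sigma>')))" for ws
    proof (induction ws)
      case (Cons w ws)
      have "(\<Sum>p\<in>UNIV. vwt (W q u) \<sigma> v p * (B * c * (of_bool (snd w = y) * Ex q u vs (put \<sigma> v p) (\<lambda>\<sigma>'. of_bool (nontriv w \<sigma>'))))) =
        B * c * (of_bool (snd w = y) * Ex q u (v # vs) \<sigma> (\<lambda>\<sigma>'. of_bool (nontriv w \<sigma>')))"
        unfolding Ex.simps sum_distrib_left by (intro sum.cong refl) (simp only: mult_ac)
      then show ?case using Cons by (simp add: distrib_left sum.distrib)
    qed simp
    show ?thesis unfolding sum.distrib s1 s2 ..
  qed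
  also have "\<dots> = B / (u * (1 - u) * (1 - q)) * (\<Sum>v'\<leftarrow>v # vs. of_bool (snd v' = y) * Ex q u (v # vs) \<sigma> (\<lambda>\<sigma>'. of_bool (nontriv v' \<sigma>')))"
    using nt by (simp add: c_def algebra_simps del: Ex.simps)
  finally show ?case .
qed simp

section \<open>The law of the sequentially sampled configuration\<close>

definition incoming :: "config \<Rightarrow> vertex \<Rightarrow> bool \<times> bool" where
  "incoming \<sigma> v = (\<sigma> (Ver (fst v) (snd v - 1)), \<sigma> (Hor (fst v) (snd v)))"

text \<open>Writes the choices into the configuration in the order of the list, in parallel to
  \<open>Ex\<close>. It links \<open>Ex\<close> to the sampling recursion \<open>s6v_sample\<close>
  on edges.\<close>

fun samp :: "vertex list \<Rightarrow> config \<Rightarrow> choices \<Rightarrow> config" where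
  "samp [] \<sigma> \<omega> = \<sigma>"
| "samp (v # vs) \<sigma> \<omega> = samp vs (put \<sigma> v (\<omega> (v, incoming \<sigma> v))) \<omega>"

lemma prob_space_choices: "prob_space (s6v_choices q u)"
  unfolding s6v_choices_def by (rule prob_space_PiM) (rule prob_space_measure_pmf)

lemma space_choices[simp]: "space (s6v_choices q u) = UNIV"
  by (simp add: s6v_choices_def space_PiM PiE_UNIV_domain)

lemma measurable_choice: "(\<lambda>\<omega>. \<omega> k) \<in> measurable (s6v_choices q u) (count_space UNIV)"
  unfolding s6v_choices_def using measurable_component_singleton[of k UNIV "\<lambda>k. measure_pmf (s6v_vertex_pmf q u (snd k))"]
  by simp

lemma choices_resample:
  "distr (measure_pmf (s6v_vertex_pmf q u (snd k)) \<Otimes>\<^sub>M s6v_choices q u) (s6v_choices q u) (\<lambda>(x, \<omega>). fun_upd \<omega> k x) = s6v_choices q u"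
proof -
  let ?p = "\<lambda>k :: vertex \<times> bool \<times> bool. measure_pmf (s6v_vertex_pmf q u (snd k))"
  have "distr (?p k \<Otimes>\<^sub>M Pi\<^sub>M UNIV ?p) (Pi\<^sub>M (insert k UNIV) ?p) (\<lambda>(x, \<omega>). fun_upd \<omega> k x) = Pi\<^sub>M (insert k UNIV) ?p"
    by (rule distr_pair_PiM_eq_PiM) (rule prob_space_measure_pmf)+
  then show ?thesis by (simp add: s6v_choices_def)
qed

text \<open>Replacing the entry \<open>k\<close> by a fresh copy preserves the law of the table, and
  \<open>h\<close> does not notice it; Fubini then separates the two factors.\<close>

lemma choice_indep:
  assumes h: "h \<in> borel_measurable (s6v_choices q u)" "\<And>\<omega>. \<bar>h \<omega>\<bar> \<le> B" and inv: "\<And>\<omega> a. h (fun_upd \<omega> k a) = h \<omega>"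
  shows "(\<integral>\<omega>. indicator S (\<omega> k) * h \<omega> \<partial>s6v_choices q u) = measure (measure_pmf (s6v_vertex_pmf q u (snd k))) S * (\<integral>\<omega>. h \<omega> \<partial>s6v_choices q u)"
proof -
  let ?M = "s6v_choices q u" and ?K = "measure_pmf (s6v_vertex_pmf q u (snd k))"
  interpret P: pair_prob_space ?K ?M
    by (simp add: pair_prob_space_def pair_sigma_finite_def prob_space_choices prob_space_measure_pmf prob_space_imp_sigma_finite)
  have [measurable]: "(\<lambda>(x, \<omega>). fun_upd \<omega> k x) \<in> measurable (?K \<Otimes>\<^sub>M ?M) ?M"
  proof -
    have "(\<lambda>(\<omega>, x). fun_upd \<omega> k x) \<in> measurable (?M \<Otimes>\<^sub>M ?K) ?M"
      using measurable_add_dim[of k UNIV "\<lambda>k. measure_pmf (s6v_vertex_pmf q u (snd k))"] by (simp add: s6v_choices_def)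
    from measurable_compose[OF measurable_pair_swap' this] show ?thesis by (simp add: case_prod_beta)
  qed
  have m1: "(\<lambda>\<omega>. indicator S (\<omega> k) * h \<omega>) \<in> borel_measurable ?M"
    by (intro borel_measurable_times measurable_compose[OF measurable_choice] h(1)) simp
  have m2: "(\<lambda>x. indicator S x :: real) \<in> borel_measurable ?K" by simp
  have "(\<integral>\<omega>. indicator S (\<omega> k) * h \<omega> \<partial>?M) = (\<integral>\<omega>. indicator S (\<omega> k) * h \<omega> \<partial>distr (?K \<Otimes>\<^sub>M ?M) ?M (\<lambda>(x, \<omega>). fun_upd \<omega> k x))"
    by (simp add: choices_resample)
  also have "\<dots> = (\<integral>z. indicator S (fst z) * h (snd z) \<partial>(?K \<Otimes>\<^sub>M ?M))"
    by (subst integral_distr) (use m1 in \<open>auto simp: case_prod_beta inv\<close>)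
  also have "\<dots> = (\<integral>x. (\<integral>\<omega>. indicator S x * h \<omega> \<partial>?M) \<partial>?K)"
  proof -
    have hm[measurable]: "h \<in> borel_measurable ?M" by (rule h(1))
    have "integrable (?K \<Otimes>\<^sub>M ?M) (\<lambda>z. indicator S (fst z) * h (snd z))"
    proof (rule P.integrable_const_bound[of _ B])
      have "\<bar>indicator S (fst z) * h (snd z)\<bar> \<le> B" for z using h(2)[of "snd z"] by (auto simp: indicator_def)
      then show "AE z in ?K \<Otimes>\<^sub>M ?M. norm (indicator S (fst z) * h (snd z)) \<le> B" by simp
      show "(\<lambda>z. indicator S (fst z) * h (snd z)) \<in> borel_measurable (?K \<Otimes>\<^sub>M ?M)"
        using measurable_compose[OF measurable_fst m2] by measurable
    qed
    from P.integral_fst'[OF this] show ?thesis by simp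
  qed
  also have "\<dots> = measure ?K S * (\<integral>\<omega>. h \<omega> \<partial>?M)" by simp
  finally show ?thesis .
qed

lemma samp_resample:
  assumes "v \<notin> set vs"
  shows "samp vs \<sigma> (fun_upd \<omega> (v, i) a) = samp vs \<sigma> \<omega>"
  using assms by (induction vs arbitrary: \<sigma>) auto

lemma measurable_samp: "(\<lambda>\<omega>. G (samp vs \<sigma> \<omega>)) \<in> measurable (s6v_choices q u) (count_space UNIV)"
proof (induction vs arbitrary: \<sigma>)
  case (Cons v vs)
  have "(\<lambda>\<omega>. G (samp vs (put \<sigma> v (\<omega> (v, incoming \<sigma> v))) \<omega>)) \<in> measurable (s6v_choices q u) (count_space UNIV)"
    by (rule measurable_compose_countable[of "\<lambda>p \<omega>. G (samp vs (put \<sigma> v p) \<omega>)", OF Cons.IH measurable_choice])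
  then show ?case by simp
qed simp

lemma vwt_pmf:
  assumes "0 \<le> q" "q < 1" "0 < u" "u < 1"
  shows "vwt (W q u) \<sigma> v p = pmf (s6v_vertex_pmf q u (incoming \<sigma> v)) p"
  using pmf_s6v_vertex_pmf[OF assms] by (cases v; cases p) (simp add: W_def incoming_def)

text \<open>A vertex occurs once in the list, so the later sampling does not use the table entry
  just read and is independent of it.\<close>

lemma integral_samp:
  assumes q: "0 \<le> q" "q < 1" and u: "0 < u" "u < 1" and ok: "okl vs" and g: "\<And>\<sigma>. \<bar>g \<sigma>\<bar> \<le> B"
  shows "(\<integral>\<omega>. g (samp vs \<sigma> \<omega>) \<partial>s6v_choices q u) = Ex q u vs \<sigma> g"
  using ok
proof (induction vs arbitrary: \<sigma>)
  case Nil
  interpret prob_space "s6v_choices q u" by (rule prob_space_choices)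
  show ?case using prob_space by simp
next
  case (Cons v vs)
  interpret prob_space "s6v_choices q u" by (rule prob_space_choices)
  have gm: "g \<in> measurable (count_space UNIV) borel" by simp
  have m: "(\<lambda>\<omega>. g (samp vs \<sigma> \<omega>)) \<in> borel_measurable (s6v_choices q u)" for \<sigma> vs
    using measurable_compose[OF measurable_samp[of "\<lambda>x. x"] gm] .
  let ?k = "(v, incoming \<sigma> v)"
  have int: "integrable (s6v_choices q u) (\<lambda>\<omega>. indicator {p} (\<omega> ?k) * g (samp vs (put \<sigma> v p) \<omega>))" for p
  proof (rule integrable_const_bound[of _ B])
    have "\<bar>indicator {p} (\<omega> ?k) * g (samp vs (put \<sigma> v p) \<omega>)\<bar> \<le> B" for \<omega>
      using g[of "samp vs (put \<sigma> v p) \<omega>"] by (auto simp: indicator_def)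
    then show "AE \<omega> in s6v_choices q u. norm (indicator {p} (\<omega> ?k) * g (samp vs (put \<sigma> v p) \<omega>)) \<le> B" by simp
    show "(\<lambda>\<omega>. indicator {p} (\<omega> ?k) * g (samp vs (put \<sigma> v p) \<omega>)) \<in> borel_measurable (s6v_choices q u)"
      using m measurable_compose[OF measurable_choice[of ?k], of "indicator {p} :: _ \<Rightarrow> real" borel] by (intro borel_measurable_times) auto
  qed
  have "(\<integral>\<omega>. g (samp (v # vs) \<sigma> \<omega>) \<partial>s6v_choices q u) = (\<integral>\<omega>. (\<Sum>p\<in>UNIV. indicator {p} (\<omega> ?k) * g (samp vs (put \<sigma> v p) \<omega>)) \<partial>s6v_choices q u)"
  proof (rule Bochner_Integration.integral_cong[OF refl])
    fix \<omega> :: choices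
    have "(\<Sum>p\<in>UNIV. indicator {p} (\<omega> ?k) * g (samp vs (put \<sigma> v p) \<omega>)) = (\<Sum>p\<in>UNIV. if p = \<omega> ?k then g (samp vs (put \<sigma> v p) \<omega>) else 0)"
      by (intro sum.cong refl) (auto simp: indicator_def)
    then show "g (samp (v # vs) \<sigma> \<omega>) = (\<Sum>p\<in>UNIV. indicator {p} (\<omega> ?k) * g (samp vs (put \<sigma> v p) \<omega>))" by simp
  qed
  also have "\<dots> = (\<Sum>p\<in>UNIV. \<integral>\<omega>. indicator {p} (\<omega> ?k) * g (samp vs (put \<sigma> v p) \<omega>) \<partial>s6v_choices q u)"
    by (rule Bochner_Integration.integral_sum) (rule int)
  also have "\<dots> = (\<Sum>p\<in>UNIV. vwt (W q u) \<sigma> v p * Ex q u vs (put \<sigma> v p) g)"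
  proof (rule sum.cong[OF refl])
    fix p :: "bool \<times> bool"
    have "v \<notin> set vs" using Cons.prems by simp
    then have "(\<integral>\<omega>. indicator {p} (\<omega> ?k) * g (samp vs (put \<sigma> v p) \<omega>) \<partial>s6v_choices q u) =
      measure (measure_pmf (s6v_vertex_pmf q u (snd ?k))) {p} * (\<integral>\<omega>. g (samp vs (put \<sigma> v p) \<omega>) \<partial>s6v_choices q u)"
      by (intro choice_indep[where B = B] m g) (simp add: samp_resample)
    then show "(\<integral>\<omega>. indicator {p} (\<omega> ?k) * g (samp vs (put \<sigma> v p) \<omega>) \<partial>s6v_choices q u) = vwt (W q u) \<sigma> v p * Ex q u vs (put \<sigma> v p) g"
      using Cons vwt_pmf[OF q u] by (simp add: measure_pmf_single)
  qed
  finally show ?case by simp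
qed

text \<open>The value \<open>False\<close> away from the boundary is a placeholder, overwritten
  inside a sampled box before it is read.\<close>

definition boundary :: "(nat \<Rightarrow> bool) \<Rightarrow> (nat \<Rightarrow> bool) \<Rightarrow> config" where
  "boundary left bottom = (\<lambda>e\<in>quad_edges. case e of Hor i l \<Rightarrow> i = 0 \<and> left l | Ver i l \<Rightarrow> l = 0 \<and> bottom i)"

text \<open>\<open>E\<close> holds the edges that already have their sampled values. If each vertex
  reads only such edges, writing its choice enlarges this set.\<close>

lemma samp_sample:
  assumes "\<forall>v\<in>set vs. 1 \<le> snd v" "\<forall>e\<in>E. \<sigma> e = s6v_sample left bottom \<omega> e"
    and "\<And>ws v ws'. vs = ws @ v # ws' \<Longrightarrow> vreads v \<subseteq> E \<union> (\<Union>w\<in>set ws. vwrites w)"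
  shows "\<forall>e\<in>E \<union> (\<Union>w\<in>set vs. vwrites w). samp vs \<sigma> \<omega> e = s6v_sample left bottom \<omega> e"
  using assms
proof (induction vs arbitrary: \<sigma> E)
  case (Cons v vs)
  obtain x y where v: "v = (x, y)" by (cases v)
  obtain y' where y: "y = Suc y'" using Cons.prems(1) v by (cases y) auto
  have "vreads v \<subseteq> E" using Cons.prems(3)[of "[]"] by simp
  then have inc: "incoming \<sigma> v = (s6v_sample left bottom \<omega> (Ver x y'), s6v_sample left bottom \<omega> (Hor x y))"
    using Cons.prems(2) by (simp add: incoming_def v y)
  define p where "p = \<omega> (v, incoming \<sigma> v)"
  have p: "fst p = s6v_sample left bottom \<omega> (Ver x y)" "snd p = s6v_sample left bottom \<omega> (Hor (Suc x) y)"
    unfolding p_def inc by (simp_all add: v y)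
  have "\<forall>e\<in>(E \<union> vwrites v) \<union> (\<Union>w\<in>set vs. vwrites w). samp vs (put \<sigma> v p) \<omega> e = s6v_sample left bottom \<omega> e"
  proof (rule Cons.IH)
    show "\<forall>e\<in>E \<union> vwrites v. put \<sigma> v p e = s6v_sample left bottom \<omega> e"
      using Cons.prems(2) p by (cases p) (auto simp: v)
    fix ws w ws' assume "vs = ws @ w # ws'"
    then show "vreads w \<subseteq> E \<union> vwrites v \<union> (\<Union>w\<in>set ws. vwrites w)"
      using Cons.prems(3)[of "v # ws" w ws'] by auto
  qed (use Cons.prems in auto)
  then show ?case by (simp add: p_def Un_assoc)
qed simp

lemma samp_box:
  assumes e: "e \<in> quad_edges" "incol N e" "row e \<le> H"
  shows "samp (boxl H 0 N) (boundary left bottom) \<omega> e = s6v_sample left bottom \<omega> e"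
proof -
  define E where "E = {Hor 0 l |l. 1 \<le> l} \<union> range (\<lambda>i. Ver i 0)"
  have "\<forall>e\<in>E \<union> (\<Union>w\<in>set (boxl H 0 N). vwrites w). samp (boxl H 0 N) (boundary left bottom) \<omega> e = s6v_sample left bottom \<omega> e"
  proof (rule samp_sample)
    show "\<forall>e\<in>E. boundary left bottom e = s6v_sample left bottom \<omega> e" by (auto simp: E_def boundary_def)
    fix ws v ws' assume eq: "boxl H 0 N = ws @ v # ws'"
    obtain x y where v: "v = (x, y)" by (cases v)
    have "v \<in> set (boxl H 0 N)" using eq by simp
    then have xy: "x \<le> N" "1 \<le> y" "y \<le> H" by (auto simp: set_boxl v)
    have before: "w \<in> set ws" if "w \<in> set (boxl H 0 N)" "vless w v" for w
    proof (rule ccontr)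
      assume "w \<notin> set ws"
      then have "w = v \<or> vless v w" using that(1) sorted_boxl[of H 0 N] unfolding eq by (auto simp: sorted_wrt_append)
      then show False using that(2) by (auto simp: vless_def)
    qed
    have 1: "Ver x (y - 1) \<in> E \<union> (\<Union>w\<in>set ws. vwrites w)"
    proof (cases "y = 1")
      case False
      then have "(x, y - 1) \<in> set ws" using xy by (intro before) (auto simp: set_boxl v vless_def)
      then show ?thesis by force
    qed (simp add: E_def)
    have 2: "Hor x y \<in> E \<union> (\<Union>w\<in>set ws. vwrites w)"
    proof (cases x)
      case (Suc x')
      then have "(x', y) \<in> set ws" using xy by (intro before) (auto simp: set_boxl v vless_def)
      then show ?thesis using Suc by force
    qed (use xy in \<open>simp add: E_def\<close>)
    show "vreads v \<subseteq> E \<union> (\<Union>w\<in>set ws. vwrites w)" using 1 2 by (simp add: v)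
  qed (auto simp: set_boxl)
  moreover have "e \<in> E \<union> (\<Union>w\<in>set (boxl H 0 N). vwrites w)"
  proof (cases e)
    case (Hor i l)
    then show ?thesis using e
    proof (cases i)
      case (Suc i')
      then have "(i', l) \<in> set (boxl H 0 N)" using e Hor by (simp add: set_boxl)
      then show ?thesis using Hor Suc by force
    qed (auto simp: E_def)
  next
    case (Ver i l)
    then show ?thesis using e
    proof (cases "l = 0")
      case False
      then have "(i, l) \<in> set (boxl H 0 N)" using e Ver by (simp add: set_boxl)
      then show ?thesis using Ver by force
    qed (auto simp: E_def)
  qed
  ultimately show ?thesis by blast
qed

lemma sample_measurable:
  "(\<lambda>\<omega>. s6v_sample left bottom \<omega> e) \<in> measurable (s6v_choices q u) (count_space UNIV)" if "e \<in> quad_edges"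
proof -
  obtain N where "incol N e" using incol_bound by blast
  then have "s6v_sample left bottom \<omega> e = samp (boxl (row e) 0 N) (boundary left bottom) \<omega> e" for \<omega>
    using samp_box[OF that, of N "row e"] by simp
  then show ?thesis using measurable_samp[of "\<lambda>\<sigma>. \<sigma> e"] by simp
qed

lemma measurable_sample_config:
  "(\<lambda>\<omega>. restrict (s6v_sample left bottom \<omega>) quad_edges) \<in> measurable (s6v_choices q u) config_space"
  by (rule measurable_into_config) (use sample_measurable in auto)

lemma prob_space_law: "prob_space (s6v_law q u left bottom)"
  unfolding s6v_law_def by (rule prob_space.prob_space_distr[OF prob_space_choices measurable_sample_config])

lemma sets_law[simp]: "sets (s6v_law q u left bottom) = sets config_space"
  by (simp add: s6v_law_def)

lemma integral_law_box:
  fixes f :: "config \<Rightarrow> real"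
  assumes q: "0 \<le> q" "q < 1" and u: "0 < u" "u < 1" and f: "box_fun N H f"
  shows "(\<integral>\<sigma>. f \<sigma> \<partial>s6v_law q u left bottom) = Ex q u (boxl H 0 N) (boundary left bottom) f"
proof -
  obtain B where B: "\<And>\<sigma>. \<bar>f \<sigma>\<bar> \<le> B" using box_fun_bounded[OF f] by blast
  have "(\<integral>\<sigma>. f \<sigma> \<partial>s6v_law q u left bottom) = (\<integral>\<omega>. f (restrict (s6v_sample left bottom \<omega>) quad_edges) \<partial>s6v_choices q u)"
    unfolding s6v_law_def by (rule integral_distr[OF measurable_sample_config]) (rule box_fun_measurable[OF f], simp)
  also have "\<dots> = (\<integral>\<omega>. f (samp (boxl H 0 N) (boundary left bottom) \<omega>) \<partial>s6v_choices q u)"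
  proof (rule Bochner_Integration.integral_cong[OF refl], rule box_funD[OF f])
    fix \<omega>
    show "agree N {..H} (restrict (s6v_sample left bottom \<omega>) quad_edges) (samp (boxl H 0 N) (boundary left bottom) \<omega>)"
      unfolding agree_def using samp_box by auto
  qed
  also have "\<dots> = Ex q u (boxl H 0 N) (boundary left bottom) f"
    by (rule integral_samp[OF q u okl_boxl B])
  finally show ?thesis .
qed

section \<open>Frozen columns\<close>

text \<open>Demanded of all entries of the table, including those never selected. It holds almost
  surely, as outcomes violating it have weight zero, and allows pathwise arguments.\<close>

definition conserving :: "choices \<Rightarrow> bool" where
  "conserving \<omega> \<longleftrightarrow> (\<forall>v i l. (i \<and> l \<longleftrightarrow> fst (\<omega> (v, i, l)) \<and> snd (\<omega> (v, i, l))) \<and> (i \<or> l \<longleftrightarrow> fst (\<omega> (v, i, l)) \<or> snd (\<omega> (v, i, l))))"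

lemma AE_conserving:
  assumes q: "0 \<le> q" "q < 1" and u: "0 < u" "u < 1"
  shows "AE \<omega> in s6v_choices q u. conserving \<omega>"
proof -
  have "AE \<omega> in s6v_choices q u. \<forall>k. (fst (snd k) \<and> snd (snd k) \<longleftrightarrow> fst (\<omega> k) \<and> snd (\<omega> k)) \<and> (fst (snd k) \<or> snd (snd k) \<longleftrightarrow> fst (\<omega> k) \<or> snd (\<omega> k))"
    unfolding AE_all_countable
  proof
    fix k :: "vertex \<times> bool \<times> bool"
    let ?P = "\<lambda>p. (fst (snd k) \<and> snd (snd k) \<longleftrightarrow> fst p \<and> snd p) \<and> (fst (snd k) \<or> snd (snd k) \<longleftrightarrow> fst p \<or> snd p)"
    have "?P p" if "p \<in> set_pmf (s6v_vertex_pmf q u (snd k))" for p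
    proof -
      have "pmf (s6v_vertex_pmf q u (fst (snd k), snd (snd k))) (fst p, snd p) \<noteq> 0" using that by (simp add: set_pmf_iff)
      then have "W q u (fst (snd k)) (snd (snd k)) (fst p) (snd p) \<noteq> 0"
        unfolding pmf_s6v_vertex_pmf[OF q u] W_def .
      then show ?thesis by (cases "fst (snd k)"; cases "snd (snd k)"; cases "fst p"; cases "snd p") (simp_all add: W_simps)
    qed
    then have "AE p in measure_pmf (s6v_vertex_pmf q u (snd k)). ?P p" by (simp add: AE_measure_pmf_iff)
    then show "AE \<omega> in s6v_choices q u. ?P (\<omega> k)"
      unfolding s6v_choices_def by (intro AE_PiM_component[where P = ?P]) (auto intro: prob_space_measure_pmf)
  qed
  then show ?thesis
  proof eventually_elim
    case (elim \<omega>)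
    then show ?case unfolding conserving_def by (metis fst_conv snd_conv)
  qed
qed

lemma sample_conserve:
  assumes "conserving \<omega>" "1 \<le> y"
  shows "(s6v_sample left bottom \<omega> (Ver x (y - 1)) \<and> s6v_sample left bottom \<omega> (Hor x y) \<longleftrightarrow> s6v_sample left bottom \<omega> (Ver x y) \<and> s6v_sample left bottom \<omega> (Hor (Suc x) y)) \<and>
    (s6v_sample left bottom \<omega> (Ver x (y - 1)) \<or> s6v_sample left bottom \<omega> (Hor x y) \<longleftrightarrow> s6v_sample left bottom \<omega> (Ver x y) \<or> s6v_sample left bottom \<omega> (Hor (Suc x) y))"
proof -
  obtain y' where y: "y = Suc y'" using assms(2) by (cases y) auto
  show ?thesis using assms(1) unfolding y conserving_def by simp
qed

text \<open>An entry at height \<open>l\<close> cannot influence lower rows. Hence the choice made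
  in the next row is independent of what has been sampled up to the present row.\<close>

lemma sample_resample:
  "row e < l \<Longrightarrow> s6v_sample left bottom (fun_upd \<omega> ((x, l), i) a) e = s6v_sample left bottom \<omega> e"
proof (induction left bottom "fun_upd \<omega> ((x, l), i) a" e rule: s6v_sample.induct)
  case (2 left bottom x' y)
  then show ?case by simp
next
  case (4 left bottom x' y)
  have "y - 1 < l" "y < l" using 4(3) by auto
  then show ?case using 4(1,2) by simp
qed simp_all

definition frozen :: "bool \<Rightarrow> (nat \<Rightarrow> bool) \<Rightarrow> nat \<Rightarrow> nat \<Rightarrow> choices \<Rightarrow> bool" where
  "frozen j bottom n y \<omega> \<longleftrightarrow> (\<forall>x<n. s6v_sample (\<lambda>_. j) bottom \<omega> (Ver x y) = j)"

text \<open>If the incoming edges of a vertex are both in the state \<open>j\<close>, conservation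
  forces the outgoing ones to be; starting from the left boundary this runs along the row.\<close>

lemma frozen_hor:
  assumes c: "conserving \<omega>" and f: "frozen j bottom n y \<omega>" and i: "i \<le> n"
  shows "s6v_sample (\<lambda>_. j) bottom \<omega> (Hor i (Suc y)) = j"
  using i
proof (induction i)
  case (Suc i)
  have "s6v_sample (\<lambda>_. j) bottom \<omega> (Ver i y) = j" using f Suc by (simp add: frozen_def)
  then show ?case using sample_conserve[OF c, of "Suc y" "\<lambda>_. j" bottom i] Suc by (cases j) auto
qed simp

lemma frozen_Suc:
  assumes c: "conserving \<omega>" and f: "frozen j bottom n y \<omega>"
  shows "frozen j bottom n (Suc y) \<omega>"
  unfolding frozen_def
proof (intro allI impI)
  fix x assume x: "x < n"
  have "s6v_sample (\<lambda>_. j) bottom \<omega> (Ver x y) = j" using f x by (simp add: frozen_def)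
  then show "s6v_sample (\<lambda>_. j) bottom \<omega> (Ver x (Suc y)) = j"
    using frozen_hor[OF c f, of x] sample_conserve[OF c, of "Suc y" "\<lambda>_. j" bottom x] x by (cases j) auto
qed

lemma frozen_le:
  assumes "conserving \<omega>" "frozen j bottom n y \<omega>" "y \<le> y'"
  shows "frozen j bottom n y' \<omega>"
  using assms(3) by (induction rule: dec_induct) (use assms frozen_Suc in auto)

lemma frozen_sets: "{\<omega>. \<not> frozen j bottom n y \<omega>} \<in> sets (s6v_choices q u)"
proof -
  have "{\<omega> \<in> space (s6v_choices q u). \<exists>x\<in>{..<n}. s6v_sample (\<lambda>_. j) bottom \<omega> (Ver x y) \<noteq> j} \<in> sets (s6v_choices q u)"
  proof (rule sets.sets_Collect_finite_Ex)
    fix x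
    have "(\<lambda>\<omega>. s6v_sample (\<lambda>_. j) bottom \<omega> (Ver x y)) \<in> measurable (s6v_choices q u) (count_space UNIV)"
      by (rule sample_measurable) simp
    from measurable_sets[OF this, of "- {j}"]
    show "{\<omega> \<in> space (s6v_choices q u). s6v_sample (\<lambda>_. j) bottom \<omega> (Ver x y) \<noteq> j} \<in> sets (s6v_choices q u)"
      by (simp add: vimage_def)
  qed simp
  then show ?thesis by (simp add: frozen_def Bex_def)
qed

text \<open>The probability that a vertex whose left edge is \<open>j\<close> and bottom edge is not
  lets both pass straight on. It is \<open>(1 - u) / (1 - q * u)\<close> or \<open>q\<close> times
  this, depending on \<open>j\<close>.\<close>

lemma leave_prob:
  assumes q: "0 \<le> q" "q < 1" and u: "0 < u" "u < 1"
  shows "measure (measure_pmf (s6v_vertex_pmf q u (\<not> j, j))) {p. fst p = (\<not> j)} \<le> 1 - u * (1 - q)"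
proof -
  have qu: "q * u < 1" using q u by (smt (verit) mult_left_le_one_le)
  have "{p :: bool \<times> bool. fst p = (\<not> j)} = {(\<not> j, True), (\<not> j, False)}" by auto
  then have "measure (measure_pmf (s6v_vertex_pmf q u (\<not> j, j))) {p. fst p = (\<not> j)} =
    W q u (\<not> j) j (\<not> j) True + W q u (\<not> j) j (\<not> j) False"
    by (simp add: measure_measure_pmf_finite pmf_s6v_vertex_pmf[OF q u] W_def)
  also have "\<dots> \<le> (1 - u) / (1 - q * u)"
  proof -
    have "q * u \<le> u" using q u by (simp add: mult_left_le_one_le)
    then have "q * (1 - u) / (1 - q * u) \<le> (1 - u) / (1 - q * u)"
      using q u qu by (intro divide_right_mono) (simp_all add: mult_left_le_one_le less_imp_le)
    then show ?thesis by (cases j) (simp_all add: W_simps)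
  qed
  also have "(1 - u) / (1 - q * u) = 1 - u * (1 - q) / (1 - q * u)"
  proof -
    have "1 - q * u \<noteq> 0" using qu by simp
    moreover have "1 - u = (1 - q * u) - u * (1 - q)" by (simp add: algebra_simps)
    ultimately show ?thesis by (metis diff_divide_distrib divide_self)
  qed
  also have "\<dots> \<le> 1 - u * (1 - q)"
  proof -
    have "0 \<le> q * u" using q u by simp
    then have "u * (1 - q) / 1 \<le> u * (1 - q) / (1 - q * u)" using q u qu by (intro divide_left_mono) auto
    then show ?thesis by simp
  qed
  finally show ?thesis .
qed

text \<open>
  Once the columns to its left are frozen, a column which is not yet frozen freezes in the next row with
  probability at least \<open>d\<close>.
\<close>

lemma prob_not_frozen:
  assumes q: "0 \<le> q" "q < 1" and u: "0 < u" "u < 1" and d: "0 < d" "d \<le> u * (1 - q)"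
  shows "measure (s6v_choices q u) {\<omega>. \<not> frozen j bottom n y \<omega>} \<le> (2 / d) ^ n * (1 - d / 2) ^ y"
proof (induction y arbitrary: n)
  interpret prob_space "s6v_choices q u" by (rule prob_space_choices)
  have "u * (1 - q) \<le> 1" using q u by (simp add: mult_le_one)
  then have d1: "d \<le> 1" using d by linarith
  case 0
  have "1 \<le> (2 / d) ^ n" using d d1 by (intro one_le_power) (simp add: field_simps)
  then show ?case using order_trans[OF prob_le_1] by simp
next
  case (Suc y)
  interpret prob_space "s6v_choices q u" by (rule prob_space_choices)
  have "u * (1 - q) \<le> 1" using q u by (simp add: mult_le_one)
  then have d1: "d \<le> 1" using d by linarith
  show ?case
  proof (cases n)
    case 0
    then show ?thesis using d d1 by (simp add: frozen_def)
  next
    case n: (Suc m)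
    let ?k = "((m, Suc y), (\<not> j, j))"
    define A where "A = {\<omega>. \<not> frozen j bottom m y \<omega>}"
    \<comment> \<open>If the first \<open>m\<close> columns are frozen but column \<open>m\<close>
      stays unfrozen, its vertex in the next row receives \<open>j\<close> from the left and lets
      its vertical state pass. The table entry responsible is independent of the rows up to
      \<open>y\<close>.\<close>
    define B where "B = {\<omega>. fst (\<omega> ?k) = (\<not> j) \<and> \<not> frozen j bottom n y \<omega>}"
    have mA: "A \<in> events" unfolding A_def by (rule frozen_sets)
    have mk: "{\<omega>. fst (\<omega> ?k) = (\<not> j)} \<in> events"
      using measurable_sets[OF measurable_choice[of ?k], of "{p. fst p = (\<not> j)}"] by (simp add: vimage_def)
    have mB: "B \<in> events" unfolding B_def using sets.Int[OF mk frozen_sets[of j bottom n y]] by (simp add: Int_def)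
    have "prob {\<omega>. \<not> frozen j bottom n (Suc y) \<omega>} \<le> prob (A \<union> B)"
    proof (rule finite_measure_mono_AE)
      show "AE \<omega> in s6v_choices q u. \<omega> \<in> {\<omega>. \<not> frozen j bottom n (Suc y) \<omega>} \<longrightarrow> \<omega> \<in> A \<union> B"
        using AE_conserving[OF q u]
      proof eventually_elim
        case (elim \<omega>)
        show ?case
        proof
          assume "\<omega> \<in> {\<omega>. \<not> frozen j bottom n (Suc y) \<omega>}"
          then have nf: "\<not> frozen j bottom n (Suc y) \<omega>" by simp
          show "\<omega> \<in> A \<union> B"
          proof (cases "frozen j bottom m y \<omega>")
            case True
            have fS: "frozen j bottom m (Suc y) \<omega>" by (rule frozen_Suc[OF elim True])
            have nf': "\<not> frozen j bottom n y \<omega>" using frozen_Suc[OF elim] nf by blast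
            then have V: "s6v_sample (\<lambda>_. j) bottom \<omega> (Ver m y) = (\<not> j)" using True unfolding frozen_def n by (auto simp: less_Suc_eq)
            have V': "s6v_sample (\<lambda>_. j) bottom \<omega> (Ver m (Suc y)) = (\<not> j)" using fS nf unfolding frozen_def n by (auto simp: less_Suc_eq)
            have "s6v_sample (\<lambda>_. j) bottom \<omega> (Hor m (Suc y)) = j" by (rule frozen_hor[OF elim True]) simp
            then have "fst (\<omega> ?k) = (\<not> j)" using V V' by simp
            then show ?thesis using nf' by (simp add: B_def)
          qed (simp add: A_def)
        qed
      qed
    qed (use mA mB in auto)
    also have "\<dots> \<le> prob A + prob B" by (rule measure_Un_le[OF mA mB])
    also have "prob B \<le> (1 - d) * prob {\<omega>. \<not> frozen j bottom n y \<omega>}"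
    proof -
      have "prob B = (\<integral>\<omega>. indicator {p. fst p = (\<not> j)} (\<omega> ?k) * indicator {\<omega>. \<not> frozen j bottom n y \<omega>} \<omega> \<partial>s6v_choices q u)"
      proof -
        have "indicator {p. fst p = (\<not> j)} (\<omega> ?k) * indicator {\<omega>. \<not> frozen j bottom n y \<omega>} \<omega> = (indicator B \<omega> :: real)" for \<omega>
          by (auto simp: B_def indicator_def)
        then show ?thesis using mB by simp
      qed
      also have "\<dots> = measure (measure_pmf (s6v_vertex_pmf q u (snd ?k))) {p. fst p = (\<not> j)} * (\<integral>\<omega>. indicator {\<omega>. \<not> frozen j bottom n y \<omega>} \<omega> \<partial>s6v_choices q u)"
      proof (rule choice_indep[where B = 1])
        show "indicator {\<omega>. \<not> frozen j bottom n y \<omega>} \<in> borel_measurable (s6v_choices q u)"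
          by (rule borel_measurable_indicator) (rule frozen_sets)
        fix \<omega> a
        have "frozen j bottom n y (fun_upd \<omega> ?k a) = frozen j bottom n y \<omega>"
          unfolding frozen_def by (simp add: sample_resample)
        then show "(indicator {\<omega>. \<not> frozen j bottom n y \<omega>} (fun_upd \<omega> ?k a) :: real) = indicator {\<omega>. \<not> frozen j bottom n y \<omega>} \<omega>"
          by (simp add: indicator_def)
      qed (simp add: indicator_def)
      also have "\<dots> = measure (measure_pmf (s6v_vertex_pmf q u (\<not> j, j))) {p. fst p = (\<not> j)} * prob {\<omega>. \<not> frozen j bottom n y \<omega>}"
        using frozen_sets by simp
      also have "\<dots> \<le> (1 - d) * prob {\<omega>. \<not> frozen j bottom n y \<omega>}"
        using leave_prob[OF q u, of j] d by (intro mult_right_mono) auto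
      finally show ?thesis .
    qed
    also have "prob A + (1 - d) * prob {\<omega>. \<not> frozen j bottom n y \<omega>} \<le> (2 / d) ^ m * (1 - d / 2) ^ y + (1 - d) * ((2 / d) ^ n * (1 - d / 2) ^ y)"
      unfolding A_def using Suc.IH d1 by (intro add_mono mult_left_mono) auto
    \<comment> \<open>One column fewer is worth a factor \<open>d / 2\<close>, and
      \<open>d / 2 + (1 - d) = 1 - d / 2\<close>. The form of the bound is chosen so that the
      recursion closes with equality.\<close>
    also have "\<dots> = (2 / d) ^ n * (1 - d / 2) ^ Suc y"
    proof -
      have "(2 / d) ^ m = (2 / d) ^ n * (d / 2)" using d by (simp add: n)
      then show ?thesis by (simp add: algebra_simps)
    qed
    finally show ?thesis by simp
  qed
qed

lemma frozen_trivial: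
  assumes c: "conserving \<omega>" and f: "frozen j bottom (Suc N) y \<omega>" and x: "x \<le> N" and y': "y < y'"
  shows "s6v_sample (\<lambda>_. j) bottom \<omega> (Ver x (y' - 1)) = j" "s6v_sample (\<lambda>_. j) bottom \<omega> (Hor x y') = j"
    "s6v_sample (\<lambda>_. j) bottom \<omega> (Ver x y') = j" "s6v_sample (\<lambda>_. j) bottom \<omega> (Hor (Suc x) y') = j"
proof -
  have f1: "frozen j bottom (Suc N) (y' - 1) \<omega>" "frozen j bottom (Suc N) y' \<omega>"
    using y' by (auto intro!: frozen_le[OF c f])
  then show "s6v_sample (\<lambda>_. j) bottom \<omega> (Ver x (y' - 1)) = j" "s6v_sample (\<lambda>_. j) bottom \<omega> (Ver x y') = j"
    using x by (auto simp: frozen_def)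
  show "s6v_sample (\<lambda>_. j) bottom \<omega> (Hor x y') = j" "s6v_sample (\<lambda>_. j) bottom \<omega> (Hor (Suc x) y') = j"
    using frozen_hor[OF c f1(1), of x] frozen_hor[OF c f1(1), of "Suc x"] x y' by (simp_all del: s6v_sample.simps)
qed

text \<open>The probability that \<open>n\<close> columns never freeze is below every term of a null
  sequence. Above a frozen row all edges of these columns are in the state \<open>j\<close>.\<close>

lemma AE_law_regular:
  assumes q: "0 \<le> q" "q < 1" and u: "0 < u" "u < 1"
  shows "AE \<sigma> in s6v_law q u (\<lambda>_. j) bottom. \<sigma> \<in> regular_configurations"
proof -
  interpret prob_space "s6v_choices q u" by (rule prob_space_choices)
  define d where "d = u * (1 - q)"
  have d: "0 < d" "d \<le> u * (1 - q)" "d \<le> 1" using q u by (auto simp: d_def mult_le_one)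
  have "AE \<omega> in s6v_choices q u. \<forall>n. \<exists>y. frozen j bottom n y \<omega>"
    unfolding AE_all_countable
  proof
    fix n
    define V where "V = (\<Inter>y. {\<omega>. \<not> frozen j bottom n y \<omega>})"
    have mV: "V \<in> events" unfolding V_def using frozen_sets by (intro sets.countable_INT) auto
    have "prob V \<le> (2 / d) ^ n * (1 - d / 2) ^ y" for y
      by (rule order_trans[OF finite_measure_mono[OF _ frozen_sets] prob_not_frozen[OF q u d(1,2)]]) (auto simp: V_def)
    moreover have "(\<lambda>y. (2 / d) ^ n * (1 - d / 2) ^ y) \<longlonglongrightarrow> (2 / d) ^ n * 0"
      by (intro tendsto_intros LIMSEQ_realpow_zero) (use d in auto)
    ultimately have "prob V \<le> 0" using LIMSEQ_le_const[of "\<lambda>y. (2 / d) ^ n * (1 - d / 2) ^ y" 0 "prob V"] by auto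
    then have "V \<in> null_sets (s6v_choices q u)" using mV by (auto simp: null_sets_def emeasure_eq_measure measure_le_0_iff)
    then have "AE \<omega> in s6v_choices q u. \<omega> \<notin> V" by (rule AE_not_in)
    then show "AE \<omega> in s6v_choices q u. \<exists>y. frozen j bottom n y \<omega>" by (rule AE_mp) (simp add: V_def)
  qed
  then have "AE \<omega> in s6v_choices q u. restrict (s6v_sample (\<lambda>_. j) bottom \<omega>) quad_edges \<in> regular_configurations"
    using AE_conserving[OF q u]
  proof eventually_elim
    case (elim \<omega>)
    let ?S = "restrict (s6v_sample (\<lambda>_. j) bottom \<omega>) quad_edges"
    show ?case
      unfolding regular_iff
    proof (intro conjI allI)
      show "?S \<in> configurations"
        unfolding configurations_def vertex_type_conserve using sample_conserve[OF elim(2), of _ "\<lambda>_. j" bottom] by simp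
      fix N
      obtain y where y: "frozen j bottom (Suc N) y \<omega>" using elim(1) by blast
      have "vertex_type ?S (x, y') = (of_bool j, of_bool j, of_bool j, of_bool j)" if "x \<le> N" "Suc y \<le> y'" for x y'
        using frozen_trivial[OF elim(2) y, of x y'] that by (simp del: s6v_sample.simps)
      then have "triv N (Suc y) ?S" unfolding triv_def by (cases j) (simp_all del: s6v_sample.simps vertex_type.simps)
      then show "\<exists>L. triv N L ?S" by blast
    qed
  qed
  moreover have "{\<sigma> \<in> space config_space. \<sigma> \<in> regular_configurations} \<in> sets config_space"
    using regular_sets regular_space by (metis (no_types, lifting) Collect_cong Collect_mem_eq)
  ultimately show ?thesis
    unfolding s6v_law_def by (subst AE_distr_iff[OF measurable_sample_config]) auto
qed

text \<open>Different incoming edges at the height \<open>Suc y\<close> show that the columns were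
  not frozen at the height \<open>y\<close>.\<close>

lemma Ex_nontriv_le:
  assumes q: "0 \<le> q" "q < 1" and u: "0 < u" "u < 1" and d: "0 < d" "d \<le> u * (1 - q)" and x: "x \<le> N" and y: "y < H"
  shows "Ex q u (boxl H 0 N) (boundary (\<lambda>_. j) bottom) (\<lambda>\<sigma>. of_bool (nontriv (x, Suc y) \<sigma>)) \<le> (2 / d) ^ Suc N * (1 - d / 2) ^ y"
proof -
  interpret prob_space "s6v_choices q u" by (rule prob_space_choices)
  have "Ex q u (boxl H 0 N) (boundary (\<lambda>_. j) bottom) (\<lambda>\<sigma>. of_bool (nontriv (x, Suc y) \<sigma>)) =
    (\<integral>\<omega>. of_bool (nontriv (x, Suc y) (samp (boxl H 0 N) (boundary (\<lambda>_. j) bottom) \<omega>)) \<partial>s6v_choices q u)"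
    by (rule integral_samp[symmetric, OF q u okl_boxl, of _ 1]) simp
  also have "\<dots> \<le> (\<integral>\<omega>. indicator {\<omega>. \<not> frozen j bottom (Suc N) y \<omega>} \<omega> \<partial>s6v_choices q u)"
  proof (rule integral_mono_AE)
    show "integrable (s6v_choices q u) (\<lambda>\<omega>. of_bool (nontriv (x, Suc y) (samp (boxl H 0 N) (boundary (\<lambda>_. j) bottom) \<omega>)) :: real)"
    proof (rule integrable_const_bound[of _ 1])
      show "(\<lambda>\<omega>. of_bool (nontriv (x, Suc y) (samp (boxl H 0 N) (boundary (\<lambda>_. j) bottom) \<omega>)) :: real) \<in> borel_measurable (s6v_choices q u)"
        by (rule measurable_compose[OF measurable_samp[of "\<lambda>\<sigma>. nontriv (x, Suc y) \<sigma>"]]) simp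
    qed simp
    show "integrable (s6v_choices q u) (\<lambda>\<omega>. indicator {\<omega>. \<not> frozen j bottom (Suc N) y \<omega>} \<omega> :: real)"
      using frozen_sets by (intro integrable_real_indicator) (auto simp: emeasure_eq_measure)
    show "AE \<omega> in s6v_choices q u. of_bool (nontriv (x, Suc y) (samp (boxl H 0 N) (boundary (\<lambda>_. j) bottom) \<omega>)) \<le> (indicator {\<omega>. \<not> frozen j bottom (Suc N) y \<omega>} \<omega> :: real)"
      using AE_conserving[OF q u]
    proof eventually_elim
      case (elim \<omega>)
      have "samp (boxl H 0 N) (boundary (\<lambda>_. j) bottom) \<omega> (Ver x y) = s6v_sample (\<lambda>_. j) bottom \<omega> (Ver x y)"
        "samp (boxl H 0 N) (boundary (\<lambda>_. j) bottom) \<omega> (Hor x (Suc y)) = s6v_sample (\<lambda>_. j) bottom \<omega> (Hor x (Suc y))"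
        by (rule samp_box; use x y in simp)+
      then have "\<not> nontriv (x, Suc y) (samp (boxl H 0 N) (boundary (\<lambda>_. j) bottom) \<omega>)" if "frozen j bottom (Suc N) y \<omega>"
        using frozen_trivial[OF elim that x, of "Suc y"] by (simp add: nontriv_def)
      then show ?case by (auto simp: indicator_def)
    qed
  qed
  also have "\<dots> = prob {\<omega>. \<not> frozen j bottom (Suc N) y \<omega>}" using frozen_sets by simp
  also have "\<dots> \<le> (2 / d) ^ Suc N * (1 - d / 2) ^ y" by (rule prob_not_frozen[OF q u d])
  finally show ?thesis .
qed

lemma sum_list_boxl: "(\<Sum>v\<leftarrow>boxl H 0 N. f v) = (\<Sum>v\<in>{0..N} \<times> {1..H}. f v :: real)"
proof -
  have "distinct vs" if "okl vs" for vs using that by (induction vs) auto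
  then show ?thesis using okl_boxl set_boxl by (simp add: sum_list_distinct_conv_sum_set)
qed

lemma dEx_top_row_le:
  assumes q: "0 \<le> q" "q < 1" and u: "0 < u" "u < 1" and d: "0 < d" "d \<le> u * (1 - q)" and g: "\<And>\<sigma>. \<bar>g \<sigma>\<bar> \<le> B"
  shows "\<bar>dEx q u (Suc H) (boxl (Suc H) 0 N) (boundary (\<lambda>_. j) bottom) g\<bar> \<le>
    B / (u * (1 - u) * (1 - q)) * (real (Suc N) * ((2 / d) ^ Suc N * (1 - d / 2) ^ H))"
proof -
  let ?bd = "boundary (\<lambda>_. j) bottom" and ?vs = "boxl (Suc H) 0 N"
  have B0: "0 \<le> B" using g[of undefined] by linarith
  have le: "\<bar>dEx q u (Suc H) ?vs ?bd g\<bar> \<le> B / (u * (1 - u) * (1 - q)) * (\<Sum>v\<leftarrow>?vs. of_bool (snd v = Suc H) * Ex q u ?vs ?bd (\<lambda>\<sigma>'. of_bool (nontriv v \<sigma>')))"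
    by (rule dEx_abs[OF q u g okl_boxl])
  have "(\<Sum>v\<leftarrow>?vs. of_bool (snd v = Suc H) * Ex q u ?vs ?bd (\<lambda>\<sigma>'. of_bool (nontriv v \<sigma>'))) =
    (\<Sum>x\<in>{0..N}. Ex q u ?vs ?bd (\<lambda>\<sigma>'. of_bool (nontriv (x, Suc H) \<sigma>')))"
  proof -
    have "(\<Sum>y\<in>{1..Suc H}. of_bool (y = Suc H) * Ex q u ?vs ?bd (\<lambda>\<sigma>'. of_bool (nontriv (x, y) \<sigma>'))) = Ex q u ?vs ?bd (\<lambda>\<sigma>'. of_bool (nontriv (x, Suc H) \<sigma>'))" for x
      by (simp add: of_bool_def if_distrib[of "\<lambda>a. a * _"] cong: if_cong)
    then show ?thesis unfolding sum_list_boxl sum.cartesian_product' by simp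
  qed
  also have "\<dots> \<le> (\<Sum>x\<in>{0..N}. (2 / d) ^ Suc N * (1 - d / 2) ^ H)"
    by (intro sum_mono Ex_nontriv_le[OF q u d]) auto
  also have "\<dots> = real (Suc N) * ((2 / d) ^ Suc N * (1 - d / 2) ^ H)" by simp
  finally have "(\<Sum>v\<leftarrow>?vs. of_bool (snd v = Suc H) * Ex q u ?vs ?bd (\<lambda>\<sigma>'. of_bool (nontriv v \<sigma>'))) \<le> real (Suc N) * ((2 / d) ^ Suc N * (1 - d / 2) ^ H)" .
  then show ?thesis using B0 q u by (intro order_trans[OF le] mult_left_mono) auto
qed

lemma dEx_abs_le:
  assumes q: "0 \<le> q" "q < 1" and u: "0 < u" "u < 1" and g: "\<And>\<sigma>. \<bar>g \<sigma>\<bar> \<le> B"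
  shows "\<bar>dEx q u y (boxl H 0 N) \<sigma> g\<bar> \<le> B / (u * (1 - u) * (1 - q)) * real (Suc N * H)"
proof -
  have B0: "0 \<le> B" using g[of undefined] by linarith
  have "\<bar>dEx q u y (boxl H 0 N) \<sigma> g\<bar> \<le> B / (u * (1 - u) * (1 - q)) * (\<Sum>v\<leftarrow>boxl H 0 N. of_bool (snd v = y) * Ex q u (boxl H 0 N) \<sigma> (\<lambda>\<sigma>'. of_bool (nontriv v \<sigma>')))"
    by (rule dEx_abs[OF q u g okl_boxl])
  also have "\<dots> \<le> B / (u * (1 - u) * (1 - q)) * (\<Sum>v\<leftarrow>boxl H 0 N. 1)"
  proof (intro mult_left_mono sum_list_mono)
    fix v
    have "\<bar>Ex q u (boxl H 0 N) \<sigma> (\<lambda>\<sigma>'. of_bool (nontriv v \<sigma>'))\<bar> \<le> 1" by (rule Ex_abs[OF q u]) simp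
    then show "of_bool (snd v = y) * Ex q u (boxl H 0 N) \<sigma> (\<lambda>\<sigma>'. of_bool (nontriv v \<sigma>')) \<le> 1" by (cases "snd v = y") auto
  qed (use B0 q u in auto)
  also have "(\<Sum>v\<leftarrow>boxl H 0 N. 1 :: real) = real (Suc N * H)"
    unfolding sum_list_boxl by simp
  finally show ?thesis .
qed

lemma Ex_lipschitz:
  assumes q: "0 \<le> q" "q < 1" and ab: "0 < a" "b < 1" and g: "\<And>\<sigma>. \<bar>g \<sigma>\<bar> \<le> B" and uv: "u \<in> {a..b}" "v \<in> {a..b}"
  shows "\<bar>Ex q u (boxl H 0 N) \<sigma> g - Ex q v (boxl H 0 N) \<sigma> g\<bar> \<le> real H * (B / (a * (1 - b) * (1 - q)) * real (Suc N * H)) * \<bar>u - v\<bar>"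
proof -
  have B0: "0 \<le> B" using g[of undefined] by linarith
  have "norm (Ex q u (boxl H 0 N) \<sigma> g - Ex q v (boxl H 0 N) \<sigma> g) \<le> real H * (B / (a * (1 - b) * (1 - q)) * real (Suc N * H)) * norm (u - v)"
  proof (rule field_differentiable_bound[of "{a..b}" "\<lambda>u. Ex q u (boxl H 0 N) \<sigma> g" "\<lambda>u. \<Sum>y\<in>{1..H}. dEx q u y (boxl H 0 N) \<sigma> g"])
    fix w assume w: "w \<in> {a..b}"
    then have w': "0 < w" "w < 1" using ab by auto
    have "q * w < 1" using q w' by (smt (verit) mult_left_le_one_le)
    then have "((\<lambda>u. Ex q u (boxl H 0 N) \<sigma> g) has_real_derivative (\<Sum>y\<in>{1..H}. dEx q w y (boxl H 0 N) \<sigma> g)) (at w)"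
      by (intro Ex_deriv) (auto simp: set_boxl)
    then show "((\<lambda>u. Ex q u (boxl H 0 N) \<sigma> g) has_field_derivative (\<Sum>y\<in>{1..H}. dEx q w y (boxl H 0 N) \<sigma> g)) (at w within {a..b})"
      by (rule has_field_derivative_at_within)
    have "a * (1 - b) * (1 - q) \<le> w * (1 - w) * (1 - q)"
      using w ab q by (intro mult_right_mono mult_mono) auto
    then have "B / (w * (1 - w) * (1 - q)) \<le> B / (a * (1 - b) * (1 - q))"
      using w w' ab q B0 by (intro divide_left_mono) auto
    then have "\<bar>dEx q w y (boxl H 0 N) \<sigma> g\<bar> \<le> B / (a * (1 - b) * (1 - q)) * real (Suc N * H)" for y
      using dEx_abs_le[OF q w' g, of y H N \<sigma>] by (meson mult_right_mono of_nat_0_le_iff order_trans)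
    then have "\<bar>\<Sum>y\<in>{1..H}. dEx q w y (boxl H 0 N) \<sigma> g\<bar> \<le> (\<Sum>y\<in>{1..H}. B / (a * (1 - b) * (1 - q)) * real (Suc N * H))"
      by (intro order_trans[OF sum_abs] sum_mono) auto
    then show "norm (\<Sum>y\<in>{1..H}. dEx q w y (boxl H 0 N) \<sigma> g) \<le> real H * (B / (a * (1 - b) * (1 - q)) * real (Suc N * H))" by simp
  qed (use uv in auto)
  then show ?thesis by simp
qed

section \<open>The evolution of the six vertex measures\<close>

text \<open>Over \<open>n + 1\<close> equal pieces the quadratic errors add up to
  \<open>L * t * t / (n + 1)\<close>, which disappears in the limit. Thus \<open>F\<close> need not
  be differentiated; the constant \<open>L\<close> may be as large as it likes.\<close>

lemma abs_diff_le_of_local: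
  fixes F :: "real \<Rightarrow> real"
  assumes t: "0 \<le> t" and loc: "\<And>a b. 0 \<le> a \<Longrightarrow> a \<le> b \<Longrightarrow> b \<le> t \<Longrightarrow> \<bar>F b - F a\<bar> \<le> c * (b - a) + L * (b - a)\<^sup>2"
  shows "\<bar>F t - F 0\<bar> \<le> c * t"
proof -
  have le: "\<bar>F t - F 0\<bar> \<le> c * t + L * t\<^sup>2 / real (Suc n)" for n
  proof -
    define p where "p i = t * real i / real (Suc n)" for i
    have d: "p (Suc i) - p i = t / real (Suc n)" for i
      by (simp add: p_def diff_divide_distrib[symmetric] algebra_simps del: of_nat_Suc) (simp add: algebra_simps)
    define X where "X = c * (t / real (Suc n)) + L * (t / real (Suc n))\<^sup>2"
    have "\<bar>F (p m) - F 0\<bar> \<le> real m * X" if "m \<le> Suc n" for m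
      using that
    proof (induction m)
      case (Suc m)
      have "0 \<le> p m" using t by (simp add: p_def del: of_nat_Suc)
      moreover have "0 \<le> t / real (Suc n)" using t by (simp del: of_nat_Suc)
      then have "p m \<le> p (Suc m)" using d[of m] by linarith
      moreover have "p (Suc m) \<le> t"
      proof -
        have "t * real (Suc m) \<le> t * real (Suc n)" using Suc.prems t by (intro mult_left_mono) auto
        then show ?thesis unfolding p_def by (simp add: divide_simps del: of_nat_Suc)
      qed
      ultimately have "\<bar>F (p (Suc m)) - F (p m)\<bar> \<le> X"
        using loc[of "p m" "p (Suc m)"] unfolding d X_def by simp
      moreover have "\<bar>F (p (Suc m)) - F 0\<bar> \<le> \<bar>F (p (Suc m)) - F (p m)\<bar> + \<bar>F (p m) - F 0\<bar>" by linarith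
      moreover have "real (Suc m) * X = real m * X + X" by (simp add: algebra_simps)
      ultimately show ?case using Suc.IH[OF Suc_leD[OF Suc.prems]] by linarith
    qed (simp add: p_def)
    from this[of "Suc n"] have "\<bar>F (p (Suc n)) - F 0\<bar> \<le> real (Suc n) * (c * (t / real (Suc n)) + L * (t / real (Suc n))\<^sup>2)" unfolding X_def by simp
    moreover have "p (Suc n) = t" by (simp add: p_def del: of_nat_Suc)
    moreover have "real (Suc n) * (c * (t / real (Suc n)) + L * (t / real (Suc n))\<^sup>2) = c * t + L * t\<^sup>2 / real (Suc n)"
      by (simp add: field_simps power2_eq_square del: of_nat_Suc)
    ultimately show ?thesis by simp
  qed
  have "(\<lambda>n. c * t + L * t\<^sup>2 / real (Suc n)) \<longlonglongrightarrow> c * t + 0"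
    by (intro tendsto_add tendsto_const LIMSEQ_Suc[OF lim_const_over_n])
  from LIMSEQ_le_const[OF this] show ?thesis using le by auto
qed

section \<open>Evolution under finitely many clocks\<close>

lemma run_seq_agree:
  assumes "\<And>k. Some k \<in> set xs \<Longrightarrow> k \<in> kbox N (Suc H)" "agree N {..Suc H} \<sigma> \<sigma>'"
  shows "agree N {..Suc H} (run_seq xs \<sigma>) (run_seq xs \<sigma>')"
  using assms
proof (induction xs arbitrary: \<sigma> \<sigma>')
  case (Cons oc xs)
  have step: "agree N {..Suc H} (case oc of None \<Rightarrow> \<sigma> | Some k \<Rightarrow> if k \<in> seed_clocks then act k \<sigma> else \<sigma>)
      (case oc of None \<Rightarrow> \<sigma>' | Some k \<Rightarrow> if k \<in> seed_clocks then act k \<sigma>' else \<sigma>')"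
  proof (cases oc)
    case (Some k)
    then have "k \<in> kbox N (Suc H)" using Cons.prems(1) by simp
    then show ?thesis using Some act_agree_box Cons.prems(2) kbox_seed by (simp add: subset_iff)
  qed (use Cons.prems in simp)
  show ?case using Cons.IH[OF _ step] Cons.prems(1) unfolding run_seq_def by simp
qed (simp add: run_seq_def)

lemma ring_seq_mem: "Some k \<in> set (ring_seq K c m) \<Longrightarrow> k \<in> K"
proof -
  assume "Some k \<in> set (ring_seq K c m)"
  then obtain j where j: "Some k = (if \<exists>k\<in>K. c (k, m, j) \<noteq> 0 then Some (SOME k. k \<in> K \<and> c (k, m, j) \<noteq> 0) else None)"
    unfolding ring_seq_def set_map by (rule imageE)
  have ex: "\<exists>k\<in>K. c (k, m, j) \<noteq> 0"
    by (rule ccontr) (use j in \<open>simp only: if_False option.distinct\<close>)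
  then have "k = (SOME k. k \<in> K \<and> c (k, m, j) \<noteq> 0)" using j by (simp only: if_True option.inject)
  moreover have "\<exists>k. k \<in> K \<and> c (k, m, j) \<noteq> 0" using ex by (simp only: Bex_def)
  ultimately show "k \<in> K" using someI_ex[of "\<lambda>k. k \<in> K \<and> c (k, m, j) \<noteq> 0"] by simp
qed

text \<open>With clocks up to the height \<open>H\<close> only, nothing above the row
  \<open>Suc H\<close> is read. Hence the backward evolution of a function of the box is again
  one.\<close>

lemma Psi_agree:
  assumes "A \<subseteq> kbox N (Suc H)" "agree N {..Suc H} \<sigma> \<sigma>'"
  shows "agree N {..Suc H} (Psi A c \<sigma>) (Psi A c \<sigma>')"
  unfolding agree_def
proof (intro ballI impI)
  fix e assume e: "e \<in> quad_edges" "incol N e \<and> row e \<in> {..Suc H}"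
  have "run_seq (ring_seq (kbox n n \<inter> A) c m) \<sigma> e = run_seq (ring_seq (kbox n n \<inter> A) c m) \<sigma>' e" for n m
  proof (rule agreeD[OF _ e(1) conjunct1[OF e(2)] conjunct2[OF e(2)]], rule run_seq_agree[OF _ assms(2)])
    fix k assume "Some k \<in> set (ring_seq (kbox n n \<inter> A) c m)"
    then show "k \<in> kbox N (Suc H)" using ring_seq_mem assms(1) by blast
  qed
  then show "Psi A c \<sigma> e = Psi A c \<sigma>' e" using e(1) by (simp only: Psi_def restrict_apply')
qed

lemma agree_restrict: "agree N R (restrict \<sigma> quad_edges) \<sigma>"
  by (simp add: agree_def)

text \<open>At each position only the clock of the current types moves the configuration, so the sum
  over all clocks of the box collapses to the generator restricted to the heights up to
  \<open>H\<close>.\<close>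

lemma sum_kbox:
  fixes g :: "config \<Rightarrow> real"
  shows "(\<Sum>k\<in>kbox N (Suc H). clock_rate q u \<eta> k \<tau> * (g (act k \<sigma>) - g \<sigma>)) =
    \<eta> * exp (- \<tau>) * (\<Sum>y=1..H. real y * (\<Sum>x=0..N. seed_diff q (u_at u \<eta> \<tau>) y g x \<sigma>))"
proof -
  let ?V = "{0..N} \<times> {1..H}" and ?P = "up_types \<union> down_types"
  have K: "kbox N (Suc H) = ?V \<times> ?P" by (auto simp: kbox_def seed_clocks_def)
  have "(\<Sum>p\<in>?P. clock_rate q u \<eta> (v, p) \<tau> * (g (act (v, p) \<sigma>) - g \<sigma>)) =
    \<eta> * exp (- \<tau>) * (real (snd v) * seed_diff q (u_at u \<eta> \<tau>) (snd v) g (fst v) \<sigma>)" for v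
  proof -
    have "(\<Sum>p\<in>?P. clock_rate q u \<eta> (v, p) \<tau> * (g (act (v, p) \<sigma>) - g \<sigma>)) =
      (\<Sum>p\<in>?P. if p = pair_type \<sigma> v then clock_rate q u \<eta> (v, p) \<tau> * (g (jump \<sigma> v) - g \<sigma>) else 0)"
      by (intro sum.cong refl) (auto simp: act.simps)
    also have "\<dots> = (if pair_type \<sigma> v \<in> ?P then clock_rate q u \<eta> (v, pair_type \<sigma> v) \<tau> * (g (jump \<sigma> v) - g \<sigma>) else 0)"
      by (rule sum.delta[OF finite_types])
    also have "\<dots> = \<eta> * exp (- \<tau>) * (real (snd v) * seed_diff q (u_at u \<eta> \<tau>) (snd v) g (fst v) \<sigma>)"
    proof (cases "pair_type \<sigma> v \<in> ?P")
      case False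
      then have "seed_rate q (pair_type \<sigma> v) (u_at u \<eta> \<tau>) = 0" using seed_rate_nonzero by blast
      then show ?thesis using False by (simp add: seed_diff_def)
    qed (simp add: seed_diff_def mult_ac)
    finally show ?thesis .
  qed
  note * = this
  have "(\<Sum>k\<in>kbox N (Suc H). clock_rate q u \<eta> k \<tau> * (g (act k \<sigma>) - g \<sigma>)) =
    (\<Sum>v\<in>?V. \<eta> * exp (- \<tau>) * (real (snd v) * seed_diff q (u_at u \<eta> \<tau>) (snd v) g (fst v) \<sigma>))"
    by (simp only: K sum.cartesian_product'[where A = ?V and B = ?P] *)
  also have "\<dots> = \<eta> * exp (- \<tau>) * (\<Sum>y=1..H. real y * (\<Sum>x=0..N. seed_diff q (u_at u \<eta> \<tau>) y g x \<sigma>))"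
    unfolding sum_distrib_left[symmetric] sum.cartesian_product' by (subst sum.swap) (simp add: sum_distrib_left)
  finally show ?thesis .
qed

context clock_process
begin

lemma box_fun_Phi:
  assumes "box_fun N (Suc H) f" "A \<subseteq> kbox N (Suc H)"
  shows "box_fun N (Suc H) (\<lambda>\<sigma>. f (Phi A s t \<omega> \<sigma>))"
  unfolding box_fun_def Phi_def using Psi_agree[OF assms(2)] box_funD[OF assms(1)] by blast

lemma box_fun_expectation:
  fixes f :: "config \<Rightarrow> real"
  assumes "box_fun N (Suc H) f" "A \<subseteq> kbox N (Suc H)"
  shows "box_fun N (Suc H) (\<lambda>\<sigma>. expectation (\<lambda>\<omega>. f (Phi A s t \<omega> \<sigma>)))"
  unfolding box_fun_def using box_funD[OF box_fun_Phi[OF assms]] by presburger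

text \<open>Integrability is not asked for, since the integral of a nonintegrable function is
  \<open>0\<close>. This gives bounds also at configurations that are not elements of the measurable
  space.\<close>

lemma expectation_bound:
  fixes h :: "'w \<Rightarrow> real"
  assumes "\<And>\<omega>. \<bar>h \<omega>\<bar> \<le> B"
  shows "\<bar>expectation h\<bar> \<le> B"
proof (cases "integrable M h")
  case True
  have "\<bar>expectation h\<bar> \<le> expectation (\<lambda>\<omega>. \<bar>h \<omega>\<bar>)" by (rule integral_abs_bound)
  also have "\<dots> \<le> expectation (\<lambda>_. B)" by (rule integral_mono) (use True assms in auto)
  finally show ?thesis by (simp add: prob_space)
next
  case False
  then show ?thesis using assms[of undefined] by (simp add: not_integrable_integral_eq)
qed

text \<open>With finitely many clocks the flow composes from every configuration of the space, not
  only from regular ones, so the backward evolution can be split at any time.\<close>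

lemma semigroup_box:
  fixes f :: "config \<Rightarrow> real"
  assumes f: "box_fun N (Suc H) f" and A: "A = kbox N (Suc H)" and abt: "0 \<le> a" "a \<le> b" "b \<le> t" and \<sigma>: "\<sigma> \<in> space config_space"
  shows "expectation (\<lambda>\<omega>. f (Phi A a t \<omega> \<sigma>)) = (\<integral>\<sigma>'. expectation (\<lambda>\<omega>. f (Phi A b t \<omega> \<sigma>')) \<partial>Q A a b \<sigma>)"
proof -
  have A': "A \<subseteq> seed_clocks" "finite A" unfolding A by (rule kbox_seed, rule finite_kbox)
  have b0: "0 \<le> b" "a \<le> t" using abt by auto
  have fm: "f \<in> borel_measurable config_space" by (rule box_fun_measurable[OF f]) simp
  obtain B where B: "B \<ge> 0" "\<And>\<sigma>. \<bar>f \<sigma>\<bar> \<le> B" using box_fun_bounded[OF f] by blast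
  have "expectation (\<lambda>\<omega>. f (Phi A a t \<omega> \<sigma>)) = (\<integral>\<sigma>'. f \<sigma>' \<partial>Q A a t \<sigma>)"
    by (rule expectation_box_fun(1)[symmetric, OF f A'(1) abt(1) b0(2) \<sigma>])
  also have "Q A a t \<sigma> = Q A a b \<sigma> \<bind> Q A b t"
    by (rule chapman_kolmogorov[symmetric, OF A'(1) abt \<sigma> AE_flow_Phi_finite[OF A'(2,1) \<sigma> abt]])
  also have "(\<integral>\<sigma>'. f \<sigma>' \<partial>(Q A a b \<sigma> \<bind> Q A b t)) = (\<integral>\<sigma>'. (\<integral>\<sigma>''. f \<sigma>'' \<partial>Q A b t \<sigma>') \<partial>Q A a b \<sigma>)"
  proof (rule integral_bind[OF fm, where B = B and B' = 1])
    have Qs: "sets (Q A a b \<sigma>) = sets config_space" by (simp add: Q_def)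
    show "Q A b t \<in> measurable (Q A a b \<sigma>) (subprob_algebra config_space)"
      using measurable_prob_algebraD[OF measurable_Q[OF A'(1) b0(1) abt(3)]] measurable_cong_sets[OF Qs refl] by blast
    have P: "prob_space (Q A a b \<sigma>)" unfolding Q_def by (rule prob_space_distr[OF measurable_Phi[OF A'(1) abt(1,2) \<sigma>]])
    then show "finite_measure (Q A a b \<sigma>)" by (simp add: prob_space.finite_measure)
    show "AE x in Q A a b \<sigma>. emeasure (Q A b t x) (space (Q A b t x)) \<le> ennreal 1"
    proof (rule AE_I2)
      fix x assume "x \<in> space (Q A a b \<sigma>)"
      then have "x \<in> space config_space" by (simp add: Q_def)
      then have "prob_space (Q A b t x)" unfolding Q_def by (intro prob_space_distr measurable_Phi[OF A'(1) b0(1) abt(3)])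
      then show "emeasure (Q A b t x) (space (Q A b t x)) \<le> ennreal 1" by (simp add: prob_space.emeasure_space_1)
    qed
  qed (use B in auto)
  also have "\<dots> = (\<integral>\<sigma>'. expectation (\<lambda>\<omega>. f (Phi A b t \<omega> \<sigma>')) \<partial>Q A a b \<sigma>)"
    by (rule Bochner_Integration.integral_cong[OF refl]) (rule expectation_box_fun(1)[OF f A'(1) b0(1) abt(3)], simp add: Q_def)
  finally show ?thesis .
qed

end

lemma u_at_bounds:
  assumes "0 < \<eta>" "0 \<le> \<tau>"
  shows "u \<le> u_at u \<eta> \<tau>" "u_at u \<eta> \<tau> \<le> u + \<eta>"
proof -
  have "exp (- \<tau>) \<le> 1" "0 < exp (- \<tau>)" using assms(2) by auto
  then have "0 \<le> (1 - exp (- \<tau>)) * \<eta>" "(1 - exp (- \<tau>)) * \<eta> \<le> 1 * \<eta>"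
    using assms(1) by (auto intro!: mult_right_mono)
  then show "u \<le> u_at u \<eta> \<tau>" "u_at u \<eta> \<tau> \<le> u + \<eta>" by (auto simp: u_at_def)
qed

lemma u_at_deriv: "(u_at u \<eta> has_real_derivative \<eta> * exp (- \<tau>)) (at \<tau> within S)"
  unfolding u_at_def by (auto intro!: derivative_eq_intros)

lemma u_at_lipschitz:
  assumes "0 < \<eta>" "0 \<le> a" "0 \<le> b"
  shows "\<bar>u_at u \<eta> b - u_at u \<eta> a\<bar> \<le> \<eta> * \<bar>b - a\<bar>"
proof -
  have "norm (u_at u \<eta> b - u_at u \<eta> a) \<le> \<eta> * norm (b - a)"
  proof (rule field_differentiable_bound[of "{0..}"])
    show "(u_at u \<eta> has_field_derivative \<eta> * exp (- \<tau>)) (at \<tau> within {0..})" for \<tau> by (rule u_at_deriv)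
    show "norm (\<eta> * exp (- \<tau>)) \<le> \<eta>" if "\<tau> \<in> {0..}" for \<tau>
      using that assms(1) by (simp add: mult_left_le)
  qed (use assms in auto)
  then show ?thesis by simp
qed

locale s6v_clocks = clock_process M T "clock_rate q u \<eta>" C
  for M :: "'w measure" and T q u \<eta> C +
  assumes q: "0 \<le> q" "q < 1" and u: "0 < u" "u + \<eta> < 1" and eta: "0 < \<eta>"
begin

abbreviation w :: "real \<Rightarrow> real" where "w \<equiv> u_at u \<eta>"

lemma w: "0 \<le> \<tau> \<Longrightarrow> 0 < w \<tau>" "0 \<le> \<tau> \<Longrightarrow> w \<tau> < 1" "0 \<le> \<tau> \<Longrightarrow> w \<tau> \<in> {u..u + \<eta>}"
  using u_at_bounds[OF eta, of \<tau> u] u by auto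

lemma lam_deriv:
  assumes "k \<in> seed_clocks" "0 \<le> a" "r \<in> {a..b}"
  shows "((\<lambda>r. lam k a r) has_real_derivative clock_rate q u \<eta> k r) (at r within {a..b})"
  unfolding lam_def
  by (rule integral_has_real_derivative) (use assms in \<open>auto intro!: continuous_on_subset[OF cont[OF assms(1)]]\<close>)

text \<open>Bound for the boundary term of the summation by parts, uniform in time:
  \<open>w r\<close> is at least \<open>u\<close>, and \<open>1 - w r\<close> at least
  \<open>1 - (u + \<eta>)\<close>; the freezing rate is taken at its worst value
  \<open>u * (1 - q)\<close>.\<close>

definition top_bound :: "nat \<Rightarrow> nat \<Rightarrow> real \<Rightarrow> real" where
  "top_bound N H B = real (Suc H) * (B / (u * (1 - (u + \<eta>)) * (1 - q)) *
     (real (Suc N) * ((2 / (u * (1 - q))) ^ Suc N * (1 - u * (1 - q) / 2) ^ H)))"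

lemma top_row:
  assumes "0 \<le> r" "\<And>\<sigma>. \<bar>g \<sigma>\<bar> \<le> B"
  shows "real (Suc H) * \<bar>dEx q (w r) (Suc H) (boxl (Suc H) 0 N) (boundary (\<lambda>_. j) bottom) g\<bar> \<le> top_bound N H B"
  unfolding top_bound_def
proof (rule mult_left_mono)
  let ?d = "u * (1 - q)"
  let ?X = "real (Suc N) * ((2 / ?d) ^ Suc N * (1 - ?d / 2) ^ H)"
  have B0: "0 \<le> B" using assms(2)[of undefined] by linarith
  note wr = w[OF assms(1)]
  have d: "0 < ?d" "?d \<le> w r * (1 - q)" "?d \<le> 1" using q u eta wr by (auto intro!: mult_right_mono mult_le_one)
  have X0: "0 \<le> ?X" using d by (intro mult_nonneg_nonneg zero_le_power) auto
  have "u * (1 - (u + \<eta>)) * (1 - q) \<le> w r * (1 - w r) * (1 - q)"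
    using wr q u eta by (intro mult_right_mono mult_mono) auto
  then have "B / (w r * (1 - w r) * (1 - q)) \<le> B / (u * (1 - (u + \<eta>)) * (1 - q))"
    using B0 wr q u by (intro divide_left_mono mult_pos_pos) auto
  then have "B / (w r * (1 - w r) * (1 - q)) * ?X \<le> B / (u * (1 - (u + \<eta>)) * (1 - q)) * ?X"
    using X0 by (rule mult_right_mono)
  then show "\<bar>dEx q (w r) (Suc H) (boxl (Suc H) 0 N) (boundary (\<lambda>_. j) bottom) g\<bar> \<le> B / (u * (1 - (u + \<eta>)) * (1 - q)) * ?X"
    using dEx_top_row_le[OF q wr(1,2) d(1,2) assms(2)] by (meson order_trans)
qed simp

lemma top_tendsto_0: "(\<lambda>H. top_bound N H B) \<longlonglongrightarrow> 0"
proof -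
  let ?d = "u * (1 - q)"
  have d: "0 < ?d" "?d \<le> 1" using q u eta by (auto intro!: mult_le_one)
  have "(\<lambda>H. real H * (1 - ?d / 2) ^ H) \<longlonglongrightarrow> 0" by (rule powser_times_n_limit_0) (use d in auto)
  moreover have "(\<lambda>H. (1 - ?d / 2) ^ H) \<longlonglongrightarrow> 0" by (rule LIMSEQ_realpow_zero) (use d in auto)
  ultimately have "(\<lambda>H. real H * (1 - ?d / 2) ^ H + (1 - ?d / 2) ^ H) \<longlonglongrightarrow> 0 + 0" by (rule tendsto_add)
  then have "(\<lambda>H. (B / (u * (1 - (u + \<eta>)) * (1 - q)) * (real (Suc N) * (2 / ?d) ^ Suc N)) * (real H * (1 - ?d / 2) ^ H + (1 - ?d / 2) ^ H)) \<longlonglongrightarrow>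
     (B / (u * (1 - (u + \<eta>)) * (1 - q)) * (real (Suc N) * (2 / ?d) ^ Suc N)) * (0 + 0)"
    by (rule tendsto_mult[OF tendsto_const])
  moreover have "(B / (u * (1 - (u + \<eta>)) * (1 - q)) * (real (Suc N) * (2 / ?d) ^ Suc N)) * (real H * (1 - ?d / 2) ^ H + (1 - ?d / 2) ^ H) = top_bound N H B" for H
  proof -
    have gen: "(X * (Y * Z)) * (h * r + r) = (1 + h) * (X * (Y * (Z * r)))" for X Y Z h r :: real by (simp add: algebra_simps)
    show ?thesis unfolding top_bound_def gen by simp
  qed
  ultimately show ?thesis by simp
qed

text \<open>
  Along the time interval, the parameter of the six vertex measure and the backward evolution of \<open>f\<close> change
  simultaneously; the auxiliary function \<open>\<psi>\<close> below freezes the latter at its value at the time \<open>b\<close>, up to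
  the first order correction given by the jump rates.
\<close>

lemma local_estimate:
  fixes f :: "config \<Rightarrow> real" and N H :: nat and j :: bool and bottom
  defines "K \<equiv> kbox N (Suc H)"
  defines "F \<equiv> \<lambda>t s. Ex q (w s) (boxl (Suc H) 0 N) (boundary (\<lambda>_. j) bottom) (\<lambda>\<sigma>. expectation (\<lambda>\<omega>. f (Phi K s t \<omega> \<sigma>)))"
  assumes f: "box_fun N (Suc H) f" and B: "\<And>\<sigma>. \<bar>f \<sigma>\<bar> \<le> B"
  shows "\<exists>L. \<forall>t a b. 0 \<le> a \<longrightarrow> a \<le> b \<longrightarrow> b \<le> t \<longrightarrow> \<bar>F t b - F t a\<bar> \<le> \<eta> * top_bound N H B * (b - a) + L * (b - a)\<^sup>2"
proof -
  let ?vs = "boxl (Suc H) 0 N" and ?bd = "boundary (\<lambda>_. j) bottom"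
  have K: "K \<subseteq> seed_clocks" "finite K" unfolding K_def by (rule kbox_seed, rule finite_kbox)
  have B0: "0 \<le> B" using B[of undefined] by linarith
  \<comment> \<open>\<open>R * (b - a)\<close> bounds the expected number of rings between
    \<open>a\<close> and \<open>b\<close>, \<open>BG\<close> the generator applied to the backward
    evolution, and \<open>L1\<close> the effect of a changing parameter on its average.\<close>
  define R where "R = (\<Sum>k\<in>K. C * real (snd (fst k)))"
  define BG where "BG = R * (2 * B)"
  define L1 where "L1 = real (Suc H) * (BG / (u * (1 - (u + \<eta>)) * (1 - q)) * real (Suc N * Suc H)) * \<eta>"
  have R0: "0 \<le> R" unfolding R_def using C_pos by (intro sum_nonneg) auto
  have L10: "0 \<le> L1" unfolding L1_def BG_def using R0 B0 q u eta by (intro mult_nonneg_nonneg divide_nonneg_nonneg) auto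
  have "\<bar>F t b - F t a\<bar> \<le> \<eta> * top_bound N H B * (b - a) + (L1 + 3 * B * R\<^sup>2) * (b - a)\<^sup>2" if abt: "0 \<le> a" "a \<le> b" "b \<le> t" for t a b
  proof -
    define g where "g s \<sigma> = expectation (\<lambda>\<omega>. f (Phi K s t \<omega> \<sigma>))" for s \<sigma>
    define D where "D k \<sigma> = g b (act k \<sigma>) - g b \<sigma>" for k \<sigma>
    define G where "G r \<sigma> = (\<Sum>k\<in>K. clock_rate q u \<eta> k r * D k \<sigma>)" for r \<sigma>
    define \<psi> where "\<psi> r = Ex q (w r) ?vs ?bd (g b) - (\<Sum>k\<in>K. lam k a r * Ex q (w a) ?vs ?bd (D k))" for r
    have g: "box_fun N (Suc H) (g s)" for s unfolding g_def by (rule box_fun_expectation[OF f]) (simp add: K_def)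
    have gB: "\<bar>g s \<sigma>\<bar> \<le> B" for s \<sigma> unfolding g_def by (rule expectation_bound[OF B])
    have DB: "\<bar>D k \<sigma>\<bar> \<le> 2 * B" for k \<sigma> unfolding D_def using gB[of b "act k \<sigma>"] gB[of b \<sigma>] by linarith
    have rate_K: "0 \<le> clock_rate q u \<eta> k r" "clock_rate q u \<eta> k r \<le> C * real (snd (fst k))" if "k \<in> K" "0 \<le> r" for k r
      using rate[of k r] K(1) that by blast+
    have GB: "\<bar>G r \<sigma>\<bar> \<le> BG" if "0 \<le> r" for r \<sigma>
    proof -
      have "\<bar>G r \<sigma>\<bar> \<le> (\<Sum>k\<in>K. C * real (snd (fst k)) * (2 * B))"
        unfolding G_def using rate_K that DB B0 C_pos
        by (intro order_trans[OF sum_abs] sum_mono) (auto simp: abs_mult intro!: mult_mono)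
      then show ?thesis by (simp add: BG_def R_def sum_distrib_right)
    qed
    have G_eq: "G r \<sigma> = \<eta> * exp (- r) * (\<Sum>y=1..H. real y * (\<Sum>x=0..N. seed_diff q (w r) y (g b) x \<sigma>))" for r \<sigma>
      unfolding G_def D_def K_def by (rule sum_kbox)
    have ExG: "Ex q (w r) ?vs ?bd (G r) = \<eta> * exp (- r) * ((\<Sum>y=1..Suc H. dEx q (w r) y ?vs ?bd (g b)) - real (Suc H) * dEx q (w r) (Suc H) ?vs ?bd (g b))"
      if "0 \<le> r" for r
    proof -
      have "Ex q (w r) ?vs ?bd (G r) = \<eta> * exp (- r) * Ex q (w r) ?vs ?bd (\<lambda>\<sigma>. \<Sum>y=1..H. real y * (\<Sum>x=0..N. seed_diff q (w r) y (g b) x \<sigma>))"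
        unfolding G_eq Ex_scale ..
      also have "Ex q (w r) ?vs ?bd (\<lambda>\<sigma>. \<Sum>y=1..H. real y * (\<Sum>x=0..N. seed_diff q (w r) y (g b) x \<sigma>)) =
         (\<Sum>y=1..Suc H. dEx q (w r) y ?vs ?bd (g b)) - real (Suc H) * dEx q (w r) (Suc H) ?vs ?bd (g b)"
        by (rule generator_derivative[OF q w(1,2)[OF that] g, where a = j]) (simp add: boundary_def)
      finally show ?thesis .
    qed
    have ExGa: "Ex q v ?vs ?bd (G r) = (\<Sum>k\<in>K. clock_rate q u \<eta> k r * Ex q v ?vs ?bd (D k))" for v r
      unfolding G_def Ex_sum Ex_scale ..
    define d\<psi> where "d\<psi> r = (\<Sum>y=1..Suc H. dEx q (w r) y ?vs ?bd (g b)) * (\<eta> * exp (- r)) - Ex q (w a) ?vs ?bd (G r)" for r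
    have \<psi>_deriv: "(\<psi> has_field_derivative d\<psi> r) (at r within {a..b})" if r: "r \<in> {a..b}" for r
    proof -
      have r0: "0 \<le> r" using r abt by auto
      have "q * w r < 1" using q w(1,2)[OF r0] by (smt (verit) mult_left_le_one_le)
      then have "((\<lambda>v. Ex q v ?vs ?bd (g b)) has_real_derivative (\<Sum>y=1..Suc H. dEx q (w r) y ?vs ?bd (g b))) (at (w r))"
        by (intro Ex_deriv) (auto simp: set_boxl)
      from DERIV_chain2[OF this u_at_deriv]
      have 1: "((\<lambda>r. Ex q (w r) ?vs ?bd (g b)) has_real_derivative (\<Sum>y=1..Suc H. dEx q (w r) y ?vs ?bd (g b)) * (\<eta> * exp (- r))) (at r within {a..b})" .
      have 2: "((\<lambda>r. \<Sum>k\<in>K. lam k a r * Ex q (w a) ?vs ?bd (D k)) has_real_derivative (\<Sum>k\<in>K. clock_rate q u \<eta> k r * Ex q (w a) ?vs ?bd (D k))) (at r within {a..b})"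
        by (intro DERIV_sum DERIV_cmult_right lam_deriv) (use K abt r in auto)
      show ?thesis unfolding \<psi>_def d\<psi>_def ExGa by (rule DERIV_diff[OF 1 2])
    qed
    have d\<psi>_le: "norm (d\<psi> r) \<le> \<eta> * top_bound N H B + L1 * (b - a)" if r: "r \<in> {a..b}" for r
    proof -
      have r0: "0 \<le> r" using r abt by auto
      let ?X = "real (Suc H) * dEx q (w r) (Suc H) ?vs ?bd (g b)"
      \<comment> \<open>By \<open>ExG\<close> the total derivative cancels. There remain the top row
        and the difference between averaging \<open>G r\<close> with the parameter at time
        \<open>r\<close> and with that at time \<open>a\<close>.\<close>
      have "d\<psi> r = \<eta> * exp (- r) * ?X + (Ex q (w r) ?vs ?bd (G r) - Ex q (w a) ?vs ?bd (G r))"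
        unfolding d\<psi>_def ExG[OF r0] by (simp add: algebra_simps)
      moreover have "\<bar>\<eta> * exp (- r) * ?X\<bar> \<le> \<eta> * top_bound N H B"
      proof -
        have e: "\<eta> * exp (- r) \<le> \<eta>" "0 \<le> \<eta> * exp (- r)" using eta r0 by (auto simp: mult_left_le)
        have X: "\<bar>?X\<bar> \<le> top_bound N H B" using top_row[OF r0 gB] by (simp add: abs_mult)
        show ?thesis unfolding abs_mult[of "\<eta> * exp (- r)"] using e X eta by (intro mult_mono) auto
      qed
      moreover have "\<bar>Ex q (w r) ?vs ?bd (G r) - Ex q (w a) ?vs ?bd (G r)\<bar> \<le> L1 * (b - a)"
      proof -
        have "\<bar>Ex q (w r) ?vs ?bd (G r) - Ex q (w a) ?vs ?bd (G r)\<bar> \<le> real (Suc H) * (BG / (u * (1 - (u + \<eta>)) * (1 - q)) * real (Suc N * Suc H)) * \<bar>w r - w a\<bar>"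
          by (rule Ex_lipschitz[OF q u(1) u(2) GB[OF r0] w(3)[OF r0] w(3)[OF abt(1)]])
        also have "\<dots> \<le> real (Suc H) * (BG / (u * (1 - (u + \<eta>)) * (1 - q)) * real (Suc N * Suc H)) * (\<eta> * (b - a))"
        proof (rule mult_left_mono)
          have "\<eta> * \<bar>r - a\<bar> \<le> \<eta> * (b - a)" using r eta by (intro mult_left_mono) auto
          then show "\<bar>w r - w a\<bar> \<le> \<eta> * (b - a)" using u_at_lipschitz[OF eta abt(1) r0, of u] by linarith
          show "0 \<le> real (Suc H) * (BG / (u * (1 - (u + \<eta>)) * (1 - q)) * real (Suc N * Suc H))"
            unfolding BG_def using R0 B0 q u by (intro mult_nonneg_nonneg divide_nonneg_nonneg) auto
        qed
        finally show ?thesis by (simp add: L1_def mult_ac)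
      qed
      ultimately show ?thesis by (simp add: abs_le_iff)
    qed
    have \<psi>_diff: "\<bar>\<psi> b - \<psi> a\<bar> \<le> (\<eta> * top_bound N H B + L1 * (b - a)) * (b - a)"
    proof -
      have "norm (\<psi> b - \<psi> a) \<le> (\<eta> * top_bound N H B + L1 * (b - a)) * norm (b - a)"
        by (rule field_differentiable_bound[of "{a..b}" \<psi> d\<psi>, OF _ \<psi>_deriv d\<psi>_le]) (use abt in auto)
      then show ?thesis using abt by simp
    qed
    \<comment> \<open>The remainder of the first order expansion of the backward evolution between
      \<open>a\<close> and \<open>b\<close>.\<close>
    define Z where "Z \<sigma> = g a \<sigma> - g b \<sigma> - (\<Sum>k\<in>K. lam k a b * D k \<sigma>)" for \<sigma>
    have Z_le: "\<bar>Z \<sigma>\<bar> \<le> 3 * B * R\<^sup>2 * (b - a)\<^sup>2" for \<sigma>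
    proof -
      \<comment> \<open>\<open>Ex\<close> evaluates its integrand also at functions outside the
        measurable space, where the kernels say nothing; restricting to the edges of the quadrant
        changes no function of the box.\<close>
      let ?\<sigma> = "restrict \<sigma> quad_edges"
      have ag: "agree N {..Suc H} \<sigma> ?\<sigma>" by (rule agree_sym[OF agree_restrict])
      have sp: "?\<sigma> \<in> space config_space" by (simp add: space_config)
      have D_eq: "D k \<sigma> = D k ?\<sigma>" if "k \<in> K" for k
        unfolding D_def using box_funD[OF g ag] box_funD[OF g act_agree_box[OF _ ag]] that by (simp add: K_def)
      have Z_eq: "Z \<sigma> = Z ?\<sigma>" unfolding Z_def box_funD[OF g ag] using D_eq by simp
      have ga: "g a ?\<sigma> = (\<integral>\<sigma>'. g b \<sigma>' \<partial>Q K a b ?\<sigma>)"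
        unfolding g_def by (rule semigroup_box[OF f K_def[THEN meta_eq_to_obj_eq] abt sp])
      have "\<bar>Z ?\<sigma>\<bar> \<le> 3 * B * (\<Sum>k\<in>K. lam k a b)\<^sup>2"
        unfolding Z_def ga D_def by (rule Q_short_time_finite[OF g gB sp abt(1,2) K(2,1)])
      also have "\<dots> \<le> 3 * B * (R * (b - a))\<^sup>2"
      proof (intro mult_left_mono power_mono)
        show "(\<Sum>k\<in>K. lam k a b) \<le> R * (b - a)"
          unfolding R_def sum_distrib_right using lam_le K(1) abt by (intro sum_mono) auto
        show "0 \<le> (\<Sum>k\<in>K. lam k a b)" using lam_nonneg K(1) abt by (intro sum_nonneg) auto
      qed (use B0 in auto)
      finally show ?thesis unfolding Z_eq by (simp add: power_mult_distrib mult_ac)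
    qed
    have "Ex q (w a) ?vs ?bd Z = Ex q (w a) ?vs ?bd (g a) - Ex q (w a) ?vs ?bd (g b) - (\<Sum>k\<in>K. lam k a b * Ex q (w a) ?vs ?bd (D k))"
      unfolding Z_def Ex_diff Ex_sum Ex_scale ..
    moreover have "\<bar>Ex q (w a) ?vs ?bd Z\<bar> \<le> 3 * B * R\<^sup>2 * (b - a)\<^sup>2" by (rule Ex_abs[OF q w(1,2)[OF abt(1)] Z_le])
    moreover have "\<psi> a = Ex q (w a) ?vs ?bd (g b)" by (simp add: \<psi>_def lam_def)
    moreover have "\<psi> b = Ex q (w b) ?vs ?bd (g b) - (\<Sum>k\<in>K. lam k a b * Ex q (w a) ?vs ?bd (D k))" by (simp add: \<psi>_def)
    ultimately have "\<bar>Ex q (w b) ?vs ?bd (g b) - Ex q (w a) ?vs ?bd (g a)\<bar> \<le> (\<eta> * top_bound N H B + L1 * (b - a)) * (b - a) + 3 * B * R\<^sup>2 * (b - a)\<^sup>2"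
      using \<psi>_diff by linarith
    then show ?thesis unfolding F_def g_def by (simp add: algebra_simps power2_eq_square)
  qed
  then show ?thesis by blast
qed

end

context s6v_clocks
begin

lemma Phi_box_eventually:
  fixes f :: "config \<Rightarrow> real"
  assumes f: "box_fun N H0 f" and \<sigma>: "\<sigma> \<in> regular_configurations" and t: "0 \<le> t" and good: "good_rings (\<lambda>k. T k \<omega>)"
  shows "\<forall>\<^sub>F H in sequentially. f (Phi (kbox N (Suc H)) 0 t \<omega> \<sigma>) = f (Phi seed_clocks 0 t \<omega> \<sigma>)"
proof -
  obtain H1 where H1: "\<And>K I. finite K \<Longrightarrow> kbox N H1 \<inter> seed_clocks \<subseteq> K \<Longrightarrow> K \<subseteq> seed_clocks \<Longrightarrow> I \<subseteq> {0<..t} \<Longrightarrow>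
      agree N UNIV (flow (\<lambda>k. T k \<omega>) seed_clocks I \<sigma>) (evoI (\<lambda>k. T k \<omega>) K I \<sigma>)"
    using good_rings.flow_agree[OF good \<sigma> order_refl, of N t] by blast
  show ?thesis
    unfolding eventually_sequentially
  proof (intro exI[of _ H1] allI impI)
    fix H assume "H1 \<le> H"
    then have sub: "kbox N H1 \<inter> seed_clocks \<subseteq> kbox N (Suc H)" using kbox_mono[of N N H1 "Suc H"] by auto
    have "agree N UNIV (flow (\<lambda>k. T k \<omega>) seed_clocks {0<..t} \<sigma>) (evoI (\<lambda>k. T k \<omega>) (kbox N (Suc H)) {0<..t} \<sigma>)"
      by (rule H1[OF finite_kbox sub kbox_seed order_refl])
    then have "agree N UNIV (Phi seed_clocks 0 t \<omega> \<sigma>) (Phi (kbox N (Suc H)) 0 t \<omega> \<sigma>)"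
      unfolding Phi_flow[OF good order_refl order_refl t] Phi_flow[OF good kbox_seed order_refl t]
        good_rings.flow_finite[OF good finite_kbox kbox_seed]
      by (rule agree_trans) (rule agree_sym[OF agree_restrict])
    then have "agree N {..H0} (Phi (kbox N (Suc H)) 0 t \<omega> \<sigma>) (Phi seed_clocks 0 t \<omega> \<sigma>)"
      by (rule agree_sym[OF agree_mono[OF _ order_refl subset_UNIV]])
    then show "f (Phi (kbox N (Suc H)) 0 t \<omega> \<sigma>) = f (Phi seed_clocks 0 t \<omega> \<sigma>)" by (rule box_funD[OF f])
  qed
qed

text \<open>With the clocks of a finite box, \<open>F s\<close> averages the evolution from
  \<open>s\<close> to \<open>t\<close> over the measure with parameter \<open>w s\<close>. It
  interpolates between the two sides and varies by at most
  \<open>\<eta> * top_bound N H B * t\<close>, which tends to \<open>0\<close> with growing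
  \<open>H\<close>.\<close>

lemma integral_law_evolution:
  fixes f :: "config \<Rightarrow> real"
  assumes f: "box_fun N H0 f" and t: "0 \<le> t"
  shows "(\<integral>\<sigma>. (\<integral>\<sigma>'. f \<sigma>' \<partial>Q seed_clocks 0 t \<sigma>) \<partial>s6v_law q u (\<lambda>_. j) bottom) = (\<integral>\<sigma>. f \<sigma> \<partial>s6v_law q (w t) (\<lambda>_. j) bottom)"
proof -
  let ?\<mu> = "s6v_law q u (\<lambda>_. j) bottom" and ?bd = "boundary (\<lambda>_. j) bottom"
  have u1: "u < 1" using u eta by simp
  obtain B where B: "B \<ge> 0" "\<And>\<sigma>. \<bar>f \<sigma>\<bar> \<le> B" using box_fun_bounded[OF f] by blast
  interpret \<mu>: prob_space ?\<mu> by (rule prob_space_law)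
  have space_\<mu>: "space ?\<mu> = space config_space" by (rule sets_eq_imp_space_eq) simp
  have fm: "f \<in> borel_measurable config_space" by (rule box_fun_measurable[OF f]) simp
  define E where "E A s \<sigma> = expectation (\<lambda>\<omega>. f (Phi A s t \<omega> \<sigma>))" for A s \<sigma>
  have fH: "box_fun N (Suc H) f" if "H0 \<le> H" for H using box_fun_mono[OF f] that by simp
  have EB: "\<bar>E A s \<sigma>\<bar> \<le> B" for A s \<sigma> unfolding E_def by (rule expectation_bound[OF B(2)])
  have E_box: "box_fun N (Suc H) (E (kbox N (Suc H)) s)" if "H0 \<le> H" for H s
    unfolding E_def by (rule box_fun_expectation[OF fH[OF that]]) simp
  have E_t: "E (kbox N (Suc H)) t = f" if H: "H0 \<le> H" for H
  proof
    fix \<sigma> :: config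
    let ?\<sigma> = "restrict \<sigma> quad_edges"
    have sp: "?\<sigma> \<in> space config_space" by (simp add: space_config)
    have "AE \<omega> in M. f (Phi (kbox N (Suc H)) t t \<omega> ?\<sigma>) = f ?\<sigma>"
      using AE_good_rings
    proof eventually_elim
      case (elim \<omega>)
      have "Phi (kbox N (Suc H)) t t \<omega> ?\<sigma> = ?\<sigma>"
        unfolding Phi_flow[OF elim kbox_seed t order_refl] by (rule good_rings.flow_no_rings[OF elim]) auto
      then show ?case by simp
    qed
    then have "E (kbox N (Suc H)) t ?\<sigma> = expectation (\<lambda>_. f ?\<sigma>)"
      unfolding E_def by (intro integral_cong_AE expectation_box_fun(2)[OF f kbox_seed t order_refl sp]) auto
    then show "E (kbox N (Suc H)) t \<sigma> = f \<sigma>"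
      using box_funD[OF f agree_restrict] box_funD[OF E_box[OF H] agree_restrict] by (simp add: prob_space)
  qed
  define a where "a H = (\<integral>\<sigma>. E (kbox N (Suc H)) 0 \<sigma> \<partial>?\<mu>)" for H
  have le: "\<forall>\<^sub>F H in sequentially. norm (a H - (\<integral>\<sigma>. f \<sigma> \<partial>s6v_law q (w t) (\<lambda>_. j) bottom)) \<le> \<eta> * top_bound N H B * t"
    unfolding eventually_sequentially
  proof (intro exI[of _ H0] allI impI)
    fix H assume H: "H0 \<le> H"
    define F where "F s = Ex q (w s) (boxl (Suc H) 0 N) ?bd (E (kbox N (Suc H)) s)" for s
    obtain L where L: "\<And>a b. 0 \<le> a \<Longrightarrow> a \<le> b \<Longrightarrow> b \<le> t \<Longrightarrow> \<bar>F b - F a\<bar> \<le> \<eta> * top_bound N H B * (b - a) + L * (b - a)\<^sup>2"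
      using local_estimate[OF fH[OF H] B(2), of j bottom] unfolding F_def E_def by blast
    have "\<bar>F t - F 0\<bar> \<le> \<eta> * top_bound N H B * t" by (rule abs_diff_le_of_local[OF t L])
    moreover have "F 0 = a H" unfolding F_def a_def integral_law_box[OF q u(1) u1 E_box[OF H]] by (simp add: u_at_def)
    moreover have "F t = (\<integral>\<sigma>. f \<sigma> \<partial>s6v_law q (w t) (\<lambda>_. j) bottom)"
      unfolding F_def E_t[OF H] integral_law_box[OF q w(1,2)[OF t] fH[OF H]] ..
    ultimately show "norm (a H - (\<integral>\<sigma>. f \<sigma> \<partial>s6v_law q (w t) (\<lambda>_. j) bottom)) \<le> \<eta> * top_bound N H B * t" by simp
  qed
  have "(\<lambda>H. \<eta> * top_bound N H B * t) \<longlonglongrightarrow> \<eta> * 0 * t"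
    by (rule tendsto_mult[OF tendsto_mult[OF tendsto_const top_tendsto_0] tendsto_const])
  then have 0: "(\<lambda>H. \<eta> * top_bound N H B * t) \<longlonglongrightarrow> 0" by (simp only: mult_zero_right mult_zero_left)
  have lim1: "a \<longlonglongrightarrow> (\<integral>\<sigma>. f \<sigma> \<partial>s6v_law q (w t) (\<lambda>_. j) bottom)"
    by (rule LIM_zero_cancel[OF Lim_null_comparison[OF le 0]])
  have mE: "E A 0 \<in> borel_measurable ?\<mu>" if "A \<subseteq> seed_clocks" for A
  proof -
    have "(\<lambda>\<sigma>. \<integral>\<sigma>'. f \<sigma>' \<partial>Q A 0 t \<sigma>) \<in> borel_measurable config_space"
      by (rule measurable_compose[OF measurable_prob_algebraD[OF measurable_Q[OF that order_refl t]] integral_measurable_subprob_algebra[OF fm]])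
    also have "(\<lambda>\<sigma>. \<integral>\<sigma>'. f \<sigma>' \<partial>Q A 0 t \<sigma>) \<in> borel_measurable config_space \<longleftrightarrow> E A 0 \<in> borel_measurable config_space"
      by (rule measurable_cong) (simp add: E_def expectation_box_fun(1)[OF f that order_refl t])
    finally show ?thesis by (simp cong: measurable_cong_sets)
  qed
  \<comment> \<open>Almost every configuration of the six vertex measure is regular, so along almost
    every outcome the finite boxes eventually give the full flow; dominated convergence removes the
    truncation.\<close>
  have "AE \<sigma> in ?\<mu>. (\<lambda>H. E (kbox N (Suc H)) 0 \<sigma>) \<longlonglongrightarrow> E seed_clocks 0 \<sigma>"
    using AE_law_regular[OF q u(1) u1]
  proof eventually_elim
    case (elim \<sigma>)
    note sp = regular_space[OF elim]
    show ?case unfolding E_def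
    proof (rule integral_dominated_convergence[where w = "\<lambda>_. B"])
      show "(\<lambda>\<omega>. f (Phi seed_clocks 0 t \<omega> \<sigma>)) \<in> borel_measurable M"
        by (rule expectation_box_fun(2)[OF f order_refl order_refl t sp])
      show "(\<lambda>\<omega>. f (Phi (kbox N (Suc H)) 0 t \<omega> \<sigma>)) \<in> borel_measurable M" for H
        by (rule expectation_box_fun(2)[OF f kbox_seed order_refl t sp])
      show "AE \<omega> in M. (\<lambda>H. f (Phi (kbox N (Suc H)) 0 t \<omega> \<sigma>)) \<longlonglongrightarrow> f (Phi seed_clocks 0 t \<omega> \<sigma>)"
        using AE_good_rings by eventually_elim (rule tendsto_eventually[OF Phi_box_eventually[OF f elim t]])
    qed (use B(2) in auto)
  qed
  then have lim2: "a \<longlonglongrightarrow> (\<integral>\<sigma>. E seed_clocks 0 \<sigma> \<partial>?\<mu>)"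
    unfolding a_def
    by (intro integral_dominated_convergence[where w = "\<lambda>_. B"] mE order_refl kbox_seed) (use EB in auto)
  have "(\<integral>\<sigma>. (\<integral>\<sigma>'. f \<sigma>' \<partial>Q seed_clocks 0 t \<sigma>) \<partial>?\<mu>) = (\<integral>\<sigma>. E seed_clocks 0 \<sigma> \<partial>?\<mu>)"
    by (rule Bochner_Integration.integral_cong[OF refl]) (simp add: E_def space_\<mu> expectation_box_fun(1)[OF f order_refl order_refl t])
  then show ?thesis using LIMSEQ_unique[OF lim1 lim2] by simp
qed

text \<open>Events of finitely many edges determine a measure on configurations, and their
  indicators are cylindric functions.\<close>

lemma law_evolution:
  assumes t: "0 \<le> t"
  shows "s6v_law q u (\<lambda>_. j) bottom \<bind> Q seed_clocks 0 t = s6v_law q (w t) (\<lambda>_. j) bottom"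
proof -
  let ?\<mu> = "s6v_law q u (\<lambda>_. j) bottom" and ?\<nu> = "s6v_law q (w t) (\<lambda>_. j) bottom"
  interpret \<mu>: prob_space ?\<mu> by (rule prob_space_law)
  interpret \<nu>: prob_space ?\<nu> by (rule prob_space_law)
  have sp: "space ?\<mu> = space config_space" "space ?\<nu> = space config_space" by (rule sets_eq_imp_space_eq, simp)+
  have mQ: "Q seed_clocks 0 t \<in> measurable ?\<mu> (prob_algebra config_space)"
    using measurable_Q[OF order_refl order_refl t] by (simp cong: measurable_cong_sets)
  have mQ': "Q seed_clocks 0 t \<in> measurable ?\<mu> (subprob_algebra config_space)" by (rule measurable_prob_algebraD[OF mQ])
  have \<mu>_prob: "?\<mu> \<in> space (prob_algebra config_space)" by (simp add: space_prob_algebra \<mu>.prob_space_axioms)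
  have bp: "?\<mu> \<bind> Q seed_clocks 0 t \<in> space (prob_algebra config_space)"
    using prob_space_bind'[OF \<mu>_prob measurable_Q[OF order_refl order_refl t]] sets_bind'[OF \<mu>_prob measurable_Q[OF order_refl order_refl t]]
    by (simp add: space_prob_algebra)
  then interpret b: prob_space "?\<mu> \<bind> Q seed_clocks 0 t" by (simp add: space_prob_algebra)
  have sb: "sets (?\<mu> \<bind> Q seed_clocks 0 t) = sets config_space" using bp by (simp add: space_prob_algebra)
  have spb: "space (?\<mu> \<bind> Q seed_clocks 0 t) = space config_space" by (rule sets_eq_imp_space_eq[OF sb])
  show ?thesis
  proof (rule measure_eqI_PiM_infinite)
    show "sets (?\<mu> \<bind> Q seed_clocks 0 t) = sets (\<Pi>\<^sub>M e\<in>quad_edges. count_space UNIV)"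
      "sets ?\<nu> = sets (\<Pi>\<^sub>M e\<in>quad_edges. count_space UNIV)" by (simp_all add: sb flip: config_space_def)
    show "finite_measure (?\<mu> \<bind> Q seed_clocks 0 t)" by (rule b.finite_measure_axioms)
    fix A :: "edge \<Rightarrow> bool set" and J assume J: "finite J" "J \<subseteq> quad_edges"
    let ?E = "prod_emb quad_edges (\<lambda>_. count_space UNIV) J (Pi\<^sub>E J A)"
    define f :: "config \<Rightarrow> real" where "f \<sigma> = of_bool (\<forall>e\<in>J. \<sigma> e \<in> A e)" for \<sigma>
    have "cylindric f" unfolding cylindric_def f_def by (intro exI[of _ J] conjI J allI impI) simp
    then obtain N H where fb: "box_fun N H f" using cylindric_box by blast
    have fm: "f \<in> borel_measurable config_space" by (rule box_fun_measurable[OF fb]) simp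
    have E: "?E \<in> sets config_space" unfolding config_space_def by (rule sets_PiM_I[OF J]) simp
    have ind: "indicator ?E \<sigma> = f \<sigma>" if "\<sigma> \<in> space config_space" for \<sigma>
      using that J by (simp add: f_def indicator_def prod_emb_iff space_config PiE_iff)
    have meas: "measure P ?E = (\<integral>\<sigma>. f \<sigma> \<partial>P)" if "sets P = sets config_space" for P
    proof -
      have s: "space P = space config_space" by (rule sets_eq_imp_space_eq[OF that])
      have "?E \<subseteq> space P" using sets.sets_into_space[OF E] s by simp
      then have "measure P ?E = (\<integral>\<sigma>. indicator ?E \<sigma> \<partial>P)" by (simp add: Int_absorb2)
      also have "\<dots> = (\<integral>\<sigma>. f \<sigma> \<partial>P)" by (rule Bochner_Integration.integral_cong[OF refl]) (simp add: ind s)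
      finally show ?thesis .
    qed
    have "measure (?\<mu> \<bind> Q seed_clocks 0 t) ?E = (\<integral>\<sigma>. f \<sigma> \<partial>(?\<mu> \<bind> Q seed_clocks 0 t))" by (rule meas[OF sb])
    also have "\<dots> = (\<integral>\<sigma>. (\<integral>\<sigma>'. f \<sigma>' \<partial>Q seed_clocks 0 t \<sigma>) \<partial>?\<mu>)"
    proof (rule integral_bind[OF fm _ mQ', where B = 1 and B' = 1])
      show "AE x in ?\<mu>. emeasure (Q seed_clocks 0 t x) (space (Q seed_clocks 0 t x)) \<le> ennreal 1"
        using measurable_space[OF mQ'] by (intro AE_I2) (auto simp: space_subprob_algebra subprob_space.emeasure_space_le_1)
    qed (auto simp: f_def \<mu>.finite_measure_axioms)
    also have "\<dots> = (\<integral>\<sigma>. f \<sigma> \<partial>?\<nu>)" by (rule integral_law_evolution[OF fb t])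
    also have "\<dots> = measure ?\<nu> ?E" by (rule meas[symmetric]) simp
    finally show "emeasure (?\<mu> \<bind> Q seed_clocks 0 t) ?E = emeasure ?\<nu> ?E"
      by (simp add: b.emeasure_eq_measure \<nu>.emeasure_eq_measure)
  qed
qed

end

section \<open>Construction of Poisson clocks\<close>

text \<open>The multinomial probability that among \<open>r\<close> independent points exactly
  \<open>n i\<close> fall into class \<open>i\<close>, for each \<open>i\<close> in
  \<open>S\<close>; \<open>p0\<close> is the probability of hitting no class.\<close>

definition mnom :: "'i set \<Rightarrow> real \<Rightarrow> ('i \<Rightarrow> real) \<Rightarrow> nat \<Rightarrow> ('i \<Rightarrow> nat) \<Rightarrow> real" where
  "mnom S p0 p r n = (if sum n S \<le> r then fact r / fact (r - sum n S) * p0 ^ (r - sum n S) * (\<Prod>i\<in>S. p i ^ n i / fact (n i)) else 0)"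

text \<open>Condition on the class of one of the \<open>Suc r\<close> points. Algebraically, the
  term for class \<open>i\<close> is \<open>n i\<close> times a common factor and the one for no
  class takes the rest, which together make \<open>Suc r\<close>.\<close>

lemma mnom_Suc:
  assumes "finite S"
  shows "mnom S p0 p (Suc r) n = p0 * mnom S p0 p r n + (\<Sum>i\<in>S. if n i = 0 then 0 else p i * mnom S p0 p r (n(i := n i - 1)))"
proof -
  define s where "s = sum n S"
  define P where "P = (\<Prod>i\<in>S. p i ^ n i / fact (n i))"
  have *: "(if n i = 0 then 0 else p i * mnom S p0 p r (n(i := n i - 1))) =
     real (n i) * (if s \<le> Suc r then fact r / fact (Suc r - s) * p0 ^ (Suc r - s) * P else 0)" if i: "i \<in> S" for i
  proof (cases "n i = 0")
    case False
    have s: "sum (n(i := n i - 1)) S = s - 1" "s \<noteq> 0"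
    proof -
      have "s = n i + sum n (S - {i})" unfolding s_def using sum.remove[OF assms i] .
      moreover have "sum (n(i := n i - 1)) S = (n i - 1) + sum (n(i := n i - 1)) (S - {i})"
        using sum.remove[OF assms i, of "n(i := n i - 1)"] by simp
      moreover have "sum (n(i := n i - 1)) (S - {i}) = sum n (S - {i})" by (rule sum.cong) auto
      ultimately show "sum (n(i := n i - 1)) S = s - 1" "s \<noteq> 0" using False by auto
    qed
    have "P = p i ^ n i / fact (n i) * (\<Prod>i\<in>S - {i}. p i ^ n i / fact (n i))" unfolding P_def using prod.remove[OF assms i] .
    moreover have "(\<Prod>l\<in>S. p l ^ (n(i := n i - 1)) l / fact ((n(i := n i - 1)) l)) = p i ^ (n i - 1) / fact (n i - 1) * (\<Prod>l\<in>S - {i}. p l ^ n l / fact (n l))"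
      by (subst prod.remove[OF assms i]) (auto intro!: arg_cong2[where f = "(*)"] prod.cong)
    moreover have "real (n i) * (p i ^ n i / fact (n i) * R) = p i * (p i ^ (n i - 1) / fact (n i - 1) * R)" for R
      using False by (cases "n i") (simp_all add: divide_simps)
    ultimately have P: "real (n i) * P = p i * (\<Prod>l\<in>S. p l ^ (n(i := n i - 1)) l / fact ((n(i := n i - 1)) l))"
      by (simp only:)
    have le: "s - 1 \<le> r \<longleftrightarrow> s \<le> Suc r" "r - (s - 1) = Suc r - s" using s(2) by auto
    show ?thesis using False unfolding mnom_def s(1) le using P by (simp add: mult_ac del: fun_upd_apply)
  qed simp
  have "(\<Sum>i\<in>S. if n i = 0 then 0 else p i * mnom S p0 p r (n(i := n i - 1))) =
     real s * (if s \<le> Suc r then fact r / fact (Suc r - s) * p0 ^ (Suc r - s) * P else 0)"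
    by (simp only: sum.cong[OF refl *] sum_distrib_right[symmetric] of_nat_sum s_def)
  moreover have "p0 * mnom S p0 p r n = (real (Suc r) - real s) * (if s \<le> Suc r then fact r / fact (Suc r - s) * p0 ^ (Suc r - s) * P else 0)"
  proof (cases "s \<le> r")
    case True
    then have d: "Suc r - s = Suc (r - s)" "real (Suc r) - real s = real (Suc (r - s))" by auto
    show ?thesis using True unfolding mnom_def s_def[symmetric] P_def[symmetric] d by (simp del: of_nat_Suc)
  qed (auto simp: mnom_def s_def[symmetric])
  moreover have "mnom S p0 p (Suc r) n = real (Suc r) * (if s \<le> Suc r then fact r / fact (Suc r - s) * p0 ^ (Suc r - s) * P else 0)"
    unfolding mnom_def s_def[symmetric] P_def[symmetric] by (simp del: of_nat_Suc)
  ultimately show ?thesis by (simp add: algebra_simps)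
qed

text \<open>Mixing multinomials over a Poisson number of points decouples the classes: after a shift
  by the total count the series is the exponential of \<open>c * p0\<close>, and
  \<open>p0 = 1 - sum p S\<close> splits the exponentials over the classes.\<close>

lemma poisson_mnom_sums:
  assumes S: "finite S" and p0: "p0 = 1 - sum p S"
  shows "(\<lambda>r. c ^ r / fact r * exp (- c) * mnom S p0 p r n) sums (\<Prod>i\<in>S. (c * p i) ^ n i / fact (n i) * exp (- (c * p i)))"
proof -
  define s where "s = sum n S"
  define P where "P = (\<Prod>i\<in>S. p i ^ n i / fact (n i))"
  define f where "f = (\<lambda>r. c ^ r / fact r * exp (- c) * mnom S p0 p r n)"
  have "(\<lambda>r. (c * p0) ^ r /\<^sub>R fact r) sums exp (c * p0)" by (rule exp_converges)
  then have "(\<lambda>r. (c ^ s * exp (- c) * P) * ((c * p0) ^ r /\<^sub>R fact r)) sums ((c ^ s * exp (- c) * P) * exp (c * p0))" by (rule sums_mult)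
  moreover have "(c ^ s * exp (- c) * P) * ((c * p0) ^ r /\<^sub>R fact r) = f (r + s)" for r
    unfolding f_def mnom_def s_def[symmetric] P_def[symmetric]
    by (simp add: power_add power_mult_distrib divide_simps)
  ultimately have "(\<lambda>r. f (r + s)) sums ((c ^ s * exp (- c) * P) * exp (c * p0))" by simp
  moreover have "(\<Sum>r<s. f r) = 0" by (rule sum.neutral) (simp add: f_def mnom_def s_def[symmetric])
  ultimately have "f sums ((c ^ s * exp (- c) * P) * exp (c * p0))" using sums_iff_shift'[of f s] by simp
  moreover have "(c ^ s * exp (- c) * P) * exp (c * p0) = (\<Prod>i\<in>S. (c * p i) ^ n i / fact (n i) * exp (- (c * p i)))"
  proof -
    have "exp (- c) * exp (c * p0) = exp (- (\<Sum>i\<in>S. c * p i))"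
      by (simp add: p0 right_diff_distrib sum_distrib_left flip: exp_add)
    also have "\<dots> = (\<Prod>i\<in>S. exp (- (c * p i)))" by (simp add: exp_sum[OF S] flip: sum_negf)
    finally have e: "exp (- c) * exp (c * p0) = (\<Prod>i\<in>S. exp (- (c * p i)))" .
    have "c ^ s * P = (\<Prod>i\<in>S. (c * p i) ^ n i / fact (n i))"
      by (simp add: s_def P_def power_sum power_mult_distrib flip: prod.distrib)
    then have "(c ^ s * P) * (exp (- c) * exp (c * p0)) = (\<Prod>i\<in>S. (c * p i) ^ n i / fact (n i) * exp (- (c * p i)))"
      unfolding e by (simp only: prod.distrib)
    then show ?thesis by (simp only: mult_ac)
  qed
  ultimately show ?thesis by (simp only: f_def)
qed

text \<open>
  Each of a Poisson number of independent points falls into at most one of the sets \<open>A i\<close>. The induction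
  reveals the points one after the other; the positions of the points not yet counted are kept arbitrary.
\<close>

lemma (in prob_space) poisson_thinning:
  fixes V :: "nat \<Rightarrow> 'a \<Rightarrow> real" and A :: "'i \<Rightarrow> real set" and \<nu> :: "real measure"
  assumes V: "indep_vars (\<lambda>_. borel) V UNIV"
    and N: "\<And>r. prob {\<omega> \<in> space M. nat \<lfloor>V 0 \<omega>\<rfloor> = r} = c ^ r / fact r * exp (- c)"
    and U: "\<And>l B. B \<in> sets borel \<Longrightarrow> prob {\<omega> \<in> space M. V (Suc l) \<omega> \<in> B} = measure \<nu> B"
    and \<nu>: "prob_space \<nu>" "sets \<nu> = sets borel"
    and S: "finite S" and A: "\<And>i. i \<in> S \<Longrightarrow> A i \<in> sets borel" and dj: "disjoint_family_on A S"
  shows "prob {\<omega> \<in> space M. \<forall>i\<in>S. card {l. l < nat \<lfloor>V 0 \<omega>\<rfloor> \<and> V (Suc l) \<omega> \<in> A i} = n i} =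
    (\<Prod>i\<in>S. (c * measure \<nu> (A i)) ^ n i / fact (n i) * exp (- (c * measure \<nu> (A i))))"
proof -
  interpret \<nu>: prob_space \<nu> by fact
  have Vm[measurable]: "V l \<in> borel_measurable M" for l using V by (auto simp: indep_vars_def)
  have \<nu>sp: "space \<nu> = UNIV" using sets_eq_imp_space_eq[OF \<nu>(2)] by simp
  define p where "p i = measure \<nu> (A i)" for i
  define A0 where "A0 = - (\<Union>i\<in>S. A i)"
  have A0[measurable]: "A0 \<in> sets borel" unfolding A0_def using A S by (intro borel_comp sets.finite_UN) auto
  have UA: "(\<Union>i\<in>S. A i) \<in> sets borel" using A S by (intro sets.finite_UN) auto
  have p0: "measure \<nu> A0 = 1 - sum p S"
  proof -
    have "measure \<nu> (\<Union>i\<in>S. A i) = sum p S"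
      unfolding p_def by (rule \<nu>.finite_measure_finite_Union[OF S _ dj]) (use A \<nu>(2) in auto)
    then show ?thesis using \<nu>.prob_compl[of "\<Union>i\<in>S. A i"] UA \<nu>(2) by (simp add: A0_def \<nu>sp Compl_eq_Diff_UNIV)
  qed
  define X where "X r i \<omega> = card {l. l < r \<and> V (Suc l) \<omega> \<in> A i}" for r i \<omega>
  have X0: "X 0 i \<omega> = 0" for i \<omega> by (simp add: X_def)
  have XS: "X (Suc r) i \<omega> = X r i \<omega> + of_bool (V (Suc r) \<omega> \<in> A i)" for r i \<omega>
  proof -
    have "{l. l < Suc r \<and> V (Suc l) \<omega> \<in> A i} = (if V (Suc r) \<omega> \<in> A i then {r} else {}) \<union> {l. l < r \<and> V (Suc l) \<omega> \<in> A i}" by (auto simp: less_Suc_eq)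
    then show ?thesis by (simp add: X_def)
  qed
  have Xm: "{\<omega> \<in> space M. X r i \<omega> = m} \<in> events" if "i \<in> S" for r i m
  proof (induction r arbitrary: m)
    case (Suc r)
    have "{\<omega> \<in> space M. X (Suc r) i \<omega> = m} = ({\<omega> \<in> space M. X r i \<omega> = m} \<inter> {\<omega> \<in> space M. V (Suc r) \<omega> \<notin> A i}) \<union>
       (if m = 0 then {} else {\<omega> \<in> space M. X r i \<omega> = m - 1} \<inter> {\<omega> \<in> space M. V (Suc r) \<omega> \<in> A i})"
      by (auto simp: XS)
    moreover have "{\<omega> \<in> space M. V (Suc r) \<omega> \<notin> A i} \<in> events" "{\<omega> \<in> space M. V (Suc r) \<omega> \<in> A i} \<in> events" using A[OF that] by measurable
    ultimately show ?case using Suc by (auto intro!: sets.Un sets.Int)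
  qed (simp add: X0)
  \<comment> \<open>There are \<open>R\<close> points in all; the first \<open>r\<close> are counted
    by class, and the positions of the others are prescribed by arbitrary sets, which lets the
    induction on \<open>r\<close> absorb one point at a time.\<close>
  define E where "E R r n B = {\<omega> \<in> space M. nat \<lfloor>V 0 \<omega>\<rfloor> = R \<and> (\<forall>i\<in>S. X r i \<omega> = n i) \<and> (\<forall>l\<in>{r..<R}. V (Suc l) \<omega> \<in> B l)}" for R r n B
  have Em: "E R r n B \<in> events" if "\<And>l. B l \<in> sets borel" for R r n B
  proof -
    have "E R r n B = {\<omega> \<in> space M. nat \<lfloor>V 0 \<omega>\<rfloor> = R} \<inter> {\<omega> \<in> space M. \<forall>i\<in>S. X r i \<omega> = n i} \<inter> {\<omega> \<in> space M. \<forall>l\<in>{r..<R}. V (Suc l) \<omega> \<in> B l}"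
      by (auto simp: E_def)
    moreover have "{\<omega> \<in> space M. \<forall>i\<in>S. X r i \<omega> = n i} \<in> events" by (rule sets.sets_Collect_finite_All[OF Xm S])
    moreover have "{\<omega> \<in> space M. \<forall>l\<in>{r..<R}. V (Suc l) \<omega> \<in> B l} \<in> events"
      by (rule sets.sets_Collect_finite_All) (use that in measurable)
    moreover have "{\<omega> \<in> space M. nat \<lfloor>V 0 \<omega>\<rfloor> = R} \<in> events" by measurable
    ultimately show ?thesis by (simp add: sets.Int)
  qed
  have base: "prob (E R 0 n B) = (c ^ R / fact R * exp (- c)) * of_bool (\<forall>i\<in>S. n i = 0) * (\<Prod>l\<in>{0..<R}. measure \<nu> (B l))"
    if B: "\<And>l. B l \<in> sets borel" for R n B
  proof (cases "\<forall>i\<in>S. n i = 0")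
    case True
    define B' where "B' l = (case l of 0 \<Rightarrow> {x. nat \<lfloor>x\<rfloor> = R} | Suc l \<Rightarrow> B l)" for l
    have B'0: "{x::real. nat \<lfloor>x\<rfloor> = R} \<in> sets borel" by measurable
    have B': "B' l \<in> sets borel" for l unfolding B'_def using B B'0 by (cases l) auto
    have I: "{..R} = insert 0 (Suc ` {0..<R})" by (auto simp: image_iff)
    have "prob (\<Inter>l\<in>{..R}. V l -` B' l \<inter> space M) = (\<Prod>l\<in>{..R}. prob (V l -` B' l \<inter> space M))"
      by (rule indep_varsD[OF V]) (use B' in auto)
    moreover have "(\<Inter>l\<in>{..R}. V l -` B' l \<inter> space M) = E R 0 n B"
      unfolding I using True by (auto simp: E_def B'_def X0 simp del: image_Suc_atLeastLessThan)
    moreover have "(\<Prod>l\<in>{..R}. prob (V l -` B' l \<inter> space M)) = prob (V 0 -` B' 0 \<inter> space M) * (\<Prod>l\<in>{0..<R}. prob (V (Suc l) -` B' (Suc l) \<inter> space M))"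
      unfolding I by (subst prod.insert) (auto simp: prod.reindex simp del: image_Suc_atLeastLessThan)
    moreover have "V 0 -` B' 0 \<inter> space M = {\<omega> \<in> space M. nat \<lfloor>V 0 \<omega>\<rfloor> = R}" by (auto simp: B'_def)
    moreover have "V (Suc l) -` B' (Suc l) \<inter> space M = {\<omega> \<in> space M. V (Suc l) \<omega> \<in> B l}" for l by (auto simp: B'_def)
    ultimately show ?thesis using True U[OF B] N by simp
  next
    case False
    then have "E R 0 n B = {}" by (auto simp: E_def X0)
    then show ?thesis using False by simp
  qed
  have step: "prob (E R r n B) = (c ^ R / fact R * exp (- c)) * mnom S (measure \<nu> A0) p r n * (\<Prod>l\<in>{r..<R}. measure \<nu> (B l))"
    if "r \<le> R" "\<And>l. B l \<in> sets borel" for R r n B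
    using that
  proof (induction r arbitrary: n B)
    case 0
    have "mnom S (measure \<nu> A0) p 0 n = of_bool (\<forall>i\<in>S. n i = 0)"
      using S by (auto simp: mnom_def)
    then show ?case using base[OF 0(2)] by simp
  next
    case (Suc r)
    let ?m = "\<lambda>i. n(i := n i - 1)"
    \<comment> \<open>The cases for the newly counted point: outside all classes
      (\<open>None\<close>) or in the class \<open>i\<close>, whose earlier count is then one
      less.\<close>
    define F where "F o' = (case o' of None \<Rightarrow> E R r n (B(r := A0)) | Some i \<Rightarrow> if n i = 0 then {} else E R r (?m i) (B(r := A i)))" for o'
    let ?O = "insert None (Some ` S)"
    have split: "{r..<R} = insert r {Suc r..<R}" using Suc.prems(1) by auto
    have "E R (Suc r) n B = (\<Union>o'\<in>?O. F o')"
    proof (intro equalityI subsetI)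
      fix \<omega> assume \<omega>: "\<omega> \<in> E R (Suc r) n B"
      show "\<omega> \<in> (\<Union>o'\<in>?O. F o')"
      proof (cases "\<exists>i\<in>S. V (Suc r) \<omega> \<in> A i")
        case True
        then obtain i where i: "i \<in> S" "V (Suc r) \<omega> \<in> A i" by blast
        have no: "V (Suc r) \<omega> \<notin> A i'" if "i' \<in> S" "i' \<noteq> i" for i' using dj i that unfolding disjoint_family_on_def by blast
        have "n i \<noteq> 0" using \<omega> i by (auto simp: E_def XS)
        moreover have "\<omega> \<in> E R r (?m i) (B(r := A i))" using \<omega> i no unfolding E_def split by (auto simp: XS)
        ultimately have "\<omega> \<in> F (Some i)" by (simp add: F_def)
        then show ?thesis using i(1) by blast
      next
        case False
        then have "\<omega> \<in> E R r n (B(r := A0))" using \<omega> unfolding E_def split by (auto simp: XS A0_def)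
        then show ?thesis by (simp add: F_def)
      qed
    next
      fix \<omega> assume "\<omega> \<in> (\<Union>o'\<in>?O. F o')"
      then consider "\<omega> \<in> F None" | i where "i \<in> S" "\<omega> \<in> F (Some i)" by auto
      then show "\<omega> \<in> E R (Suc r) n B"
      proof cases
        case 1
        then have "\<omega> \<in> E R r n (B(r := A0))" by (simp add: F_def)
        then show ?thesis unfolding E_def split by (auto simp: XS A0_def)
      next
        case 2
        then have n: "n i \<noteq> 0" and \<omega>: "\<omega> \<in> E R r (?m i) (B(r := A i))" by (auto simp: F_def split: if_splits)
        have V: "V (Suc r) \<omega> \<in> A i" using \<omega> unfolding E_def split by auto
        have no: "V (Suc r) \<omega> \<notin> A i'" if "i' \<in> S" "i' \<noteq> i" for i' using dj 2(1) V that unfolding disjoint_family_on_def by blast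
        have "X (Suc r) i' \<omega> = n i'" if "i' \<in> S" for i'
        proof (cases "i' = i")
          case True
          have "X r i \<omega> = n i - 1" using \<omega> 2(1) by (auto simp: E_def)
          then show ?thesis using True V n by (simp add: XS)
        next
          case False
          have "X r i' \<omega> = n i'" using \<omega> that False by (auto simp: E_def)
          then show ?thesis using no[OF that False] by (simp add: XS)
        qed
        then show ?thesis using \<omega> unfolding E_def split by auto
      qed
    qed
    moreover have mF: "F o' \<in> events" if "o' \<in> ?O" for o'
      using that Suc.prems(2) A A0 by (auto simp: F_def intro!: Em split: option.split)
    moreover have "disjoint_family_on F ?O"
    proof -
      have V: "\<omega> \<in> F o' \<Longrightarrow> o' \<in> ?O \<Longrightarrow> V (Suc r) \<omega> \<in> (case o' of None \<Rightarrow> A0 | Some i \<Rightarrow> A i)" for \<omega> o'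
        unfolding F_def E_def split by (auto split: option.splits if_splits)
      have "o1 = o2" if "\<omega> \<in> F o1" "\<omega> \<in> F o2" "o1 \<in> ?O" "o2 \<in> ?O" for \<omega> o1 o2
        using V[OF that(1,3)] V[OF that(2,4)] that(3,4) dj
        by (auto simp: A0_def disjoint_family_on_def split: option.splits)
      then show ?thesis unfolding disjoint_family_on_def by blast
    qed
    ultimately have "prob (E R (Suc r) n B) = (\<Sum>o'\<in>?O. prob (F o'))"
      using S by (simp only:) (rule finite_measure_finite_Union, auto)
    also have "\<dots> = prob (F None) + (\<Sum>i\<in>S. prob (F (Some i)))"
      using S by (subst sum.insert) (auto simp: sum.reindex)
    also have "prob (F None) = (c ^ R / fact R * exp (- c)) * mnom S (measure \<nu> A0) p r n * (measure \<nu> A0 * (\<Prod>l\<in>{Suc r..<R}. measure \<nu> (B l)))"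
    proof -
      have "prob (F None) = (c ^ R / fact R * exp (- c)) * mnom S (measure \<nu> A0) p r n * (\<Prod>l\<in>{r..<R}. measure \<nu> ((B(r := A0)) l))"
        unfolding F_def option.case by (rule Suc.IH) (use Suc.prems A0 in auto)
      also have "(\<Prod>l\<in>{r..<R}. measure \<nu> ((B(r := A0)) l)) = measure \<nu> A0 * (\<Prod>l\<in>{Suc r..<R}. measure \<nu> (B l))"
        unfolding split by (subst prod.insert) (auto intro!: prod.cong)
      finally show ?thesis .
    qed
    also have "(\<Sum>i\<in>S. prob (F (Some i))) = (\<Sum>i\<in>S. (c ^ R / fact R * exp (- c)) * (if n i = 0 then 0 else p i * mnom S (measure \<nu> A0) p r (?m i)) * (\<Prod>l\<in>{Suc r..<R}. measure \<nu> (B l)))"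
    proof (rule sum.cong[OF refl])
      fix i assume i: "i \<in> S"
      show "prob (F (Some i)) = (c ^ R / fact R * exp (- c)) * (if n i = 0 then 0 else p i * mnom S (measure \<nu> A0) p r (?m i)) * (\<Prod>l\<in>{Suc r..<R}. measure \<nu> (B l))"
      proof (cases "n i = 0")
        case False
        then have "prob (F (Some i)) = (c ^ R / fact R * exp (- c)) * mnom S (measure \<nu> A0) p r (?m i) * (\<Prod>l\<in>{r..<R}. measure \<nu> ((B(r := A i)) l))"
          unfolding F_def option.case if_not_P[OF False] by (intro Suc.IH) (use Suc.prems A[OF i] in auto)
        also have "(\<Prod>l\<in>{r..<R}. measure \<nu> ((B(r := A i)) l)) = p i * (\<Prod>l\<in>{Suc r..<R}. measure \<nu> (B l))"
          unfolding split p_def by (subst prod.insert) (auto intro!: prod.cong)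
        finally show ?thesis using False by (simp add: mult_ac del: fun_upd_apply)
      qed (simp add: F_def)
    qed
    finally show ?case
      unfolding mnom_Suc[OF S] sum_distrib_right[symmetric] sum_distrib_left[symmetric] by (simp add: algebra_simps)
  qed
  define G where "G R = E R R n (\<lambda>_. UNIV)" for R
  have "prob (\<Union>R. G R) = prob {\<omega> \<in> space M. \<forall>i\<in>S. card {l. l < nat \<lfloor>V 0 \<omega>\<rfloor> \<and> V (Suc l) \<omega> \<in> A i} = n i}"
    by (rule arg_cong[where f = prob]) (auto simp: G_def E_def X_def)
  moreover have "(\<lambda>R. prob (G R)) sums prob (\<Union>R. G R)"
  proof (rule finite_measure_UNION)
    show "range G \<subseteq> events" unfolding G_def using Em by auto
    show "disjoint_family G" by (auto simp: G_def disjoint_family_on_def E_def)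
  qed
  moreover have "prob (G R) = c ^ R / fact R * exp (- c) * mnom S (measure \<nu> A0) p R n" for R
    unfolding G_def by (subst step) auto
  ultimately have "(\<lambda>R. c ^ R / fact R * exp (- c) * mnom S (measure \<nu> A0) p R n) sums prob {\<omega> \<in> space M. \<forall>i\<in>S. card {l. l < nat \<lfloor>V 0 \<omega>\<rfloor> \<and> V (Suc l) \<omega> \<in> A i} = n i}"
    by simp
  from sums_unique2[OF this poisson_mnom_sums[OF S p0]] show ?thesis by (simp add: p_def)
qed

lemma (in prob_space) indep_vars_reindex:
  assumes X: "indep_vars (\<lambda>_. N) X UNIV" and e: "inj e"
  shows "indep_vars (\<lambda>_. N) (\<lambda>i. X (e i)) UNIV"
  unfolding indep_vars_def2
proof (intro conjI ballI indep_setsI)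
  have rv: "X i \<in> measurable M N" for i using X by (simp add: indep_vars_def)
  then show "X (e i) \<in> measurable M N" for i .
  show "{X (e i) -` A \<inter> space M |A. A \<in> sets N} \<subseteq> events" for i using measurable_sets[OF rv] by auto
  fix A J assume J: "J \<noteq> {}" "J \<subseteq> UNIV" "finite J" and A: "\<forall>j\<in>J. A j \<in> {X (e j) -` A \<inter> space M |A. A \<in> sets N}"
  then obtain B where B: "\<And>j. j \<in> J \<Longrightarrow> A j = X (e j) -` B j \<inter> space M \<and> B j \<in> sets N" by (simp add: Bex_def) metis
  have inv: "inv e (e j) = j" for j using e by simp
  have "prob (\<Inter>i\<in>e ` J. X i -` B (inv e i) \<inter> space M) = (\<Prod>i\<in>e ` J. prob (X i -` B (inv e i) \<inter> space M))"
    by (rule indep_varsD[OF X]) (use J B inv in auto)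
  then show "prob (\<Inter>j\<in>J. A j) = (\<Prod>j\<in>J. prob (A j))"
    using B J(1) by (simp add: inv prod.reindex[OF inj_on_subset[OF e subset_UNIV]])
qed

text \<open>
  Rates may vanish, hence \<open>F\<close> may have intervals of constancy; keeping only the leftmost preimages makes
  \<open>F\<close> injective on \<open>hits F Y\<close>.
\<close>

definition hits :: "(real \<Rightarrow> real) \<Rightarrow> real set \<Rightarrow> real set" where
  "hits F Y = {t. 0 < t \<and> F t \<in> Y \<and> (\<forall>s. 0 \<le> s \<and> s < t \<longrightarrow> F s < F t)}"

lemma inj_on_hits: "inj_on F (hits F Y)"
proof (rule inj_onI)
  fix s t assume st: "s \<in> hits F Y" "t \<in> hits F Y" "F s = F t"
  have lt: "F r < F r'" if "r \<in> hits F Y" "r' \<in> hits F Y" "r < r'" for r r' using that by (simp add: hits_def)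
  show "s = t" using lt[OF st(1,2)] lt[OF st(2,1)] st(3) by (cases s t rule: linorder_cases) auto
qed

lemma finite_hits: "finite Y \<Longrightarrow> finite (hits F Y)"
  by (rule finite_imageD[OF finite_subset inj_on_hits]) (auto simp: hits_def)

text \<open>By the intermediate value theorem each level between \<open>F s\<close> and
  \<open>F t\<close> is attained, and compactness provides its leftmost preimage, which is the one
  that \<open>hits\<close> retains.\<close>

lemma image_hits:
  assumes F: "continuous_on {0..t} F" "\<And>s t. 0 \<le> s \<Longrightarrow> s \<le> t \<Longrightarrow> F s \<le> F t" and st: "0 \<le> s" "s \<le> t"
  shows "F ` (hits F Y \<inter> {s<..t}) = Y \<inter> {F s<..F t}"
proof (intro equalityI subsetI)
  fix y assume "y \<in> F ` (hits F Y \<inter> {s<..t})"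
  then show "y \<in> Y \<inter> {F s<..F t}" using st F(2) unfolding hits_def by auto
next
  fix y assume y: "y \<in> Y \<inter> {F s<..F t}"
  define D where "D = {r \<in> {s..t}. F r = y}"
  have c: "continuous_on {s..t} F" using continuous_on_subset[OF F(1)] st by auto
  have "D \<noteq> {}" using IVT'[of F s y t] y st c unfolding D_def by auto
  moreover have "D = {s..t} \<inter> F -` {y}" by (auto simp: D_def)
  then have "closed D" using continuous_closed_preimage[OF c closed_atLeastAtMost, of "{y}"] by simp
  moreover have "bounded D" by (rule bounded_subset[OF bounded_closed_interval[of s t]]) (auto simp: D_def)
  ultimately have "D \<noteq> {}" "compact D" by (simp_all add: compact_eq_bounded_closed)
  then obtain r where r: "r \<in> D" "\<And>r'. r' \<in> D \<Longrightarrow> r \<le> r'" using compact_attains_inf by metis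
  have rs: "s < r" "r \<le> t" "F r = y" using r(1) y by (auto simp: D_def order_le_less)
  have "F s' < F r" if s': "0 \<le> s'" "s' < r" for s'
  proof (rule ccontr)
    assume "\<not> F s' < F r"
    then have eq: "F s' = F r" using F(2)[of s' r] s' by linarith
    show False
    proof (cases "s \<le> s'")
      case True
      then have "s' \<in> D" using eq rs s' by (auto simp: D_def)
      then show False using r(2)[of s'] s' by simp
    next
      case False
      then show False using F(2)[of s' s] s' eq rs y by auto
    qed
  qed
  then have "r \<in> hits F Y \<inter> {s<..t}" unfolding hits_def using rs y st by auto
  then show "y \<in> F ` (hits F Y \<inter> {s<..t})" using rs by blast
qed

lemma card_hits:
  assumes "continuous_on {0..t} F" "\<And>s t. 0 \<le> s \<Longrightarrow> s \<le> t \<Longrightarrow> F s \<le> F t" "0 \<le> s" "s \<le> t"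
  shows "card (hits F Y \<inter> {s<..t}) = card (Y \<inter> {F s<..F t})"
  using card_image[OF inj_on_subset[OF inj_on_hits Int_lower1], of F Y "{s<..t}"] image_hits[OF assms, of Y] by simp

text \<open>
  A sequence \<open>v\<close> encodes the number \<open>\<lfloor>v 0\<rfloor>\<close> of points and their positions \<open>v 1, v 2, \<dots>\<close>. The null set of
  sequences with coincident points is discarded.
\<close>

definition points :: "(nat \<Rightarrow> real) \<Rightarrow> real set" where
  "points v = (if inj_on (\<lambda>l. v (Suc l)) {..<nat \<lfloor>v 0\<rfloor>} then (\<lambda>l. v (Suc l)) ` {..<nat \<lfloor>v 0\<rfloor>} else {})"

lemma finite_points: "finite (points v)"
  by (simp add: points_def)

lemma card_points: "card (points v \<inter> {a<..b}) =
   (if inj_on (\<lambda>l. v (Suc l)) {..<nat \<lfloor>v 0\<rfloor>} then card {l. l < nat \<lfloor>v 0\<rfloor> \<and> v (Suc l) \<in> {a<..b}} else 0)"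
proof (cases "inj_on (\<lambda>l. v (Suc l)) {..<nat \<lfloor>v 0\<rfloor>}")
  case True
  have "points v \<inter> {a<..b} = (\<lambda>l. v (Suc l)) ` {l. l < nat \<lfloor>v 0\<rfloor> \<and> v (Suc l) \<in> {a<..b}}"
    using True by (auto simp: points_def)
  then show ?thesis using True card_image[OF inj_on_subset[OF True]] by (metis (no_types, lifting) lessThan_iff mem_Collect_eq subsetI)
qed (simp add: points_def)

lemma measurable_card_points[measurable]:
  "(\<lambda>v. card (points v \<inter> {a<..b})) \<in> measurable (\<Pi>\<^sub>M l\<in>UNIV. borel) (count_space UNIV)"
proof -
  let ?P = "\<Pi>\<^sub>M l\<in>(UNIV :: nat set). borel :: real measure"
  have v[measurable]: "(\<lambda>v. v l) \<in> borel_measurable ?P" for l :: nat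
    by (rule measurable_component_singleton) simp
  have N[measurable]: "(\<lambda>v. nat \<lfloor>v 0\<rfloor>) \<in> measurable ?P (count_space UNIV)"
  proof -
    have "(\<lambda>x :: real. nat \<lfloor>x\<rfloor>) \<in> measurable borel (count_space UNIV)" by measurable
    from measurable_compose[OF v[of 0] this] show ?thesis .
  qed
  have lt[measurable]: "Measurable.pred ?P (\<lambda>v. x < nat \<lfloor>v 0\<rfloor>)" for x
    by (rule measurable_compose[OF N]) simp
  have "Measurable.pred ?P (\<lambda>v. x < nat \<lfloor>v 0\<rfloor> \<and> y < nat \<lfloor>v 0\<rfloor> \<longrightarrow> v (Suc x) = v (Suc y) \<longrightarrow> x = y)" for x y
  proof (cases "x = y")
    case False
    have "{v \<in> space ?P. v (Suc x) = v (Suc y)} \<in> sets ?P" by (rule borel_measurable_eq[OF v v])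
    then have "Measurable.pred ?P (\<lambda>v. v (Suc x) = v (Suc y))" by (simp only: pred_def)
    then show ?thesis using False lt[of x] lt[of y] by (simp add: pred_intros_logic)
  qed simp
  then have "Measurable.pred ?P (\<lambda>v. \<forall>x y. x < nat \<lfloor>v 0\<rfloor> \<and> y < nat \<lfloor>v 0\<rfloor> \<longrightarrow> v (Suc x) = v (Suc y) \<longrightarrow> x = y)"
    by (intro pred_intros_countable)
  also have "(\<lambda>v :: nat \<Rightarrow> real. \<forall>x y. x < nat \<lfloor>v 0\<rfloor> \<and> y < nat \<lfloor>v 0\<rfloor> \<longrightarrow> v (Suc x) = v (Suc y) \<longrightarrow> x = y) =
    (\<lambda>v. inj_on (\<lambda>l. v (Suc l)) {..<nat \<lfloor>v 0\<rfloor>})"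
    by (intro ext) (auto simp: inj_on_def)
  finally have inj: "Measurable.pred ?P (\<lambda>v. inj_on (\<lambda>l. v (Suc l)) {..<nat \<lfloor>v 0\<rfloor>})" .
  have "(\<lambda>v. card {l. l < nat \<lfloor>v 0\<rfloor> \<and> v (Suc l) \<in> {a<..b}}) \<in> measurable ?P (count_space UNIV)"
  proof (rule measurable_card)
    fix l
    have "{v \<in> space ?P. v (Suc l) \<in> {a<..b}} \<in> sets ?P" by measurable
    moreover have "{v \<in> space ?P. l < nat \<lfloor>v 0\<rfloor>} \<in> sets ?P" using lt by (simp add: pred_def)
    ultimately have "{v \<in> space ?P. l < nat \<lfloor>v 0\<rfloor>} \<inter> {v \<in> space ?P. v (Suc l) \<in> {a<..b}} \<in> sets ?P" by blast
    also have "{v \<in> space ?P. l < nat \<lfloor>v 0\<rfloor>} \<inter> {v \<in> space ?P. v (Suc l) \<in> {a<..b}} = {v \<in> space ?P. l \<in> {l. l < nat \<lfloor>v 0\<rfloor> \<and> v (Suc l) \<in> {a<..b}}}" by auto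
    finally show "{v \<in> space ?P. l \<in> {l. l < nat \<lfloor>v 0\<rfloor> \<and> v (Suc l) \<in> {a<..b}}} \<in> sets ?P" .
  qed
  then show ?thesis unfolding card_points by (intro measurable_If inj[unfolded pred_def]) auto
qed

text \<open>Two independent uniform points share one of \<open>n + 1\<close> equal cells with
  probability \<open>1 / (n + 1)\<close>, for every \<open>n\<close>.\<close>

lemma (in prob_space) AE_inj_on_uniform:
  fixes V :: "nat \<Rightarrow> 'a \<Rightarrow> real"
  assumes V: "indep_vars (\<lambda>_. borel) V UNIV"
    and U: "\<And>l B. B \<in> sets borel \<Longrightarrow> prob {\<omega> \<in> space M. V (Suc l) \<omega> \<in> B} = measure (uniform_measure lborel {0<..1}) B"
  shows "AE \<omega> in M. inj (\<lambda>l. V (Suc l) \<omega>)"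
proof -
  have Vm[measurable]: "V l \<in> borel_measurable M" for l using V by (auto simp: indep_vars_def)
  have unif: "AE \<omega> in M. V (Suc l) \<omega> \<in> {0<..1}" for l
  proof -
    have "prob {\<omega> \<in> space M. V (Suc l) \<omega> \<in> {0<..1}} = 1" using U[of "{0<..1}" l] by simp
    then show ?thesis by (subst prob_Collect_eq_1[symmetric]) measurable
  qed
  have ne: "AE \<omega> in M. V (Suc l) \<omega> \<noteq> V (Suc m) \<omega>" if lm: "l \<noteq> m" for l m
  proof -
    define I where "I n i = {real i / real (Suc n)<..real (Suc i) / real (Suc n)}" for n i
    define E where "E n i = {\<omega> \<in> space M. V (Suc l) \<omega> \<in> I n i \<and> V (Suc m) \<omega> \<in> I n i}" for n i
    define D where "D n = (\<Union>i\<in>{..n}. E n i)" for n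
    have mE: "E n i \<in> events" for n i unfolding E_def I_def by measurable
    have mD: "D n \<in> events" for n unfolding D_def using mE by blast
    have pI: "measure (uniform_measure lborel {0<..1}) (I n i) = 1 / real (Suc n)" if "i \<le> n" for n i
    proof -
      have "real (Suc i) / real (Suc n) \<le> 1" "0 \<le> real i / real (Suc n)" using that by auto
      then have "{0<..1} \<inter> I n i = I n i" by (auto simp: I_def simp del: of_nat_Suc)
      moreover have "measure lborel (I n i) = 1 / real (Suc n)"
      proof -
        have "real i / real (Suc n) \<le> real (Suc i) / real (Suc n)" by (intro divide_right_mono) auto
        then have "measure lborel (I n i) = real (Suc i) / real (Suc n) - real i / real (Suc n)" by (simp add: I_def del: of_nat_Suc)
        also have "\<dots> = 1 / real (Suc n)" by (simp add: diff_divide_distrib[symmetric])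
        finally show ?thesis .
      qed
      moreover have "I n i \<in> sets lborel" by (simp add: I_def)
      ultimately show ?thesis by simp
    qed
    have pE: "prob (E n i) = 1 / (real (Suc n))\<^sup>2" if "i \<le> n" for n i
    proof -
      have "prob (\<Inter>j\<in>{Suc l, Suc m}. V j -` I n i \<inter> space M) = (\<Prod>j\<in>{Suc l, Suc m}. prob (V j -` I n i \<inter> space M))"
        by (rule indep_varsD[OF V]) (auto simp: I_def)
      moreover have "(\<Inter>j\<in>{Suc l, Suc m}. V j -` I n i \<inter> space M) = E n i" by (auto simp: E_def)
      moreover have "V j -` I n i \<inter> space M = {\<omega> \<in> space M. V j \<omega> \<in> I n i}" for j by auto
      ultimately show ?thesis using lm U[of "I n i"] pI[OF that] by (simp add: I_def power2_eq_square del: of_nat_Suc)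
    qed
    have pD: "prob (D n) \<le> 1 / real (Suc n)" for n
    proof -
      have "prob (D n) \<le> (\<Sum>i\<in>{..n}. prob (E n i))" unfolding D_def by (rule finite_measure_subadditive_finite) (use mE in auto)
      also have "\<dots> = 1 / real (Suc n)" by (simp add: pE power2_eq_square del: of_nat_Suc)
      finally show ?thesis .
    qed
    define Z where "Z = (\<Inter>n. D n)"
    have mZ: "Z \<in> events" unfolding Z_def using mD by (intro sets.countable_INT) auto
    have "prob Z \<le> 1 / real (Suc n)" for n
    proof -
      have "prob Z \<le> prob (D n)" unfolding Z_def by (intro finite_measure_mono mD) auto
      then show ?thesis using pD[of n] by linarith
    qed
    then have "prob Z \<le> 0" by (intro LIMSEQ_le_const[OF LIMSEQ_Suc[OF lim_const_over_n[of 1]]]) auto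
    then have "Z \<in> null_sets M" using mZ by (auto simp: null_sets_def emeasure_eq_measure measure_le_0_iff)
    then have "AE \<omega> in M. \<omega> \<notin> Z" by (rule AE_not_in)
    then show ?thesis
      using unif[of l] AE_space
    proof eventually_elim
      case (elim \<omega>)
      show ?case
      proof
        assume eq: "V (Suc l) \<omega> = V (Suc m) \<omega>"
        define x where "x = V (Suc l) \<omega>"
        have x: "0 < x" "x \<le> 1" using elim(2) by (auto simp: x_def)
        have "\<omega> \<in> D n" for n
        proof -
          define i where "i = (LEAST i. x \<le> real (Suc i) / real (Suc n))"
          have ex: "x \<le> real (Suc n) / real (Suc n)" using x by (simp del: of_nat_Suc)
          have i: "x \<le> real (Suc i) / real (Suc n)" "i \<le> n" unfolding i_def
            using LeastI[of "\<lambda>i. x \<le> real (Suc i) / real (Suc n)", OF ex] Least_le[of "\<lambda>i. x \<le> real (Suc i) / real (Suc n)", OF ex] by auto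
          have "real i / real (Suc n) < x"
          proof (cases i)
            case (Suc j)
            then show ?thesis using not_less_Least[of j "\<lambda>i. x \<le> real (Suc i) / real (Suc n)"] by (simp add: i_def)
          qed (use x in simp)
          then have "\<omega> \<in> E n i" using i eq elim(3) by (simp add: E_def I_def x_def)
          then show ?thesis using i(2) by (auto simp: D_def)
        qed
        then show False using elim(1) by (simp add: Z_def)
      qed
    qed
  qed
  then have "AE \<omega> in M. \<forall>l m. l \<noteq> m \<longrightarrow> V (Suc l) \<omega> \<noteq> V (Suc m) \<omega>"
    unfolding AE_all_countable by (auto intro!: AE_impI)
  then show ?thesis by eventually_elim (auto simp: inj_def)
qed

text \<open>The total mass of each rate is finite, so a clock is a Poisson number of uniform points
  in the unit interval, pulled back by the normalised cumulative rate \<open>F k\<close>. As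
  \<open>c k\<close> is only an upper bound, points beyond the range of \<open>F k\<close> never
  become rings.\<close>

lemma ex_poisson_clocks:
  fixes \<rho> :: "'k::countable \<Rightarrow> real \<Rightarrow> real" and c :: "'k \<Rightarrow> real"
  assumes cont: "\<And>k. k \<in> K \<Longrightarrow> continuous_on {0..} (\<rho> k)"
    and nonneg: "\<And>k t. k \<in> K \<Longrightarrow> 0 \<le> t \<Longrightarrow> 0 \<le> \<rho> k t"
    and bound: "\<And>k t. k \<in> K \<Longrightarrow> 0 \<le> t \<Longrightarrow> integral {0..t} (\<rho> k) \<le> c k"
    and c: "\<And>k. 0 < c k"
  shows "\<exists>(M :: (nat \<Rightarrow> real) measure) T. prob_space M \<and> poisson_clocks M K T \<rho>"
proof -
  define \<nu> where "\<nu> = uniform_measure lborel {0<..1::real}"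
  \<comment> \<open>One sequence of independent real numbers carries all clocks: index
    \<open>0\<close> of a clock is its Poisson number of points, the later ones are uniform
    positions.\<close>
  define D where "D n = (if snd (prod_decode n) = 0 then distr (measure_pmf (poisson_pmf (c (from_nat (fst (prod_decode n)))))) borel real else \<nu>)" for n
  define M where "M = PiM (UNIV :: nat set) D"
  define e where "e k i = prod_encode (to_nat k, i)" for k :: 'k and i
  define V where "V k i \<omega> = \<omega> (e k i)" for k i and \<omega> :: "nat \<Rightarrow> real"
  define F where "F k t = integral {0..t} (\<rho> k) / c k" for k t
  define T where "T k \<omega> = hits (F k) (points (\<lambda>i. V k i \<omega>))" for k \<omega>
  have sD[measurable_cong, simp]: "sets (D n) = sets borel" for n by (simp add: D_def \<nu>_def)
  have p\<nu>: "prob_space \<nu>" unfolding \<nu>_def by (rule prob_space_uniform_measure) auto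
  have pD: "prob_space (D n)" for n
    unfolding D_def using p\<nu> by (auto intro!: measure_pmf.prob_space_distr)
  interpret M: prob_space M unfolding M_def by (rule prob_space_PiM[OF pD])
  have Mm[measurable]: "(\<lambda>\<omega>. \<omega> n) \<in> borel_measurable M" for n
    using measurable_component_singleton[of n UNIV D] unfolding M_def by (simp cong: measurable_cong_sets)
  have indD: "M.indep_vars D (\<lambda>n \<omega>. \<omega> n) UNIV"
  proof (subst M.indep_vars_iff_distr_eq_PiM)
    show "distr M (Pi\<^sub>M UNIV D) (\<lambda>x. \<lambda>i\<in>UNIV. x i) = (\<Pi>\<^sub>M i\<in>UNIV. distr M (D i) (\<lambda>\<omega>. \<omega> i))"
    proof -
      have "(\<lambda>i. distr M (D i) (\<lambda>\<omega>. \<omega> i)) = D" unfolding M_def by (intro ext distr_PiM_component pD) simp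
      moreover have "distr M (Pi\<^sub>M UNIV D) (\<lambda>x. \<lambda>i\<in>UNIV. x i) = M"
        unfolding restrict_UNIV M_def by (rule distr_id)
      ultimately show ?thesis by (simp add: M_def)
    qed
  qed (auto simp: M_def)
  have ind: "M.indep_vars (\<lambda>_. borel) (\<lambda>n \<omega>. \<omega> n) UNIV"
    by (rule M.indep_vars_compose2[OF indD, of "\<lambda>_ x. x"]) (simp add: measurable_ident_sets)
  have inj_e: "inj (e k)" for k by (auto simp: inj_def e_def)
  have indV: "M.indep_vars (\<lambda>_. borel) (V k) UNIV" for k
    using M.indep_vars_reindex[OF ind inj_e[of k]] unfolding V_def .
  have law: "M.prob {\<omega> \<in> space M. \<omega> n \<in> B} = measure (D n) B" if "B \<in> sets borel" for n B
  proof -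
    have "measure (D n) B = measure (distr M (D n) (\<lambda>\<omega>. \<omega> n)) B" unfolding M_def by (subst distr_PiM_component) (simp_all add: pD)
    also have "\<dots> = M.prob {\<omega> \<in> space M. \<omega> n \<in> B}"
      using that Mm[of n] by (subst measure_distr) (auto simp: vimage_def Int_def conj_commute cong: measurable_cong_sets)
    finally show ?thesis by simp
  qed
  have lawU: "M.prob {\<omega> \<in> space M. V k (Suc l) \<omega> \<in> B} = measure \<nu> B" if "B \<in> sets borel" for k l B
    unfolding V_def law[OF that] by (simp add: D_def e_def)
  have inj_AE: "AE \<omega> in M. inj (\<lambda>l. V k (Suc l) \<omega>)" for k
    by (rule M.AE_inj_on_uniform[OF indV[of k]]) (rule lawU[unfolded \<nu>_def])
  have lawN: "M.prob {\<omega> \<in> space M. nat \<lfloor>V k 0 \<omega>\<rfloor> = r} = c k ^ r / fact r * exp (- c k)" for k r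
  proof -
    have B: "{x::real. nat \<lfloor>x\<rfloor> = r} \<in> sets borel" by measurable
    have "M.prob {\<omega> \<in> space M. nat \<lfloor>V k 0 \<omega>\<rfloor> = r} = measure (D (e k 0)) {x. nat \<lfloor>x\<rfloor> = r}"
      using law[OF B, of "e k 0"] by (simp add: V_def)
    also have "\<dots> = measure (measure_pmf (poisson_pmf (c k))) {r}"
      using B by (simp add: D_def e_def measure_distr vimage_def)
    finally show ?thesis using c[of k] by (simp add: measure_pmf_single pmf_poisson)
  qed
  have F_cont: "continuous_on {0..t} (F k)" if "k \<in> K" for k t
    unfolding F_def using c[of k]
    by (intro continuous_intros indefinite_integral_continuous_1 integrable_continuous_interval continuous_on_subset[OF cont[OF that]]) auto
  have F_diff: "c k * (F k t - F k s) = integral {s..t} (\<rho> k)" if "k \<in> K" "0 \<le> s" "s \<le> t" for k s t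
  proof -
    have "\<rho> k integrable_on {0..t}"
      by (intro integrable_continuous_interval continuous_on_subset[OF cont[OF that(1)]]) auto
    from Henstock_Kurzweil_Integration.integral_combine[OF that(2,3) this]
    show ?thesis using c[of k] by (simp add: F_def right_diff_distrib)
  qed
  have F_mono: "F k s \<le> F k t" if "k \<in> K" "0 \<le> s" "s \<le> t" for k s t
  proof -
    have "0 \<le> integral {s..t} (\<rho> k)"
      using that by (intro integral_nonneg integrable_continuous_interval continuous_on_subset[OF cont[OF that(1)]] nonneg) auto
    then have "0 \<le> c k * (F k t - F k s)" using F_diff[OF that] by simp
    then show ?thesis using c[of k] by (simp add: zero_le_mult_iff)
  qed
  have F01: "0 \<le> F k t" "F k t \<le> 1" if "k \<in> K" "0 \<le> t" for k t
    using F_mono[OF that(1) order_refl that(2)] bound[OF that] c[of k] by (auto simp: F_def)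
  have \<nu>F: "measure \<nu> {F k s<..F k t} = F k t - F k s" if "k \<in> K" "0 \<le> s" "s \<le> t" for k s t
  proof -
    have "{0<..1} \<inter> {F k s<..F k t} = {F k s<..F k t}" using F01[of k s] F01[of k t] that by auto
    then show ?thesis using F_mono[OF that] by (simp add: \<nu>_def)
  qed
  have card_T: "card (T k \<omega> \<inter> {s<..t}) = card (points (\<lambda>i. V k i \<omega>) \<inter> {F k s<..F k t})" if "k \<in> K" "0 \<le> s" "s \<le> t" for k s t \<omega>
    unfolding T_def by (rule card_hits[OF F_cont[OF that(1)] F_mono[OF that(1)] that(2,3)])
  have Vm[measurable]: "(\<lambda>\<omega> i. V k i \<omega>) \<in> measurable M (\<Pi>\<^sub>M l\<in>UNIV. borel)" for k
  proof -
    have "(\<lambda>\<omega>. \<lambda>i\<in>UNIV. V k i \<omega>) \<in> measurable M (\<Pi>\<^sub>M l\<in>UNIV. borel)"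
      unfolding V_def by (intro measurable_restrict Mm)
    then show ?thesis by (simp only: restrict_UNIV)
  qed
  \<comment> \<open>For a single clock, disjoint intervals in the image of \<open>F k\<close> are
    the classes of the thinning lemma; this gives both the Poisson law and the independence of
    increments.\<close>
  have thin: "M.prob {\<omega> \<in> space M. \<forall>i\<in>S. card (points (\<lambda>i. V k i \<omega>) \<inter> {F k (a i)<..F k (b i)}) = n i} =
     (\<Prod>i\<in>S. integral {a i..b i} (\<rho> k) ^ n i / fact (n i) * exp (- integral {a i..b i} (\<rho> k)))"
    if k: "k \<in> K" and S: "finite S" and ab: "\<And>i. i \<in> S \<Longrightarrow> 0 \<le> a i \<and> a i \<le> b i" and dj: "disjoint_family_on (\<lambda>i. {F k (a i)<..F k (b i)}) S"
    for k a b n and S :: "nat set"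
  proof -
    have "M.prob {\<omega> \<in> space M. \<forall>i\<in>S. card (points (\<lambda>i. V k i \<omega>) \<inter> {F k (a i)<..F k (b i)}) = n i} =
      M.prob {\<omega> \<in> space M. \<forall>i\<in>S. card {l. l < nat \<lfloor>V k 0 \<omega>\<rfloor> \<and> V k (Suc l) \<omega> \<in> {F k (a i)<..F k (b i)}} = n i}"
    proof (rule M.prob_eq_AE)
      show "AE \<omega> in M. (\<forall>i\<in>S. card (points (\<lambda>i. V k i \<omega>) \<inter> {F k (a i)<..F k (b i)}) = n i) \<longleftrightarrow>
         (\<forall>i\<in>S. card {l. l < nat \<lfloor>V k 0 \<omega>\<rfloor> \<and> V k (Suc l) \<omega> \<in> {F k (a i)<..F k (b i)}} = n i)"
        using inj_AE[of k]
      proof eventually_elim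
        case (elim \<omega>)
        have "inj_on (\<lambda>l. V k (Suc l) \<omega>) {..<nat \<lfloor>V k 0 \<omega>\<rfloor>}" by (rule inj_on_subset[OF elim]) simp
        then show ?case unfolding card_points by simp
      qed
      show "{\<omega> \<in> space M. \<forall>i\<in>S. card (points (\<lambda>i. V k i \<omega>) \<inter> {F k (a i)<..F k (b i)}) = n i} \<in> sets M"
        by (rule sets.sets_Collect_finite_All[OF _ S]) measurable
      have [measurable]: "V k i \<in> borel_measurable M" for i unfolding V_def by measurable
      show "{\<omega> \<in> space M. \<forall>i\<in>S. card {l. l < nat \<lfloor>V k 0 \<omega>\<rfloor> \<and> V k (Suc l) \<omega> \<in> {F k (a i)<..F k (b i)}} = n i} \<in> sets M"
        by (rule sets.sets_Collect_finite_All[OF _ S]) measurable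
    qed
    also have "\<dots> = (\<Prod>i\<in>S. (c k * measure \<nu> {F k (a i)<..F k (b i)}) ^ n i / fact (n i) * exp (- (c k * measure \<nu> {F k (a i)<..F k (b i)})))"
      by (rule M.poisson_thinning[OF indV lawN lawU p\<nu> _ S _ dj]) (auto simp: \<nu>_def)
    also have "\<dots> = (\<Prod>i\<in>S. integral {a i..b i} (\<rho> k) ^ n i / fact (n i) * exp (- integral {a i..b i} (\<rho> k)))"
      using ab by (intro prod.cong refl) (simp add: \<nu>F[OF k] F_diff[OF k])
    finally show ?thesis .
  qed
  \<comment> \<open>Different clocks use disjoint index sets of the sequence, hence are independent
    as whole sequences.\<close>
  have blocks: "M.indep_vars (\<lambda>_. \<Pi>\<^sub>M l\<in>UNIV. borel) (\<lambda>k \<omega> i. V k i \<omega>) UNIV"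
  proof -
    have "M.indep_vars (\<lambda>k. \<Pi>\<^sub>M n\<in>range (e k). borel) (\<lambda>k \<omega>. restrict (\<lambda>n. \<omega> n) (range (e k))) UNIV"
      by (rule M.indep_vars_restrict[OF ind]) (auto simp: disjoint_family_on_def e_def)
    then have "M.indep_vars (\<lambda>_. \<Pi>\<^sub>M l\<in>UNIV. borel) (\<lambda>k \<omega>. (\<lambda>z i. z (e k i)) (restrict (\<lambda>n. \<omega> n) (range (e k)))) UNIV"
    proof (rule M.indep_vars_compose2)
      fix k
      have "(\<lambda>z. \<lambda>i\<in>UNIV. z (e k i)) \<in> measurable (\<Pi>\<^sub>M n\<in>range (e k). borel) (\<Pi>\<^sub>M l\<in>UNIV. borel :: real measure)"
        by (intro measurable_restrict measurable_component_singleton) auto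
      then show "(\<lambda>z i. z (e k i)) \<in> measurable (\<Pi>\<^sub>M n\<in>range (e k). borel) (\<Pi>\<^sub>M l\<in>UNIV. borel :: real measure)" by (simp only: restrict_UNIV)
    qed
    then show ?thesis by (simp add: V_def)
  qed
  have "poisson_clocks M K T \<rho>"
    unfolding poisson_clocks_def
  proof (intro conjI ballI allI impI)
    show "T k \<omega> \<subseteq> {0<..}" for k \<omega> by (auto simp: T_def hits_def)
    show "finite (T k \<omega> \<inter> {0..t})" for k \<omega> and t :: real
      unfolding T_def using finite_hits[OF finite_points] by blast
  next
    fix k n and s t :: real assume k: "k \<in> K" and st: "0 \<le> s \<and> s \<le> t"
    show "M.prob {\<omega> \<in> space M. card (T k \<omega> \<inter> {s<..t}) = n} = integral {s..t} (\<rho> k) ^ n / fact n * exp (- integral {s..t} (\<rho> k))"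
      using thin[OF k, of "{0}" "\<lambda>_. s" "\<lambda>_. t" "\<lambda>_. n"] st by (simp add: card_T[OF k] disjoint_family_on_def)
  next
    fix t :: "nat \<Rightarrow> real" assume t: "t 0 = 0 \<and> mono t"
    have t': "0 \<le> t i" "t i \<le> t (Suc i)" for i using t monoD[of t 0 i] monoD[of t i "Suc i"] by auto
    define X where "X j \<omega> = card (points (\<lambda>i. V (fst j) i \<omega>) \<inter> {F (fst j) (t (snd j))<..F (fst j) (t (Suc (snd j)))})" for j :: "'k \<times> nat" and \<omega>
    have Xm[measurable]: "X j \<in> measurable M (count_space UNIV)" for j unfolding X_def by measurable
    \<comment> \<open>Events fixing one count, with the empty set added to make the family stable
      under intersection; they generate all events of \<open>X j\<close>.\<close>
    define G where "G j = insert {} {X j -` {n} \<inter> space M |n. True}" for j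
    have dj: "disjoint_family_on (\<lambda>i. {F k (t i)<..F k (t (Suc i))}) S" if k: "k \<in> K" for k S
    proof -
      have "F k (t (Suc i)) \<le> F k (t j)" if "i < j" for i j
        using that t t' by (intro F_mono[OF k]) (auto intro: monoD)
      then have "{F k (t i)<..F k (t (Suc i))} \<inter> {F k (t j)<..F k (t (Suc j))} = {}" if "i < j" for i j using that by fastforce
      then show ?thesis unfolding disjoint_family_on_def by (metis inf_commute linorder_neqE_nat)
    qed
    have indG: "M.indep_sets G (K \<times> UNIV)"
    proof (rule M.indep_setsI)
      show "G j \<subseteq> M.events" for j using measurable_sets[OF Xm] by (auto simp: G_def)
      fix A J assume J: "J \<noteq> {}" "J \<subseteq> K \<times> UNIV" "finite J" and A: "\<forall>j\<in>J. A j \<in> G j"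
      show "M.prob (\<Inter>j\<in>J. A j) = (\<Prod>j\<in>J. M.prob (A j))"
      proof (cases "\<exists>j\<in>J. A j = {}")
        case True
        then have "(\<Inter>j\<in>J. A j) = {}" by blast
        moreover have "\<exists>j\<in>J. M.prob (A j) = 0" using True by (metis measure_empty)
        then have "(\<Prod>j\<in>J. M.prob (A j)) = 0" by (rule prod_zero[OF J(3)])
        ultimately show ?thesis by simp
      next
        case False
        then have "\<forall>j\<in>J. \<exists>n. A j = X j -` {n} \<inter> space M" using A by (auto simp: G_def)
        then obtain n where n: "\<And>j. j \<in> J \<Longrightarrow> A j = X j -` {n j} \<inter> space M" by metis
        define pois where "pois j = integral {t (snd j)..t (Suc (snd j))} (\<rho> (fst j)) ^ n j / fact (n j) * exp (- integral {t (snd j)..t (Suc (snd j))} (\<rho> (fst j)))" for j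
        define S where "S k = {i. (k, i) \<in> J}" for k
        have S: "finite (S k)" for k
          by (rule finite_subset[of _ "snd ` J"]) (use J(3) in \<open>force simp: S_def\<close>, use J(3) in simp)
        define B where "B k = {v \<in> space (\<Pi>\<^sub>M l\<in>UNIV. borel :: real measure). \<forall>i\<in>S k. card (points v \<inter> {F k (t i)<..F k (t (Suc i))}) = n (k, i)}" for k
        have Bm: "B k \<in> sets (\<Pi>\<^sub>M l\<in>UNIV. borel :: real measure)" for k
          unfolding B_def by (rule sets.sets_Collect_finite_All[OF _ S]) measurable
        have pB: "M.prob ((\<lambda>\<omega> i. V k i \<omega>) -` B k \<inter> space M) = (\<Prod>i\<in>S k. pois (k, i))" if "k \<in> K" for k
        proof -
          have "(\<lambda>\<omega> i. V k i \<omega>) -` B k \<inter> space M = {\<omega> \<in> space M. \<forall>i\<in>S k. card (points (\<lambda>i. V k i \<omega>) \<inter> {F k (t i)<..F k (t (Suc i))}) = n (k, i)}"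
            by (auto simp: B_def space_PiM)
          then show ?thesis using thin[OF that S[of k], of t "\<lambda>i. t (Suc i)" "\<lambda>i. n (k, i)"] t' dj[OF that] by (simp add: pois_def)
        qed
        have single: "M.prob (A j) = pois j" if "j \<in> J" for j
        proof -
          have k: "fst j \<in> K" using that J(2) by auto
          have "A j = {\<omega> \<in> space M. \<forall>i\<in>{snd j}. card (points (\<lambda>i. V (fst j) i \<omega>) \<inter> {F (fst j) (t i)<..F (fst j) (t (Suc i))}) = n j}"
            unfolding n[OF that] X_def by auto
          then show ?thesis using thin[OF k, of "{snd j}" t "\<lambda>i. t (Suc i)" "\<lambda>_. n j"] t' dj[OF k] by (simp add: pois_def)
        qed
        have "(\<Inter>j\<in>J. A j) = (\<Inter>k\<in>fst ` J. (\<lambda>\<omega> i. V k i \<omega>) -` B k \<inter> space M)"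
          using J(1) by (force simp: n B_def S_def X_def space_PiM)
        also have "M.prob \<dots> = (\<Prod>k\<in>fst ` J. M.prob ((\<lambda>\<omega> i. V k i \<omega>) -` B k \<inter> space M))"
          by (rule M.indep_varsD[OF blocks]) (use J Bm in auto)
        also have "\<dots> = (\<Prod>k\<in>fst ` J. \<Prod>i\<in>S k. pois (k, i))"
          using J(2) by (intro prod.cong refl pB) auto
        also have "\<dots> = (\<Prod>j\<in>Sigma (fst ` J) S. pois j)" using J(3) S by (subst prod.Sigma) auto
        also have "Sigma (fst ` J) S = J" by (force simp: S_def)
        finally show ?thesis using single by simp
      qed
    qed
    have "M.indep_vars (\<lambda>_. count_space UNIV) X (K \<times> UNIV)"
      unfolding M.indep_vars_def2
    proof (intro conjI ballI Xm)
      have "M.indep_sets (\<lambda>j. sigma_sets (space M) (G j)) (K \<times> UNIV)"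
      proof (rule M.indep_sets_sigma[OF indG])
        fix j
        show "Int_stable (G j)"
        proof (rule Int_stableI)
          fix a b assume "a \<in> G j" "b \<in> G j"
          then show "a \<inter> b \<in> G j" unfolding G_def by fastforce
        qed
      qed
      then show "M.indep_sets (\<lambda>j. {X j -` A \<inter> space M |A. A \<in> sets (count_space UNIV)}) (K \<times> UNIV)"
      proof (rule M.indep_sets_mono_sets)
        fix j
        show "{X j -` A \<inter> space M |A. A \<in> sets (count_space UNIV)} \<subseteq> sigma_sets (space M) (G j)"
        proof safe
          fix A :: "nat set"
          have "(\<Union>n\<in>A. X j -` {n} \<inter> space M) \<in> sigma_sets (space M) (G j)"
            by (intro sigma_sets_UNION) (auto simp: G_def)
          also have "(\<Union>n\<in>A. X j -` {n} \<inter> space M) = X j -` A \<inter> space M" by auto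
          finally show "X j -` A \<inter> space M \<in> sigma_sets (space M) (G j)" .
        qed
      qed
    qed
    also have "M.indep_vars (\<lambda>_. count_space UNIV) X (K \<times> UNIV) \<longleftrightarrow>
      M.indep_vars (\<lambda>_. count_space UNIV) (\<lambda>(k, i) \<omega>. card (T k \<omega> \<inter> {t i<..t (Suc i)})) (K \<times> UNIV)"
      by (rule M.indep_vars_cong) (use t' in \<open>auto simp: X_def card_T fun_eq_iff\<close>)
    finally show "M.indep_vars (\<lambda>_. count_space UNIV) (\<lambda>(k, i) \<omega>. card (T k \<omega> \<inter> {t i<..t (Suc i)})) (K \<times> UNIV)" .
  qed
  then show ?thesis using M.prob_space_axioms by blast
qed

section \<open>The generator on cylindric functions\<close>

text \<open>Jumps outside the box leave \<open>f\<close> unchanged, and positions without a seed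
  pair have rate zero, so the infinite sum over seed pairs is a finite sum over clocks.\<close>

lemma generator_quad_box:
  assumes f: "box_fun N H f"
  shows "generator_quad q u \<eta> \<tau> f \<sigma> = (\<Sum>k\<in>kbox N (Suc (Suc H)). clock_rate q u \<eta> k \<tau> * (f (act k \<sigma>) - f \<sigma>))"
proof -
  let ?V = "{0..N} \<times> {1..Suc H}"
  let ?h = "\<lambda>v. real (snd v) * seed_rate q (pair_type \<sigma> v) (u_at u \<eta> \<tau>) * (f (jump \<sigma> v) - f \<sigma>)"
  have "infsum ?h (seed_pairs \<sigma>) = infsum ?h ?V"
  proof (rule infsum_cong_neutral)
    fix v assume v: "v \<in> ?V - seed_pairs \<sigma>"
    then have "pair_type \<sigma> v \<notin> up_types \<union> down_types" by (auto simp: seed_pairs_def)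
    then have "seed_rate q (pair_type \<sigma> v) (u_at u \<eta> \<tau>) = 0" using seed_rate_nonzero by blast
    then show "?h v = 0" by simp
  next
    fix v assume v: "v \<in> seed_pairs \<sigma> - ?V"
    define k where "k = (v, pair_type \<sigma> v)"
    have "k \<in> seed_clocks" using v by (auto simp: k_def seed_clocks_def seed_pairs_def)
    moreover have "k \<notin> kbox N (Suc H)" using v by (auto simp: k_def kbox_def seed_pairs_def mem_Times_iff)
    ultimately have "f (act k \<sigma>) = f \<sigma>" using box_funD[OF f act_outside_box] by blast
    then show "?h v = 0" by (simp add: k_def act.simps)
  qed simp
  also have "\<dots> = sum ?h ?V" by (rule infsum_finite) simp
  also have "\<dots> = (\<Sum>y=1..Suc H. real y * (\<Sum>x=0..N. seed_diff q (u_at u \<eta> \<tau>) y f x \<sigma>))"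
    unfolding sum.cartesian_product' by (subst sum.swap) (simp add: seed_diff_def sum_distrib_left mult.assoc)
  finally show ?thesis unfolding generator_quad_def sum_kbox by simp
qed

lemma seed_rate_bounds:
  assumes q: "0 \<le> q" "q < 1" and ab: "0 < a" "b < 1"
  shows "\<exists>R>0. \<forall>p. \<forall>w\<in>{a..b}. 0 \<le> seed_rate q p w \<and> seed_rate q p w \<le> R"
    and "continuous_on {a..b} (seed_rate q p)"
proof -
  have w: "0 < w" "w < 1" "q * w < 1" if "w \<in> {a..b}" for w
    using that ab q by (auto intro: le_less_trans[OF mult_right_mono[of q 1 w]])
  have cont: "continuous_on {a..b} (rate_a q)" "continuous_on {a..b} (rate_b q)" "continuous_on {a..b} (rate_c q)"
    unfolding rate_a_def rate_b_def rate_c_def by (intro continuous_intros; use w q in fastforce)+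
  have pos: "0 \<le> rate_a q w \<and> 0 \<le> rate_b q w \<and> 0 \<le> rate_c q w" if "w \<in> {a..b}" for w
    using w[OF that] q by (simp add: rate_a_def rate_b_def rate_c_def)
  have "\<exists>B. \<forall>w\<in>{a..b}. f w \<le> B" if "continuous_on {a..b} f" for f :: "real \<Rightarrow> real"
    using compact_imp_bounded[OF compact_continuous_image[OF that compact_Icc]]
    unfolding bounded_iff by (auto simp: abs_le_iff)
  from this[OF cont(1)] this[OF cont(2)] this[OF cont(3)] obtain A B D where
    le: "\<And>w. w \<in> {a..b} \<Longrightarrow> rate_a q w \<le> A \<and> rate_b q w \<le> B \<and> rate_c q w \<le> D" by metis
  show "\<exists>R>0. \<forall>p. \<forall>w\<in>{a..b}. 0 \<le> seed_rate q p w \<and> seed_rate q p w \<le> R"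
  proof (intro exI[of _ "\<bar>A\<bar> + \<bar>B\<bar> + \<bar>D\<bar> + 1"] conjI allI ballI)
    fix p w assume "w \<in> {a..b}"
    from pos[OF this] le[OF this]
    show "0 \<le> seed_rate q p w" "seed_rate q p w \<le> \<bar>A\<bar> + \<bar>B\<bar> + \<bar>D\<bar> + 1" unfolding seed_rate_def by (auto split: if_split)
  qed linarith
  show "continuous_on {a..b} (seed_rate q p)"
  proof -
    have *: "continuous_on {a..b} (\<lambda>w. if P then f w else g w)" if "continuous_on {a..b} f" "continuous_on {a..b} g" for P and f g :: "real \<Rightarrow> real"
      using that by (cases P) simp_all
    show ?thesis unfolding seed_rate_def by (intro * cont continuous_on_const)
  qed
qed

theorem theorem4p9:
  fixes q u \<eta> :: real
  assumes "0 \<le> q" and "q < 1"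
    and "0 < u" and "u < 1"
    and "0 < \<eta>" and "u + \<eta> < 1"
  shows "\<exists>Q :: real \<Rightarrow> real \<Rightarrow> config \<Rightarrow> config measure.
    transition_functions Q \<and>
    has_generator Q (generator_quad q u \<eta>) \<and>
    (\<forall>\<sigma>0\<in>regular_configurations.
       \<exists>(M :: (nat \<Rightarrow> real) measure) X T.
         markov_chain_from M X Q \<sigma>0 \<and>
         poisson_clocks M seed_clocks T (clock_rate q u \<eta>) \<and>
         (AE \<omega> in M. driven_by_clocks (\<lambda>t. X t \<omega>) (\<lambda>k. T k \<omega>))) \<and>
    (\<forall>(\<Lambda> :: nat set) \<tau>. 0 \<le> \<tau> \<longrightarrow>
       s6v_step q u \<Lambda> \<bind> Q 0 \<tau> = s6v_step q (u + (1 - exp (- \<tau>)) * \<eta>) \<Lambda> \<and>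
       s6v_empty q u \<Lambda> \<bind> Q 0 \<tau> = s6v_empty q (u + (1 - exp (- \<tau>)) * \<eta>) \<Lambda>)"
proof -
  obtain R where R: "R > 0" "\<And>p w. w \<in> {u..u + \<eta>} \<Longrightarrow> 0 \<le> seed_rate q p w \<and> seed_rate q p w \<le> R"
    using seed_rate_bounds(1)[OF assms(1,2,3,6)] by meson
  have ut: "u_at u \<eta> t \<in> {u..u + \<eta>}" if "0 \<le> t" for t using u_at_bounds[OF assms(5) that, of u] by simp
  have rate: "0 \<le> clock_rate q u \<eta> k t \<and> clock_rate q u \<eta> k t \<le> real (snd (fst k)) * R * (\<eta> * exp (- t))" if "0 \<le> t" for k t
  proof -
    obtain v p where k: "k = (v, p)" by (cases k)
    have "real (snd v) * (\<eta> * exp (- t)) * seed_rate q p (u_at u \<eta> t) \<le> real (snd v) * (\<eta> * exp (- t)) * R"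
      using R(2)[OF ut[OF that]] assms(5) by (intro mult_left_mono) auto
    then show ?thesis using R(2)[OF ut[OF that]] assms(5) by (simp add: k mult_ac)
  qed
  have cont: "continuous_on {0..} (clock_rate q u \<eta> k)" for k
  proof -
    obtain v p where k: "k = (v, p)" by (cases k)
    have "continuous_on {0..} (u_at u \<eta>)" unfolding u_at_def by (intro continuous_intros)
    moreover have "u_at u \<eta> ` {0..} \<subseteq> {u..u + \<eta>}" by (rule image_subsetI) (simp only: ut atLeast_iff)
    ultimately have "continuous_on {0..} (\<lambda>t. seed_rate q p (u_at u \<eta> t))"
      by (rule continuous_on_compose2[OF seed_rate_bounds(2)[OF assms(1,2,3,6)]])
    then have "continuous_on {0..} (\<lambda>t. real (snd v) * (\<eta> * exp (- t)) * seed_rate q p (u_at u \<eta> t))"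
      by (intro continuous_intros)
    then show ?thesis by (simp add: k)
  qed
  \<comment> \<open>The factor \<open>exp (- t)\<close> in the rates keeps the total mass of a clock
    finite over the whole half-line.\<close>
  have mass: "integral {0..t} (clock_rate q u \<eta> k) \<le> real (snd (fst k)) * R * \<eta> + 1" if t: "0 \<le> t" for k t
  proof -
    let ?c = "real (snd (fst k)) * R * \<eta>"
    have I: "((\<lambda>t. ?c * exp (- t)) has_integral (- ?c * exp (- t)) - (- ?c * exp (- 0))) {0..t}"
      by (rule fundamental_theorem_of_calculus[OF t])
        (auto intro!: derivative_eq_intros simp: has_real_derivative_iff_has_vector_derivative[symmetric])
    have "integral {0..t} (clock_rate q u \<eta> k) \<le> integral {0..t} (\<lambda>t. ?c * exp (- t))"
    proof (rule integral_le)
      show "clock_rate q u \<eta> k integrable_on {0..t}"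
        by (intro integrable_continuous_interval continuous_on_subset[OF cont]) auto
      show "(\<lambda>t. ?c * exp (- t)) integrable_on {0..t}" using I by blast
      show "clock_rate q u \<eta> k s \<le> ?c * exp (- s)" if "s \<in> {0..t}" for s
        using rate[of s k] that by (simp add: mult.assoc)
    qed
    also have "\<dots> = ?c - ?c * exp (- t)" using integral_unique[OF I] by simp
    also have "\<dots> \<le> ?c + 1"
    proof -
      have "0 \<le> ?c * exp (- t)" using R(1) assms(5) by simp
      then show ?thesis by linarith
    qed
    finally show ?thesis .
  qed
  have "\<exists>(M :: (nat \<Rightarrow> real) measure) T. prob_space M \<and> poisson_clocks M seed_clocks T (clock_rate q u \<eta>)"
  proof (rule ex_poisson_clocks[OF cont _ mass])
    \<comment> \<open>The added \<open>1\<close> keeps the Poisson mean positive at height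
      \<open>0\<close> too, as positivity is required for every index of the clock type.\<close>
    show "0 < real (snd (fst k)) * R * \<eta> + 1" for k :: clock using R(1) assms(5) by (intro add_nonneg_pos) auto
    show "0 \<le> clock_rate q u \<eta> k t" if "0 \<le> t" for k t using rate[OF that] by blast
  qed
  then obtain M :: "(nat \<Rightarrow> real) measure" and T where M: "prob_space M" "poisson_clocks M seed_clocks T (clock_rate q u \<eta>)"
    by blast
  interpret prob_space M by (rule M(1))
  interpret s6v_clocks M T q u \<eta> "R * \<eta>"
  proof
    show "poisson_clocks M seed_clocks T (clock_rate q u \<eta>)" by (rule M(2))
    show "0 \<le> clock_rate q u \<eta> k t \<and> clock_rate q u \<eta> k t \<le> R * \<eta> * real (snd (fst k))" if t: "0 \<le> t" for k t
    proof -
      have "real (snd (fst k)) * R * (\<eta> * exp (- t)) \<le> real (snd (fst k)) * R * \<eta>"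
        using t R(1) assms(5) by (intro mult_left_mono) (auto simp: mult_left_le)
      then show ?thesis using rate[OF t, of k] by (simp add: mult_ac)
    qed
    show "continuous_on {0..} (clock_rate q u \<eta> k)" for k by (rule cont)
  qed (use assms R(1) in auto)
  have gen: "has_generator (Q seed_clocks) (generator_quad q u \<eta>)"
    unfolding has_generator_def
  proof (intro allI impI)
    fix \<tau> :: real and f assume \<tau>: "0 \<le> \<tau>" and "cylindric f"
    then obtain N H where f: "box_fun N H f" using cylindric_box by blast
    have "generator_quad q u \<eta> \<tau> f = (\<lambda>\<sigma>. \<Sum>k\<in>kbox N (Suc (Suc H)). clock_rate q u \<eta> k \<tau> * (f (act k \<sigma>) - f \<sigma>))"
      by (intro ext generator_quad_box[OF f])
    then show "uniform_limit regular_configurations (\<lambda>h \<sigma>. ((\<integral>\<sigma>'. f \<sigma>' \<partial>Q seed_clocks \<tau> (\<tau> + h) \<sigma>) - f \<sigma>) / h)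
        (generator_quad q u \<eta> \<tau> f) (at_right 0)"
      using generator_limit[OF f \<tau>] by simp
  qed
  have law: "s6v_step q u \<Lambda> \<bind> Q seed_clocks 0 \<tau> = s6v_step q (u + (1 - exp (- \<tau>)) * \<eta>) \<Lambda> \<and>
       s6v_empty q u \<Lambda> \<bind> Q seed_clocks 0 \<tau> = s6v_empty q (u + (1 - exp (- \<tau>)) * \<eta>) \<Lambda>" if "0 \<le> \<tau>" for \<Lambda> \<tau>
    using law_evolution[OF that] unfolding s6v_step_def s6v_empty_def u_at_def by blast
  \<comment> \<open>One probability space with one family of clocks serves all initial
    configurations.\<close>
  show ?thesis
    using transition_functions_Q gen law M(2) chain_from_markov chain_from_driven
    by (intro exI[of _ "Q seed_clocks"] conjI ballI allI impI) blast+
qed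

end
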